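(* Let $A$ be an $R$-dagger algebra or a $K$-dagger algebra, and let $\hat A$ be its completion, which is an $R$-affinoid, respectively $K$-affinoid, algebra. Then $$K^{-n}_{\mathrm{top}}(A)\cong K^{-n}_{\mathrm{top}}(\hat A),\qquad n\ge1,$$ where the left side is the topological $K$-theory of the dagger algebra $A$ (defined with overconvergent power series) and the right side is that of the ultrametric Banach ring $\hat A$ (defined with convergent power series).
   Context: $R$ is a complete discrete valuation ring with maximal ideal $(\pi)$, perfect residue field of characteristic $p>0$ and field of fractions $K$ of characteristic $0$, with absolute value $|\cdot|$. $K\langle x_1,\dots,x_n\rangle$ is the Tate algebra of power series $\sum a_\nu x^\nu$ with $|a_\nu|\to0$; $K\langle x_1,\dots,x_n\rangle^\dagger$ is the subalgebra of those with $|a_\nu|\rho^{|\nu|}\to0$ for some $\rho>1$; $R\langle\cdot\rangle$, $R\langle\cdot\rangle^\dagger$ are the subrings of series with coefficients in $R$. An $R$- (resp. $K$-) affinoid algebra is a quotient of some $R\langle\underline x\rangle$ (resp. $K\langle\underline x\rangle$); an $R$- (resp. $K$-) dagger algebra is a quotient of some $R\langle\underline x\rangle^\dagger$ (resp. $K\langle\underline x\rangle^\dagger$). Affinoid algebras carry the residue norm of the Gauss norm (for which they are ultrametric Banach rings). The completion of $A=R\langle\underline y\rangle^\dagger/I$ is $\hat A=R\langle\underline y\rangle/(I)$, similarly over $K$. Coproducts of dagger algebras: $R\langle\underline x\rangle^\dagger/I\otimes^\dagger_RR\langle\underline y\rangle^\dagger/J=R\langle\underline x,\underline y\rangle^\dagger/(I+J)$,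 similarly over $K$. For a unital ultrametric Banach ring $B$ put $B_p=B\langle x_0,\dots,x_p\rangle/(\sum_ix_i-1)$, where $B\langle\underline x\rangle$ is the ring of power series over $B$ with coefficients tending to $0$; an increasing $\varphi:[p]\to[q]$ acts by $x_i\mapsto\sum_{\varphi(j)=i}x_j$, giving a simplicial ring $B_\bullet$. Then $K^{-i}_{\mathrm{top}}(B)=\pi_i(B_\bullet\mathrm{GL}(B_\bullet))=\pi_{i-1}(\mathrm{GL}(B_\bullet))$, $i\ge1$, where $B_\bullet\mathrm{GL}(B_\bullet)$ denotes the simplicial classifying set of the simplicial group $\mathrm{GL}(B_\bullet)$. Let $R_p^\dagger=R\langle x_0,\dots,x_p\rangle^\dagger/(\sum_ix_i-1)$ (a simplicial $R$-dagger algebra with the same structure maps). For an $R$-dagger algebra $A$, $K^{-i}_{\mathrm{top}}(A)=\pi_{i-1}(\mathrm{GL}(A\otimes_R^\dagger R_\bullet^\dagger))$, $i\ge1$; for a $K$-dagger algebra replace $R$ by $K$. *)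

theory Defs
  imports Complex_Main "HOL-Algebra.Algebra"
begin

section \<open>The base: a complete discrete valuation ring of mixed characteristic\<close>

text \<open>
  The field of fractions \<open>K\<close> is the ambient structure; the valuation ring \<open>R\<close> is a subset of
  its carrier.  A discrete valuation ring is a principal ideal domain that is not a field and has
  exactly one maximal ideal, here generated by \<open>\<pi>\<close>.  The absolute value is any non-archimedean
  absolute value on \<open>K\<close> with valuation ring \<open>R\<close>, which determines it up to a positive power;
  completeness refers to its metric.
\<close>

locale mixed_char_complete_dvr = field K
  for K :: "'a ring" (structure) +
  fixes R :: "'a set" and \<pi> :: 'a and p :: nat and absv :: "'a \<Rightarrow> real"
  assumes subring: "subring R K"
    and principal: "principal_domain (K\<lparr>carrier := R\<rparr>)"
    and uniformizer: "\<pi> \<in> R" "\<pi> \<noteq> \<zero>"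
    and local: "{M. maximalideal M (K\<lparr>carrier := R\<rparr>)} = {PIdl\<^bsub>K\<lparr>carrier := R\<rparr>\<^esub> \<pi>}"
    and fractions: "\<And>x. x \<in> carrier K \<Longrightarrow> \<exists>a\<in>R. \<exists>b\<in>R - {\<zero>}. x = a \<otimes> inv b"
    and char_zero: "\<And>k::nat. k > 0 \<Longrightarrow> [k] \<cdot> \<one> \<noteq> \<zero>"
    and prime: "Factorial_Ring.prime p"
    and residue_char: "let k = K\<lparr>carrier := R\<rparr> Quot (PIdl\<^bsub>K\<lparr>carrier := R\<rparr>\<^esub> \<pi>)
      in [p] \<cdot>\<^bsub>k\<^esub> \<one>\<^bsub>k\<^esub> = \<zero>\<^bsub>k\<^esub>"
    and residue_perfect: "let k = K\<lparr>carrier := R\<rparr> Quot (PIdl\<^bsub>K\<lparr>carrier := R\<rparr>\<^esub> \<pi>)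
      in \<forall>x\<in>carrier k. \<exists>y\<in>carrier k. y [^]\<^bsub>k\<^esub> p = x"
    and absv_nonneg: "\<And>x. x \<in> carrier K \<Longrightarrow> 0 \<le> absv x"
    and absv_eq_zero: "\<And>x. x \<in> carrier K \<Longrightarrow> absv x = 0 \<longleftrightarrow> x = \<zero>"
    and absv_mult: "\<And>x y. x \<in> carrier K \<Longrightarrow> y \<in> carrier K \<Longrightarrow> absv (x \<otimes> y) = absv x * absv y"
    and absv_add: "\<And>x y. x \<in> carrier K \<Longrightarrow> y \<in> carrier K
      \<Longrightarrow> absv (x \<oplus> y) \<le> max (absv x) (absv y)"
    and valuation_ring: "R = {x \<in> carrier K. absv x \<le> 1}"
    and complete: "\<And>s :: nat \<Rightarrow> 'a. (\<And>i. s i \<in> R)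
      \<Longrightarrow> (\<And>\<epsilon>. \<epsilon> > 0 \<Longrightarrow> \<exists>N. \<forall>i\<ge>N. \<forall>j\<ge>N. absv (s i \<ominus> s j) < \<epsilon>)
      \<Longrightarrow> \<exists>l\<in>R. (\<lambda>i. absv (s i \<ominus> l)) \<longlonglongrightarrow> 0"


section \<open>Rings of power series\<close>

text \<open>
  Variables are indexed by a finite set \<open>V\<close>.  A multi-index is a function that vanishes outside
  \<open>V\<close>, and a power series is the function \<open>\<nu> \<mapsto> a\<^sub>\<nu>\<close>, extended by zero to arguments that are not
  multi-indices.
\<close>

definition mexp :: "'v set \<Rightarrow> ('v \<Rightarrow> nat) set"
  where "mexp V = {\<nu>. \<forall>v. v \<notin> V \<longrightarrow> \<nu> v = 0}"

definition mdeg :: "'v set \<Rightarrow> ('v \<Rightarrow> nat) \<Rightarrow> nat"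
  where "mdeg V \<nu> = (\<Sum>v\<in>V. \<nu> v)"

definition power_series :: "('b, 'c) ring_scheme \<Rightarrow> 'v set \<Rightarrow> (('v \<Rightarrow> nat) \<Rightarrow> 'b) ring"
  where "power_series B V =
    \<lparr>carrier = {f. (\<forall>\<nu>\<in>mexp V. f \<nu> \<in> carrier B) \<and> (\<forall>\<nu>. \<nu> \<notin> mexp V \<longrightarrow> f \<nu> = \<zero>\<^bsub>B\<^esub>)},
     monoid.mult = (\<lambda>f g \<nu>. if \<nu> \<in> mexp V
       then \<Oplus>\<^bsub>B\<^esub>\<alpha>\<in>{\<alpha>. \<forall>v. \<alpha> v \<le> \<nu> v}. f \<alpha> \<otimes>\<^bsub>B\<^esub> g (\<lambda>v. \<nu> v - \<alpha> v) else \<zero>\<^bsub>B\<^esub>),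
     monoid.one = (\<lambda>\<nu>. if \<nu> = (\<lambda>_. 0) then \<one>\<^bsub>B\<^esub> else \<zero>\<^bsub>B\<^esub>),
     ring.zero = (\<lambda>_. \<zero>\<^bsub>B\<^esub>),
     ring.add = (\<lambda>f g \<nu>. f \<nu> \<oplus>\<^bsub>B\<^esub> g \<nu>)\<rparr>"

definition variable :: "('b, 'c) ring_scheme \<Rightarrow> 'v \<Rightarrow> ('v \<Rightarrow> nat) \<Rightarrow> 'b"
  where "variable B v = (\<lambda>\<nu>. if \<nu> = (\<lambda>w. if w = v then 1 else 0) then \<one>\<^bsub>B\<^esub> else \<zero>\<^bsub>B\<^esub>)"

text \<open>
  Convergent series \<open>B\<langle>V\<rangle>\<close> and overconvergent series \<open>B\<langle>V\<rangle>\<^sup>\<dagger>\<close>.  Since \<open>V\<close> is finite and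
  coefficients vanish off \<^term>\<open>mexp V\<close>, convergence to 0 as \<open>\<bar>\<nu>\<bar> \<rightarrow> \<infinity>\<close> is convergence
  along the cofinite filter.
\<close>

definition convergent_series ::
    "('b, 'c) ring_scheme \<Rightarrow> ('b \<Rightarrow> real) \<Rightarrow> 'v set \<Rightarrow> (('v \<Rightarrow> nat) \<Rightarrow> 'b) ring"
  where "convergent_series B nrm V = (power_series B V)
    \<lparr>carrier := {f \<in> carrier (power_series B V). ((\<lambda>\<nu>. nrm (f \<nu>)) \<longlongrightarrow> 0) cofinite}\<rparr>"

definition dagger_series ::
    "('b, 'c) ring_scheme \<Rightarrow> ('b \<Rightarrow> real) \<Rightarrow> 'v set \<Rightarrow> (('v \<Rightarrow> nat) \<Rightarrow> 'b) ring"
  where "dagger_series B nrm V = (power_series B V)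
    \<lparr>carrier := {f \<in> carrier (power_series B V).
       \<exists>\<rho>>1. ((\<lambda>\<nu>. nrm (f \<nu>) * \<rho> ^ mdeg V \<nu>) \<longlongrightarrow> 0) cofinite}\<rparr>"

text \<open>
  \<open>linear_subst B V W l f\<close> is the power series in the variables \<open>W\<close> obtained from \<open>f\<close> by
  substituting the homogeneous linear form \<open>l v\<close> for each variable \<open>v \<in> V\<close>.  As \<open>\<Prod>\<^sub>v (l v)\<^bsup>\<nu> v\<^esup>\<close> is
  homogeneous of degree \<open>\<bar>\<nu>\<bar>\<close>, only the finitely many \<open>\<nu>\<close> with \<open>\<bar>\<nu>\<bar> = \<bar>\<mu>\<bar>\<close> contribute to the
  coefficient at \<open>\<mu>\<close>.
\<close>

definition linear_subst :: "('b, 'c) ring_scheme \<Rightarrow> 'v set \<Rightarrow> 'w set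
    \<Rightarrow> ('v \<Rightarrow> ('w \<Rightarrow> nat) \<Rightarrow> 'b) \<Rightarrow> (('v \<Rightarrow> nat) \<Rightarrow> 'b) \<Rightarrow> ('w \<Rightarrow> nat) \<Rightarrow> 'b"
  where "linear_subst B V W l f = (\<lambda>\<mu>. if \<mu> \<in> mexp W
    then \<Oplus>\<^bsub>B\<^esub>\<nu>\<in>{\<nu> \<in> mexp V. mdeg V \<nu> = mdeg W \<mu>}.
      f \<nu> \<otimes>\<^bsub>B\<^esub> (\<Otimes>\<^bsub>power_series B W\<^esub>v\<in>V. l v [^]\<^bsub>power_series B W\<^esub> \<nu> v) \<mu>
    else \<zero>\<^bsub>B\<^esub>)"

text \<open>
  The map \<open>S' Quot I \<rightarrow> S Quot J\<close> induced by \<open>h\<close> (with \<open>h ` I \<subseteq> J\<close>): a coset \<open>C\<close> is sent to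
  \<open>J + h ` C\<close>, which is the coset of \<open>h c\<close> for any \<open>c \<in> C\<close>.
\<close>

definition quot_map :: "('s, 'c) ring_scheme \<Rightarrow> 's set \<Rightarrow> ('t \<Rightarrow> 's) \<Rightarrow> 't set \<Rightarrow> 's set"
  where "quot_map S J h C = set_add S J (h ` C)"


section \<open>Affinoid and dagger algebras\<close>

text \<open>
  Throughout, \<open>B\<close> is \<open>R\<close> or \<open>K\<close> with its absolute value.  A dagger algebra is given by a
  presentation: a finite set \<open>V\<close> of variables and an ideal \<open>I\<close> of \<open>B\<langle>V\<rangle>\<^sup>\<dagger>\<close>.
\<close>

definition completion_ideal :: "('b, 'c) ring_scheme \<Rightarrow> ('b \<Rightarrow> real) \<Rightarrow> 'v set
    \<Rightarrow> (('v \<Rightarrow> nat) \<Rightarrow> 'b) set \<Rightarrow> (('v \<Rightarrow> nat) \<Rightarrow> 'b) set"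
  where "completion_ideal B absv V I = Idl\<^bsub>convergent_series B absv V\<^esub> I"

definition completion :: "('b, 'c) ring_scheme \<Rightarrow> ('b \<Rightarrow> real) \<Rightarrow> 'v set
    \<Rightarrow> (('v \<Rightarrow> nat) \<Rightarrow> 'b) set \<Rightarrow> (('v \<Rightarrow> nat) \<Rightarrow> 'b) set ring"
  where "completion B absv V I = convergent_series B absv V Quot completion_ideal B absv V I"

definition gauss_norm :: "('b \<Rightarrow> real) \<Rightarrow> 'v set \<Rightarrow> (('v \<Rightarrow> nat) \<Rightarrow> 'b) \<Rightarrow> real"
  where "gauss_norm absv V f = (SUP \<nu>\<in>mexp V. absv (f \<nu>))"

definition residue_norm :: "('b \<Rightarrow> real) \<Rightarrow> 'v set \<Rightarrow> (('v \<Rightarrow> nat) \<Rightarrow> 'b) set \<Rightarrow> real"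
  where "residue_norm absv V C = (INF f\<in>C. gauss_norm absv V f)"

text \<open>
  The coproduct \<open>B\<langle>V\<rangle>\<^sup>\<dagger>/I \<otimes>\<^sup>\<dagger> B\<langle>W\<rangle>\<^sup>\<dagger>/J = B\<langle>V,W\<rangle>\<^sup>\<dagger>/(I + J)\<close>; the disjoint union of the two
  sets of variables is formed in the sum type.
\<close>

definition coproduct_ideal :: "('b, 'c) ring_scheme \<Rightarrow> ('b \<Rightarrow> real)
    \<Rightarrow> 'v set \<Rightarrow> (('v \<Rightarrow> nat) \<Rightarrow> 'b) set \<Rightarrow> 'w set \<Rightarrow> (('w \<Rightarrow> nat) \<Rightarrow> 'b) set
    \<Rightarrow> (('v + 'w \<Rightarrow> nat) \<Rightarrow> 'b) set"
  where "coproduct_ideal B absv V I W J = Idl\<^bsub>dagger_series B absv (Sum_Type.Plus V W)\<^esub>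
    (linear_subst B V (Sum_Type.Plus V W) (\<lambda>v. variable B (Inl v)) ` I \<union>
     linear_subst B W (Sum_Type.Plus V W) (\<lambda>w. variable B (Inr w)) ` J)"

definition dagger_coproduct :: "('b, 'c) ring_scheme \<Rightarrow> ('b \<Rightarrow> real)
    \<Rightarrow> 'v set \<Rightarrow> (('v \<Rightarrow> nat) \<Rightarrow> 'b) set \<Rightarrow> 'w set \<Rightarrow> (('w \<Rightarrow> nat) \<Rightarrow> 'b) set
    \<Rightarrow> (('v + 'w \<Rightarrow> nat) \<Rightarrow> 'b) set ring"
  where "dagger_coproduct B absv V I W J =
    dagger_series B absv (Sum_Type.Plus V W) Quot coproduct_ideal B absv V I W J"


section \<open>Homotopy groups of simplicial groups\<close>

text \<open>
  A simplicial group consists of levels \<open>G q\<close> and maps \<open>act q r \<phi> : G r \<rightarrow> G q\<close> for weakly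
  increasing \<open>\<phi> : {0..q} \<rightarrow> {0..r}\<close>.  Its underlying simplicial set is Kan, and its homotopy groups
  (at the unit) are classes of \<open>n\<close>-simplices all of whose faces are trivial, modulo simplicial
  homotopy relative to the boundary.  The group law is induced by that of \<open>G n\<close>; for \<open>n \<ge> 1\<close> it
  agrees with the one defined by horn fillers.
\<close>

definition coface :: "nat \<Rightarrow> nat \<Rightarrow> nat"
  where "coface i j = (if j < i then j else Suc j)"

definition spheres :: "(nat \<Rightarrow> ('g, 'c) monoid_scheme) \<Rightarrow> (nat \<Rightarrow> nat \<Rightarrow> (nat \<Rightarrow> nat) \<Rightarrow> 'g \<Rightarrow> 'g)
    \<Rightarrow> nat \<Rightarrow> 'g set"
  where "spheres G act n = {x \<in> carrier (G n).
    n > 0 \<longrightarrow> (\<forall>i\<le>n. act (n - 1) n (coface i) x = \<one>\<^bsub>G (n - 1)\<^esub>)}"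

definition sphere_homotopy :: "(nat \<Rightarrow> ('g, 'c) monoid_scheme)
    \<Rightarrow> (nat \<Rightarrow> nat \<Rightarrow> (nat \<Rightarrow> nat) \<Rightarrow> 'g \<Rightarrow> 'g) \<Rightarrow> nat \<Rightarrow> ('g \<times> 'g) set"
  where "sphere_homotopy G act n = {(x, y) \<in> spheres G act n \<times> spheres G act n.
    \<exists>z\<in>carrier (G (Suc n)).
      (\<forall>i<n. act n (Suc n) (coface i) z = \<one>\<^bsub>G n\<^esub>) \<and>
      act n (Suc n) (coface n) z = x \<and> act n (Suc n) (coface (Suc n)) z = y}"

definition homotopy_group :: "(nat \<Rightarrow> ('g, 'c) monoid_scheme)
    \<Rightarrow> (nat \<Rightarrow> nat \<Rightarrow> (nat \<Rightarrow> nat) \<Rightarrow> 'g \<Rightarrow> 'g) \<Rightarrow> nat \<Rightarrow> 'g set monoid"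
  where "homotopy_group G act n =
    \<lparr>carrier = spheres G act n // sphere_homotopy G act n,
     monoid.mult = (\<lambda>C D. sphere_homotopy G act n `` {x \<otimes>\<^bsub>G n\<^esub> y | x y. x \<in> C \<and> y \<in> D}),
     monoid.one = sphere_homotopy G act n `` {\<one>\<^bsub>G n\<^esub>}\<rparr>"


section \<open>The stable general linear group\<close>

text \<open>
  \<open>GL(S)\<close> is the union of the groups \<open>GL\<^sub>N(S)\<close> along \<open>g \<mapsto> g \<oplus> 1\<close>, realised as the invertible
  \<open>\<nat> \<times> \<nat>\<close> matrices that agree with the identity outside a finite block.  The rows of such matrices
  have finite support, so the sum in the product is finite.
\<close>

definition stable_matrices :: "('s, 'c) ring_scheme \<Rightarrow> (nat \<Rightarrow> nat \<Rightarrow> 's) monoid"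
  where "stable_matrices S =
    \<lparr>carrier = {g. (\<forall>i j. g i j \<in> carrier S) \<and>
       (\<exists>N. \<forall>i j. i \<ge> N \<or> j \<ge> N \<longrightarrow> g i j = (if i = j then \<one>\<^bsub>S\<^esub> else \<zero>\<^bsub>S\<^esub>))},
     monoid.mult = (\<lambda>g h i k. \<Oplus>\<^bsub>S\<^esub>j\<in>{j. g i j \<noteq> \<zero>\<^bsub>S\<^esub>}. g i j \<otimes>\<^bsub>S\<^esub> h j k),
     monoid.one = (\<lambda>i j. if i = j then \<one>\<^bsub>S\<^esub> else \<zero>\<^bsub>S\<^esub>)\<rparr>"

definition GL :: "('s, 'c) ring_scheme \<Rightarrow> (nat \<Rightarrow> nat \<Rightarrow> 's) monoid"
  where "GL S = units_of (stable_matrices S)"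

definition map_matrix :: "('s \<Rightarrow> 't) \<Rightarrow> (nat \<Rightarrow> nat \<Rightarrow> 's) \<Rightarrow> nat \<Rightarrow> nat \<Rightarrow> 't"
  where "map_matrix h g = (\<lambda>i j. h (g i j))"


section \<open>Topological K-theory\<close>

text \<open>
  \<open>simplex_relation S B q\<close> is \<open>\<Sum>\<^sub>i x\<^sub>i - 1\<close>, computed in the ring \<open>S\<close> of series over \<open>B\<close> in
  \<open>x\<^sub>0, \<dots>, x\<^sub>q\<close>.
\<close>

definition simplex_relation :: "((nat \<Rightarrow> nat) \<Rightarrow> 'b) ring \<Rightarrow> ('b, 'c) ring_scheme \<Rightarrow> nat
    \<Rightarrow> (nat \<Rightarrow> nat) \<Rightarrow> 'b"
  where "simplex_relation S B q = (\<Oplus>\<^bsub>S\<^esub>i\<in>{..q}. variable B i) \<ominus>\<^bsub>S\<^esub> \<one>\<^bsub>S\<^esub>"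

subsection \<open>Ultrametric Banach rings\<close>

definition banach_simplex_ideal :: "('b, 'c) ring_scheme \<Rightarrow> ('b \<Rightarrow> real) \<Rightarrow> nat
    \<Rightarrow> ((nat \<Rightarrow> nat) \<Rightarrow> 'b) set"
  where "banach_simplex_ideal B nrm q = Idl\<^bsub>convergent_series B nrm {..q}\<^esub>
    {simplex_relation (convergent_series B nrm {..q}) B q}"

definition banach_simplex :: "('b, 'c) ring_scheme \<Rightarrow> ('b \<Rightarrow> real) \<Rightarrow> nat
    \<Rightarrow> ((nat \<Rightarrow> nat) \<Rightarrow> 'b) set ring"
  where "banach_simplex B nrm q =
    convergent_series B nrm {..q} Quot banach_simplex_ideal B nrm q"

definition banach_simplex_act :: "('b, 'c) ring_scheme \<Rightarrow> ('b \<Rightarrow> real)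
    \<Rightarrow> nat \<Rightarrow> nat \<Rightarrow> (nat \<Rightarrow> nat)
    \<Rightarrow> ((nat \<Rightarrow> nat) \<Rightarrow> 'b) set \<Rightarrow> ((nat \<Rightarrow> nat) \<Rightarrow> 'b) set"
  where "banach_simplex_act B nrm q r \<phi> =
    quot_map (convergent_series B nrm {..q}) (banach_simplex_ideal B nrm q)
      (linear_subst B {..r} {..q}
        (\<lambda>i. \<Oplus>\<^bsub>power_series B {..q}\<^esub>j\<in>{j \<in> {..q}. \<phi> j = i}. variable B j))"

text \<open>\<open>K_top_banach B nrm n\<close> is \<open>K\<^sup>-\<^sup>n\<^sub>t\<^sub>o\<^sub>p(B) = \<pi>\<^sub>n\<^sub>-\<^sub>1(GL(B\<^sub>\<bullet>))\<close>, meaningful for \<open>n \<ge> 1\<close>.\<close>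

definition K_top_banach :: "('b, 'c) ring_scheme \<Rightarrow> ('b \<Rightarrow> real) \<Rightarrow> nat
    \<Rightarrow> (nat \<Rightarrow> nat \<Rightarrow> ((nat \<Rightarrow> nat) \<Rightarrow> 'b) set) set monoid"
  where "K_top_banach B nrm n =
    homotopy_group (\<lambda>q. GL (banach_simplex B nrm q))
      (\<lambda>q r \<phi>. map_matrix (banach_simplex_act B nrm q r \<phi>)) (n - 1)"

subsection \<open>Dagger algebras\<close>

definition standard_simplex_ideal :: "('b, 'c) ring_scheme \<Rightarrow> ('b \<Rightarrow> real) \<Rightarrow> nat
    \<Rightarrow> ((nat \<Rightarrow> nat) \<Rightarrow> 'b) set"
  where "standard_simplex_ideal B absv q = Idl\<^bsub>dagger_series B absv {..q}\<^esub>
    {simplex_relation (dagger_series B absv {..q}) B q}"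

definition dagger_simplex :: "('b, 'c) ring_scheme \<Rightarrow> ('b \<Rightarrow> real)
    \<Rightarrow> 'v set \<Rightarrow> (('v \<Rightarrow> nat) \<Rightarrow> 'b) set \<Rightarrow> nat \<Rightarrow> (('v + nat \<Rightarrow> nat) \<Rightarrow> 'b) set ring"
  where "dagger_simplex B absv V I q =
    dagger_coproduct B absv V I {..q} (standard_simplex_ideal B absv q)"

definition dagger_simplex_act :: "('b, 'c) ring_scheme \<Rightarrow> ('b \<Rightarrow> real)
    \<Rightarrow> 'v set \<Rightarrow> (('v \<Rightarrow> nat) \<Rightarrow> 'b) set \<Rightarrow> nat \<Rightarrow> nat \<Rightarrow> (nat \<Rightarrow> nat)
    \<Rightarrow> (('v + nat \<Rightarrow> nat) \<Rightarrow> 'b) set \<Rightarrow> (('v + nat \<Rightarrow> nat) \<Rightarrow> 'b) set"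
  where "dagger_simplex_act B absv V I q r \<phi> =
    quot_map (dagger_series B absv (Sum_Type.Plus V {..q}))
      (coproduct_ideal B absv V I {..q} (standard_simplex_ideal B absv q))
      (linear_subst B (Sum_Type.Plus V {..r}) (Sum_Type.Plus V {..q})
        (case_sum (\<lambda>v. variable B (Inl v))
          (\<lambda>i. \<Oplus>\<^bsub>power_series B (Sum_Type.Plus V {..q})\<^esub>j\<in>{j \<in> {..q}. \<phi> j = i}. variable B (Inr j))))"

text \<open>\<open>K_top_dagger B absv V I n\<close> is \<open>K\<^sup>-\<^sup>n\<^sub>t\<^sub>o\<^sub>p(A)\<close> for \<open>A = B\<langle>V\<rangle>\<^sup>\<dagger>/I\<close>, meaningful for \<open>n \<ge> 1\<close>.\<close>

definition K_top_dagger :: "('b, 'c) ring_scheme \<Rightarrow> ('b \<Rightarrow> real)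
    \<Rightarrow> 'v set \<Rightarrow> (('v \<Rightarrow> nat) \<Rightarrow> 'b) set \<Rightarrow> nat
    \<Rightarrow> (nat \<Rightarrow> nat \<Rightarrow> (('v + nat \<Rightarrow> nat) \<Rightarrow> 'b) set) set monoid"
  where "K_top_dagger B absv V I n =
    homotopy_group (\<lambda>q. GL (dagger_simplex B absv V I q))
      (\<lambda>q r \<phi>. map_matrix (dagger_simplex_act B absv V I q r \<phi>)) (n - 1)"

end

theory Submission
  imports Defs "HOL-Library.Function_Algebras"
begin

text \<open>
  Write \<open>D\<^sub>q\<close> for the \<open>q\<close>-th level of the simplicial dagger algebra of \<open>A\<close>, \<open>B\<^sub>q\<close> for that of the
  completion, and \<open>J\<close> for the set of classes of series all of whose coefficients have absolute value
  less than 1.  Matrices congruent to 1 modulo \<open>J\<close> are invertible, because the elements of \<open>1 + J\<close> are,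
  and form simplicial subgroups of \<open>GL(D)\<close> and \<open>GL(B)\<close>.  These are contractible: as barycentric coordinates
  have norm at most 1, multiplication by them gives the linear simplicial ring \<open>J\<close> a contraction,
  so that every compatible boundary can be filled.

  Overconvergent series are dense in the convergent ones, so every element of \<open>GL(B\<^sub>q)\<close> is congruent
  modulo \<open>J\<close> to an element of \<open>GL(D\<^sub>q)\<close>.  Conversely, if the image in \<open>B\<^sub>q\<close> of an overconvergent
  series is represented by a series with coefficients less than 1, then the difference lies in an
  ideal generated by overconvergent series; approximating the finitely many large coefficients of
  the cofactors shows that the class in \<open>D\<^sub>q\<close> lies in \<open>J\<close> as well.  Thus both simplicial groups
  have the same quotient by contractible subgroups.
\<close>

section \<open>Power series and linear substitutions\<close>

text \<open>Two points shape the proof. Over K the series with coefficients of norm less than 1 do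
  not form an ideal: they are closed under products and under multiplication by series of norm at
  most 1. Hence \<open>J\<close> is treated as a ring without unit that has quasi-inverses, and an
  approximation of a matrix has to control the error multiplied by the finitely many entries of the
  matrix and of its inverse.

  The other point is that the coefficients of \<open>B q\<close> live in a quotient with a residue
  norm. Both simplicial rings are therefore presented over the base: \<open>theta\<close> makes the
  convergent series over the completion a quotient of the convergent series in all variables, those
  of A and those of the simplex, and estimates are made on coefficients in the base. The simplicial
  maps become substitutions of sums of variables, whose multinomial coefficients are integers and so
  have norm at most 1. That \<open>1 + J\<close> consists of units also for overconvergent series
  comes from lowering the radius until all weights are less than 1.\<close>

context abelian_monoid
begin

lemma finsum_Sigma:
  assumes "finite A" "\<And>a. a \<in> A \<Longrightarrow> finite (B a)"
    and "\<And>a b. a \<in> A \<Longrightarrow> b \<in> B a \<Longrightarrow> f a b \<in> carrier G"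
  shows "(\<Oplus>a\<in>A. \<Oplus>b\<in>B a. f a b) = (\<Oplus>p\<in>Sigma A B. case p of (a, b) \<Rightarrow> f a b)"
  using assms
proof (induction A rule: finite_induct)
  case (insert x A)
  have S: "Sigma (insert x A) B = Pair x ` B x \<union> Sigma A B" by auto
  have 1: "(\<Oplus>p\<in>Pair x ` B x. case p of (a, b) \<Rightarrow> f a b) = (\<Oplus>b\<in>B x. f x b)"
    by (subst finsum_reindex) (auto simp: inj_on_def insert.prems)
  have "(\<Oplus>p\<in>Sigma (insert x A) B. case p of (a, b) \<Rightarrow> f a b)
      = (\<Oplus>p\<in>Pair x ` B x. case p of (a, b) \<Rightarrow> f a b) \<oplus> (\<Oplus>p\<in>Sigma A B. case p of (a, b) \<Rightarrow> f a b)"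
    unfolding S using insert by (intro finsum_Un_disjoint) auto
  then show ?case
    using insert by (subst finsum_insert) (auto simp: 1 intro!: finsum_closed)
qed auto

lemma finsum_swap:
  assumes "finite A" "finite B" "\<And>a b. a \<in> A \<Longrightarrow> b \<in> B \<Longrightarrow> f a b \<in> carrier G"
  shows "(\<Oplus>a\<in>A. \<Oplus>b\<in>B. f a b) = (\<Oplus>b\<in>B. \<Oplus>a\<in>A. f a b)"
proof -
  have "(\<Oplus>p\<in>A \<times> B. case p of (a, b) \<Rightarrow> f a b) = (\<Oplus>p\<in>B \<times> A. case p of (b, a) \<Rightarrow> f a b)"
  proof -
    have "A \<times> B = (\<lambda>(b, a). (a, b)) ` (B \<times> A)" by auto
    then have "(\<Oplus>p\<in>A \<times> B. case p of (a, b) \<Rightarrow> f a b) = (\<Oplus>p\<in>(\<lambda>(b, a). (a, b)) ` (B \<times> A). case p of (a, b) \<Rightarrow> f a b)"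
      by simp
    also have "\<dots> = (\<Oplus>q\<in>B \<times> A. case (case q of (b, a) \<Rightarrow> (a, b)) of (a, b) \<Rightarrow> f a b)"
      by (rule finsum_reindex) (auto simp: inj_on_def assms)
    finally show ?thesis by (simp add: case_prod_unfold)
  qed
  then show ?thesis using assms by (simp add: finsum_Sigma)
qed

lemma finsum_single:
  assumes "finite A" "i \<in> A" "f i \<in> carrier G" "\<And>j. j \<in> A \<Longrightarrow> j \<noteq> i \<Longrightarrow> f j = \<zero>"
  shows "(\<Oplus>j\<in>A. f j) = f i"
proof -
  have "(\<Oplus>j\<in>A. f j) = (\<Oplus>j\<in>{i}. f j)"
    using assms by (intro add.finprod_mono_neutral_cong_right) (auto, metis zero_closed)
  then show ?thesis using assms by simp
qed

lemma finsum_zeroI: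
  assumes "\<And>j. j \<in> A \<Longrightarrow> f j = \<zero>"
  shows "(\<Oplus>j\<in>A. f j) = \<zero>"
  using assms by (rule add.finprod_one_eqI)

lemma finsum_bij:
  assumes "bij_betw h A B" "\<And>x. x \<in> A \<Longrightarrow> f x = g (h x)" "\<And>y. y \<in> B \<Longrightarrow> g y \<in> carrier G"
  shows "(\<Oplus>x\<in>A. f x) = (\<Oplus>y\<in>B. g y)"
proof -
  have B: "B = h ` A" "inj_on h A" using assms(1) by (auto simp: bij_betw_def)
  have "(\<Oplus>y\<in>B. g y) = (\<Oplus>x\<in>A. g (h x))"
    unfolding B(1) using assms(3) B by (intro finsum_reindex) auto
  also have "\<dots> = (\<Oplus>x\<in>A. f x)"
    using assms B by (intro finsum_cong') auto
  finally show ?thesis by simp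
qed

lemma finsum_superset:
  assumes "finite B" "A \<subseteq> B" "\<And>x. x \<in> A \<Longrightarrow> f x \<in> carrier G" "\<And>x. x \<in> B - A \<Longrightarrow> f x = \<zero>"
  shows "(\<Oplus>x\<in>A. f x) = (\<Oplus>x\<in>B. f x)"
  using assms by (intro add.finprod_mono_neutral_cong_left) (auto, metis DiffI zero_closed)

end

section \<open>Multi-indices and their pointwise order\<close>

lemma below_eq: "{\<alpha>. \<forall>v. \<alpha> v \<le> \<nu> v} = {..\<nu>}"
  by (auto simp: le_fun_def)

lemma mexp_below: "\<alpha> \<le> \<nu> \<Longrightarrow> \<nu> \<in> mexp V \<Longrightarrow> \<alpha> \<in> mexp V"
  by (simp add: mexp_def le_fun_def) (metis le_zero_eq)

lemma mexp_diff [simp]: "\<nu> \<in> mexp V \<Longrightarrow> \<nu> - \<alpha> \<in> mexp V"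
  by (auto simp: mexp_def)

lemma mexp_add [simp]: "\<nu> \<in> mexp V \<Longrightarrow> \<alpha> \<in> mexp V \<Longrightarrow> \<nu> + \<alpha> \<in> mexp V"
  by (auto simp: mexp_def)

lemma mexp_zero [simp]: "0 \<in> mexp V" "(\<lambda>_. 0) \<in> mexp V"
  by (auto simp: mexp_def)

text \<open>Keeps the sums over \<open>{..\<nu>}\<close> in a product of series finite; over an
  infinite set \<open>finsum\<close> would return its default value zero.\<close>

lemma finite_below: "finite V \<Longrightarrow> \<nu> \<in> mexp V \<Longrightarrow> finite {..\<nu>}"
proof -
  assume V: "finite V" "\<nu> \<in> mexp V"
  have "{..\<nu>} \<subseteq> {f. \<forall>x. (x \<in> V \<longrightarrow> f x \<in> {..Max (\<nu> ` V)}) \<and> (x \<notin> V \<longrightarrow> f x = 0)}"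
  proof (clarsimp simp: mexp_def le_fun_def)
    fix f x assume f: "\<forall>v. f v \<le> \<nu> v"
    have "f x \<le> \<nu> x" "x \<in> V \<Longrightarrow> \<nu> x \<le> Max (\<nu> ` V)" "x \<notin> V \<Longrightarrow> \<nu> x = 0"
      using f V by (auto simp: mexp_def)
    then show "(x \<in> V \<longrightarrow> f x \<le> Max (\<nu> ` V)) \<and> (x \<notin> V \<longrightarrow> f x = 0)" by fastforce
  qed
  then show ?thesis
    using finite_set_of_finite_funs[OF V(1), of "{..Max (\<nu> ` V)}" 0] by (auto intro: finite_subset)
qed

lemma le_diff_add [simp]: "\<alpha> \<le> \<nu> \<Longrightarrow> \<alpha> + (\<nu> - \<alpha>) = \<nu>" "\<alpha> \<le> \<nu> \<Longrightarrow> (\<nu> - \<alpha>) + \<alpha> = (\<nu> :: 'v \<Rightarrow> nat)"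
  by (auto simp: le_fun_def)

lemma fun_nat_diff_diff: "\<alpha> \<le> \<nu> \<Longrightarrow> \<nu> - (\<nu> - \<alpha>) = (\<alpha> :: 'v \<Rightarrow> nat)"
  by (auto simp: le_fun_def)

lemma fun_nat_diff_le [simp]: "\<nu> - \<alpha> \<le> (\<nu> :: 'v \<Rightarrow> nat)"
  by (auto simp: le_fun_def)

lemma fun_nat_le_add [simp]: "\<alpha> \<le> \<alpha> + (\<beta> :: 'v \<Rightarrow> nat)"
  by (auto simp: le_fun_def)

section \<open>The ring of formal power series\<close>

context cring
begin

lemma ps_carrier: "carrier (power_series R V) =
    {f. (\<forall>\<nu>\<in>mexp V. f \<nu> \<in> carrier R) \<and> (\<forall>\<nu>. \<nu> \<notin> mexp V \<longrightarrow> f \<nu> = \<zero>)}"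
  by (simp add: power_series_def)

lemma ps_coeff: "f \<in> carrier (power_series R V) \<Longrightarrow> f \<nu> \<in> carrier R"
  by (cases "\<nu> \<in> mexp V") (auto simp: ps_carrier)

lemma ps_outside: "f \<in> carrier (power_series R V) \<Longrightarrow> \<nu> \<notin> mexp V \<Longrightarrow> f \<nu> = \<zero>"
  by (auto simp: ps_carrier)

lemma ps_memI: "(\<And>\<nu>. \<nu> \<in> mexp V \<Longrightarrow> f \<nu> \<in> carrier R) \<Longrightarrow> (\<And>\<nu>. \<nu> \<notin> mexp V \<Longrightarrow> f \<nu> = \<zero>)
    \<Longrightarrow> f \<in> carrier (power_series R V)"
  by (auto simp: ps_carrier)

lemma ps_mult: "f \<otimes>\<^bsub>power_series R V\<^esub> g =
    (\<lambda>\<nu>. if \<nu> \<in> mexp V then \<Oplus>\<alpha>\<in>{..\<nu>}. f \<alpha> \<otimes> g (\<nu> - \<alpha>) else \<zero>)"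
  by (simp only: power_series_def below_eq[symmetric] fun_diff_def partial_object.simps monoid.simps ring.simps)

lemma ps_one: "\<one>\<^bsub>power_series R V\<^esub> = (\<lambda>\<nu>. if \<nu> = 0 then \<one> else \<zero>)"
  by (simp add: power_series_def zero_fun_def)

lemma ps_zero: "\<zero>\<^bsub>power_series R V\<^esub> = (\<lambda>_. \<zero>)"
  by (simp add: power_series_def)

lemma ps_add: "f \<oplus>\<^bsub>power_series R V\<^esub> g = (\<lambda>\<nu>. f \<nu> \<oplus> g \<nu>)"
  by (simp add: power_series_def)

lemmas ps_simps = ps_mult ps_one ps_zero ps_add

lemma ps_mult_closed:
  assumes "finite V" "f \<in> carrier (power_series R V)" "g \<in> carrier (power_series R V)"
  shows "f \<otimes>\<^bsub>power_series R V\<^esub> g \<in> carrier (power_series R V)"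
  using assms(2,3)[THEN ps_coeff] by (intro ps_memI) (auto simp: ps_mult intro!: finsum_closed)

lemma ps_mult_comm:
  assumes V: "finite V" and f: "f \<in> carrier (power_series R V)" and g: "g \<in> carrier (power_series R V)"
  shows "f \<otimes>\<^bsub>power_series R V\<^esub> g = g \<otimes>\<^bsub>power_series R V\<^esub> f"
proof -
  have "(\<Oplus>\<alpha>\<in>{..\<nu>}. f \<alpha> \<otimes> g (\<nu> - \<alpha>)) = (\<Oplus>\<alpha>\<in>{..\<nu>}. g \<alpha> \<otimes> f (\<nu> - \<alpha>))" for \<nu>
    using f[THEN ps_coeff] g[THEN ps_coeff]
    by (intro finsum_bij[where h = "\<lambda>\<alpha>. \<nu> - \<alpha>"] bij_betwI[where g = "\<lambda>\<alpha>. \<nu> - \<alpha>"])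
      (auto simp: fun_nat_diff_diff m_comm)
  then show ?thesis by (auto simp: ps_mult)
qed

text \<open>Both bracketings sum over the triples of exponents that add up to \<nu>. The left one
  lists them as pairs \<beta> \<le> \<alpha>, the right one as pairs (\<beta>, \<gamma>), and
  \<gamma> = \<alpha> - \<beta> translates one list into the other.\<close>

lemma ps_mult_assoc:
  assumes V: "finite V" and f: "f \<in> carrier (power_series R V)" and g: "g \<in> carrier (power_series R V)"
    and h: "h \<in> carrier (power_series R V)"
  shows "(f \<otimes>\<^bsub>power_series R V\<^esub> g) \<otimes>\<^bsub>power_series R V\<^esub> h = f \<otimes>\<^bsub>power_series R V\<^esub> (g \<otimes>\<^bsub>power_series R V\<^esub> h)"
proof
  fix \<nu>
  note [simp] = f[THEN ps_coeff] g[THEN ps_coeff] h[THEN ps_coeff]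
  show "((f \<otimes>\<^bsub>power_series R V\<^esub> g) \<otimes>\<^bsub>power_series R V\<^esub> h) \<nu> = (f \<otimes>\<^bsub>power_series R V\<^esub> (g \<otimes>\<^bsub>power_series R V\<^esub> h)) \<nu>"
  proof (cases "\<nu> \<in> mexp V")
    case True
    have fin: "finite {..\<alpha>}" if "\<alpha> \<le> \<nu>" for \<alpha>
      using finite_below[OF V mexp_below[OF that True]] .
    have m: "\<alpha> \<in> mexp V" if "\<alpha> \<le> \<nu>" for \<alpha>
      using mexp_below[OF that True] .
    have "((f \<otimes>\<^bsub>power_series R V\<^esub> g) \<otimes>\<^bsub>power_series R V\<^esub> h) \<nu>
        = (\<Oplus>\<alpha>\<in>{..\<nu>}. (\<Oplus>\<beta>\<in>{..\<alpha>}. f \<beta> \<otimes> g (\<alpha> - \<beta>)) \<otimes> h (\<nu> - \<alpha>))"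
      using True by (auto simp: ps_mult m intro!: finsum_cong')
    also have "\<dots> = (\<Oplus>\<alpha>\<in>{..\<nu>}. (\<Oplus>\<beta>\<in>{..\<alpha>}. f \<beta> \<otimes> g (\<alpha> - \<beta>) \<otimes> h (\<nu> - \<alpha>)))"
      using fin by (intro finsum_cong' finsum_ldistr) (auto intro!: finsum_closed)
    also have "\<dots> = (\<Oplus>p\<in>Sigma {..\<nu>} (\<lambda>\<alpha>. {..\<alpha>}). case p of (\<alpha>, \<beta>) \<Rightarrow> f \<beta> \<otimes> g (\<alpha> - \<beta>) \<otimes> h (\<nu> - \<alpha>))"
      using fin by (intro finsum_Sigma) auto
    also have "\<dots> = (\<Oplus>p\<in>Sigma {..\<nu>} (\<lambda>\<beta>. {..\<nu> - \<beta>}). case p of (\<beta>, \<gamma>) \<Rightarrow> f \<beta> \<otimes> (g \<gamma> \<otimes> h (\<nu> - \<beta> - \<gamma>)))"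
    proof (rule finsum_bij[where h = "\<lambda>(\<alpha>, \<beta>). (\<beta>, \<alpha> - \<beta>)"])
      show "bij_betw (\<lambda>(\<alpha>, \<beta>). (\<beta>, \<alpha> - \<beta>)) (Sigma {..\<nu>} (\<lambda>\<alpha>. {..\<alpha>})) (Sigma {..\<nu>} (\<lambda>\<beta>. {..\<nu> - \<beta>}))"
      proof (rule bij_betwI[where g = "\<lambda>(\<beta>, \<gamma>). (\<beta> + \<gamma>, \<beta>)"])
        have "\<beta> \<le> \<nu>" "\<alpha> - \<beta> \<le> \<nu> - \<beta>" if "\<alpha> \<le> \<nu>" "\<beta> \<le> \<alpha>" for \<alpha> \<beta>
          using that by (auto simp: le_fun_def diff_le_mono intro: order_trans)
        then show "(\<lambda>(\<alpha>, \<beta>). (\<beta>, \<alpha> - \<beta>)) \<in> (SIGMA \<alpha>:{..\<nu>}. {..\<alpha>}) \<rightarrow> (SIGMA \<beta>:{..\<nu>}. {..\<nu> - \<beta>})"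
          by auto
        have "\<beta> + \<gamma> \<le> \<nu>" if "\<beta> \<le> \<nu>" "\<gamma> \<le> \<nu> - \<beta>" for \<beta> \<gamma>
          unfolding le_fun_def
        proof
          fix v have "\<beta> v \<le> \<nu> v" "\<gamma> v \<le> \<nu> v - \<beta> v" using that by (auto simp: le_fun_def)
          then show "(\<beta> + \<gamma>) v \<le> \<nu> v" by simp
        qed
        then show "(\<lambda>(\<beta>, \<gamma>). (\<beta> + \<gamma>, \<beta>)) \<in> (SIGMA \<beta>:{..\<nu>}. {..\<nu> - \<beta>}) \<rightarrow> (SIGMA \<alpha>:{..\<nu>}. {..\<alpha>})"
          by auto
      qed auto
      have "\<nu> - \<beta> - (\<alpha> - \<beta>) = \<nu> - \<alpha>" if "\<beta> \<le> \<alpha>" for \<alpha> \<beta>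
        using that by (auto simp: le_fun_def fun_eq_iff)
      then show "\<And>x. x \<in> (SIGMA \<alpha>:{..\<nu>}. {..\<alpha>}) \<Longrightarrow>
         (case x of (\<alpha>, \<beta>) \<Rightarrow> f \<beta> \<otimes> g (\<alpha> - \<beta>) \<otimes> h (\<nu> - \<alpha>)) =
         (case case x of (\<alpha>, \<beta>) \<Rightarrow> (\<beta>, \<alpha> - \<beta>) of (\<beta>, \<gamma>) \<Rightarrow> f \<beta> \<otimes> (g \<gamma> \<otimes> h (\<nu> - \<beta> - \<gamma>)))"
        by (auto simp: m_assoc)
    qed auto
    also have "\<dots> = (\<Oplus>\<beta>\<in>{..\<nu>}. \<Oplus>\<gamma>\<in>{..\<nu> - \<beta>}. f \<beta> \<otimes> (g \<gamma> \<otimes> h (\<nu> - \<beta> - \<gamma>)))"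
      using fin by (intro finsum_Sigma[symmetric]) auto
    also have "\<dots> = (\<Oplus>\<beta>\<in>{..\<nu>}. f \<beta> \<otimes> (\<Oplus>\<gamma>\<in>{..\<nu> - \<beta>}. g \<gamma> \<otimes> h (\<nu> - \<beta> - \<gamma>)))"
      using fin by (intro finsum_cong' finsum_rdistr[symmetric]) (auto intro!: finsum_closed)
    also have "\<dots> = (f \<otimes>\<^bsub>power_series R V\<^esub> (g \<otimes>\<^bsub>power_series R V\<^esub> h)) \<nu>"
      using True by (auto simp: ps_mult m intro!: finsum_cong')
    finally show ?thesis .
  qed (auto simp: ps_mult)
qed

lemma ps_cring:
  assumes V: "finite V"
  shows "cring (power_series R V)"
proof (rule cringI)
  let ?P = "power_series R V"
  show "abelian_group ?P"
  proof (rule abelian_groupI)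
    fix x assume x: "x \<in> carrier ?P"
    note [simp] = x[THEN ps_coeff]
    have "(\<lambda>\<nu>. \<ominus> x \<nu>) \<in> carrier ?P" using x by (simp add: ps_carrier)
    moreover have "(\<lambda>\<nu>. \<ominus> x \<nu>) \<oplus>\<^bsub>?P\<^esub> x = \<zero>\<^bsub>?P\<^esub>"
      by (simp add: ps_simps l_neg)
    ultimately show "\<exists>y\<in>carrier ?P. y \<oplus>\<^bsub>?P\<^esub> x = \<zero>\<^bsub>?P\<^esub>" by blast
    show "\<zero>\<^bsub>?P\<^esub> \<oplus>\<^bsub>?P\<^esub> x = x" by (simp add: ps_simps)
    fix y assume y: "y \<in> carrier ?P"
    note [simp] = y[THEN ps_coeff]
    show "x \<oplus>\<^bsub>?P\<^esub> y = y \<oplus>\<^bsub>?P\<^esub> x" by (simp add: ps_simps a_comm)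
    fix z assume z: "z \<in> carrier ?P"
    note [simp] = z[THEN ps_coeff]
    show "x \<oplus>\<^bsub>?P\<^esub> y \<oplus>\<^bsub>?P\<^esub> z = x \<oplus>\<^bsub>?P\<^esub> (y \<oplus>\<^bsub>?P\<^esub> z)" by (simp add: ps_simps a_assoc)
  qed (auto simp: ps_simps ps_carrier)
  show "comm_monoid ?P"
  proof (rule comm_monoidI)
    show "\<one>\<^bsub>?P\<^esub> \<in> carrier ?P" by (auto simp: ps_simps ps_carrier)
    fix f assume f: "f \<in> carrier ?P"
    show "\<one>\<^bsub>?P\<^esub> \<otimes>\<^bsub>?P\<^esub> f = f"
    proof
      fix \<nu>
      show "(\<one>\<^bsub>?P\<^esub> \<otimes>\<^bsub>?P\<^esub> f) \<nu> = f \<nu>"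
      proof (cases "\<nu> \<in> mexp V")
        case True
        have "(\<Oplus>\<alpha>\<in>{..\<nu>}. (if \<alpha> = 0 then \<one> else \<zero>) \<otimes> f (\<nu> - \<alpha>)) = (\<lambda>\<alpha>. (if \<alpha> = 0 then \<one> else \<zero>) \<otimes> f (\<nu> - \<alpha>)) 0"
          using f[THEN ps_coeff] True finite_below[OF V True]
          by (intro finsum_single[where f = "\<lambda>\<alpha>. (if \<alpha> = 0 then \<one> else \<zero>) \<otimes> f (\<nu> - \<alpha>)"]) (auto simp: le_fun_def)
        then show ?thesis using True f[THEN ps_coeff] by (simp add: ps_simps fun_diff_def)
      qed (use f in \<open>auto simp: ps_mult ps_outside\<close>)
    qed
  qed (simp_all add: ps_mult_closed ps_mult_assoc V, simp add: ps_mult_comm V)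
  fix f g h assume fgh: "f \<in> carrier ?P" "g \<in> carrier ?P" "h \<in> carrier ?P"
  have "(\<Oplus>\<alpha>\<in>{..\<nu>}. (f \<alpha> \<oplus> g \<alpha>) \<otimes> h (\<nu> - \<alpha>))
    = (\<Oplus>\<alpha>\<in>{..\<nu>}. f \<alpha> \<otimes> h (\<nu> - \<alpha>)) \<oplus> (\<Oplus>\<alpha>\<in>{..\<nu>}. g \<alpha> \<otimes> h (\<nu> - \<alpha>))" if "\<nu> \<in> mexp V" for \<nu>
    using fgh[THEN ps_coeff] finite_below[OF V that] by (subst finsum_addf[symmetric]) (auto simp: l_distr)
  then show "(f \<oplus>\<^bsub>?P\<^esub> g) \<otimes>\<^bsub>?P\<^esub> h = f \<otimes>\<^bsub>?P\<^esub> h \<oplus>\<^bsub>?P\<^esub> g \<otimes>\<^bsub>?P\<^esub> h"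
    by (auto simp: ps_simps)
qed

lemma ps_a_inv:
  assumes V: "finite V" and f: "f \<in> carrier (power_series R V)"
  shows "\<ominus>\<^bsub>power_series R V\<^esub> f = (\<lambda>\<nu>. \<ominus> f \<nu>)"
proof -
  interpret P: cring "power_series R V" by (rule ps_cring[OF V])
  have 1: "(\<lambda>\<nu>. \<ominus> f \<nu>) \<in> carrier (power_series R V)" using f by (auto simp: ps_carrier)
  have "(\<lambda>\<nu>. \<ominus> f \<nu>) \<oplus>\<^bsub>power_series R V\<^esub> f = \<zero>\<^bsub>power_series R V\<^esub>"
    using f[THEN ps_coeff] by (auto simp: ps_simps l_neg)
  then show ?thesis using 1 f by (metis P.minus_equality)
qed

lemma ps_finsum:
  assumes V: "finite V" and A: "finite A" "\<And>a. a \<in> A \<Longrightarrow> F a \<in> carrier (power_series R V)"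
  shows "(\<Oplus>\<^bsub>power_series R V\<^esub>a\<in>A. F a) = (\<lambda>\<nu>. \<Oplus>a\<in>A. F a \<nu>)"
proof -
  interpret P: cring "power_series R V" by (rule ps_cring[OF V])
  show ?thesis using A
  proof (induction A rule: finite_induct)
    case (insert x A)
    have "(\<Oplus>\<^bsub>power_series R V\<^esub>a\<in>insert x A. F a) = F x \<oplus>\<^bsub>power_series R V\<^esub> (\<Oplus>\<^bsub>power_series R V\<^esub>a\<in>A. F a)"
      using insert by (intro P.finsum_insert) auto
    moreover have "(\<Oplus>a\<in>insert x A. F a \<nu>) = F x \<nu> \<oplus> (\<Oplus>a\<in>A. F a \<nu>)" for \<nu>
      using insert.hyps insert.prems[THEN ps_coeff] by (intro finsum_insert) auto
    ultimately show ?case using insert by (simp add: ps_add)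
  qed (simp add: ps_zero)
qed

end

section \<open>Exponents and multinomial coefficients of a substitution\<close>

definition single :: "'v \<Rightarrow> 'v \<Rightarrow> nat"
  where "single v = (\<lambda>w. if w = v then 1 else 0)"

text \<open>
  The substitution \<open>x\<^sub>v \<mapsto> \<Sum> x\<^sub>w\<close>, the sum over all \<open>w \<in> U\<close> with \<open>\<phi> w = v\<close>, is multinomial:
  \<open>x\<^bsup>\<nu>\<^esup>\<close> is sent to the sum of all \<open>mcoef \<phi> U \<mu> x\<^bsup>\<mu>\<^esup>\<close> with \<open>push \<phi> U \<mu> = \<nu>\<close>.
\<close>

definition push :: "('w \<Rightarrow> 'v) \<Rightarrow> 'w set \<Rightarrow> ('w \<Rightarrow> nat) \<Rightarrow> 'v \<Rightarrow> nat"
  where "push \<phi> U \<mu> = (\<lambda>v. \<Sum>w | w \<in> U \<and> \<phi> w = v. \<mu> w)"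

definition mcoef :: "('w \<Rightarrow> 'v) \<Rightarrow> 'w set \<Rightarrow> ('w \<Rightarrow> nat) \<Rightarrow> nat"
  where "mcoef \<phi> U \<mu> = (\<Prod>v\<in>\<phi> ` U. fact (push \<phi> U \<mu> v)) div (\<Prod>w\<in>U. fact (\<mu> w))"

lemma single_apply: "single v w = (if w = v then 1 else 0)"
  by (simp add: single_def)

lemma single_inj [simp]: "single v = single w \<longleftrightarrow> v = w"
  by (metis single_apply zero_neq_one)

lemma single_nonzero [simp]: "single v \<noteq> 0" "0 \<noteq> single v"
  by (auto simp: single_def fun_eq_iff)

lemma single_mexp [simp]: "single v \<in> mexp V \<longleftrightarrow> v \<in> V"
  by (auto simp: single_def mexp_def)

lemma single_le_iff: "single v \<le> \<mu> \<longleftrightarrow> 0 < \<mu> v"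
  by (auto simp: single_def le_fun_def Suc_le_eq)

lemma mdeg_add [simp]: "mdeg V (\<mu> + \<nu>) = mdeg V \<mu> + mdeg V \<nu>"
  by (simp add: mdeg_def sum.distrib)

lemma mdeg_zero [simp]: "mdeg V 0 = 0"
  by (simp add: mdeg_def)

lemma mdeg_single [simp]: "finite V \<Longrightarrow> v \<in> V \<Longrightarrow> mdeg V (single v) = 1"
  by (simp add: mdeg_def single_def)

lemma mdeg_le: "finite V \<Longrightarrow> v \<in> V \<Longrightarrow> \<nu> v \<le> mdeg V \<nu>"
  unfolding mdeg_def by (rule member_le_sum) auto

lemma mdeg_zero_iff: "finite V \<Longrightarrow> \<nu> \<in> mexp V \<Longrightarrow> mdeg V \<nu> = 0 \<longleftrightarrow> \<nu> = 0"
  by (auto simp: mdeg_def mexp_def fun_eq_iff)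

lemma finite_mdeg_le: "finite V \<Longrightarrow> finite {\<nu> \<in> mexp V. mdeg V \<nu> \<le> n}"
proof -
  assume V: "finite V"
  have "{\<nu> \<in> mexp V. mdeg V \<nu> \<le> n} \<subseteq> {f. \<forall>x. (x \<in> V \<longrightarrow> f x \<in> {..n}) \<and> (x \<notin> V \<longrightarrow> f x = 0)}"
  proof clarsimp
    fix \<nu> x assume "\<nu> \<in> mexp V" "mdeg V \<nu> \<le> n"
    then show "(x \<in> V \<longrightarrow> \<nu> x \<le> n) \<and> (x \<notin> V \<longrightarrow> \<nu> x = 0)"
      using mdeg_le[OF V, of x \<nu>] by (auto simp: mexp_def)
  qed
  then show ?thesis
    using finite_set_of_finite_funs[OF V, of "{..n}" 0] by (auto intro: finite_subset)
qed

lemma push_add [simp]: "push \<phi> U (\<mu> + \<nu>) = push \<phi> U \<mu> + push \<phi> U \<nu>"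
  by (auto simp: push_def fun_eq_iff sum.distrib)

lemma push_zero [simp]: "push \<phi> U 0 = 0"
  by (auto simp: push_def fun_eq_iff)

lemma push_single [simp]: "finite U \<Longrightarrow> w \<in> U \<Longrightarrow> push \<phi> U (single w) = single (\<phi> w)"
proof
  fix v assume U: "finite U" "w \<in> U"
  have "(\<Sum>x | x \<in> U \<and> \<phi> x = v. single w x) = (\<Sum>x\<in>(if \<phi> w = v then {w} else {}). 1)"
    using U by (intro sum.mono_neutral_cong_right) (auto simp: single_def split: if_splits)
  then show "push \<phi> U (single w) v = single (\<phi> w) v" by (auto simp: push_def single_def)
qed

lemma push_mexp: "\<phi> ` U \<subseteq> V \<Longrightarrow> push \<phi> U \<mu> \<in> mexp V"
  by (auto simp: push_def mexp_def intro!: sum.neutral)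

lemma push_mono: "\<mu> \<le> \<nu> \<Longrightarrow> push \<phi> U \<mu> \<le> push \<phi> U \<nu>"
  by (auto simp: push_def le_fun_def intro!: sum_mono)

lemma push_diff: "\<mu> \<le> \<nu> \<Longrightarrow> push \<phi> U (\<nu> - \<mu>) = push \<phi> U \<nu> - push \<phi> U \<mu>"
  using push_add[of \<phi> U \<mu> "\<nu> - \<mu>"] by (auto simp: fun_eq_iff)

text \<open>The fibres of \<phi> partition \<open>U\<close>. The substitution thus preserves
  degrees, which is why it respects every radius of convergence.\<close>

lemma mdeg_push:
  assumes "finite U" "finite V" "\<phi> ` U \<subseteq> V"
  shows "mdeg V (push \<phi> U \<mu>) = mdeg U \<mu>"
  unfolding mdeg_def push_def using sum.group[OF assms, of \<mu>] by simp

lemma mdeg_superset: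
  assumes "finite W" "U \<subseteq> W" "\<mu> \<in> mexp U"
  shows "mdeg W \<mu> = mdeg U \<mu>"
  unfolding mdeg_def using assms by (intro sum.mono_neutral_right) (auto simp: mexp_def)

lemma mexp_mono: "U \<subseteq> W \<Longrightarrow> mexp U \<subseteq> mexp W"
  by (auto simp: mexp_def)

lemma push_eq_zero:
  assumes "finite U" "\<mu> \<in> mexp U" "push \<phi> U \<mu> = 0"
  shows "\<mu> = 0"
proof -
  have "mdeg (\<phi> ` U) (push \<phi> U \<mu>) = mdeg U \<mu>" using assms by (intro mdeg_push) auto
  then show ?thesis using assms mdeg_zero_iff[of U \<mu>] by auto
qed

text \<open>Removing from \<mu> one variable that occurs in it leaves an exponent whose push is
  zero, and such an exponent is zero because the degree is preserved.\<close>

lemma push_eq_single: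
  assumes U: "finite U" "\<mu> \<in> mexp U" and p: "push \<phi> U \<mu> = single v"
  shows "\<exists>w\<in>U. \<phi> w = v \<and> \<mu> = single w"
proof -
  have "\<mu> \<noteq> 0" using p by auto
  then obtain w where w: "0 < \<mu> w" by (auto simp: fun_eq_iff)
  then have wU: "w \<in> U" using U by (auto simp: mexp_def)
  have \<mu>: "\<mu> = single w + (\<mu> - single w)" using w by (simp add: single_le_iff)
  then have "push \<phi> U \<mu> = single (\<phi> w) + push \<phi> U (\<mu> - single w)"
    using push_add[of \<phi> U "single w" "\<mu> - single w"] U wU by simp
  then have *: "single v = single (\<phi> w) + push \<phi> U (\<mu> - single w)" using p by simp
  have v: "\<phi> w = v"
  proof (rule ccontr)
    assume "\<phi> w \<noteq> v"
    then show False using fun_cong[OF *, of "\<phi> w"] by (simp add: single_def)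
  qed
  with * have "push \<phi> U (\<mu> - single w) = 0" by simp
  then have "\<mu> - single w = 0" using push_eq_zero U by (metis mexp_diff)
  then show ?thesis using \<mu> v wU by auto
qed

text \<open>The degree of \<mu> is that of its push, and only finitely many exponents have bounded
  degree. This keeps the set of large coefficients finite under a substitution.\<close>

lemma finite_push_fibre:
  assumes U: "finite U" and S: "finite S"
  shows "finite {\<mu> \<in> mexp U. push \<phi> U \<mu> \<in> S}"
proof -
  have "{\<mu> \<in> mexp U. push \<phi> U \<mu> \<in> S} \<subseteq> (\<Union>\<nu>\<in>S. {\<mu> \<in> mexp U. mdeg U \<mu> \<le> mdeg (\<phi> ` U) \<nu>})"
  proof
    fix \<mu> assume "\<mu> \<in> {\<mu> \<in> mexp U. push \<phi> U \<mu> \<in> S}"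
    then show "\<mu> \<in> (\<Union>\<nu>\<in>S. {\<mu> \<in> mexp U. mdeg U \<mu> \<le> mdeg (\<phi> ` U) \<nu>})"
      using mdeg_push[OF U finite_imageI[OF U] subset_refl, of \<phi> \<mu>]
      by (intro UN_I[of "push \<phi> U \<mu>"]) auto
  qed
  moreover have "finite (\<Union>\<nu>\<in>S. {\<mu> \<in> mexp U. mdeg U \<mu> \<le> mdeg (\<phi> ` U) \<nu>})"
    using S finite_mdeg_le[OF U] by simp
  ultimately show ?thesis by (rule finite_subset)
qed

text \<open>Integrality of multinomial coefficients, from that of the binomial ones by adding one
  variable at a time.\<close>

lemma prod_fact_dvd:
  "finite A \<Longrightarrow> (\<Prod>w\<in>A. fact (\<mu> w)) dvd (fact (\<Sum>w\<in>A. \<mu> w) :: nat)"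
proof (induction A rule: finite_induct)
  case (insert x A)
  then have "fact (\<mu> x) * (\<Prod>w\<in>A. fact (\<mu> w)) dvd fact (\<mu> x) * (fact (\<Sum>w\<in>A. \<mu> w) :: nat)" by simp
  also have "\<dots> dvd fact (\<mu> x + (\<Sum>w\<in>A. \<mu> w))" by (rule fact_fact_dvd_fact)
  finally show ?case using insert by simp
qed simp

text \<open>The division in \<open>mcoef\<close> is exact, because each fibre of \<phi> contributes
  a multinomial coefficient. Later computations with \<open>mcoef\<close> multiply out by this
  equation.\<close>

lemma mcoef_spec:
  assumes U: "finite U"
  shows "mcoef \<phi> U \<mu> * (\<Prod>w\<in>U. fact (\<mu> w)) = (\<Prod>v\<in>\<phi> ` U. fact (push \<phi> U \<mu> v))"
proof -
  have "(\<Prod>w\<in>U. fact (\<mu> w)) = (\<Prod>v\<in>\<phi> ` U. \<Prod>w | w \<in> U \<and> \<phi> w = v. fact (\<mu> w) :: nat)"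
    using prod.group[of U "\<phi> ` U" \<phi> "\<lambda>w. fact (\<mu> w) :: nat"] U by simp
  also have "\<dots> dvd (\<Prod>v\<in>\<phi> ` U. fact (push \<phi> U \<mu> v))"
    unfolding push_def using U by (intro prod_dvd_prod prod_fact_dvd) auto
  finally show ?thesis by (simp add: mcoef_def)
qed

lemma mcoef_eqI:
  assumes "finite U" "c * (\<Prod>w\<in>U. fact (\<mu> w)) = (\<Prod>v\<in>\<phi> ` U. fact (push \<phi> U \<mu> v))"
  shows "mcoef \<phi> U \<mu> = c"
proof -
  have "(\<Prod>w\<in>U. fact (\<mu> w) :: nat) \<noteq> 0" using assms(1) by simp
  then show ?thesis using mcoef_spec[OF assms(1), of \<phi> \<mu>] assms(2) by (metis mult_cancel2)
qed

lemma mcoef_spec':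
  assumes V: "finite V" and U: "finite U" "\<phi> ` U \<subseteq> V"
  shows "mcoef \<phi> U \<mu> * (\<Prod>w\<in>U. fact (\<mu> w)) = (\<Prod>v\<in>V. fact (push \<phi> U \<mu> v))"
proof -
  have "push \<phi> U \<mu> v = 0" if "v \<notin> \<phi> ` U" for v
    using that by (auto simp: push_def intro!: sum.neutral)
  then have "(\<Prod>v\<in>V. fact (push \<phi> U \<mu> v) :: nat) = (\<Prod>v\<in>\<phi> ` U. fact (push \<phi> U \<mu> v))"
    using V U by (intro prod.mono_neutral_right) auto
  then show ?thesis using mcoef_spec[OF U(1), of \<phi> \<mu>] by simp
qed

text \<open>With one-point fibres every multinomial factor is 1. This covers an inclusion of
  variables and the identity map.\<close>

lemma mcoef_inj:
  assumes U: "finite U" and i: "inj_on \<phi> U"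
  shows "mcoef \<phi> U \<mu> = 1"
proof (rule mcoef_eqI[OF U])
  have "push \<phi> U \<mu> (\<phi> w) = \<mu> w" if "w \<in> U" for w
  proof -
    have "{x. x \<in> U \<and> \<phi> x = \<phi> w} = {w}" using that i by (auto dest: inj_onD)
    then show ?thesis by (simp add: push_def)
  qed
  then show "1 * (\<Prod>w\<in>U. fact (\<mu> w)) = (\<Prod>v\<in>\<phi> ` U. fact (push \<phi> U \<mu> v))"
    using i by (simp add: prod.reindex)
qed

lemma mcoef_zero [simp]: "finite U \<Longrightarrow> mcoef \<phi> U 0 = 1"
  by (rule mcoef_eqI) auto

lemma prod_fact_single:
  assumes "finite A" "w \<in> A" "0 < \<mu> w"
  shows "(\<Prod>x\<in>A. fact ((\<mu> - single w) x)) * \<mu> w = (\<Prod>x\<in>A. fact (\<mu> x) :: nat)"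
proof -
  have *: "(\<Prod>x\<in>A - {w}. fact ((\<mu> - single w) x)) = (\<Prod>x\<in>A - {w}. fact (\<mu> x) :: nat)"
    by (intro prod.cong) (auto simp: single_def)
  have "fact (\<mu> w - 1) * \<mu> w = (fact (\<mu> w) :: nat)"
    using assms(3) by (metis fact_reduce mult.commute of_nat_id)
  then show ?thesis
    using assms * by (simp add: prod.remove[OF assms(1,2)] single_apply mult.assoc mult.left_commute mult.commute)
qed

text \<open>A Pascal rule: the last linear form in the power belonging to \<open>v\<close>
  contributes one variable \<open>w\<close> of the fibre over \<open>v\<close>, and the remaining
  factors contribute \<mu> with one \<open>w\<close> removed.\<close>

lemma mcoef_rec:
  assumes U: "finite U" and v: "0 < push \<phi> U \<mu> v"
  shows "(\<Sum>w | w \<in> U \<and> \<phi> w = v \<and> 0 < \<mu> w. mcoef \<phi> U (\<mu> - single w)) = mcoef \<phi> U \<mu>"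
proof -
  let ?F = "\<Prod>w\<in>U. fact (\<mu> w) :: nat" and ?G = "\<Prod>v\<in>\<phi> ` U. fact (push \<phi> U \<mu> v) :: nat"
  have vU: "v \<in> \<phi> ` U"
  proof (rule ccontr)
    assume "v \<notin> \<phi> ` U"
    then have "push \<phi> U \<mu> v = 0" by (auto simp: push_def intro!: sum.neutral)
    with v show False by simp
  qed
  \<comment> \<open>Cleared of denominators, the summand for \<open>w\<close> is proportional to
    \<open>\<mu> w\<close>, and over the fibre these exponents add up to
    \<open>push \<phi> U \<mu> v\<close>.\<close>
  have *: "mcoef \<phi> U (\<mu> - single w) * ?F * push \<phi> U \<mu> v = \<mu> w * ?G"
    if w: "w \<in> U" "\<phi> w = v" "0 < \<mu> w" for w
  proof -
    have p: "push \<phi> U (\<mu> - single w) = push \<phi> U \<mu> - single v"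
      using push_diff[of "single w" \<mu> \<phi> U] w U by (simp add: single_le_iff)
    have "mcoef \<phi> U (\<mu> - single w) * ?F
        = mcoef \<phi> U (\<mu> - single w) * (\<Prod>x\<in>U. fact ((\<mu> - single w) x)) * \<mu> w"
      using prod_fact_single[of U w \<mu>] w U by (simp add: mult.assoc)
    also have "\<dots> = (\<Prod>u\<in>\<phi> ` U. fact ((push \<phi> U \<mu> - single v) u)) * \<mu> w"
      by (simp only: mcoef_spec[OF U] p)
    finally have "mcoef \<phi> U (\<mu> - single w) * ?F * push \<phi> U \<mu> v
        = ((\<Prod>u\<in>\<phi> ` U. fact ((push \<phi> U \<mu> - single v) u)) * push \<phi> U \<mu> v) * \<mu> w"
      by (simp only: mult_ac)
    also have "\<dots> = ?G * \<mu> w"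
      using prod_fact_single[of "\<phi> ` U" v "push \<phi> U \<mu>"] U v vU by simp
    finally show ?thesis by simp
  qed
  have "(\<Sum>w | w \<in> U \<and> \<phi> w = v \<and> 0 < \<mu> w. mcoef \<phi> U (\<mu> - single w)) * ?F * push \<phi> U \<mu> v
      = (\<Sum>w | w \<in> U \<and> \<phi> w = v \<and> 0 < \<mu> w. \<mu> w * ?G)"
    by (simp add: sum_distrib_right *)
  also have "\<dots> = (\<Sum>w | w \<in> U \<and> \<phi> w = v. \<mu> w * ?G)"
    using U by (intro sum.mono_neutral_left) auto
  also have "\<dots> = push \<phi> U \<mu> v * ?G" by (simp add: push_def sum_distrib_right)
  finally have "(\<Sum>w | w \<in> U \<and> \<phi> w = v \<and> 0 < \<mu> w. mcoef \<phi> U (\<mu> - single w)) * ?F = ?G"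
    using v by simp
  then show ?thesis by (rule mcoef_eqI[OF U, symmetric])
qed

section \<open>Substituting sums of variables for variables\<close>

definition linear_form :: "('b, 'c) ring_scheme \<Rightarrow> 'w set \<Rightarrow> ('w \<Rightarrow> nat) \<Rightarrow> 'b"
  where "linear_form B A = (\<lambda>\<mu>. if \<exists>w\<in>A. \<mu> = single w then \<one>\<^bsub>B\<^esub> else \<zero>\<^bsub>B\<^esub>)"

text \<open>Each coefficient is an integer multiple of one coefficient of \<open>f\<close>, so
  bounds and decay pass to the result without an estimate of sums. Since \<open>U\<close> may be
  smaller than the full set of variables, inclusions of variable sets are covered as well.\<close>

definition pull :: "('b, 'c) ring_scheme \<Rightarrow> ('w \<Rightarrow> 'v) \<Rightarrow> 'w set \<Rightarrow> (('v \<Rightarrow> nat) \<Rightarrow> 'b) \<Rightarrow> ('w \<Rightarrow> nat) \<Rightarrow> 'b"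
  where "pull B \<phi> U f = (\<lambda>\<mu>. if \<mu> \<in> mexp U then [mcoef \<phi> U \<mu>] \<cdot>\<^bsub>B\<^esub> f (push \<phi> U \<mu>) else \<zero>\<^bsub>B\<^esub>)"

lemma variable_eq: "variable B v = linear_form B {v}"
  by (auto simp: variable_def linear_form_def single_def)

lemma fact_single: "fact (single v w) = 1"
  by (simp add: single_def)

context cring
begin

lemma linear_form_closed: "A \<subseteq> V \<Longrightarrow> linear_form R A \<in> carrier (power_series R V)"
  by (rule ps_memI) (auto simp: linear_form_def)

lemma variable_closed: "v \<in> V \<Longrightarrow> variable R v \<in> carrier (power_series R V)"
  unfolding variable_eq by (rule linear_form_closed) simp

lemma linear_form_coeff: "linear_form R A \<mu> \<in> carrier R"
  by (simp add: linear_form_def)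

lemma finsum_variable_ps:
  assumes V: "finite V" and A: "A \<subseteq> V"
  shows "(\<Oplus>\<^bsub>power_series R V\<^esub>v\<in>A. variable R v) = linear_form R A"
proof
  fix \<mu>
  have fA: "finite A" using V A finite_subset by blast
  have "(\<Oplus>\<^bsub>power_series R V\<^esub>v\<in>A. variable R v) \<mu> = (\<Oplus>v\<in>A. variable R v \<mu>)"
    by (subst ps_finsum[OF V fA]) (use A in \<open>auto intro: variable_closed\<close>)
  also have "\<dots> = linear_form R A \<mu>"
  proof (cases "\<exists>w\<in>A. \<mu> = single w")
    case True
    then obtain w where w: "w \<in> A" "\<mu> = single w" by blast
    have "(\<Oplus>v\<in>A. variable R v \<mu>) = variable R w \<mu>"
      using fA w by (intro finsum_single[where f = "\<lambda>v. variable R v \<mu>"]) (auto simp: variable_eq linear_form_def)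
    then show ?thesis using w by (auto simp: variable_eq linear_form_def)
  next
    case False
    then show ?thesis by (auto simp: variable_eq linear_form_def intro!: finsum_zeroI)
  qed
  finally show "(\<Oplus>\<^bsub>power_series R V\<^esub>v\<in>A. variable R v) \<mu> = linear_form R A \<mu>" .
qed

text \<open>In the Cauchy product only the terms in which \<open>\<mu> - \<alpha>\<close> is a
  single variable from \<open>A\<close> survive.\<close>

lemma ps_mult_linear_form:
  assumes V: "finite V" and A: "A \<subseteq> V" and f: "f \<in> carrier (power_series R V)" and \<mu>: "\<mu> \<in> mexp V"
  shows "(f \<otimes>\<^bsub>power_series R V\<^esub> linear_form R A) \<mu> = (\<Oplus>w\<in>{w. w \<in> A \<and> 0 < \<mu> w}. f (\<mu> - single w))"
proof -
  note [simp] = f[THEN ps_coeff] linear_form_coeff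
  let ?T = "{\<alpha>. \<alpha> \<le> \<mu> \<and> (\<exists>w\<in>A. \<mu> - \<alpha> = single w)}"
  have "(f \<otimes>\<^bsub>power_series R V\<^esub> linear_form R A) \<mu> = (\<Oplus>\<alpha>\<in>{..\<mu>}. f \<alpha> \<otimes> linear_form R A (\<mu> - \<alpha>))"
    using \<mu> by (simp add: ps_mult)
  also have "\<dots> = (\<Oplus>\<alpha>\<in>?T. f \<alpha> \<otimes> linear_form R A (\<mu> - \<alpha>))"
    using finite_below[OF V \<mu>] by (intro finsum_superset[symmetric]) (auto simp: linear_form_def)
  also have "\<dots> = (\<Oplus>w\<in>{w. w \<in> A \<and> 0 < \<mu> w}. f (\<mu> - single w))"
  proof (rule finsum_bij[symmetric])
    show "bij_betw (\<lambda>w. \<mu> - single w) {w. w \<in> A \<and> 0 < \<mu> w} ?T"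
    proof (rule bij_betw_imageI)
      have *: "w = w'" if "\<mu> - single w = \<mu> - single w'" "0 < \<mu> w" "0 < \<mu> w'" for w w'
        using that by (metis fun_nat_diff_diff single_inj single_le_iff)
      then show "inj_on (\<lambda>w. \<mu> - single w) {w. w \<in> A \<and> 0 < \<mu> w}"
        by (auto simp: inj_on_def)
      show "(\<lambda>w. \<mu> - single w) ` {w. w \<in> A \<and> 0 < \<mu> w} = ?T"
      proof (intro equalityI subsetI)
        fix \<alpha> assume "\<alpha> \<in> ?T"
        then obtain w where w: "\<alpha> \<le> \<mu>" "w \<in> A" "\<mu> - \<alpha> = single w" by blast
        then have "\<alpha> = \<mu> - single w" by (metis fun_nat_diff_diff)
        moreover have "0 < \<mu> w" using fun_cong[OF w(3), of w] by (simp add: single_def)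
        ultimately show "\<alpha> \<in> (\<lambda>w. \<mu> - single w) ` {w. w \<in> A \<and> 0 < \<mu> w}" using w by blast
      qed (auto simp: single_le_iff fun_nat_diff_diff)
    qed
    show "f (\<mu> - single w) = f (\<mu> - single w) \<otimes> linear_form R A (\<mu> - (\<mu> - single w))"
      if "w \<in> {w. w \<in> A \<and> 0 < \<mu> w}" for w
      using that by (auto simp: single_le_iff fun_nat_diff_diff linear_form_def)
  qed auto
  finally show ?thesis .
qed

lemma finsum_add_pow:
  assumes "finite A" "x \<in> carrier R"
  shows "(\<Oplus>a\<in>A. [(n a :: nat)] \<cdot> x) = [(\<Sum>a\<in>A. n a)] \<cdot> x"
  using assms by (induction A rule: finite_induct) (auto simp: add.nat_pow_mult)

definition monomial_subst :: "('w \<Rightarrow> 'v) \<Rightarrow> 'w set \<Rightarrow> 'v set \<Rightarrow> 'w set \<Rightarrow> ('v \<Rightarrow> nat) \<Rightarrow> ('w \<Rightarrow> nat) \<Rightarrow> 'a"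
  where "monomial_subst \<phi> U V W \<nu> =
    (\<Otimes>\<^bsub>power_series R W\<^esub>v\<in>V. linear_form R {w \<in> U. \<phi> w = v} [^]\<^bsub>power_series R W\<^esub> \<nu> v)"

context
  fixes V :: "'v set" and U W :: "'w set" and \<phi> :: "'w \<Rightarrow> 'v"
  assumes V: "finite V" and W: "finite W" and U: "U \<subseteq> W" and \<phi>: "\<phi> ` U \<subseteq> V"
begin

lemma fU: "finite U"
  using W U finite_subset by blast

lemma monomial_subst_closed: "monomial_subst \<phi> U V W \<nu> \<in> carrier (power_series R W)"
proof -
  interpret P: cring "power_series R W" by (rule ps_cring[OF W])
  show ?thesis unfolding monomial_subst_def
    using U by (intro P.finprod_closed) (auto intro!: P.nat_pow_closed linear_form_closed)
qed

lemma monomial_subst_add: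
  "monomial_subst \<phi> U V W (\<nu> + \<nu>') =
    monomial_subst \<phi> U V W \<nu> \<otimes>\<^bsub>power_series R W\<^esub> monomial_subst \<phi> U V W \<nu>'"
proof -
  interpret P: cring "power_series R W" by (rule ps_cring[OF W])
  have c: "linear_form R {w \<in> U. \<phi> w = v} \<in> carrier (power_series R W)" for v
    using U by (intro linear_form_closed) auto
  show ?thesis unfolding monomial_subst_def
    by (subst P.finprod_multf[symmetric]) (auto simp: P.nat_pow_mult c)
qed

lemma monomial_subst_single:
  assumes "v \<in> V"
  shows "monomial_subst \<phi> U V W (single v) = linear_form R {w \<in> U. \<phi> w = v}"
proof -
  interpret P: cring "power_series R W" by (rule ps_cring[OF W])
  have c: "linear_form R {w \<in> U. \<phi> w = v} \<in> carrier (power_series R W)" for v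
    using U by (intro linear_form_closed) auto
  have "monomial_subst \<phi> U V W (single v) = (\<Otimes>\<^bsub>power_series R W\<^esub>u\<in>V.
      if v = u then linear_form R {w \<in> U. \<phi> w = u} else \<one>\<^bsub>power_series R W\<^esub>)"
    unfolding monomial_subst_def by (intro P.finprod_cong') (auto simp: single_def c)
  also have "\<dots> = linear_form R {w \<in> U. \<phi> w = v}"
    using P.finprod_singleton[of v V "\<lambda>v. linear_form R {w \<in> U. \<phi> w = v}"] assms V c by simp
  finally show ?thesis .
qed

lemma monomial_subst_zero: "monomial_subst \<phi> U V W 0 = \<one>\<^bsub>power_series R W\<^esub>"
proof -
  interpret P: cring "power_series R W" by (rule ps_cring[OF W])
  show ?thesis unfolding monomial_subst_def by simp
qed

text \<open>The multinomial theorem, for all fibres at once. The induction splits off one linear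
  form, and the coefficients add up by \<open>mcoef_rec\<close>.\<close>

lemma monomial_subst_coeff:
  assumes "\<nu> \<in> mexp V" "\<mu> \<in> mexp W"
  shows "monomial_subst \<phi> U V W \<nu> \<mu> =
    (if \<mu> \<in> mexp U \<and> push \<phi> U \<mu> = \<nu> then [mcoef \<phi> U \<mu>] \<cdot> \<one> else \<zero>)"
  using assms
proof (induction "mdeg V \<nu>" arbitrary: \<nu> \<mu> rule: less_induct)
  case less
  show ?case
  proof (cases "\<nu> = 0")
    case True
    then show ?thesis
      using push_eq_zero[OF fU, of \<mu> \<phi>] fU by (auto simp: monomial_subst_zero ps_one)
  next
    case False
    then obtain v where v: "0 < \<nu> v" by (auto simp: fun_eq_iff)
    then have vV: "v \<in> V" using less.prems by (auto simp: mexp_def)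
    define \<nu>' where "\<nu>' = \<nu> - single v"
    have \<nu>: "\<nu> = \<nu>' + single v" using v by (simp add: \<nu>'_def single_le_iff)
    have \<nu>': "\<nu>' \<in> mexp V" using less.prems by (simp add: \<nu>'_def)
    have lt: "mdeg V \<nu>' < mdeg V \<nu>" using \<nu> V vV by simp
    let ?A = "{w. w \<in> {w \<in> U. \<phi> w = v} \<and> 0 < \<mu> w}"
    have "monomial_subst \<phi> U V W \<nu> \<mu> =
        (monomial_subst \<phi> U V W \<nu>' \<otimes>\<^bsub>power_series R W\<^esub> linear_form R {w \<in> U. \<phi> w = v}) \<mu>"
      by (simp add: \<nu> monomial_subst_add monomial_subst_single vV)
    also have "\<dots> = (\<Oplus>w\<in>?A. monomial_subst \<phi> U V W \<nu>' (\<mu> - single w))"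
      using U less.prems by (intro ps_mult_linear_form[OF W]) (auto simp: monomial_subst_closed)
    also have "\<dots> = (\<Oplus>w\<in>?A. if \<mu> - single w \<in> mexp U \<and> push \<phi> U (\<mu> - single w) = \<nu>'
        then [mcoef \<phi> U (\<mu> - single w)] \<cdot> \<one> else \<zero>)"
      using less.hyps[OF lt \<nu>'] less.prems by (intro finsum_cong') auto
    also have "\<dots> = (if \<mu> \<in> mexp U \<and> push \<phi> U \<mu> = \<nu> then [mcoef \<phi> U \<mu>] \<cdot> \<one> else \<zero>)"
    proof -
      have p: "push \<phi> U \<mu> = push \<phi> U (\<mu> - single w) + single v" if "w \<in> ?A" for w
      proof -
        have "push \<phi> U \<mu> = push \<phi> U ((\<mu> - single w) + single w)"
          using that by (simp add: single_le_iff)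
        also have "\<dots> = push \<phi> U (\<mu> - single w) + single v"
          using that fU by (auto simp only: push_add push_single)
        finally show ?thesis .
      qed
      have m: "\<mu> \<in> mexp U" if "w \<in> ?A" "\<mu> - single w \<in> mexp U" for w
        using that mexp_add[of "\<mu> - single w" U "single w"] by (auto simp: single_le_iff)
      show ?thesis
      proof (cases "\<mu> \<in> mexp U \<and> push \<phi> U \<mu> = \<nu>")
        case True
        have "push \<phi> U (\<mu> - single w) = \<nu>'" if "w \<in> ?A" for w
          using p[OF that] True \<nu> by (metis add_right_cancel)
        then have "(\<Oplus>w\<in>?A. if \<mu> - single w \<in> mexp U \<and> push \<phi> U (\<mu> - single w) = \<nu>'
            then [mcoef \<phi> U (\<mu> - single w)] \<cdot> \<one> else \<zero>) = (\<Oplus>w\<in>?A. [mcoef \<phi> U (\<mu> - single w)] \<cdot> \<one>)"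
          using True by (intro finsum_cong') auto
        also have "\<dots> = [(\<Sum>w\<in>?A. mcoef \<phi> U (\<mu> - single w))] \<cdot> \<one>"
          using fU by (intro finsum_add_pow) auto
        also have "(\<Sum>w\<in>?A. mcoef \<phi> U (\<mu> - single w)) = mcoef \<phi> U \<mu>"
          using mcoef_rec[OF fU, of \<phi> \<mu> v] True v by (simp add: conj_assoc)
        finally show ?thesis by (simp only: if_P[OF True])
      next
        case False
        have n: "\<not> (\<mu> - single w \<in> mexp U \<and> push \<phi> U (\<mu> - single w) = \<nu>')" if "w \<in> ?A" for w
          using False p[OF that] m[OF that] \<nu> by auto
        show ?thesis
          unfolding if_not_P[OF False] by (intro finsum_zeroI if_not_P) (rule n)
      qed
    qed
    finally show ?thesis .
  qed
qed

lemma pull_closed: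
  assumes "f \<in> carrier (power_series R V)"
  shows "pull R \<phi> U f \<in> carrier (power_series R W)"
  using assms[THEN ps_coeff] mexp_mono[OF U] by (intro ps_memI) (auto simp: pull_def)

text \<open>The definition sums over all monomials of the right degree, but at \<mu> only the
  monomial with exponent \<open>push \<phi> U \<mu>\<close> has a nonzero coefficient.\<close>

lemma linear_subst_eq_pull:
  assumes l: "\<And>v. v \<in> V \<Longrightarrow> l v = linear_form R {w \<in> U. \<phi> w = v}"
    and f: "f \<in> carrier (power_series R V)"
  shows "linear_subst R V W l f = pull R \<phi> U f"
proof
  fix \<mu>
  note [simp] = f[THEN ps_coeff]
  interpret P: cring "power_series R W" by (rule ps_cring[OF W])
  have c: "linear_form R {w \<in> U. \<phi> w = v} \<in> carrier (power_series R W)" for v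
    using U by (intro linear_form_closed) auto
  have l': "(\<Otimes>\<^bsub>power_series R W\<^esub>v\<in>V. l v [^]\<^bsub>power_series R W\<^esub> \<nu> v) = monomial_subst \<phi> U V W \<nu>" for \<nu>
    unfolding monomial_subst_def by (intro P.finprod_cong') (auto simp: l c)
  show "linear_subst R V W l f \<mu> = pull R \<phi> U f \<mu>"
  proof (cases "\<mu> \<in> mexp W")
    case True
    let ?N = "{\<nu> \<in> mexp V. mdeg V \<nu> = mdeg W \<mu>}"
    have fN: "finite ?N"
      by (rule finite_subset[OF _ finite_mdeg_le[OF V, of "mdeg W \<mu>"]]) auto
    have "linear_subst R V W l f \<mu> = (\<Oplus>\<nu>\<in>?N. f \<nu> \<otimes> monomial_subst \<phi> U V W \<nu> \<mu>)"
      using True by (simp add: linear_subst_def l')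
    also have "\<dots> = (\<Oplus>\<nu>\<in>?N. f \<nu> \<otimes> (if \<mu> \<in> mexp U \<and> push \<phi> U \<mu> = \<nu> then [mcoef \<phi> U \<mu>] \<cdot> \<one> else \<zero>))"
      using True by (intro finsum_cong') (auto simp: monomial_subst_coeff)
    also have "\<dots> = pull R \<phi> U f \<mu>"
    proof (cases "\<mu> \<in> mexp U")
      case mU: True
      have "push \<phi> U \<mu> \<in> ?N"
        using push_mexp[OF \<phi>] mdeg_push[OF fU V \<phi>] mdeg_superset[OF W U mU] by simp
      then have "(\<Oplus>\<nu>\<in>?N. f \<nu> \<otimes> (if \<mu> \<in> mexp U \<and> push \<phi> U \<mu> = \<nu> then [mcoef \<phi> U \<mu>] \<cdot> \<one> else \<zero>))
         = (\<lambda>\<nu>. f \<nu> \<otimes> (if \<mu> \<in> mexp U \<and> push \<phi> U \<mu> = \<nu> then [mcoef \<phi> U \<mu>] \<cdot> \<one> else \<zero>)) (push \<phi> U \<mu>)"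
        using fN by (intro finsum_single[where i = "push \<phi> U \<mu>"]) auto
      also have "\<dots> = pull R \<phi> U f \<mu>"
        using mU by (simp add: pull_def add_pow_rdistr)
      finally show ?thesis .
    qed (auto simp: pull_def intro!: finsum_zeroI)
    finally show ?thesis .
  next
    case False
    then show ?thesis using mexp_mono[OF U] by (auto simp: linear_subst_def pull_def)
  qed
qed

text \<open>Multiplicativity is reduced to monomials, where it is \<open>monomial_subst_add\<close>:
  the multinomial coefficient at \<mu> is expanded separately for each splitting of the exponent,
  and then the two summations are exchanged.\<close>

lemma pull_hom: "pull R \<phi> U \<in> ring_hom (power_series R V) (power_series R W)"
proof (rule ring_hom_memI)
  fix f assume f: "f \<in> carrier (power_series R V)"
  note [simp] = f[THEN ps_coeff]
  show "pull R \<phi> U f \<in> carrier (power_series R W)" using f by (rule pull_closed)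
  fix g assume g: "g \<in> carrier (power_series R V)"
  note [simp] = g[THEN ps_coeff]
  show "pull R \<phi> U (f \<oplus>\<^bsub>power_series R V\<^esub> g) = pull R \<phi> U f \<oplus>\<^bsub>power_series R W\<^esub> pull R \<phi> U g"
    by (auto simp: pull_def ps_add add.nat_pow_distrib)
  show "pull R \<phi> U (f \<otimes>\<^bsub>power_series R V\<^esub> g) = pull R \<phi> U f \<otimes>\<^bsub>power_series R W\<^esub> pull R \<phi> U g"
  proof
    fix \<mu>
    have [simp]: "pull R \<phi> U f \<alpha> \<in> carrier R" "pull R \<phi> U g \<alpha> \<in> carrier R" for \<alpha>
      using pull_closed[OF f, THEN ps_coeff] pull_closed[OF g, THEN ps_coeff] by auto
    note [simp] = monomial_subst_closed[THEN ps_coeff]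
    show "pull R \<phi> U (f \<otimes>\<^bsub>power_series R V\<^esub> g) \<mu> = (pull R \<phi> U f \<otimes>\<^bsub>power_series R W\<^esub> pull R \<phi> U g) \<mu>"
    proof (cases "\<mu> \<in> mexp U")
      case False
      have "pull R \<phi> U f \<alpha> \<otimes> pull R \<phi> U g (\<mu> - \<alpha>) = \<zero>" if "\<alpha> \<le> \<mu>" for \<alpha>
      proof -
        have "\<alpha> \<notin> mexp U \<or> \<mu> - \<alpha> \<notin> mexp U"
          using False mexp_add[of \<alpha> U "\<mu> - \<alpha>"] that by auto
        then show ?thesis by (auto simp: pull_def)
      qed
      then show ?thesis using False by (auto simp: pull_def ps_mult intro!: finsum_zeroI[symmetric])
    next
      case True
      then have \<mu>W: "\<mu> \<in> mexp W" using mexp_mono[OF U] by auto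
      define \<kappa> where "\<kappa> = push \<phi> U \<mu>"
      have \<kappa>: "\<kappa> \<in> mexp V" unfolding \<kappa>_def by (rule push_mexp[OF \<phi>])
      let ?M = "monomial_subst \<phi> U V W"
      have fin: "finite {..\<mu>}" "finite {..\<kappa>}"
        using finite_below[OF W \<mu>W] finite_below[OF V \<kappa>] by auto
      have "pull R \<phi> U (f \<otimes>\<^bsub>power_series R V\<^esub> g) \<mu> = [mcoef \<phi> U \<mu>] \<cdot> (\<Oplus>\<nu>\<in>{..\<kappa>}. f \<nu> \<otimes> g (\<kappa> - \<nu>))"
        using True \<kappa> by (simp add: pull_def ps_mult \<kappa>_def)
      also have "\<dots> = (\<Oplus>\<nu>\<in>{..\<kappa>}. f \<nu> \<otimes> g (\<kappa> - \<nu>)) \<otimes> ([mcoef \<phi> U \<mu>] \<cdot> \<one>)"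
        by (simp add: add_pow_rdistr)
      also have "\<dots> = (\<Oplus>\<nu>\<in>{..\<kappa>}. f \<nu> \<otimes> g (\<kappa> - \<nu>) \<otimes> ([mcoef \<phi> U \<mu>] \<cdot> \<one>))"
        using fin by (intro finsum_ldistr) auto
      \<comment> \<open>For each splitting of \<kappa> into \<nu> and
        \<open>\<kappa> - \<nu>\<close> the multinomial coefficient is a coefficient of the product
        of the two monomial images; this is the Vandermonde identity.\<close>
      also have "\<dots> = (\<Oplus>\<nu>\<in>{..\<kappa>}. f \<nu> \<otimes> g (\<kappa> - \<nu>) \<otimes> (\<Oplus>\<alpha>\<in>{..\<mu>}. ?M \<nu> \<alpha> \<otimes> ?M (\<kappa> - \<nu>) (\<mu> - \<alpha>)))"
      proof (intro finsum_cong' refl)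
        fix \<nu> assume "\<nu> \<in> {..\<kappa>}"
        then have "\<nu> + (\<kappa> - \<nu>) = \<kappa>" by simp
        then have "[mcoef \<phi> U \<mu>] \<cdot> \<one> = ?M (\<nu> + (\<kappa> - \<nu>)) \<mu>"
          using monomial_subst_coeff[OF \<kappa> \<mu>W] True by (simp add: \<kappa>_def)
        also have "\<dots> = (\<Oplus>\<alpha>\<in>{..\<mu>}. ?M \<nu> \<alpha> \<otimes> ?M (\<kappa> - \<nu>) (\<mu> - \<alpha>))"
          unfolding monomial_subst_add using \<mu>W by (simp add: ps_mult)
        finally show "f \<nu> \<otimes> g (\<kappa> - \<nu>) \<otimes> ([mcoef \<phi> U \<mu>] \<cdot> \<one>)
            = f \<nu> \<otimes> g (\<kappa> - \<nu>) \<otimes> (\<Oplus>\<alpha>\<in>{..\<mu>}. ?M \<nu> \<alpha> \<otimes> ?M (\<kappa> - \<nu>) (\<mu> - \<alpha>))" by simp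
      qed auto
      also have "\<dots> = (\<Oplus>\<nu>\<in>{..\<kappa>}. \<Oplus>\<alpha>\<in>{..\<mu>}. f \<nu> \<otimes> g (\<kappa> - \<nu>) \<otimes> (?M \<nu> \<alpha> \<otimes> ?M (\<kappa> - \<nu>) (\<mu> - \<alpha>)))"
        using fin by (intro finsum_cong' finsum_rdistr) auto
      also have "\<dots> = (\<Oplus>\<alpha>\<in>{..\<mu>}. \<Oplus>\<nu>\<in>{..\<kappa>}. f \<nu> \<otimes> g (\<kappa> - \<nu>) \<otimes> (?M \<nu> \<alpha> \<otimes> ?M (\<kappa> - \<nu>) (\<mu> - \<alpha>)))"
        using fin by (intro finsum_swap) auto
      \<comment> \<open>Once \<alpha> is fixed, only the splitting with \<nu> equal to the push of
        \<alpha> contributes.\<close>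
      also have "\<dots> = (\<Oplus>\<alpha>\<in>{..\<mu>}. pull R \<phi> U f \<alpha> \<otimes> pull R \<phi> U g (\<mu> - \<alpha>))"
      proof (intro finsum_cong' refl)
        fix \<alpha> assume "\<alpha> \<in> {..\<mu>}"
        then have \<alpha>: "\<alpha> \<le> \<mu>" "\<alpha> \<in> mexp U" using mexp_below True by auto
        let ?\<nu> = "push \<phi> U \<alpha>"
        have le: "?\<nu> \<le> \<kappa>" unfolding \<kappa>_def by (rule push_mono[OF \<alpha>(1)])
        have M: "?M \<nu> \<alpha> = (if ?\<nu> = \<nu> then [mcoef \<phi> U \<alpha>] \<cdot> \<one> else \<zero>)" if "\<nu> \<le> \<kappa>" for \<nu>
          using monomial_subst_coeff[of \<nu> \<alpha>] \<alpha> mexp_below[OF that \<kappa>] mexp_mono[OF U] by auto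
        have "\<kappa> - ?\<nu> = push \<phi> U (\<mu> - \<alpha>)" using \<alpha> by (simp add: push_diff \<kappa>_def)
        then have M': "?M (\<kappa> - ?\<nu>) (\<mu> - \<alpha>) = [mcoef \<phi> U (\<mu> - \<alpha>)] \<cdot> \<one>"
          using monomial_subst_coeff[of "\<kappa> - ?\<nu>" "\<mu> - \<alpha>"] \<kappa> True \<mu>W push_mexp[OF \<phi>] by simp
        have "(\<Oplus>\<nu>\<in>{..\<kappa>}. f \<nu> \<otimes> g (\<kappa> - \<nu>) \<otimes> (?M \<nu> \<alpha> \<otimes> ?M (\<kappa> - \<nu>) (\<mu> - \<alpha>)))
          = (\<lambda>\<nu>. f \<nu> \<otimes> g (\<kappa> - \<nu>) \<otimes> (?M \<nu> \<alpha> \<otimes> ?M (\<kappa> - \<nu>) (\<mu> - \<alpha>))) ?\<nu>"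
          using fin le M by (intro finsum_single[where i = ?\<nu>]) auto
        also have "\<dots> = f ?\<nu> \<otimes> g (\<kappa> - ?\<nu>) \<otimes> (([mcoef \<phi> U \<alpha>] \<cdot> \<one>) \<otimes> ([mcoef \<phi> U (\<mu> - \<alpha>)] \<cdot> \<one>))"
          using M[OF le] M' by simp
        also have "\<dots> = (f ?\<nu> \<otimes> ([mcoef \<phi> U \<alpha>] \<cdot> \<one>)) \<otimes> (g (\<kappa> - ?\<nu>) \<otimes> ([mcoef \<phi> U (\<mu> - \<alpha>)] \<cdot> \<one>))"
          by (simp add: m_ac)
        also have "\<dots> = pull R \<phi> U f \<alpha> \<otimes> pull R \<phi> U g (\<mu> - \<alpha>)"
          using \<alpha> True by (simp add: pull_def add_pow_rdistr push_diff \<kappa>_def)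
        finally show "(\<Oplus>\<nu>\<in>{..\<kappa>}. f \<nu> \<otimes> g (\<kappa> - \<nu>) \<otimes> (?M \<nu> \<alpha> \<otimes> ?M (\<kappa> - \<nu>) (\<mu> - \<alpha>)))
          = pull R \<phi> U f \<alpha> \<otimes> pull R \<phi> U g (\<mu> - \<alpha>)" .
      qed auto
      also have "\<dots> = (pull R \<phi> U f \<otimes>\<^bsub>power_series R W\<^esub> pull R \<phi> U g) \<mu>"
        using \<mu>W by (simp add: ps_mult)
      finally show ?thesis .
    qed
  qed
next
  show "pull R \<phi> U \<one>\<^bsub>power_series R V\<^esub> = \<one>\<^bsub>power_series R W\<^esub>"
  proof
    fix \<mu> :: "'w \<Rightarrow> nat"
    show "pull R \<phi> U \<one>\<^bsub>power_series R V\<^esub> \<mu> = \<one>\<^bsub>power_series R W\<^esub> \<mu>"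
      using push_eq_zero[OF fU, of \<mu> \<phi>] fU by (cases "\<mu> = 0") (auto simp: pull_def ps_one)
  qed
qed

lemma pull_linear_form:
  assumes "A \<subseteq> V"
  shows "pull R \<phi> U (linear_form R A) = linear_form R {w \<in> U. \<phi> w \<in> A}"
proof
  fix \<mu>
  show "pull R \<phi> U (linear_form R A) \<mu> = linear_form R {w \<in> U. \<phi> w \<in> A} \<mu>"
  proof (cases "\<exists>w\<in>U. \<phi> w \<in> A \<and> \<mu> = single w")
    case True
    then obtain w where w: "w \<in> U" "\<phi> w \<in> A" "\<mu> = single w" by blast
    have "mcoef \<phi> U \<mu> = 1"
      using w fU by (intro mcoef_eqI) (simp_all add: fact_single)
    then show ?thesis using w fU by (auto simp: pull_def linear_form_def)
  next
    case False
    then have "\<mu> \<notin> mexp U \<or> \<not> (\<exists>v\<in>A. push \<phi> U \<mu> = single v)"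
      using push_eq_single[OF fU, of \<mu> \<phi>] by auto
    then show ?thesis using False by (auto simp: pull_def linear_form_def)
  qed
qed

end

text \<open>Multinomial coefficients multiply under composition, because the factorials of the
  intermediate exponents cancel.\<close>

lemma pull_pull:
  assumes U: "finite U" and U': "finite U'" and \<phi>: "\<phi> ` U \<subseteq> U'" and f: "\<And>\<nu>. f \<nu> \<in> carrier R"
  shows "pull R \<phi> U (pull R \<psi> U' f) = pull R (\<psi> \<circ> \<phi>) U f"
proof
  fix \<mu>
  have p: "push \<psi> U' (push \<phi> U \<mu>) = push (\<psi> \<circ> \<phi>) U \<mu>"
  proof
    fix v
    have "(\<Sum>w | w \<in> U' \<and> \<psi> w = v. \<Sum>x | x \<in> U \<and> \<phi> x = w. \<mu> x)
      = (\<Sum>w\<in>{w \<in> U'. \<psi> w = v}. \<Sum>x\<in>{x \<in> {x \<in> U. \<psi> (\<phi> x) = v}. \<phi> x = w}. \<mu> x)"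
      by (intro sum.cong) auto
    also have "\<dots> = (\<Sum>x\<in>{x \<in> U. \<psi> (\<phi> x) = v}. \<mu> x)"
      using U U' \<phi> by (intro sum.group) auto
    finally show "push \<psi> U' (push \<phi> U \<mu>) v = push (\<psi> \<circ> \<phi>) U \<mu> v"
      by (simp add: push_def)
  qed
  have "mcoef \<psi> U' (push \<phi> U \<mu>) * mcoef \<phi> U \<mu> * (\<Prod>w\<in>U. fact (\<mu> w))
      = mcoef \<psi> U' (push \<phi> U \<mu>) * (\<Prod>v\<in>U'. fact (push \<phi> U \<mu> v))"
    using mcoef_spec'[OF U' U \<phi>, of \<mu>] by (simp add: mult.assoc)
  also have "\<dots> = (\<Prod>v\<in>\<psi> ` U'. fact (push (\<psi> \<circ> \<phi>) U \<mu> v))"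
    by (simp only: mcoef_spec[OF U'] p)
  also have "\<dots> = mcoef (\<psi> \<circ> \<phi>) U \<mu> * (\<Prod>w\<in>U. fact (\<mu> w))"
    using U U' \<phi> by (intro mcoef_spec'[symmetric]) auto
  finally have c: "mcoef \<psi> U' (push \<phi> U \<mu>) * mcoef \<phi> U \<mu> = mcoef (\<psi> \<circ> \<phi>) U \<mu>"
    using U by simp
  show "pull R \<phi> U (pull R \<psi> U' f) \<mu> = pull R (\<psi> \<circ> \<phi>) U f \<mu>"
    using f push_mexp[OF \<phi>, of \<mu>] by (auto simp: pull_def p c[symmetric] add.nat_pow_pow mult.commute)
qed

lemma pull_cong:
  assumes "\<And>w. w \<in> U \<Longrightarrow> \<phi> w = \<psi> w"
  shows "pull R \<phi> U f = pull R \<psi> U f"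
proof -
  have "push \<phi> U \<mu> = push \<psi> U \<mu>" for \<mu>
    unfolding push_def using assms by (intro ext sum.cong) auto
  moreover from this have "mcoef \<phi> U \<mu> = mcoef \<psi> U \<mu>" for \<mu>
    using assms by (simp add: mcoef_def cong: image_cong)
  ultimately show ?thesis by (simp only: pull_def)
qed

end

section \<open>Convergent and overconvergent series\<close>

lemma subring_cring:
  assumes "cring S" "subring H S"
  shows "cring (S\<lparr>carrier := H\<rparr>)"
proof -
  interpret S: cring S by fact
  show ?thesis
    using S.subcring_iff[OF subringE(1)[OF assms(2)]] S.subcringI'[OF assms(2)] by simp
qed

text \<open>The common ground of R and K. The last axiom says that an element at distance less than
  1 from the unit has an inverse of norm at most 1; it supplies the constant terms from which
  inverses of series are built.\<close>

locale ultrametric_cring = cring R for R (structure) +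
  fixes absv :: "'a \<Rightarrow> real"
  assumes absv_nonneg: "x \<in> carrier R \<Longrightarrow> 0 \<le> absv x"
    and absv_zero [simp]: "absv \<zero> = 0"
    and absv_one: "absv \<one> \<le> 1"
    and absv_mult: "x \<in> carrier R \<Longrightarrow> y \<in> carrier R \<Longrightarrow> absv (x \<otimes> y) = absv x * absv y"
    and absv_add: "x \<in> carrier R \<Longrightarrow> y \<in> carrier R \<Longrightarrow> absv (x \<oplus> y) \<le> max (absv x) (absv y)"
    and absv_uminus: "x \<in> carrier R \<Longrightarrow> absv (\<ominus> x) = absv x"
    and one_add_small: "x \<in> carrier R \<Longrightarrow> absv x < 1
      \<Longrightarrow> \<exists>y\<in>carrier R. (\<one> \<oplus> x) \<otimes> y = \<one> \<and> absv y \<le> 1"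
begin

lemma absv_finsum_le:
  assumes "0 \<le> c" "\<And>x. x \<in> A \<Longrightarrow> f x \<in> carrier R" "\<And>x. x \<in> A \<Longrightarrow> absv (f x) \<le> c"
  shows "absv (\<Oplus>x\<in>A. f x) \<le> c"
proof (cases "finite A")
  case True
  then show ?thesis using assms(2,3)
  proof (induction A rule: finite_induct)
    case (insert x A)
    then have "absv (f x \<oplus> (\<Oplus>x\<in>A. f x)) \<le> max (absv (f x)) (absv (\<Oplus>x\<in>A. f x))"
      by (intro absv_add finsum_closed) auto
    also have "\<dots> \<le> c" using insert by auto
    finally show ?case using insert by (subst finsum_insert) auto
  qed (use assms in simp)
qed (use assms in simp)

lemma absv_finsum_less:
  assumes "0 < c" "finite A" "\<And>x. x \<in> A \<Longrightarrow> f x \<in> carrier R" "\<And>x. x \<in> A \<Longrightarrow> absv (f x) < c"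
  shows "absv (\<Oplus>x\<in>A. f x) < c"
  using assms(2,3,4)
proof (induction A rule: finite_induct)
  case (insert x A)
  then have "absv (f x \<oplus> (\<Oplus>x\<in>A. f x)) \<le> max (absv (f x)) (absv (\<Oplus>x\<in>A. f x))"
    by (intro absv_add finsum_closed) auto
  also have "\<dots> < c" using insert by auto
  finally show ?case using insert by (subst finsum_insert) auto
qed (use assms in simp)

lemma absv_add_pow: "x \<in> carrier R \<Longrightarrow> absv ([(n :: nat)] \<cdot> x) \<le> absv x"
proof (induction n)
  case (Suc n)
  then have "absv ([n] \<cdot> x \<oplus> x) \<le> max (absv ([n] \<cdot> x)) (absv x)" by (intro absv_add) auto
  then show ?case using Suc by simp
qed (simp add: absv_nonneg)

lemma absv_add_less:
  assumes "x \<in> carrier R" "y \<in> carrier R" "absv x < c" "absv y < c"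
  shows "absv (x \<oplus> y) < c"
  using absv_add[of x y] assms by simp

section \<open>Series that decay at a given radius\<close>

definition weight :: "real \<Rightarrow> 'v set \<Rightarrow> (('v \<Rightarrow> nat) \<Rightarrow> 'a) \<Rightarrow> ('v \<Rightarrow> nat) \<Rightarrow> real"
  where "weight \<rho> V f \<nu> = absv (f \<nu>) * \<rho> ^ mdeg V \<nu>"

text \<open>Radius 1 gives the convergent series, and the union over all radii greater than 1 the
  overconvergent ones. Decay is expressed by finite exceptional sets because products, substitutions
  and truncations act directly on these.\<close>

definition decaying :: "real \<Rightarrow> 'v set \<Rightarrow> (('v \<Rightarrow> nat) \<Rightarrow> 'a) set"
  where "decaying \<rho> V = {f \<in> carrier (power_series R V). \<forall>\<epsilon>>0. finite {\<nu>. \<epsilon> \<le> weight \<rho> V f \<nu>}}"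

lemma weight_nonneg: "f \<in> carrier (power_series R V) \<Longrightarrow> 0 \<le> \<rho> \<Longrightarrow> 0 \<le> weight \<rho> V f \<nu>"
  by (auto simp: weight_def ps_coeff absv_nonneg)

lemma weight_one [simp]: "weight 1 V f \<nu> = absv (f \<nu>)"
  by (simp add: weight_def)

lemma decaying_iff:
  assumes "f \<in> carrier (power_series R V)" "0 \<le> \<rho>"
  shows "f \<in> decaying \<rho> V \<longleftrightarrow> ((\<lambda>\<nu>. absv (f \<nu>) * \<rho> ^ mdeg V \<nu>) \<longlongrightarrow> 0) cofinite"
proof -
  have "(weight \<rho> V f \<longlongrightarrow> 0) cofinite \<longleftrightarrow> (\<forall>\<epsilon>>0. finite {\<nu>. \<epsilon> \<le> weight \<rho> V f \<nu>})"
    using weight_nonneg[OF assms] by (simp add: tendsto_iff eventually_cofinite not_less)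
  then show ?thesis using assms by (simp add: decaying_def weight_def[abs_def])
qed

lemma carrier_convergent: "carrier (convergent_series R absv V) = decaying 1 V"
  using decaying_iff[of _ V 1] by (auto simp: convergent_series_def decaying_def)

lemma carrier_dagger: "carrier (dagger_series R absv V) = (\<Union>\<rho>\<in>{1<..}. decaying \<rho> V)"
  using decaying_iff[of _ V] by (fastforce simp: dagger_series_def decaying_def)

lemma convergent_eq: "convergent_series R absv V = (power_series R V)\<lparr>carrier := decaying 1 V\<rparr>"
  using carrier_convergent[of V] by (simp add: convergent_series_def)

lemma dagger_eq: "dagger_series R absv V = (power_series R V)\<lparr>carrier := (\<Union>\<rho>\<in>{1<..}. decaying \<rho> V)\<rparr>"
  using carrier_dagger[of V] by (simp add: dagger_series_def)

lemma decaying_ps: "f \<in> decaying \<rho> V \<Longrightarrow> f \<in> carrier (power_series R V)"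
  by (simp add: decaying_def)

lemma decaying_finite: "f \<in> decaying \<rho> V \<Longrightarrow> 0 < \<epsilon> \<Longrightarrow> finite {\<nu>. \<epsilon> \<le> weight \<rho> V f \<nu>}"
  by (simp add: decaying_def)

lemma decaying_antimono:
  assumes "0 \<le> \<eta>" "\<eta> \<le> \<rho>"
  shows "decaying \<rho> V \<subseteq> decaying \<eta> V"
proof
  fix f assume f: "f \<in> decaying \<rho> V"
  then have "weight \<eta> V f \<nu> \<le> weight \<rho> V f \<nu>" for \<nu>
    using assms by (auto simp: weight_def decaying_def ps_coeff absv_nonneg intro!: mult_left_mono power_mono)
  then have "{\<nu>. \<epsilon> \<le> weight \<eta> V f \<nu>} \<subseteq> {\<nu>. \<epsilon> \<le> weight \<rho> V f \<nu>}" for \<epsilon>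
    by (auto intro: order_trans)
  then show "f \<in> decaying \<eta> V" using f by (auto simp: decaying_def intro: finite_subset)
qed

text \<open>Only finitely many weights reach 1. The bound is taken to be at least 1 so that it can
  serve as a denominator.\<close>

lemma decaying_bounded:
  assumes "f \<in> decaying \<rho> V"
  obtains C where "1 \<le> C" "\<And>\<nu>. weight \<rho> V f \<nu> \<le> C"
proof -
  let ?A = "{\<nu>. 1 \<le> weight \<rho> V f \<nu>}"
  have fin: "finite ?A" using decaying_finite[OF assms] by simp
  let ?C = "Max (insert 1 (weight \<rho> V f ` ?A))"
  have "weight \<rho> V f \<nu> \<le> ?C" for \<nu>
  proof (cases "\<nu> \<in> ?A")
    case True then show ?thesis using fin by (intro Max_ge) auto
  next
    case False
    then have "weight \<rho> V f \<nu> \<le> 1" by simp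
    also have "1 \<le> ?C" using fin by (intro Max_ge) auto
    finally show ?thesis .
  qed
  moreover have "1 \<le> ?C" using fin by (intro Max_ge) auto
  ultimately show ?thesis using that by blast
qed

lemma weight_term:
  assumes "f \<in> carrier (power_series R V)" "g \<in> carrier (power_series R V)" "\<alpha> \<le> \<nu>"
  shows "absv (f \<alpha> \<otimes> g (\<nu> - \<alpha>)) * \<rho> ^ mdeg V \<nu> = weight \<rho> V f \<alpha> * weight \<rho> V g (\<nu> - \<alpha>)"
proof -
  have "mdeg V \<nu> = mdeg V \<alpha> + mdeg V (\<nu> - \<alpha>)"
    using mdeg_add[of V \<alpha> "\<nu> - \<alpha>"] assms by simp
  then show ?thesis using assms(1,2)[THEN ps_coeff] by (simp add: weight_def absv_mult power_add)
qed

lemma weight_finsum_le: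
  assumes "0 \<le> c" "0 < \<rho>" "\<And>x. x \<in> A \<Longrightarrow> f x \<in> carrier R" "\<And>x. x \<in> A \<Longrightarrow> absv (f x) * \<rho> ^ n \<le> c"
  shows "absv (\<Oplus>x\<in>A. f x) * \<rho> ^ n \<le> c"
proof -
  have "absv (\<Oplus>x\<in>A. f x) \<le> c / \<rho> ^ n"
    using assms by (intro absv_finsum_le) (auto simp: field_simps)
  then show ?thesis using assms by (simp add: field_simps)
qed

lemma weight_finsum_less:
  assumes "0 < c" "0 < \<rho>" "finite A" "\<And>x. x \<in> A \<Longrightarrow> f x \<in> carrier R" "\<And>x. x \<in> A \<Longrightarrow> absv (f x) * \<rho> ^ n < c"
  shows "absv (\<Oplus>x\<in>A. f x) * \<rho> ^ n < c"
proof -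
  have "absv (\<Oplus>x\<in>A. f x) < c / \<rho> ^ n"
    using assms by (intro absv_finsum_less) (auto simp: field_simps)
  then show ?thesis using assms by (simp add: field_simps)
qed

text \<open>By the ultrametric inequality a large coefficient of the product comes from a large
  term. As the factors are bounded by \<open>C\<close> and \<open>D\<close>, both exponents in that
  term lie in finite sets, and so does their sum.\<close>

lemma decaying_mult:
  assumes V: "finite V" and \<rho>: "0 < \<rho>" and f: "f \<in> decaying \<rho> V" and g: "g \<in> decaying \<rho> V"
  shows "f \<otimes>\<^bsub>power_series R V\<^esub> g \<in> decaying \<rho> V"
proof -
  note fp = decaying_ps[OF f] and gp = decaying_ps[OF g]
  note [simp] = fp[THEN ps_coeff] gp[THEN ps_coeff]
  obtain C where C: "1 \<le> C" "\<And>\<nu>. weight \<rho> V f \<nu> \<le> C" using decaying_bounded[OF f] by blast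
  obtain D where D: "1 \<le> D" "\<And>\<nu>. weight \<rho> V g \<nu> \<le> D" using decaying_bounded[OF g] by blast
  let ?h = "f \<otimes>\<^bsub>power_series R V\<^esub> g"
  have "finite {\<nu>. \<epsilon> \<le> weight \<rho> V ?h \<nu>}" if \<epsilon>: "0 < \<epsilon>" for \<epsilon>
  proof (rule finite_subset)
    let ?A = "{\<alpha>. \<epsilon> / D \<le> weight \<rho> V f \<alpha>}" and ?B = "{\<beta>. \<epsilon> / C \<le> weight \<rho> V g \<beta>}"
    show "finite ((\<lambda>(\<alpha>, \<beta>). \<alpha> + \<beta>) ` (?A \<times> ?B))"
      using \<epsilon> C(1) D(1) f g by (intro finite_imageI finite_cartesian_product decaying_finite) auto
    show "{\<nu>. \<epsilon> \<le> weight \<rho> V ?h \<nu>} \<subseteq> (\<lambda>(\<alpha>, \<beta>). \<alpha> + \<beta>) ` (?A \<times> ?B)"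
    proof
      fix \<nu> assume "\<nu> \<in> {\<nu>. \<epsilon> \<le> weight \<rho> V ?h \<nu>}"
      then have w: "\<epsilon> \<le> weight \<rho> V ?h \<nu>" by simp
      have \<nu>: "\<nu> \<in> mexp V"
      proof (rule ccontr)
        assume "\<nu> \<notin> mexp V" then show False using w \<epsilon> by (simp add: weight_def ps_mult)
      qed
      have "\<exists>\<alpha>\<in>{..\<nu>}. \<epsilon> \<le> absv (f \<alpha> \<otimes> g (\<nu> - \<alpha>)) * \<rho> ^ mdeg V \<nu>"
      proof (rule ccontr)
        assume "\<not> ?thesis"
        then have "absv (\<Oplus>\<alpha>\<in>{..\<nu>}. f \<alpha> \<otimes> g (\<nu> - \<alpha>)) * \<rho> ^ mdeg V \<nu> < \<epsilon>"
          using \<epsilon> \<rho> finite_below[OF V \<nu>] by (intro weight_finsum_less) (auto simp: not_le)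
        then show False using w \<nu> by (simp add: weight_def ps_mult)
      qed
      then obtain \<alpha> where \<alpha>: "\<alpha> \<le> \<nu>" "\<epsilon> \<le> weight \<rho> V f \<alpha> * weight \<rho> V g (\<nu> - \<alpha>)"
        using weight_term[OF fp gp] by auto
      have "weight \<rho> V f \<alpha> * weight \<rho> V g (\<nu> - \<alpha>) \<le> weight \<rho> V f \<alpha> * D"
        "weight \<rho> V f \<alpha> * weight \<rho> V g (\<nu> - \<alpha>) \<le> C * weight \<rho> V g (\<nu> - \<alpha>)"
        using C D weight_nonneg[OF fp, of \<rho>] weight_nonneg[OF gp, of \<rho>] \<rho>
        by (auto intro!: mult_left_mono mult_right_mono)
      with \<alpha> have "\<alpha> \<in> ?A" "\<nu> - \<alpha> \<in> ?B" using C(1) D(1) by (auto simp: field_simps)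
      then show "\<nu> \<in> (\<lambda>(\<alpha>, \<beta>). \<alpha> + \<beta>) ` (?A \<times> ?B)"
        using \<alpha> by (intro image_eqI[of _ _ "(\<alpha>, \<nu> - \<alpha>)"]) auto
    qed
  qed
  then show ?thesis using ps_mult_closed[OF V fp gp] by (simp add: decaying_def)
qed

lemma decaying_add:
  assumes V: "finite V" and \<rho>: "0 < \<rho>" and f: "f \<in> decaying \<rho> V" and g: "g \<in> decaying \<rho> V"
  shows "f \<oplus>\<^bsub>power_series R V\<^esub> g \<in> decaying \<rho> V"
proof -
  interpret P: cring "power_series R V" by (rule ps_cring[OF V])
  note fp = decaying_ps[OF f] and gp = decaying_ps[OF g]
  note [simp] = fp[THEN ps_coeff] gp[THEN ps_coeff]
  have le: "weight \<rho> V (f \<oplus>\<^bsub>power_series R V\<^esub> g) \<nu> \<le> max (weight \<rho> V f \<nu>) (weight \<rho> V g \<nu>)" for \<nu>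
    using mult_right_mono[OF absv_add[of "f \<nu>" "g \<nu>"], of "\<rho> ^ mdeg V \<nu>"] \<rho>
    by (simp add: weight_def ps_add max_mult_distrib_right)
  have "{\<nu>. \<epsilon> \<le> weight \<rho> V (f \<oplus>\<^bsub>power_series R V\<^esub> g) \<nu>} \<subseteq> {\<nu>. \<epsilon> \<le> weight \<rho> V f \<nu>} \<union> {\<nu>. \<epsilon> \<le> weight \<rho> V g \<nu>}" for \<epsilon>
  proof
    fix \<nu> assume "\<nu> \<in> {\<nu>. \<epsilon> \<le> weight \<rho> V (f \<oplus>\<^bsub>power_series R V\<^esub> g) \<nu>}"
    then show "\<nu> \<in> {\<nu>. \<epsilon> \<le> weight \<rho> V f \<nu>} \<union> {\<nu>. \<epsilon> \<le> weight \<rho> V g \<nu>}"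
      using le[of \<nu>] by (auto simp: max_def split: if_splits)
  qed
  then have "finite {\<nu>. \<epsilon> \<le> weight \<rho> V (f \<oplus>\<^bsub>power_series R V\<^esub> g) \<nu>}" if "0 < \<epsilon>" for \<epsilon>
    by (rule finite_subset) (use decaying_finite[OF f that] decaying_finite[OF g that] in simp)
  then show ?thesis using P.a_closed[OF fp gp] by (simp add: decaying_def)
qed

lemma decaying_uminus:
  assumes V: "finite V" and f: "f \<in> decaying \<rho> V"
  shows "\<ominus>\<^bsub>power_series R V\<^esub> f \<in> decaying \<rho> V"
proof -
  interpret P: cring "power_series R V" by (rule ps_cring[OF V])
  have "weight \<rho> V (\<ominus>\<^bsub>power_series R V\<^esub> f) = weight \<rho> V f"
    using decaying_ps[OF f, THEN ps_coeff] by (auto simp: weight_def ps_a_inv[OF V decaying_ps[OF f]] absv_uminus)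
  then show ?thesis using f by (auto simp: decaying_def)
qed

lemma finite_support_decaying:
  assumes "f \<in> carrier (power_series R V)" "finite A" "\<And>\<nu>. \<nu> \<notin> A \<Longrightarrow> f \<nu> = \<zero>"
  shows "f \<in> decaying \<rho> V"
proof -
  have "{\<nu>. \<epsilon> \<le> weight \<rho> V f \<nu>} \<subseteq> A" if "0 < \<epsilon>" for \<epsilon>
    using assms(3) that by (force simp: weight_def)
  then show ?thesis using assms by (auto simp: decaying_def intro: finite_subset)
qed

lemma linear_form_decaying:
  assumes "finite V" "A \<subseteq> V"
  shows "linear_form R A \<in> decaying \<rho> V"
proof (rule finite_support_decaying[OF linear_form_closed[OF assms(2)]])
  show "finite (single ` A)" using assms finite_subset by blast
qed (auto simp: linear_form_def)

lemma one_decaying: "finite V \<Longrightarrow> \<one>\<^bsub>power_series R V\<^esub> \<in> decaying \<rho> V"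
  by (rule finite_support_decaying[of _ _ "{0}"]) (auto simp: ps_carrier ps_one)

lemma subring_decaying:
  assumes V: "finite V" and \<rho>: "0 < \<rho>"
  shows "subring (decaying \<rho> V) (power_series R V)"
proof -
  interpret P: cring "power_series R V" by (rule ps_cring[OF V])
  show ?thesis
    using V \<rho> by (intro P.subringI)
      (auto simp: decaying_uminus decaying_mult decaying_add one_decaying decaying_ps)
qed

text \<open>Two series with different radii both decay at the smaller one, which is still greater
  than 1.\<close>

lemma subring_dagger:
  assumes V: "finite V"
  shows "subring (\<Union>\<rho>\<in>{1<..}. decaying \<rho> V) (power_series R V)"
proof -
  interpret P: cring "power_series R V" by (rule ps_cring[OF V])
  have *: "\<exists>\<tau>>1. f \<in> decaying \<tau> V \<and> g \<in> decaying \<tau> V"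
    if "f \<in> decaying \<rho> V" "g \<in> decaying \<eta> V" "\<rho> > 1" "\<eta> > 1" for f g \<rho> \<eta>
    using that decaying_antimono[of "min \<rho> \<eta>" \<rho> V] decaying_antimono[of "min \<rho> \<eta>" \<eta> V]
    by (intro exI[of _ "min \<rho> \<eta>"]) auto
  show ?thesis
  proof (rule P.subringI)
    show "\<one>\<^bsub>power_series R V\<^esub> \<in> (\<Union>\<rho>\<in>{1<..}. decaying \<rho> V)"
      using one_decaying[OF V, of 2] by (intro UN_I[of 2]) auto
    fix f assume "f \<in> (\<Union>\<rho>\<in>{1<..}. decaying \<rho> V)"
    then obtain \<rho> where f: "\<rho> > 1" "f \<in> decaying \<rho> V" by auto
    then show "\<ominus>\<^bsub>power_series R V\<^esub> f \<in> (\<Union>\<rho>\<in>{1<..}. decaying \<rho> V)"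
      using decaying_uminus[OF V] by auto
    fix g assume "g \<in> (\<Union>\<rho>\<in>{1<..}. decaying \<rho> V)"
    then obtain \<eta> where g: "\<eta> > 1" "g \<in> decaying \<eta> V" by auto
    obtain \<tau> where \<tau>: "\<tau> > 1" "f \<in> decaying \<tau> V" "g \<in> decaying \<tau> V" using *[OF f(2) g(2)] f g by blast
    show "f \<otimes>\<^bsub>power_series R V\<^esub> g \<in> (\<Union>\<rho>\<in>{1<..}. decaying \<rho> V)"
      "f \<oplus>\<^bsub>power_series R V\<^esub> g \<in> (\<Union>\<rho>\<in>{1<..}. decaying \<rho> V)"
      using decaying_mult[OF V _ \<tau>(2,3)] decaying_add[OF V _ \<tau>(2,3)] \<tau>(1) by (auto intro!: bexI[of _ \<tau>])
  qed (auto simp: decaying_ps)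
qed

lemma convergent_cring: "finite V \<Longrightarrow> cring (convergent_series R absv V)"
  unfolding convergent_eq by (simp add: subring_cring ps_cring subring_decaying)

lemma dagger_cring: "finite V \<Longrightarrow> cring (dagger_series R absv V)"
  unfolding dagger_eq by (simp add: subring_cring ps_cring subring_dagger)

text \<open>An integer multiple is no larger than the element itself, and the degree is preserved,
  so the weight at \<mu> is at most that of \<open>f\<close> at the push of \<mu>. Finite fibres do
  the rest.\<close>

lemma pull_decaying:
  assumes V: "finite V" and W: "finite W" and U: "U \<subseteq> W" and \<phi>: "\<phi> ` U \<subseteq> V" and \<rho>: "0 \<le> \<rho>"
    and f: "f \<in> decaying \<rho> V"
  shows "pull R \<phi> U f \<in> decaying \<rho> W"
proof -
  note fp = decaying_ps[OF f]
  note [simp] = fp[THEN ps_coeff]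
  have fU: "finite U" using U W finite_subset by blast
  have "{\<mu>. \<epsilon> \<le> weight \<rho> W (pull R \<phi> U f) \<mu>} \<subseteq> {\<mu> \<in> mexp U. push \<phi> U \<mu> \<in> {\<nu>. \<epsilon> \<le> weight \<rho> V f \<nu>}}"
    if \<epsilon>: "0 < \<epsilon>" for \<epsilon>
  proof
    fix \<mu> assume "\<mu> \<in> {\<mu>. \<epsilon> \<le> weight \<rho> W (pull R \<phi> U f) \<mu>}"
    then have w: "\<epsilon> \<le> weight \<rho> W (pull R \<phi> U f) \<mu>" by simp
    have \<mu>: "\<mu> \<in> mexp U"
    proof (rule ccontr)
      assume "\<mu> \<notin> mexp U" then show False using w \<epsilon> by (simp add: weight_def pull_def)
    qed
    have "weight \<rho> W (pull R \<phi> U f) \<mu> \<le> weight \<rho> V f (push \<phi> U \<mu>)"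
      using \<mu> \<rho> absv_add_pow[of "f (push \<phi> U \<mu>)"]
      by (simp add: weight_def pull_def mdeg_push[OF fU V \<phi>] mdeg_superset[OF W U \<mu>] mult_right_mono)
    then show "\<mu> \<in> {\<mu> \<in> mexp U. push \<phi> U \<mu> \<in> {\<nu>. \<epsilon> \<le> weight \<rho> V f \<nu>}}" using w \<mu> by simp
  qed
  then have "finite {\<mu>. \<epsilon> \<le> weight \<rho> W (pull R \<phi> U f) \<mu>}" if "0 < \<epsilon>" for \<epsilon>
    using finite_subset[OF _ finite_push_fibre[OF fU decaying_finite[OF f that]]] that by blast
  then show ?thesis using pull_closed[OF V W U \<phi> fp] by (simp add: decaying_def)
qed

lemma absv_pull_less:
  assumes "\<And>\<nu>. f \<nu> \<in> carrier R" "\<And>\<nu>. absv (f \<nu>) < c" "0 < c"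
  shows "absv (pull R \<phi> U f \<mu>) < c"
  using assms le_less_trans[OF absv_add_pow[of "f (push \<phi> U \<mu>)" "mcoef \<phi> U \<mu>"]]
  by (auto simp: pull_def)

text \<open>Density of the overconvergent series: the coefficients of norm at least \<epsilon> are
  finitely many, and keeping just these gives a polynomial, which decays at every radius. The radius
  2 in the proof is an arbitrary number above 1.\<close>

lemma truncate:
  assumes f: "f \<in> decaying 1 V" and \<epsilon>: "0 < \<epsilon>" and V: "finite V"
  obtains g where "g \<in> carrier (dagger_series R absv V)" "\<And>\<nu>. absv (f \<nu> \<ominus> g \<nu>) < \<epsilon>"
proof -
  let ?A = "{\<nu>. \<epsilon> \<le> absv (f \<nu>)}"
  note fp = decaying_ps[OF f]
  have fin: "finite ?A" using decaying_finite[OF f \<epsilon>] by simp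
  define g where "g = (\<lambda>\<nu>. if \<nu> \<in> ?A then f \<nu> else \<zero>)"
  have "g \<in> carrier (power_series R V)" using fp by (auto simp: g_def ps_carrier)
  then have "g \<in> decaying 2 V" by (rule finite_support_decaying[OF _ fin]) (simp add: g_def)
  then have "g \<in> carrier (dagger_series R absv V)" by (auto simp: carrier_dagger intro: bexI[of _ 2])
  moreover have "absv (f \<nu> \<ominus> g \<nu>) < \<epsilon>" for \<nu>
    using ps_coeff[OF fp, of \<nu>] \<epsilon> by (auto simp: g_def a_minus_def r_neg)
  ultimately show ?thesis using that by blast
qed

lemma dagger_subset_convergent: "carrier (dagger_series R absv V) \<subseteq> carrier (convergent_series R absv V)"
proof
  fix f assume "f \<in> carrier (dagger_series R absv V)"
  then obtain \<rho> where "1 < \<rho>" "f \<in> decaying \<rho> V" by (auto simp: carrier_dagger)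
  then show "f \<in> carrier (convergent_series R absv V)"
    using decaying_antimono[of 1 \<rho> V] by (auto simp: carrier_convergent)
qed

end

lemma cring_idealI:
  assumes "cring S" "J \<subseteq> carrier S" "\<zero>\<^bsub>S\<^esub> \<in> J" "\<And>a b. a \<in> J \<Longrightarrow> b \<in> J \<Longrightarrow> a \<oplus>\<^bsub>S\<^esub> b \<in> J"
    and mult: "\<And>a x. a \<in> J \<Longrightarrow> x \<in> carrier S \<Longrightarrow> x \<otimes>\<^bsub>S\<^esub> a \<in> J"
  shows "ideal J S"
proof -
  interpret S: cring S by fact
  have "\<ominus>\<^bsub>S\<^esub> a \<in> J" if "a \<in> J" for a
    using mult[OF that, of "\<ominus>\<^bsub>S\<^esub> \<one>\<^bsub>S\<^esub>"] that assms(2) by (auto simp: S.l_minus)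
  then have "subgroup J (add_monoid S)"
    using assms by (intro S.add.subgroupI) (auto simp: a_inv_def)
  then show ?thesis
    using mult S.m_comm assms(2) by (intro idealI) (auto simp: S.ring_axioms subset_iff)
qed

section \<open>Quasi-inverses, and approximation in the completed ideal\<close>

context ultrametric_cring
begin

lemma mult_below_less:
  assumes V: "finite V" and f: "f \<in> carrier (power_series R V)" and g: "g \<in> carrier (power_series R V)"
    and less: "\<And>\<nu>. absv (f \<nu>) < \<epsilon>" and le: "\<And>\<nu>. absv (g \<nu>) \<le> C" and pos: "0 < \<epsilon>" "0 < C"
  shows "absv ((f \<otimes>\<^bsub>power_series R V\<^esub> g) \<nu>) < \<epsilon> * C"
proof (cases "\<nu> \<in> mexp V")
  case True
  note [simp] = f[THEN ps_coeff] g[THEN ps_coeff]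
  have "absv (f \<alpha> \<otimes> g (\<nu> - \<alpha>)) < \<epsilon> * C" for \<alpha>
  proof -
    have "absv (f \<alpha>) * absv (g (\<nu> - \<alpha>)) \<le> absv (f \<alpha>) * C"
      using le by (intro mult_left_mono absv_nonneg) auto
    also have "\<dots> < \<epsilon> * C" using less pos by simp
    finally show ?thesis by (simp add: absv_mult)
  qed
  then show ?thesis
    using True pos finite_below[OF V True] by (simp add: ps_mult absv_finsum_less)
qed (use pos in \<open>simp add: ps_mult\<close>)

text \<open>The equation \<open>(1 + f)(1 + g) = 1\<close> is solved degree by degree. The uniform
  bound \<open>c < 1\<close> on the weights of \<open>f\<close> first bounds those of
  \<open>g\<close> by \<open>c\<close>; decay of \<open>g\<close> then follows along the thresholds
  \<open>c ^ k\<close>.\<close>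

lemma quasi_inverse_decaying:
  assumes V: "finite V" and \<rho>: "0 < \<rho>" and f: "f \<in> decaying \<rho> V"
    and c: "0 < c" "c < 1" "\<And>\<nu>. weight \<rho> V f \<nu> \<le> c"
  shows "\<exists>g\<in>decaying \<rho> V. (\<forall>\<nu>. weight \<rho> V g \<nu> \<le> c) \<and>
    f \<oplus>\<^bsub>power_series R V\<^esub> g \<oplus>\<^bsub>power_series R V\<^esub> f \<otimes>\<^bsub>power_series R V\<^esub> g = \<zero>\<^bsub>power_series R V\<^esub>"
proof -
  note fp = decaying_ps[OF f]
  note [simp] = fp[THEN ps_coeff]
  have "absv (f 0) < 1" using c(2) c(3)[of 0] by (simp add: weight_def)
  then obtain y where y [simp]: "y \<in> carrier R" and y1: "(\<one> \<oplus> f 0) \<otimes> y = \<one>" "absv y \<le> 1"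
    using one_add_small[of "f 0"] by auto
  \<comment> \<open>The coefficient of the equation at \<nu>, solved for \<open>g \<nu>\<close>: the
    term with \<alpha> = 0 has been joined to \<open>g \<nu>\<close>, and \<open>y\<close> inverts
    the resulting factor \<open>1 + f 0\<close>.\<close>
  define F where "F g \<nu> = (if \<nu> \<in> mexp V
    then \<ominus> (y \<otimes> (f \<nu> \<oplus> (\<Oplus>\<alpha>\<in>{..\<nu>} - {0}. f \<alpha> \<otimes> g (\<nu> - \<alpha>)))) else \<zero>)" for g \<nu>
  \<comment> \<open>Recursion on the degree: for nonzero \<alpha> below \<nu> the exponent
    \<open>\<nu> - \<alpha>\<close> has smaller degree.\<close>
  define g where "g = wfrec (measure (mdeg V)) F"
  have deg: "mdeg V (\<nu> - \<alpha>) < mdeg V \<nu>" if "\<nu> \<in> mexp V" "\<alpha> \<in> {..\<nu>} - {0}" for \<nu> \<alpha>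
  proof -
    have "mdeg V \<nu> = mdeg V \<alpha> + mdeg V (\<nu> - \<alpha>)"
      using that by (metis mdeg_add le_diff_add(1) DiffD1 atMost_iff)
    moreover have "mdeg V \<alpha> \<noteq> 0" using mdeg_zero_iff[OF V mexp_below[of \<alpha> \<nu> V]] that by auto
    ultimately show ?thesis by simp
  qed
  have cut: "g \<nu> = F (cut g (measure (mdeg V)) \<nu>) \<nu>" for \<nu>
    using wfrec[OF wf_measure, of "mdeg V" F \<nu>] by (simp only: g_def)
  have gc [simp]: "g \<nu> \<in> carrier R" for \<nu>
  proof (induction "mdeg V \<nu>" arbitrary: \<nu> rule: less_induct)
    case less
    show ?case
    proof (cases "\<nu> \<in> mexp V")
      case True
      have "cut g (measure (mdeg V)) \<nu> (\<nu> - \<alpha>) \<in> carrier R" if "\<alpha> \<in> {..\<nu>} - {0}" for \<alpha>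
        using deg[OF True that] less by (simp add: cut_apply)
      then have "(\<Oplus>\<alpha>\<in>{..\<nu>} - {0}. f \<alpha> \<otimes> cut g (measure (mdeg V)) \<nu> (\<nu> - \<alpha>)) \<in> carrier R"
        by (intro finsum_closed) auto
      then show ?thesis by (subst cut) (simp add: F_def)
    qed (subst cut, simp add: F_def)
  qed
  have out: "g \<nu> = \<zero>" if "\<nu> \<notin> mexp V" for \<nu>
    by (subst cut) (simp add: F_def that)
  define S where "S \<nu> = (\<Oplus>\<alpha>\<in>{..\<nu>} - {0}. f \<alpha> \<otimes> g (\<nu> - \<alpha>))" for \<nu>
  have Sc [simp]: "S \<nu> \<in> carrier R" for \<nu> unfolding S_def by (intro finsum_closed) auto
  have rec: "g \<nu> = \<ominus> (y \<otimes> (f \<nu> \<oplus> S \<nu>))" if \<nu>: "\<nu> \<in> mexp V" for \<nu>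
  proof -
    have "(\<Oplus>\<alpha>\<in>{..\<nu>} - {0}. f \<alpha> \<otimes> cut g (measure (mdeg V)) \<nu> (\<nu> - \<alpha>)) = S \<nu>"
      unfolding S_def using deg[OF \<nu>] by (intro finsum_cong') (auto simp: cut_apply)
    then show ?thesis by (subst cut) (simp add: F_def \<nu>)
  qed
  have gp: "g \<in> carrier (power_series R V)" using out by (intro ps_memI) auto
  have wS: "weight \<rho> V g \<nu> \<le> absv (f \<nu> \<oplus> S \<nu>) * \<rho> ^ mdeg V \<nu>" if \<nu>: "\<nu> \<in> mexp V" for \<nu>
  proof -
    have "absv (g \<nu>) = absv y * absv (f \<nu> \<oplus> S \<nu>)" by (simp add: rec[OF \<nu>] absv_uminus absv_mult)
    also have "\<dots> \<le> 1 * absv (f \<nu> \<oplus> S \<nu>)" by (intro mult_right_mono y1 absv_nonneg) auto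
    finally show ?thesis using \<rho> by (simp add: weight_def mult_right_mono)
  qed
  have wle: "weight \<rho> V g \<nu> \<le> b"
    if \<nu>: "\<nu> \<in> mexp V" and b: "0 \<le> b" "weight \<rho> V f \<nu> \<le> b"
      "\<And>\<alpha>. \<alpha> \<in> {..\<nu>} - {0} \<Longrightarrow> weight \<rho> V f \<alpha> * weight \<rho> V g (\<nu> - \<alpha>) \<le> b" for \<nu> b
  proof -
    have "absv (S \<nu>) * \<rho> ^ mdeg V \<nu> \<le> b"
      unfolding S_def using b \<rho> weight_term[OF fp gp, of _ \<nu> \<rho>] by (intro weight_finsum_le) auto
    moreover have "absv (f \<nu> \<oplus> S \<nu>) * \<rho> ^ mdeg V \<nu> \<le> max (absv (f \<nu>)) (absv (S \<nu>)) * \<rho> ^ mdeg V \<nu>"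
      using \<rho> by (intro mult_right_mono absv_add) auto
    moreover have "max (absv (f \<nu>)) (absv (S \<nu>)) * \<rho> ^ mdeg V \<nu> \<le> b"
      using calculation(1) b(2) by (simp add: weight_def max_def)
    ultimately show ?thesis using wS[OF \<nu>] by linarith
  qed
  have wg: "weight \<rho> V g \<nu> \<le> c" for \<nu>
  proof (induction "mdeg V \<nu>" arbitrary: \<nu> rule: less_induct)
    case less
    show ?case
    proof (cases "\<nu> \<in> mexp V")
      case True
      have "weight \<rho> V f \<alpha> * weight \<rho> V g (\<nu> - \<alpha>) \<le> 1 * c" if "\<alpha> \<in> {..\<nu>} - {0}" for \<alpha>
        using less[OF deg[OF True that]] c(2) order_trans[OF c(3)[of \<alpha>], of 1] \<rho>
        by (intro mult_mono) (auto intro: weight_nonneg[OF gp])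
      then show ?thesis using True c by (intro wle) auto
    qed (use c in \<open>simp add: weight_def out\<close>)
  qed
  \<comment> \<open>A weight of \<open>g\<close> above \<open>c ^ (k + 2)\<close> comes either from
    \<open>f\<close> itself or from a product. In a product the factor from \<open>g\<close> must
    exceed \<open>c ^ (k + 1)\<close>, because the other one is at most \<open>c\<close>, and the
    factor from \<open>f\<close> must reach \<open>c ^ (k + 2)\<close>, because \<open>g\<close> is
    bounded by 1. Both possibilities leave finitely many exponents.\<close>
  have gfin: "finite {\<nu>. c ^ Suc k < weight \<rho> V g \<nu>}" for k
  proof (induction k)
    case 0
    have "{\<nu>. c ^ Suc 0 < weight \<rho> V g \<nu>} = {}" using wg by (auto simp: not_less)
    then show ?case by simp
  next
    case (Suc k)
    let ?A = "{\<nu>. c ^ Suc (Suc k) \<le> weight \<rho> V f \<nu>}" and ?B = "{\<nu>. c ^ Suc k < weight \<rho> V g \<nu>}"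
    have "{\<nu>. c ^ Suc (Suc k) < weight \<rho> V g \<nu>} \<subseteq> ?A \<union> (\<lambda>(\<alpha>, \<beta>). \<alpha> + \<beta>) ` (?A \<times> ?B)"
    proof
      fix \<nu> assume "\<nu> \<in> {\<nu>. c ^ Suc (Suc k) < weight \<rho> V g \<nu>}"
      then have w: "c ^ Suc (Suc k) < weight \<rho> V g \<nu>" by simp
      show "\<nu> \<in> ?A \<union> (\<lambda>(\<alpha>, \<beta>). \<alpha> + \<beta>) ` (?A \<times> ?B)"
      proof (rule ccontr)
        assume n: "\<nu> \<notin> ?A \<union> (\<lambda>(\<alpha>, \<beta>). \<alpha> + \<beta>) ` (?A \<times> ?B)"
        have pos: "0 < c ^ Suc (Suc k)" using c by simp
        have \<nu>: "\<nu> \<in> mexp V"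
        proof (rule ccontr)
          assume "\<nu> \<notin> mexp V" then show False using w pos by (simp add: weight_def out)
        qed
        have "weight \<rho> V f \<alpha> * weight \<rho> V g (\<nu> - \<alpha>) \<le> c ^ Suc (Suc k)" if "\<alpha> \<in> {..\<nu>} - {0}" for \<alpha>
        proof (cases "\<nu> - \<alpha> \<in> ?B")
          case True
          then have "\<alpha> \<notin> ?A"
            using n that by (auto simp: image_iff) (metis le_diff_add(1))
          then have "weight \<rho> V f \<alpha> * weight \<rho> V g (\<nu> - \<alpha>) \<le> c ^ Suc (Suc k) * 1"
            using wg[of "\<nu> - \<alpha>"] c \<rho> by (intro mult_mono) (auto intro: weight_nonneg[OF gp])
          then show ?thesis by simp
        next
          case False
          then have "weight \<rho> V f \<alpha> * weight \<rho> V g (\<nu> - \<alpha>) \<le> c * c ^ Suc k"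
            using c \<rho> by (intro mult_mono) (auto intro: weight_nonneg[OF gp])
          then show ?thesis by simp
        qed
        then have "weight \<rho> V g \<nu> \<le> c ^ Suc (Suc k)"
          using \<nu> pos n by (intro wle) auto
        then show False using w by simp
      qed
    qed
    moreover have "finite ?A" using c by (intro decaying_finite[OF f]) auto
    ultimately show ?case using Suc by (auto intro: finite_subset)
  qed
  have "finite {\<nu>. \<epsilon> \<le> weight \<rho> V g \<nu>}" if \<epsilon>: "0 < \<epsilon>" for \<epsilon>
  proof -
    obtain k where "c ^ k < \<epsilon>" using real_arch_pow_inv[OF \<epsilon> c(2)] by blast
    moreover have "c ^ Suc k \<le> c ^ k" using c by (simp add: mult_left_le_one_le)
    ultimately have "{\<nu>. \<epsilon> \<le> weight \<rho> V g \<nu>} \<subseteq> {\<nu>. c ^ Suc k < weight \<rho> V g \<nu>}" by auto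
    then show ?thesis using gfin[of k] by (rule finite_subset)
  qed
  then have "g \<in> decaying \<rho> V" using gp by (simp add: decaying_def)
  moreover have "f \<oplus>\<^bsub>power_series R V\<^esub> g \<oplus>\<^bsub>power_series R V\<^esub> f \<otimes>\<^bsub>power_series R V\<^esub> g = \<zero>\<^bsub>power_series R V\<^esub>"
  proof
    fix \<nu>
    show "(f \<oplus>\<^bsub>power_series R V\<^esub> g \<oplus>\<^bsub>power_series R V\<^esub> f \<otimes>\<^bsub>power_series R V\<^esub> g) \<nu> = \<zero>\<^bsub>power_series R V\<^esub> \<nu>"
    proof (cases "\<nu> \<in> mexp V")
      case True
      have "{..\<nu>} = insert 0 ({..\<nu>} - {0})" by (auto simp: le_fun_def)
      then have "(\<Oplus>\<alpha>\<in>{..\<nu>}. f \<alpha> \<otimes> g (\<nu> - \<alpha>)) = (\<Oplus>\<alpha>\<in>insert 0 ({..\<nu>} - {0}). f \<alpha> \<otimes> g (\<nu> - \<alpha>))" by simp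
      also have "\<dots> = f 0 \<otimes> g (\<nu> - 0) \<oplus> S \<nu>"
        unfolding S_def using finite_below[OF V True] by (intro finsum_insert) auto
      finally have "(\<Oplus>\<alpha>\<in>{..\<nu>}. f \<alpha> \<otimes> g (\<nu> - \<alpha>)) = f 0 \<otimes> g \<nu> \<oplus> S \<nu>" by (simp add: fun_diff_def)
      then have "(f \<oplus>\<^bsub>power_series R V\<^esub> g \<oplus>\<^bsub>power_series R V\<^esub> f \<otimes>\<^bsub>power_series R V\<^esub> g) \<nu>
          = f \<nu> \<oplus> g \<nu> \<oplus> (f 0 \<otimes> g \<nu> \<oplus> S \<nu>)"
        using True by (simp add: ps_add ps_mult)
      also have "\<dots> = (\<one> \<oplus> f 0) \<otimes> g \<nu> \<oplus> (f \<nu> \<oplus> S \<nu>)" by (simp add: l_distr a_ac)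
      also have "(\<one> \<oplus> f 0) \<otimes> g \<nu> = \<ominus> ((\<one> \<oplus> f 0) \<otimes> y \<otimes> (f \<nu> \<oplus> S \<nu>))"
        by (simp add: rec[OF True] r_minus m_assoc)
      also have "\<dots> \<oplus> (f \<nu> \<oplus> S \<nu>) = \<zero>" by (simp add: y1 l_neg)
      finally show ?thesis by (simp add: ps_zero)
    qed (use out in \<open>simp add: ps_add ps_mult ps_zero ps_outside[OF fp]\<close>)
  qed
  ultimately show ?thesis using wg by blast
qed

text \<open>Decay turns the supremum of the norms into a maximum over a finite set, so the norms
  stay below some \<open>c < 1\<close>. The value 1/2 bounds the remaining coefficients and keeps
  \<open>c\<close> positive.\<close>

lemma quasi_inverse_convergent:
  assumes V: "finite V" and f: "f \<in> carrier (convergent_series R absv V)" and small: "\<And>\<nu>. absv (f \<nu>) < 1"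
  shows "\<exists>g\<in>carrier (convergent_series R absv V). (\<forall>\<nu>. absv (g \<nu>) < 1) \<and>
    f \<oplus>\<^bsub>power_series R V\<^esub> g \<oplus>\<^bsub>power_series R V\<^esub> f \<otimes>\<^bsub>power_series R V\<^esub> g = \<zero>\<^bsub>power_series R V\<^esub>"
proof -
  have f': "f \<in> decaying 1 V" using f by (simp add: carrier_convergent)
  let ?A = "{\<nu>. 1 / 2 \<le> weight 1 V f \<nu>}"
  have fin: "finite ?A" by (rule decaying_finite[OF f']) simp
  let ?c = "Max (insert (1 / 2) ((\<lambda>\<nu>. absv (f \<nu>)) ` ?A))"
  have "absv (f \<nu>) \<le> ?c" for \<nu>
  proof (cases "\<nu> \<in> ?A")
    case True then show ?thesis using fin by (intro Max_ge) auto
  next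
    case False
    then have "absv (f \<nu>) \<le> 1 / 2" by simp
    also have "1 / 2 \<le> ?c" using fin by (intro Max_ge) auto
    finally show ?thesis .
  qed
  moreover have c1: "?c < 1" using fin small by (subst Max_less_iff) auto
  moreover have "1 / 2 \<le> ?c" using fin by (intro Max_ge) auto
  ultimately obtain g where "g \<in> decaying 1 V" "\<And>\<nu>. weight 1 V g \<nu> \<le> ?c"
    "f \<oplus>\<^bsub>power_series R V\<^esub> g \<oplus>\<^bsub>power_series R V\<^esub> f \<otimes>\<^bsub>power_series R V\<^esub> g = \<zero>\<^bsub>power_series R V\<^esub>"
    using quasi_inverse_decaying[OF V _ f', of ?c] by auto
  then show ?thesis using c1 by (intro bexI[of _ g]) (auto simp: carrier_convergent intro: le_less_trans)
qed

text \<open>At the radius \<rho> at which \<open>f\<close> decays its weights may well exceed 1,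
  although all norms are below 1. The radius has to be lowered, yet must stay above 1 for the
  inverse to be overconvergent.\<close>

lemma quasi_inverse_dagger:
  assumes V: "finite V" and f: "f \<in> carrier (dagger_series R absv V)" and small: "\<And>\<nu>. absv (f \<nu>) < 1"
  shows "\<exists>g\<in>carrier (dagger_series R absv V). (\<forall>\<nu>. absv (g \<nu>) < 1) \<and>
    f \<oplus>\<^bsub>power_series R V\<^esub> g \<oplus>\<^bsub>power_series R V\<^esub> f \<otimes>\<^bsub>power_series R V\<^esub> g = \<zero>\<^bsub>power_series R V\<^esub>"
proof -
  obtain \<rho> where \<rho>: "1 < \<rho>" and f': "f \<in> decaying \<rho> V" using f by (auto simp: carrier_dagger)
  note fp = decaying_ps[OF f']
  let ?A = "{\<nu>. 1 / 2 \<le> weight \<rho> V f \<nu>}"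
  have fin: "finite ?A" by (rule decaying_finite[OF f']) simp
  \<comment> \<open>Only the finitely many exponents in \<open>?A\<close> can violate the bound at a
    smaller radius. As the radius tends to 1 from above, their weights tend to the norms of the
    coefficients, which are below 1.\<close>
  have "\<forall>\<^sub>F t in at_right 1. \<forall>\<nu>\<in>?A. weight t V f \<nu> < 1"
  proof (intro eventually_ball_finite fin ballI)
    fix \<nu>
    have "((\<lambda>t. weight t V f \<nu>) \<longlongrightarrow> weight 1 V f \<nu>) (at_right 1)"
      unfolding weight_def by (intro tendsto_intros)
    then show "\<forall>\<^sub>F t in at_right 1. weight t V f \<nu> < 1"
      using small[of \<nu>] by (intro order_tendstoD(2)) auto
  qed
  moreover have "\<forall>\<^sub>F t in at_right (1::real). t \<in> {1<..<\<rho>}"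
    using \<rho> by (intro eventually_at_right_real)
  ultimately have "\<forall>\<^sub>F t in at_right (1::real). t \<in> {1<..<\<rho>} \<and> (\<forall>\<nu>\<in>?A. weight t V f \<nu> < 1)"
    by (rule eventually_conj[rotated])
  then obtain t where t: "1 < t" "t < \<rho>" "\<And>\<nu>. \<nu> \<in> ?A \<Longrightarrow> weight t V f \<nu> < 1"
    using eventually_happens'[of "at_right (1::real)"] by fastforce
  have ft: "f \<in> decaying t V" using decaying_antimono[of t \<rho> V] t f' by auto
  let ?c = "Max (insert (1 / 2) (weight t V f ` ?A))"
  have "weight t V f \<nu> \<le> ?c" for \<nu>
  proof (cases "\<nu> \<in> ?A")
    case True then show ?thesis using fin by (intro Max_ge) auto
  next
    case False
    have "weight t V f \<nu> \<le> weight \<rho> V f \<nu>"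
      using t ps_coeff[OF fp, of \<nu>] by (auto simp: weight_def absv_nonneg intro!: mult_left_mono power_mono)
    also have "\<dots> \<le> 1 / 2" using False by simp
    also have "1 / 2 \<le> ?c" using fin by (intro Max_ge) auto
    finally show ?thesis .
  qed
  moreover have c1: "?c < 1" using fin t by (subst Max_less_iff) auto
  moreover have "1 / 2 \<le> ?c" using fin by (intro Max_ge) auto
  ultimately obtain g where g: "g \<in> decaying t V" "\<And>\<nu>. weight t V g \<nu> \<le> ?c"
    "f \<oplus>\<^bsub>power_series R V\<^esub> g \<oplus>\<^bsub>power_series R V\<^esub> f \<otimes>\<^bsub>power_series R V\<^esub> g = \<zero>\<^bsub>power_series R V\<^esub>"
    using quasi_inverse_decaying[OF V _ ft, of ?c] t by auto
  have "absv (g \<nu>) < 1" for \<nu>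
  proof -
    have "absv (g \<nu>) * 1 \<le> weight t V g \<nu>"
      unfolding weight_def using t ps_coeff[OF decaying_ps[OF g(1)]]
      by (intro mult_left_mono) (auto simp: absv_nonneg)
    then show ?thesis using g(2)[of \<nu>] c1 by simp
  qed
  then show ?thesis using g t by (intro bexI[of _ g]) (auto simp: carrier_dagger)
qed

text \<open>The convergent series that can be approximated by \<open>I\<close> to any precision form
  an ideal that contains \<open>I\<close>, hence they contain the ideal it generates. Closure under
  multiplication by a convergent \<open>x\<close> is the point, because \<open>x i\<close> leaves
  the overconvergent series.\<close>

lemma completion_ideal_approx:
  assumes V: "finite V" and I: "ideal I (dagger_series R absv V)"
    and t: "t \<in> completion_ideal R absv V I" and \<epsilon>: "0 < \<epsilon>"
  obtains i where "i \<in> I" "\<And>\<nu>. absv (t \<nu> \<ominus> i \<nu>) < \<epsilon>"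
proof -
  let ?P = "power_series R V" and ?T = "convergent_series R absv V" and ?D = "dagger_series R absv V"
  interpret P: cring ?P by (rule ps_cring[OF V])
  interpret T: cring ?T by (rule convergent_cring[OF V])
  interpret D: cring ?D by (rule dagger_cring[OF V])
  interpret I: ideal I ?D by fact
  have ops: "(\<otimes>\<^bsub>?T\<^esub>) = (\<otimes>\<^bsub>?P\<^esub>)" "(\<oplus>\<^bsub>?T\<^esub>) = (\<oplus>\<^bsub>?P\<^esub>)" "\<zero>\<^bsub>?T\<^esub> = \<zero>\<^bsub>?P\<^esub>"
     "(\<otimes>\<^bsub>?D\<^esub>) = (\<otimes>\<^bsub>?P\<^esub>)" "(\<oplus>\<^bsub>?D\<^esub>) = (\<oplus>\<^bsub>?P\<^esub>)" "\<zero>\<^bsub>?D\<^esub> = \<zero>\<^bsub>?P\<^esub>"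
    by (simp_all add: convergent_series_def dagger_series_def)
  have TP: "x \<in> carrier ?P" if "x \<in> carrier ?T" for x using that by (simp add: carrier_convergent decaying_ps)
  have DT: "x \<in> carrier ?T" if "x \<in> carrier ?D" for x using that dagger_subset_convergent by blast
  have IT: "x \<in> carrier ?T" if "x \<in> I" for x using that I.a_subset DT by blast
  define J where "J = {t \<in> carrier ?T. \<forall>\<epsilon>>0. \<exists>i\<in>I. \<forall>\<nu>. absv (t \<nu> \<ominus> i \<nu>) < \<epsilon>}"
  have self: "\<exists>i\<in>I. \<forall>\<nu>. absv (t \<nu> \<ominus> i \<nu>) < \<epsilon>" if "t \<in> I" "0 < \<epsilon>" for t \<epsilon>
    using that ps_coeff[OF TP[OF IT]] by (intro bexI[of _ t]) (auto simp: a_minus_def r_neg)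
  have "ideal J ?T"
  proof (rule cring_idealI[OF T.cring_axioms])
    show "\<zero>\<^bsub>?T\<^esub> \<in> J" using self[of "\<zero>\<^bsub>?P\<^esub>"] I.zero_closed T.zero_closed by (simp add: J_def ops)
    fix a assume a: "a \<in> J"
    then have aT: "a \<in> carrier ?T" by (simp add: J_def)
    note [simp] = ps_coeff[OF TP[OF aT]]
    {
      fix b assume b: "b \<in> J"
      then have bT: "b \<in> carrier ?T" by (simp add: J_def)
      note [simp] = ps_coeff[OF TP[OF bT]]
      have "\<exists>k\<in>I. \<forall>\<nu>. absv ((a \<oplus>\<^bsub>?P\<^esub> b) \<nu> \<ominus> k \<nu>) < \<epsilon>" if \<epsilon>: "0 < \<epsilon>" for \<epsilon>
      proof -
        obtain i where i: "i \<in> I" "\<And>\<nu>. absv (a \<nu> \<ominus> i \<nu>) < \<epsilon>" using a \<epsilon> by (auto simp: J_def)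
        obtain j where j: "j \<in> I" "\<And>\<nu>. absv (b \<nu> \<ominus> j \<nu>) < \<epsilon>" using b \<epsilon> by (auto simp: J_def)
        note [simp] = ps_coeff[OF TP[OF IT[OF i(1)]]] ps_coeff[OF TP[OF IT[OF j(1)]]]
        have "(a \<nu> \<oplus> b \<nu>) \<ominus> (i \<nu> \<oplus> j \<nu>) = (a \<nu> \<ominus> i \<nu>) \<oplus> (b \<nu> \<ominus> j \<nu>)" for \<nu>
          by (simp add: a_minus_def minus_add a_ac)
        then have "absv ((a \<oplus>\<^bsub>?P\<^esub> b) \<nu> \<ominus> (i \<oplus>\<^bsub>?P\<^esub> j) \<nu>) < \<epsilon>" for \<nu>
          using absv_add_less[OF _ _ i(2) j(2), of \<nu> \<nu>] by (simp add: ps_add)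
        moreover have "i \<oplus>\<^bsub>?P\<^esub> j \<in> I" using I.a_closed[OF i(1) j(1)] by (simp add: ops)
        ultimately show ?thesis by blast
      qed
      then show "a \<oplus>\<^bsub>?T\<^esub> b \<in> J" using T.a_closed[OF aT bT] by (simp add: J_def ops)
    next
      fix x assume xT: "x \<in> carrier ?T"
      note [simp] = ps_coeff[OF TP[OF xT]]
      have "\<exists>k\<in>I. \<forall>\<nu>. absv ((x \<otimes>\<^bsub>?P\<^esub> a) \<nu> \<ominus> k \<nu>) < \<epsilon>" if \<epsilon>: "0 < \<epsilon>" for \<epsilon>
      proof -
        \<comment> \<open>The order of choices matters: \<open>i\<close> approximates
          \<open>a\<close> with a precision that depends on the size of \<open>x\<close>, and then
          the overconvergent \<open>x'\<close> approximates \<open>x\<close> with a precision that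
          depends on the size of \<open>i\<close>.\<close>
        obtain C where C: "1 \<le> C" "\<And>\<nu>. absv (x \<nu>) \<le> C"
          using decaying_bounded[of x 1 V] xT by (auto simp: carrier_convergent)
        have "0 < \<epsilon> / C" using C \<epsilon> by simp
        then obtain i where i: "i \<in> I" "\<And>\<nu>. absv (a \<nu> \<ominus> i \<nu>) < \<epsilon> / C" using a unfolding J_def by blast
        have iT: "i \<in> carrier ?T" using IT[OF i(1)] .
        note [simp] = ps_coeff[OF TP[OF iT]]
        obtain D where D: "1 \<le> D" "\<And>\<nu>. absv (i \<nu>) \<le> D"
          using decaying_bounded[of i 1 V] iT by (auto simp: carrier_convergent)
        have "0 < \<epsilon> / D" using D \<epsilon> by simp
        then obtain x' where x': "x' \<in> carrier ?D" "\<And>\<nu>. absv (x \<nu> \<ominus> x' \<nu>) < \<epsilon> / D"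
          using truncate[of x V "\<epsilon> / D"] xT V by (auto simp: carrier_convergent)
        note [simp] = ps_coeff[OF TP[OF DT[OF x'(1)]]]
        have *: "(u \<ominus>\<^bsub>?P\<^esub> v) \<nu> = u \<nu> \<ominus> v \<nu>" if "v \<in> carrier ?P" for u v \<nu>
          using that by (simp add: a_minus_def ps_add ps_a_inv[OF V])
        note carr = TP[OF xT] TP[OF aT] TP[OF iT] TP[OF DT[OF x'(1)]]
        have "absv (((a \<ominus>\<^bsub>?P\<^esub> i) \<otimes>\<^bsub>?P\<^esub> x) \<nu>) < \<epsilon> / C * C" for \<nu>
          using carr C i \<epsilon> by (intro mult_below_less[OF V]) (auto simp: *)
        moreover have "absv (((x \<ominus>\<^bsub>?P\<^esub> x') \<otimes>\<^bsub>?P\<^esub> i) \<nu>) < \<epsilon> / D * D" for \<nu>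
          using carr D x' \<epsilon> by (intro mult_below_less[OF V]) (auto simp: *)
        moreover have "(x \<otimes>\<^bsub>?P\<^esub> a) \<ominus>\<^bsub>?P\<^esub> (x' \<otimes>\<^bsub>?P\<^esub> i)
            = ((a \<ominus>\<^bsub>?P\<^esub> i) \<otimes>\<^bsub>?P\<^esub> x) \<oplus>\<^bsub>?P\<^esub> ((x \<ominus>\<^bsub>?P\<^esub> x') \<otimes>\<^bsub>?P\<^esub> i)"
          using carr by (simp add: P.minus_eq P.l_distr P.r_distr P.l_minus P.r_minus) (simp add: P.a_assoc P.m_comm P.l_neg P.r_neg1 P.r_neg2 P.a_lcomm)
        then have "(x \<otimes>\<^bsub>?P\<^esub> a) \<nu> \<ominus> (x' \<otimes>\<^bsub>?P\<^esub> i) \<nu>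
            = ((a \<ominus>\<^bsub>?P\<^esub> i) \<otimes>\<^bsub>?P\<^esub> x) \<nu> \<oplus> ((x \<ominus>\<^bsub>?P\<^esub> x') \<otimes>\<^bsub>?P\<^esub> i) \<nu>" for \<nu>
          using *[of "x' \<otimes>\<^bsub>?P\<^esub> i" "x \<otimes>\<^bsub>?P\<^esub> a" \<nu>] carr by (simp add: ps_add)
        ultimately have "absv ((x \<otimes>\<^bsub>?P\<^esub> a) \<nu> \<ominus> (x' \<otimes>\<^bsub>?P\<^esub> i) \<nu>) < \<epsilon>" for \<nu>
          using C D carr by (auto intro!: absv_add_less simp: ps_coeff[of _ V])
        moreover have "x' \<otimes>\<^bsub>?P\<^esub> i \<in> I" using I.I_l_closed[OF i(1) x'(1)] by (simp add: ops)
        ultimately show ?thesis by blast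
      qed
      then show "x \<otimes>\<^bsub>?T\<^esub> a \<in> J" using T.m_closed[OF xT aT] by (simp add: J_def ops)
    }
  qed (auto simp: J_def)
  moreover have "I \<subseteq> J" using IT self by (auto simp: J_def)
  ultimately have "completion_ideal R absv V I \<subseteq> J"
    unfolding completion_ideal_def by (rule T.genideal_minimal)
  then show ?thesis using t \<epsilon> that by (auto simp: J_def)
qed

end

section \<open>Presentations and completions\<close>

lemma quot_carrier: "carrier (S Quot J) = (\<lambda>x. J +>\<^bsub>S\<^esub> x) ` carrier S"
  by (auto simp: FactRing_def A_RCOSETS_def')

lemma (in ideal) coset_eq_iff:
  "x \<in> carrier R \<Longrightarrow> y \<in> carrier R \<Longrightarrow> I +> x = I +> y \<longleftrightarrow> x \<ominus> y \<in> I"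
  using quotient_eq_iff_same_a_r_cos[OF ideal_axioms] by simp

lemma (in ideal) mem_coset:
  assumes "x \<in> carrier R" "y \<in> I +> x"
  shows "y \<in> carrier R" "I +> y = I +> x"
  using assms a_rcosetsI[OF a_subset assms(1)] a_repr_independence'[OF assms(2,1)] a_elemrcos_carrier[OF assms]
  by auto

lemma (in ideal) quot_zero: "\<zero>\<^bsub>R Quot I\<^esub> = I +> \<zero>"
  using coset_eq_iff by (simp add: FactRing_def a_coset_join2[OF zero_closed a_subgroup])

lemma cring_hom:
  assumes "cring S" "cring T" "h \<in> ring_hom S T"
  shows "ring_hom_cring S T h"
  using assms by (intro ring_hom_cringI ring_hom_ringI2) (auto simp: cring_def)

text \<open>All members of a coset have the same image modulo \<open>J\<close>, so the union of
  cosets that \<open>quot_map\<close> forms is a single coset.\<close>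

lemma quot_map_coset:
  assumes S: "cring S" and T: "cring T" and I: "ideal I S" and J: "ideal J T"
    and h: "h \<in> ring_hom S T" and IJ: "h ` I \<subseteq> J" and x: "x \<in> carrier S"
  shows "quot_map T J h (I +>\<^bsub>S\<^esub> x) = J +>\<^bsub>T\<^esub> h x"
proof -
  interpret h: ring_hom_cring S T h by (rule cring_hom[OF S T h])
  interpret I: ideal I S by fact
  interpret J: ideal J T by fact
  have eq: "J +>\<^bsub>T\<^esub> h c = J +>\<^bsub>T\<^esub> h x" if "c \<in> I +>\<^bsub>S\<^esub> x" for c
  proof -
    have c: "c \<in> carrier S" "I +>\<^bsub>S\<^esub> c = I +>\<^bsub>S\<^esub> x" using I.mem_coset[OF x that] by auto
    then have "c \<ominus>\<^bsub>S\<^esub> x \<in> I" using I.coset_eq_iff x by simp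
    then have "h (c \<ominus>\<^bsub>S\<^esub> x) \<in> J" using IJ by auto
    then show ?thesis using c x J.coset_eq_iff by (simp add: a_minus_def)
  qed
  have self: "x \<in> I +>\<^bsub>S\<^esub> x" using x by (rule I.a_rcos_self)
  have "quot_map T J h (I +>\<^bsub>S\<^esub> x) = (\<Union>c\<in>I +>\<^bsub>S\<^esub> x. J +>\<^bsub>T\<^esub> h c)"
    by (auto simp: quot_map_def set_add_def' a_r_coset_def')
  also have "\<dots> = J +>\<^bsub>T\<^esub> h x" using eq self by blast
  finally show ?thesis .
qed

lemma quot_map_hom:
  assumes S: "cring S" and T: "cring T" and I: "ideal I S" and J: "ideal J T"
    and h: "h \<in> ring_hom S T" and IJ: "h ` I \<subseteq> J"
  shows "quot_map T J h \<in> ring_hom (S Quot I) (T Quot J)"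
proof -
  interpret h: ring_hom_cring S T h by (rule cring_hom[OF S T h])
  interpret I: ideal I S by fact
  interpret J: ideal J T by fact
  note q = quot_map_coset[OF assms]
  note rI = ring_hom_memE[OF I.rcos_ring_hom] and rJ = ring_hom_memE[OF J.rcos_ring_hom]
  show ?thesis
  proof (rule ring_hom_memI)
    show "quot_map T J h x \<in> carrier (T Quot J)" if "x \<in> carrier (S Quot I)" for x
      using that by (auto simp: quot_carrier q)
    fix x y assume "x \<in> carrier (S Quot I)" "y \<in> carrier (S Quot I)"
    then obtain a b where ab: "a \<in> carrier S" "b \<in> carrier S" "x = I +>\<^bsub>S\<^esub> a" "y = I +>\<^bsub>S\<^esub> b"
      by (auto simp: quot_carrier)
    show "quot_map T J h (x \<otimes>\<^bsub>S Quot I\<^esub> y) = quot_map T J h x \<otimes>\<^bsub>T Quot J\<^esub> quot_map T J h y"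
      using ab rI(2)[of a b] rJ(2)[of "h a" "h b"] q[of "a \<otimes>\<^bsub>S\<^esub> b"] by (simp add: q)
    show "quot_map T J h (x \<oplus>\<^bsub>S Quot I\<^esub> y) = quot_map T J h x \<oplus>\<^bsub>T Quot J\<^esub> quot_map T J h y"
      using ab rI(3)[of a b] rJ(3)[of "h a" "h b"] q[of "a \<oplus>\<^bsub>S\<^esub> b"] by (simp add: q)
  next
    show "quot_map T J h \<one>\<^bsub>S Quot I\<^esub> = \<one>\<^bsub>T Quot J\<^esub>"
      using q[of "\<one>\<^bsub>S\<^esub>"] rI(4) rJ(4) by simp
  qed
qed

section \<open>Series in two groups of variables\<close>

lemma sum_split: "\<mu> = case_sum (\<mu> \<circ> Inl) (\<mu> \<circ> Inr)"
  by (auto simp: fun_eq_iff split: sum.splits)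

lemma mexp_Plus: "\<mu> \<in> mexp (Sum_Type.Plus V W) \<longleftrightarrow> \<mu> \<circ> Inl \<in> mexp V \<and> \<mu> \<circ> Inr \<in> mexp W"
  by (auto simp: mexp_def Plus_def image_iff) (metis sum.exhaust)

lemma mexp_case_sum [simp]: "case_sum \<beta> \<alpha> \<in> mexp (Sum_Type.Plus V W) \<longleftrightarrow> \<beta> \<in> mexp V \<and> \<alpha> \<in> mexp W"
  by (simp add: mexp_Plus case_sum_o_inj)

lemma case_sum_inject [simp]: "case_sum \<beta> \<alpha> = case_sum \<beta>' \<alpha>' \<longleftrightarrow> \<beta> = \<beta>' \<and> \<alpha> = \<alpha>'"
  by (metis case_sum_o_inj(1) case_sum_o_inj(2))

lemma case_sum_le [simp]:
  "case_sum \<beta>' \<alpha>' \<le> case_sum \<beta> (\<alpha> :: 'w \<Rightarrow> nat) \<longleftrightarrow> \<beta>' \<le> \<beta> \<and> \<alpha>' \<le> \<alpha>"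
  by (auto simp: le_fun_def split: sum.splits)

lemma case_sum_diff [simp]:
  "case_sum \<beta> \<alpha> - case_sum \<beta>' (\<alpha>' :: 'w \<Rightarrow> nat) = case_sum (\<beta> - \<beta>') (\<alpha> - \<alpha>')"
  by (auto simp: fun_eq_iff split: sum.splits)

lemma case_sum_zero [simp]: "case_sum \<beta> \<alpha> = (0 :: 'v + 'w \<Rightarrow> nat) \<longleftrightarrow> \<beta> = 0 \<and> \<alpha> = 0"
  by (auto simp: fun_eq_iff split: sum.splits)

lemma case_sum_single: "case_sum \<beta> \<alpha> = single (Inr w) \<longleftrightarrow> \<beta> = 0 \<and> \<alpha> = single w"
  by (auto simp: fun_eq_iff single_def split: sum.splits)

lemma bij_betw_case_sum:
  "bij_betw (\<lambda>(\<alpha>, \<beta>). case_sum \<beta> \<alpha>) ({..\<alpha>} \<times> {..\<beta>}) {..case_sum \<beta> (\<alpha> :: 'w \<Rightarrow> nat)}"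
  for \<beta> :: "'v \<Rightarrow> nat"
proof (rule bij_betwI[where g = "\<lambda>\<mu>. (\<mu> \<circ> Inr, \<mu> \<circ> Inl)"])
  show "(\<lambda>\<mu>. (\<mu> \<circ> Inr, \<mu> \<circ> Inl)) \<in> {..case_sum \<beta> \<alpha>} \<rightarrow> {..\<alpha>} \<times> {..\<beta>}"
    by (auto simp: le_fun_def dest: spec[of _ "Inl _"] spec[of _ "Inr _"])
      (metis sum.case(2), metis sum.case(1))
  show "(case (\<mu> \<circ> Inr, \<mu> \<circ> Inl) of (\<alpha>, \<beta>) \<Rightarrow> case_sum \<beta> \<alpha>) = \<mu>" for \<mu> :: "'v + 'w \<Rightarrow> nat"
    using sum_split[of \<mu>] by simp
qed auto

text \<open>Reads a series in \<open>V\<close> and \<open>W\<close> as a series in \<open>W\<close>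
  with coefficients in the series in \<open>V\<close>: the slice at \<alpha> is the coefficient of
  the monomial \<alpha>.\<close>

definition slice :: "(('v + 'w \<Rightarrow> nat) \<Rightarrow> 'b) \<Rightarrow> ('w \<Rightarrow> nat) \<Rightarrow> ('v \<Rightarrow> nat) \<Rightarrow> 'b"
  where "slice f \<alpha> = (\<lambda>\<beta>. f (case_sum \<beta> \<alpha>))"

locale dagger_presentation = ultrametric_cring R absv for R (structure) and absv +
  fixes V :: "'v set" and I :: "(('v \<Rightarrow> nat) \<Rightarrow> 'a) set"
  assumes fV [simp]: "finite V" and I: "ideal I (dagger_series R absv V)"
begin

abbreviation "T \<equiv> convergent_series R absv V"
abbreviation "J \<equiv> completion_ideal R absv V I"
abbreviation "A \<equiv> completion R absv V I"
abbreviation "nrm \<equiv> residue_norm absv V"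

text \<open>Reduction of these coefficients modulo the completed ideal. It will be a surjection from
  the convergent series over the base in \<open>V\<close> and \<open>W\<close> onto the convergent
  series over \<open>A\<close> in \<open>W\<close>.\<close>

definition theta :: "(('v + 'w \<Rightarrow> nat) \<Rightarrow> 'a) \<Rightarrow> ('w \<Rightarrow> nat) \<Rightarrow> (('v \<Rightarrow> nat) \<Rightarrow> 'a) set"
  where "theta f = (\<lambda>\<alpha>. J +>\<^bsub>T\<^esub> slice f \<alpha>)"

lemma T_cring: "cring T" by (simp add: convergent_cring)

lemma I_T: "I \<subseteq> carrier T"
proof -
  interpret I: ideal I "dagger_series R absv V" by (rule I)
  show ?thesis using I.a_subset dagger_subset_convergent by blast
qed

lemma J_ideal: "ideal J T"
  unfolding completion_ideal_def using cring.axioms(1)[OF T_cring] I_T by (rule ring.genideal_ideal)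

lemma A_cring: "cring A"
  unfolding completion_def using J_ideal T_cring by (rule ideal.quotient_is_cring)

lemma A_carrier: "carrier A = (\<lambda>x. J +>\<^bsub>T\<^esub> x) ` carrier T"
  by (simp add: completion_def quot_carrier)

lemma coset_hom: "ring_hom_cring T A ((+>\<^bsub>T\<^esub>) J)"
  unfolding completion_def
  using cring_hom[OF T_cring ideal.quotient_is_cring[OF J_ideal T_cring] ideal.rcos_ring_hom[OF J_ideal]] .

lemma T_ops: "(\<otimes>\<^bsub>T\<^esub>) = (\<otimes>\<^bsub>power_series R V\<^esub>)" "(\<oplus>\<^bsub>T\<^esub>) = (\<oplus>\<^bsub>power_series R V\<^esub>)"
  "\<zero>\<^bsub>T\<^esub> = \<zero>\<^bsub>power_series R V\<^esub>" "\<one>\<^bsub>T\<^esub> = \<one>\<^bsub>power_series R V\<^esub>"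
  by (simp_all add: convergent_series_def)

lemma T_ps: "x \<in> carrier T \<Longrightarrow> x \<in> carrier (power_series R V)"
  by (simp add: carrier_convergent decaying_ps)

lemma T_finsum:
  assumes "finite B" "\<And>b. b \<in> B \<Longrightarrow> F b \<in> carrier T"
  shows "(\<Oplus>\<^bsub>T\<^esub>b\<in>B. F b) = (\<lambda>\<nu>. \<Oplus>b\<in>B. F b \<nu>)"
proof -
  interpret T: cring T by (rule T_cring)
  show ?thesis using assms
  proof (induction B rule: finite_induct)
    case (insert x B)
    have "(\<Oplus>\<^bsub>T\<^esub>b\<in>insert x B. F b) = F x \<oplus>\<^bsub>T\<^esub> (\<Oplus>\<^bsub>T\<^esub>b\<in>B. F b)"
      using insert by (intro T.finsum_insert) auto
    moreover have "(\<Oplus>b\<in>insert x B. F b \<nu>) = F x \<nu> \<oplus> (\<Oplus>b\<in>B. F b \<nu>)" for \<nu>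
      using insert.hyps insert.prems[THEN T_ps, THEN ps_coeff] by (intro finsum_insert) auto
    ultimately show ?case using insert by (simp add: T_ops ps_add)
  qed (simp add: T_ops ps_zero)
qed

lemma slice_T:
  assumes f: "f \<in> carrier (convergent_series R absv (Sum_Type.Plus V W))"
  shows "slice f \<alpha> \<in> carrier T"
proof -
  have fd: "f \<in> decaying 1 (Sum_Type.Plus V W)" using f by (simp add: carrier_convergent)
  note fp = decaying_ps[OF fd]
  have "slice f \<alpha> \<in> carrier (power_series R V)"
    using ps_coeff[OF fp] ps_outside[OF fp] by (intro ps_memI) (auto simp: slice_def)
  moreover have "finite {\<beta>. \<epsilon> \<le> absv (slice f \<alpha> \<beta>)}" if "0 < \<epsilon>" for \<epsilon>
  proof -
    have "finite ((\<lambda>\<beta>. case_sum \<beta> \<alpha>) -` {\<mu>. \<epsilon> \<le> weight 1 (Sum_Type.Plus V W) f \<mu>})"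
      using decaying_finite[OF fd that] by (rule finite_vimageI) (auto simp: inj_on_def)
    then show ?thesis by (simp add: slice_def vimage_def)
  qed
  ultimately show ?thesis by (simp add: carrier_convergent decaying_def)
qed

lemma slice_outside:
  assumes "f \<in> carrier (power_series R (Sum_Type.Plus V W))" "\<alpha> \<notin> mexp W"
  shows "slice f \<alpha> = \<zero>\<^bsub>T\<^esub>"
  using assms ps_outside by (fastforce simp: slice_def T_ops ps_zero)

text \<open>The exponents below a joint exponent are pairs, so the Cauchy product in all variables
  is an iterated one. This makes \<open>theta\<close> multiplicative.\<close>

lemma slice_mult:
  assumes W: "finite W" and f: "f \<in> carrier (convergent_series R absv (Sum_Type.Plus V W))"
    and g: "g \<in> carrier (convergent_series R absv (Sum_Type.Plus V W))" and \<alpha>: "\<alpha> \<in> mexp W"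
  shows "slice (f \<otimes>\<^bsub>power_series R (Sum_Type.Plus V W)\<^esub> g) \<alpha> = (\<Oplus>\<^bsub>T\<^esub>\<gamma>\<in>{..\<alpha>}. slice f \<gamma> \<otimes>\<^bsub>T\<^esub> slice g (\<alpha> - \<gamma>))"
proof
  fix \<beta>
  interpret T: cring T by (rule T_cring)
  have fp: "f \<in> carrier (power_series R (Sum_Type.Plus V W))" and gp: "g \<in> carrier (power_series R (Sum_Type.Plus V W))"
    using f g by (auto simp: carrier_convergent decaying_ps)
  note [simp] = ps_coeff[OF fp] ps_coeff[OF gp]
  note sT = slice_T[OF f] slice_T[OF g]
  have "(\<Oplus>\<^bsub>T\<^esub>\<gamma>\<in>{..\<alpha>}. slice f \<gamma> \<otimes>\<^bsub>T\<^esub> slice g (\<alpha> - \<gamma>)) \<beta> = (\<Oplus>\<gamma>\<in>{..\<alpha>}. (slice f \<gamma> \<otimes>\<^bsub>T\<^esub> slice g (\<alpha> - \<gamma>)) \<beta>)"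
    using finite_below[OF W \<alpha>] sT by (subst T_finsum) auto
  also have "\<dots> = slice (f \<otimes>\<^bsub>power_series R (Sum_Type.Plus V W)\<^esub> g) \<alpha> \<beta>"
  proof (cases "\<beta> \<in> mexp V")
    case True
    have "(\<Oplus>\<gamma>\<in>{..\<alpha>}. (slice f \<gamma> \<otimes>\<^bsub>T\<^esub> slice g (\<alpha> - \<gamma>)) \<beta>)
        = (\<Oplus>\<gamma>\<in>{..\<alpha>}. \<Oplus>\<delta>\<in>{..\<beta>}. f (case_sum \<delta> \<gamma>) \<otimes> g (case_sum \<beta> \<alpha> - case_sum \<delta> \<gamma>))"
      using True by (simp add: T_ops ps_mult slice_def)
    also have "\<dots> = (\<Oplus>p\<in>{..\<alpha>} \<times> {..\<beta>}. case p of (\<gamma>, \<delta>) \<Rightarrow> f (case_sum \<delta> \<gamma>) \<otimes> g (case_sum \<beta> \<alpha> - case_sum \<delta> \<gamma>))"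
      using finite_below[OF W \<alpha>] finite_below[OF fV True] by (intro finsum_Sigma) auto
    also have "\<dots> = (\<Oplus>\<mu>\<in>{..case_sum \<beta> \<alpha>}. f \<mu> \<otimes> g (case_sum \<beta> \<alpha> - \<mu>))"
      by (rule finsum_bij[OF bij_betw_case_sum]) auto
    also have "\<dots> = slice (f \<otimes>\<^bsub>power_series R (Sum_Type.Plus V W)\<^esub> g) \<alpha> \<beta>"
      using True \<alpha> by (simp add: slice_def ps_mult)
    finally show ?thesis .
  next
    case False
    then show ?thesis by (auto simp: T_ops ps_mult slice_def intro!: finsum_zeroI)
  qed
  finally show "slice (f \<otimes>\<^bsub>power_series R (Sum_Type.Plus V W)\<^esub> g) \<alpha> \<beta> =
    (\<Oplus>\<^bsub>T\<^esub>\<gamma>\<in>{..\<alpha>}. slice f \<gamma> \<otimes>\<^bsub>T\<^esub> slice g (\<alpha> - \<gamma>)) \<beta>" by simp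
qed

lemma zero_A: "J +>\<^bsub>T\<^esub> \<zero>\<^bsub>T\<^esub> = \<zero>\<^bsub>A\<^esub>"
proof -
  interpret q: ring_hom_cring T A "(+>\<^bsub>T\<^esub>) J" by (rule coset_hom)
  show ?thesis by simp
qed

lemma theta_ps:
  assumes f: "f \<in> carrier (convergent_series R absv (Sum_Type.Plus V W))"
  shows "theta f \<in> carrier (power_series A W)"
proof -
  interpret A: cring A by (rule A_cring)
  have fp: "f \<in> carrier (power_series R (Sum_Type.Plus V W))" using f by (simp add: carrier_convergent decaying_ps)
  show ?thesis
  proof (rule A.ps_memI)
    show "theta f \<alpha> \<in> carrier A" for \<alpha>
      unfolding theta_def A_carrier using slice_T[OF f] by (rule imageI)
    show "theta f \<alpha> = \<zero>\<^bsub>A\<^esub>" if "\<alpha> \<notin> mexp W" for \<alpha>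
      unfolding theta_def slice_outside[OF fp that] by (rule zero_A)
  qed
qed

lemma theta_hom_ps:
  fixes W :: "'w set"
  assumes W: "finite W"
  shows "theta \<in> ring_hom (convergent_series R absv (Sum_Type.Plus V W)) (power_series A W)"
proof (rule ring_hom_memI)
  let ?Q = "power_series R (Sum_Type.Plus V W)" and ?S = "convergent_series R absv (Sum_Type.Plus V W)"
  interpret A: cring A by (rule A_cring)
  interpret T: cring T by (rule T_cring)
  interpret q: ring_hom_cring T A "(+>\<^bsub>T\<^esub>) J" by (rule coset_hom)
  interpret P: cring "power_series A W" by (rule A.ps_cring[OF W])
  interpret S: cring ?S by (rule convergent_cring) (simp add: W)
  have ops: "(\<otimes>\<^bsub>?S\<^esub>) = (\<otimes>\<^bsub>?Q\<^esub>)" "(\<oplus>\<^bsub>?S\<^esub>) = (\<oplus>\<^bsub>?Q\<^esub>)" "\<one>\<^bsub>?S\<^esub> = \<one>\<^bsub>?Q\<^esub>"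
    by (simp_all add: convergent_series_def)
  fix f assume f: "f \<in> carrier ?S"
  note [simp] = slice_T[OF f]
  show "theta f \<in> carrier (power_series A W)" by (rule theta_ps[OF f])
  fix g assume g: "g \<in> carrier ?S"
  note [simp] = slice_T[OF g]
  show "theta (f \<oplus>\<^bsub>?S\<^esub> g) = theta f \<oplus>\<^bsub>power_series A W\<^esub> theta g"
  proof
    fix \<alpha>
    have "slice (f \<oplus>\<^bsub>?S\<^esub> g) \<alpha> = slice f \<alpha> \<oplus>\<^bsub>T\<^esub> slice g \<alpha>" by (simp add: ops T_ops ps_add slice_def)
    then show "theta (f \<oplus>\<^bsub>?S\<^esub> g) \<alpha> = (theta f \<oplus>\<^bsub>power_series A W\<^esub> theta g) \<alpha>"
      by (simp add: A.ps_add theta_def)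
  qed
  show "theta (f \<otimes>\<^bsub>?S\<^esub> g) = theta f \<otimes>\<^bsub>power_series A W\<^esub> theta g"
  proof
    fix \<alpha>
    show "theta (f \<otimes>\<^bsub>?S\<^esub> g) \<alpha> = (theta f \<otimes>\<^bsub>power_series A W\<^esub> theta g) \<alpha>"
    proof (cases "\<alpha> \<in> mexp W")
      case True
      have "theta (f \<otimes>\<^bsub>?S\<^esub> g) \<alpha> = J +>\<^bsub>T\<^esub> (\<Oplus>\<^bsub>T\<^esub>\<gamma>\<in>{..\<alpha>}. slice f \<gamma> \<otimes>\<^bsub>T\<^esub> slice g (\<alpha> - \<gamma>))"
        using slice_mult[OF W f g True] by (simp add: theta_def ops)
      also have "\<dots> = (\<Oplus>\<^bsub>A\<^esub>\<gamma>\<in>{..\<alpha>}. J +>\<^bsub>T\<^esub> (slice f \<gamma> \<otimes>\<^bsub>T\<^esub> slice g (\<alpha> - \<gamma>)))"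
        by (subst q.hom_finsum) (auto simp: o_def)
      also have "\<dots> = (theta f \<otimes>\<^bsub>power_series A W\<^esub> theta g) \<alpha>"
        using True by (simp add: A.ps_mult theta_def)
      finally show ?thesis .
    next
      case False
      have "f \<otimes>\<^bsub>?S\<^esub> g \<in> carrier ?Q"
        using S.m_closed[OF f g] by (simp add: carrier_convergent decaying_ps)
      then show ?thesis using False by (simp add: A.ps_mult theta_def slice_outside zero_A)
    qed
  qed
next
  interpret A: cring A by (rule A_cring)
  interpret q: ring_hom_cring T A "(+>\<^bsub>T\<^esub>) J" by (rule coset_hom)
  show "theta \<one>\<^bsub>convergent_series R absv (Sum_Type.Plus V W)\<^esub> = \<one>\<^bsub>power_series A W\<^esub>"
  proof
    fix \<alpha> :: "'w \<Rightarrow> nat"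
    have "slice \<one>\<^bsub>power_series R (Sum_Type.Plus V W)\<^esub> \<alpha> = (if \<alpha> = 0 then \<one>\<^bsub>T\<^esub> else \<zero>\<^bsub>T\<^esub>)"
      by (auto simp: slice_def ps_one T_ops ps_zero)
    moreover have "\<one>\<^bsub>convergent_series R absv (Sum_Type.Plus V W)\<^esub> = \<one>\<^bsub>power_series R (Sum_Type.Plus V W)\<^esub>"
      by (simp add: convergent_series_def)
    ultimately show "theta \<one>\<^bsub>convergent_series R absv (Sum_Type.Plus V W)\<^esub> \<alpha> = \<one>\<^bsub>power_series A W\<^esub> \<alpha>"
      by (simp add: theta_def A.ps_one)
  qed
qed

lemma gauss_norm_bounds:
  assumes "t \<in> carrier T"
  shows "absv (t \<nu>) \<le> gauss_norm absv V t" "0 \<le> gauss_norm absv V t"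
    "(\<And>\<nu>. absv (t \<nu>) \<le> c) \<Longrightarrow> gauss_norm absv V t \<le> c"
proof -
  have tp: "t \<in> carrier (power_series R V)" using assms by (rule T_ps)
  obtain C where C: "1 \<le> C" "\<And>\<nu>. absv (t \<nu>) \<le> C"
    using decaying_bounded[of t 1 V] assms by (auto simp: carrier_convergent)
  have bdd: "bdd_above ((\<lambda>\<nu>. absv (t \<nu>)) ` mexp V)" using C by (intro bdd_aboveI2) auto
  have *: "absv (t \<nu>) \<le> gauss_norm absv V t" if "\<nu> \<in> mexp V" for \<nu>
    unfolding gauss_norm_def using that bdd by (rule cSUP_upper)
  show nn: "0 \<le> gauss_norm absv V t"
    using *[of 0] absv_nonneg[OF ps_coeff[OF tp, of 0]] by simp
  show "absv (t \<nu>) \<le> gauss_norm absv V t"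
    using * nn ps_outside[OF tp, of \<nu>] by (cases "\<nu> \<in> mexp V") auto
  show "gauss_norm absv V t \<le> c" if "\<And>\<nu>. absv (t \<nu>) \<le> c"
    unfolding gauss_norm_def using that using mexp_zero(1)[of V] by (intro cSUP_least) blast+
qed

lemma residue_norm_bounds:
  assumes t: "t \<in> carrier T"
  shows "0 \<le> nrm (J +>\<^bsub>T\<^esub> t)" "nrm (J +>\<^bsub>T\<^esub> t) \<le> gauss_norm absv V t"
    "0 < \<epsilon> \<Longrightarrow> \<exists>u\<in>J +>\<^bsub>T\<^esub> t. gauss_norm absv V u < nrm (J +>\<^bsub>T\<^esub> t) + \<epsilon>"
proof -
  interpret J: ideal J T by (rule J_ideal)
  have self: "t \<in> J +>\<^bsub>T\<^esub> t" using t by (rule J.a_rcos_self)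
  have c: "u \<in> carrier T" if "u \<in> J +>\<^bsub>T\<^esub> t" for u using J.mem_coset[OF t that] by simp
  have bdd: "bdd_below (gauss_norm absv V ` (J +>\<^bsub>T\<^esub> t))"
    using c gauss_norm_bounds(2) by (intro bdd_belowI2[of _ 0]) auto
  show "0 \<le> nrm (J +>\<^bsub>T\<^esub> t)"
    unfolding residue_norm_def using self c gauss_norm_bounds(2) by (intro cINF_greatest) auto
  show "nrm (J +>\<^bsub>T\<^esub> t) \<le> gauss_norm absv V t"
    unfolding residue_norm_def using bdd self by (rule cINF_lower)
  show "\<exists>u\<in>J +>\<^bsub>T\<^esub> t. gauss_norm absv V u < nrm (J +>\<^bsub>T\<^esub> t) + \<epsilon>" if "0 < \<epsilon>"
    using cINF_less_iff[OF _ bdd, of "nrm (J +>\<^bsub>T\<^esub> t) + \<epsilon>"] self that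
    by (auto simp: residue_norm_def)
qed

lemma nrm_nonneg: "x \<in> carrier A \<Longrightarrow> 0 \<le> nrm x"
  using residue_norm_bounds(1) by (auto simp: A_carrier)

lemma carrier_convergent_A:
  "carrier (convergent_series A nrm W) = {F \<in> carrier (power_series A W). \<forall>\<epsilon>>0. finite {\<alpha>. \<epsilon> \<le> nrm (F \<alpha>)}}"
proof -
  interpret A: cring A by (rule A_cring)
  have "((\<lambda>\<alpha>. nrm (F \<alpha>)) \<longlongrightarrow> 0) cofinite \<longleftrightarrow> (\<forall>\<epsilon>>0. finite {\<alpha>. \<epsilon> \<le> nrm (F \<alpha>)})"
    if "F \<in> carrier (power_series A W)" for F
    using nrm_nonneg[OF A.ps_coeff[OF that]] by (simp add: tendsto_iff eventually_cofinite not_less)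
  then show ?thesis by (auto simp: convergent_series_def)
qed

lemma theta_convergent:
  assumes f: "f \<in> carrier (convergent_series R absv (Sum_Type.Plus V W))"
  shows "theta f \<in> carrier (convergent_series A nrm W)"
proof -
  have fd: "f \<in> decaying 1 (Sum_Type.Plus V W)" using f by (simp add: carrier_convergent)
  have "finite {\<alpha>. \<epsilon> \<le> nrm (theta f \<alpha>)}" if \<epsilon>: "0 < \<epsilon>" for \<epsilon>
  proof (rule finite_subset)
    \<comment> \<open>Half of \<epsilon>: a supremum that reaches \<epsilon> guarantees a
      coefficient of norm at least \<epsilon>/2.\<close>
    let ?B = "{\<mu>. \<epsilon> / 2 \<le> weight 1 (Sum_Type.Plus V W) f \<mu>}"
    show "finite ((\<lambda>\<mu>. \<mu> \<circ> Inr) ` ?B)" using \<epsilon> by (intro finite_imageI decaying_finite[OF fd]) simp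
    show "{\<alpha>. \<epsilon> \<le> nrm (theta f \<alpha>)} \<subseteq> (\<lambda>\<mu>. \<mu> \<circ> Inr) ` ?B"
    proof
      fix \<alpha> assume "\<alpha> \<in> {\<alpha>. \<epsilon> \<le> nrm (theta f \<alpha>)}"
      then have g: "\<epsilon> \<le> gauss_norm absv V (slice f \<alpha>)"
        using residue_norm_bounds(2)[OF slice_T[OF f, of \<alpha>]] by (simp add: theta_def)
      have "\<exists>\<beta>. \<epsilon> / 2 \<le> absv (slice f \<alpha> \<beta>)"
      proof (rule ccontr)
        assume "\<not> ?thesis"
        then have "absv (slice f \<alpha> \<beta>) \<le> \<epsilon> / 2" for \<beta> by (auto simp: not_le intro: less_imp_le)
        then have "gauss_norm absv V (slice f \<alpha>) \<le> \<epsilon> / 2" by (rule gauss_norm_bounds(3)[OF slice_T[OF f]])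
        with g \<epsilon> show False by simp
      qed
      then obtain \<beta> where "case_sum \<beta> \<alpha> \<in> ?B" by (auto simp: slice_def)
      then show "\<alpha> \<in> (\<lambda>\<mu>. \<mu> \<circ> Inr) ` ?B" by (intro image_eqI[of _ _ "case_sum \<beta> \<alpha>"]) (auto simp: case_sum_o_inj)
    qed
  qed
  then show ?thesis using theta_ps[OF f] by (simp add: carrier_convergent_A)
qed

text \<open>Lifting each coefficient separately is not enough, since the lifts together must tend to
  zero. The residue norm is an infimum, so each lift may exceed it a little, and the excess is made
  to tend to zero with the degree.\<close>

lemma theta_surj:
  fixes W :: "'w set"
  assumes W: "finite W" and F: "F \<in> carrier (convergent_series A nrm W)"
  obtains f where "f \<in> carrier (convergent_series R absv (Sum_Type.Plus V W))" "theta f = F"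
proof -
  interpret A: cring A by (rule A_cring)
  interpret T: cring T by (rule T_cring)
  interpret J: ideal J T by (rule J_ideal)
  have FA: "F \<in> carrier (power_series A W)" and Ffin: "\<And>\<epsilon>. 0 < \<epsilon> \<Longrightarrow> finite {\<alpha>. \<epsilon> \<le> nrm (F \<alpha>)}"
    using F by (auto simp: carrier_convergent_A)
  \<comment> \<open>The allowance is positive, as the definition of an infimum requires, and tends
    to zero because \<open>W\<close> is finite.\<close>
  have "\<exists>t\<in>carrier T. J +>\<^bsub>T\<^esub> t = F \<alpha> \<and> gauss_norm absv V t < nrm (F \<alpha>) + 1 / (1 + real (mdeg W \<alpha>))" for \<alpha>
  proof -
    obtain t where t: "t \<in> carrier T" "F \<alpha> = J +>\<^bsub>T\<^esub> t" using A.ps_coeff[OF FA, of \<alpha>] by (auto simp: A_carrier)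
    obtain u where u: "u \<in> J +>\<^bsub>T\<^esub> t" "gauss_norm absv V u < nrm (F \<alpha>) + 1 / (1 + real (mdeg W \<alpha>))"
      using residue_norm_bounds(3)[OF t(1), of "1 / (1 + real (mdeg W \<alpha>))"] t(2) by auto
    then show ?thesis using J.mem_coset[OF t(1) u(1)] t by auto
  qed
  then obtain t' where t': "\<And>\<alpha>. t' \<alpha> \<in> carrier T" "\<And>\<alpha>. J +>\<^bsub>T\<^esub> t' \<alpha> = F \<alpha>"
    "\<And>\<alpha>. gauss_norm absv V (t' \<alpha>) < nrm (F \<alpha>) + 1 / (1 + real (mdeg W \<alpha>))" by metis
  \<comment> \<open>Outside \<open>mexp W\<close> the lift has to be exactly zero, so that the
    combined series vanishes off the multi-indices.\<close>
  define t where "t \<alpha> = (if \<alpha> \<in> mexp W then t' \<alpha> else \<zero>\<^bsub>T\<^esub>)" for \<alpha>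
  have tT: "t \<alpha> \<in> carrier T" for \<alpha> using t' by (simp add: t_def)
  have tF: "J +>\<^bsub>T\<^esub> t \<alpha> = F \<alpha>" for \<alpha>
    using t' A.ps_outside[OF FA] zero_A by (simp add: t_def)
  define f where "f \<mu> = t (\<mu> \<circ> Inr) (\<mu> \<circ> Inl)" for \<mu> :: "'v + 'w \<Rightarrow> nat"
  have sl: "slice f \<alpha> = t \<alpha>" for \<alpha> by (simp add: slice_def f_def case_sum_o_inj)
  have "f \<in> carrier (power_series R (Sum_Type.Plus V W))"
  proof (rule ps_memI)
    show "f \<mu> \<in> carrier R" for \<mu> using ps_coeff[OF T_ps[OF tT]] by (simp add: f_def)
    show "f \<mu> = \<zero>" if "\<mu> \<notin> mexp (Sum_Type.Plus V W)" for \<mu>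
      using that ps_outside[OF T_ps[OF t'(1)]] by (auto simp: mexp_Plus f_def t_def T_ops ps_zero)
  qed
  moreover have "finite {\<mu>. \<epsilon> \<le> absv (f \<mu>)}" if \<epsilon>: "0 < \<epsilon>" for \<epsilon>
  proof -
    \<comment> \<open>Beyond degree \<open>N\<close> the allowance is below \<epsilon>/2, so a
      coefficient of norm at least \<epsilon> forces the residue norm there to be at least
      \<epsilon>/2.\<close>
    obtain N where N: "1 / \<epsilon> * 2 < real N" using reals_Archimedean2 by blast
    let ?A = "{\<alpha>. \<epsilon> / 2 \<le> nrm (F \<alpha>)} \<union> {\<alpha> \<in> mexp W. mdeg W \<alpha> \<le> N}"
    let ?B = "\<Union>\<alpha>\<in>?A. (\<lambda>\<beta>. case_sum \<beta> \<alpha>) ` {\<beta>. \<epsilon> \<le> weight 1 V (t \<alpha>) \<beta>}"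
    have "finite ?B"
      using Ffin[of "\<epsilon> / 2"] finite_mdeg_le[OF W] \<epsilon> tT
      by (intro finite_UN_I finite_imageI decaying_finite[of _ 1 V]) (auto simp: carrier_convergent)
    moreover have "{\<mu>. \<epsilon> \<le> absv (f \<mu>)} \<subseteq> ?B"
    proof
      fix \<mu> assume "\<mu> \<in> {\<mu>. \<epsilon> \<le> absv (f \<mu>)}"
      then have w: "\<epsilon> \<le> absv (t (\<mu> \<circ> Inr) (\<mu> \<circ> Inl))" by (simp add: f_def)
      let ?\<alpha> = "\<mu> \<circ> Inr"
      have \<alpha>: "?\<alpha> \<in> mexp W"
      proof (rule ccontr)
        assume "?\<alpha> \<notin> mexp W" then show False using w \<epsilon> by (simp add: t_def T_ops ps_zero)
      qed
      have "\<epsilon> \<le> gauss_norm absv V (t ?\<alpha>)" using w gauss_norm_bounds(1)[OF tT] order_trans by blast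
      also have "\<dots> < nrm (F ?\<alpha>) + 1 / (1 + real (mdeg W ?\<alpha>))" using t'(3) \<alpha> by (simp add: t_def)
      finally have lt: "\<epsilon> < nrm (F ?\<alpha>) + 1 / (1 + real (mdeg W ?\<alpha>))" .
      have "?\<alpha> \<in> ?A"
      proof (rule ccontr)
        assume "?\<alpha> \<notin> ?A"
        then have "nrm (F ?\<alpha>) < \<epsilon> / 2" "N < mdeg W ?\<alpha>" using \<alpha> by auto
        then have "1 / \<epsilon> * 2 < 1 + real (mdeg W ?\<alpha>)" using N by linarith
        then have "1 / (1 + real (mdeg W ?\<alpha>)) < \<epsilon> / 2" using \<epsilon> by (simp add: field_simps)
        then show False using lt \<open>nrm (F ?\<alpha>) < \<epsilon> / 2\<close> by simp
      qed
      moreover have "\<mu> \<in> (\<lambda>\<beta>. case_sum \<beta> ?\<alpha>) ` {\<beta>. \<epsilon> \<le> weight 1 V (t ?\<alpha>) \<beta>}"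
        using w sum_split[of \<mu>] by (intro image_eqI[of _ _ "\<mu> \<circ> Inl"]) auto
      ultimately show "\<mu> \<in> ?B" by blast
    qed
    ultimately show ?thesis by (rule finite_subset[rotated])
  qed
  ultimately have "f \<in> carrier (convergent_series R absv (Sum_Type.Plus V W))"
    by (simp add: carrier_convergent decaying_def)
  moreover have "theta f = F" by (auto simp: theta_def sl tF)
  ultimately show ?thesis using that by blast
qed

text \<open>The ring structure on the convergent series over \<open>A\<close> is obtained from this
  description, as the image of a ring homomorphism.\<close>

lemma convergent_A_eq:
  assumes W: "finite W"
  shows "convergent_series A nrm W = (power_series A W)
    \<lparr>carrier := theta ` carrier (convergent_series R absv (Sum_Type.Plus V W))\<rparr>"
proof -
  have "carrier (convergent_series A nrm W) = theta ` carrier (convergent_series R absv (Sum_Type.Plus V W))"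
    using theta_convergent theta_surj[OF W] by blast
  then show ?thesis by (simp add: convergent_series_def)
qed

lemma convergent_A_cring:
  assumes W: "finite W"
  shows "cring (convergent_series A nrm W)"
proof -
  interpret A: cring A by (rule A_cring)
  interpret h: ring_hom_cring "convergent_series R absv (Sum_Type.Plus V W)" "power_series A W" theta
    using W by (intro cring_hom convergent_cring A.ps_cring theta_hom_ps) auto
  show ?thesis unfolding convergent_A_eq[OF W]
    using h.ring.img_is_cring[OF h.S.cring_axioms] by simp
qed

lemma theta_hom:
  assumes W: "finite W"
  shows "theta \<in> ring_hom (convergent_series R absv (Sum_Type.Plus V W)) (convergent_series A nrm W)"
proof -
  have "theta \<in> ring_hom (convergent_series R absv (Sum_Type.Plus V W)) (power_series A W)"
    by (rule theta_hom_ps[OF W])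
  then show ?thesis
    by (auto simp: ring_hom_def convergent_A_eq[OF W])
qed

end

section \<open>The simplicial rings\<close>

text \<open>The operation \<open>a_inv\<close> depends on the carrier, so negation in a subring has
  to be identified with negation in the ambient ring; the same holds for \<open>finsum\<close> in
  the next lemma.\<close>

lemma sub_a_inv:
  assumes S: "cring S" and H: "cring (S\<lparr>carrier := H\<rparr>)" "H \<subseteq> carrier S" and x: "x \<in> H"
  shows "\<ominus>\<^bsub>S\<lparr>carrier := H\<rparr>\<^esub> x = \<ominus>\<^bsub>S\<^esub> x"
proof -
  interpret S: cring S by fact
  interpret H: cring "S\<lparr>carrier := H\<rparr>" by fact
  let ?y = "\<ominus>\<^bsub>S\<lparr>carrier := H\<rparr>\<^esub> x"
  have "?y \<in> H" using H.a_inv_closed[of x] x by simp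
  moreover have "?y \<oplus>\<^bsub>S\<^esub> x = \<zero>\<^bsub>S\<^esub>" using H.l_neg[of x] x by simp
  ultimately show ?thesis using S.minus_equality[of ?y x] H(2) x by (metis subsetD)
qed

lemma sub_finsum:
  assumes S: "cring S" and H: "cring (S\<lparr>carrier := H\<rparr>)" "H \<subseteq> carrier S"
    and f: "finite B" "\<And>b. b \<in> B \<Longrightarrow> f b \<in> H"
  shows "(\<Oplus>\<^bsub>S\<lparr>carrier := H\<rparr>\<^esub>b\<in>B. f b) = (\<Oplus>\<^bsub>S\<^esub>b\<in>B. f b)"
proof -
  interpret S: cring S by fact
  interpret H: cring "S\<lparr>carrier := H\<rparr>" by fact
  show ?thesis using f
  proof (induction B rule: finite_induct)
    case (insert x B)
    then have "(\<Oplus>\<^bsub>S\<lparr>carrier := H\<rparr>\<^esub>b\<in>insert x B. f b) = f x \<oplus>\<^bsub>S\<^esub> (\<Oplus>\<^bsub>S\<lparr>carrier := H\<rparr>\<^esub>b\<in>B. f b)"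
      by (subst H.finsum_insert) auto
    moreover have "(\<Oplus>\<^bsub>S\<^esub>b\<in>insert x B. f b) = f x \<oplus>\<^bsub>S\<^esub> (\<Oplus>\<^bsub>S\<^esub>b\<in>B. f b)"
      using insert H(2) by (intro S.finsum_insert) auto
    ultimately show ?case using insert by simp
  qed simp
qed

text \<open>Computed in the full power series ring, this element is the same for the convergent and
  the overconvergent series. The parameter \<open>S\<close> lets it stand for the relation among the
  simplex coordinates when further variables are present.\<close>

definition simplex_equation :: "('b, 'c) ring_scheme \<Rightarrow> 'w set \<Rightarrow> 'w set \<Rightarrow> ('w \<Rightarrow> nat) \<Rightarrow> 'b"
  where "simplex_equation B W S = linear_form B S \<ominus>\<^bsub>power_series B W\<^esub> \<one>\<^bsub>power_series B W\<^esub>"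

lemma (in cring) simplex_relation_eq:
  assumes W: "W = {..q :: nat}" and H: "cring (power_series R W\<lparr>carrier := H\<rparr>)" "H \<subseteq> carrier (power_series R W)"
    and v: "\<And>i. i \<le> q \<Longrightarrow> variable R i \<in> H"
  shows "simplex_relation (power_series R W\<lparr>carrier := H\<rparr>) R q = simplex_equation R W W"
proof -
  interpret H: cring "power_series R W\<lparr>carrier := H\<rparr>" by fact
  have fW: "finite W" by (simp add: W)
  note P = ps_cring[OF fW]
  have "\<one>\<^bsub>power_series R W\<^esub> \<in> H" using H.one_closed by simp
  moreover have "(\<Oplus>\<^bsub>power_series R W\<lparr>carrier := H\<rparr>\<^esub>i\<in>W. variable R i) = linear_form R W"
    using sub_finsum[OF P H fW, of "variable R"] finsum_variable_ps[OF fW] v W by auto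
  ultimately show ?thesis
    using sub_a_inv[OF P H]
    by (simp add: simplex_relation_def simplex_equation_def a_minus_def W)
qed

lemma (in cring) simplex_equation_coeff:
  assumes "finite W" "S \<subseteq> W"
  shows "simplex_equation R W S \<in> carrier (power_series R W)"
    "simplex_equation R W S \<mu> = linear_form R S \<mu> \<ominus> (if \<mu> = 0 then \<one> else \<zero>)"
proof -
  interpret P: cring "power_series R W" using assms by (intro ps_cring)
  show "simplex_equation R W S \<in> carrier (power_series R W)"
    using assms by (auto simp: simplex_equation_def intro!: P.minus_closed linear_form_closed)
  show "simplex_equation R W S \<mu> = linear_form R S \<mu> \<ominus> (if \<mu> = 0 then \<one> else \<zero>)"
  proof -
    have "simplex_equation R W S \<mu> = (linear_form R S \<oplus>\<^bsub>power_series R W\<^esub> \<ominus>\<^bsub>power_series R W\<^esub> \<one>\<^bsub>power_series R W\<^esub>) \<mu>"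
      unfolding simplex_equation_def a_minus_def ..
    also have "\<dots> = linear_form R S \<mu> \<oplus> (\<ominus>\<^bsub>power_series R W\<^esub> \<one>\<^bsub>power_series R W\<^esub>) \<mu>"
      by (rule fun_cong[OF ps_add])
    also have "(\<ominus>\<^bsub>power_series R W\<^esub> \<one>\<^bsub>power_series R W\<^esub>) \<mu> = \<ominus> \<one>\<^bsub>power_series R W\<^esub> \<mu>"
      by (rule fun_cong[OF ps_a_inv[OF assms(1) P.one_closed]])
    also have "\<one>\<^bsub>power_series R W\<^esub> \<mu> = (if \<mu> = 0 then \<one> else \<zero>)"
      by (rule fun_cong[OF ps_one])
    finally show ?thesis unfolding a_minus_def .
  qed
qed

lemma (in cring) pull_simplex_equation:
  assumes V: "finite V" and W: "finite W" and U: "U \<subseteq> W" and \<phi>: "\<phi> ` U \<subseteq> V" and S: "S \<subseteq> V"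
  shows "pull R \<phi> U (simplex_equation R V S) = simplex_equation R W {w \<in> U. \<phi> w \<in> S}"
proof -
  interpret P: cring "power_series R V" using V by (rule ps_cring)
  interpret Q: cring "power_series R W" using W by (rule ps_cring)
  interpret h: ring_hom_cring "power_series R V" "power_series R W" "pull R \<phi> U"
    using pull_hom[OF V W U \<phi>] P.cring_axioms Q.cring_axioms by (intro cring_hom)
  show ?thesis
    using linear_form_closed[OF S] pull_linear_form[OF V W U \<phi> S]
    by (simp add: simplex_equation_def a_minus_def)
qed

lemma (in cring) cring_principal_ideal:
  assumes "a \<in> carrier R" "x \<in> Idl {a}"
  obtains k where "k \<in> carrier R" "x = k \<otimes> a"
  using assms cgenideal_eq_genideal[OF assms(1)] by (auto simp: cgenideal_def)

lemma ideal_vimage_cring: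
  assumes "cring S" "cring T" "h \<in> ring_hom S T" "ideal K T"
  shows "ideal {x \<in> carrier S. h x \<in> K} S"
proof -
  interpret h: ring_hom_cring S T h using assms by (intro cring_hom)
  show ?thesis using h.ring.ideal_vimage[OF assms(4)] .
qed

lemma ring_hom_sub:
  assumes "h \<in> ring_hom S T" "H \<subseteq> carrier S" "h ` H \<subseteq> H'"
  shows "h \<in> ring_hom (S\<lparr>carrier := H\<rparr>) (T\<lparr>carrier := H'\<rparr>)"
  using assms by (auto simp: ring_hom_def subset_iff)

lemma dagger_series_carrier_update:
  "dagger_series B nrm W = power_series B W\<lparr>carrier := carrier (dagger_series B nrm W)\<rparr>"
  by (simp add: dagger_series_def)

section \<open>Substitutions between the series rings of the simplicial levels\<close>

context dagger_presentation
begin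

abbreviation "vars q \<equiv> Sum_Type.Plus V {..q :: nat}"
abbreviation "S q \<equiv> convergent_series R absv (vars q)"
abbreviation "Sd q \<equiv> dagger_series R absv (vars q)"
abbreviation "P q \<equiv> power_series R (vars q)"
abbreviation "C q \<equiv> convergent_series A nrm {..q :: nat}"
abbreviation "L q \<equiv> coproduct_ideal R absv V I {..q :: nat} (standard_simplex_ideal R absv q)"
abbreviation "M q \<equiv> banach_simplex_ideal A nrm q"
abbreviation "eqn q \<equiv> simplex_equation R (vars q) (Inr ` {..q :: nat})"
abbreviation "inclL \<equiv> pull R (projl :: 'v + nat \<Rightarrow> 'v) (Inl ` V)"
abbreviation "inclR q \<equiv> pull R (projr :: 'v + nat \<Rightarrow> nat) (Inr ` {..q :: nat})"
abbreviation "lift \<phi> q \<equiv> pull R (map_sum id \<phi> :: 'v + nat \<Rightarrow> 'v + nat) (vars q)"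

lemma fvars: "finite (vars q)" by simp

lemma cP: "cring (P q)" by (simp add: ps_cring)
lemma cS: "cring (S q)" by (simp add: convergent_cring)
lemma cSd: "cring (Sd q)" by (simp add: dagger_cring)
lemma cC: "cring (C q)" by (simp add: convergent_A_cring)

lemma S_ops: "(\<otimes>\<^bsub>S q\<^esub>) = (\<otimes>\<^bsub>P q\<^esub>)" "(\<oplus>\<^bsub>S q\<^esub>) = (\<oplus>\<^bsub>P q\<^esub>)" "\<zero>\<^bsub>S q\<^esub> = \<zero>\<^bsub>P q\<^esub>" "\<one>\<^bsub>S q\<^esub> = \<one>\<^bsub>P q\<^esub>"
  by (simp_all add: convergent_series_def)

lemma Sd_ops: "(\<otimes>\<^bsub>Sd q\<^esub>) = (\<otimes>\<^bsub>P q\<^esub>)" "(\<oplus>\<^bsub>Sd q\<^esub>) = (\<oplus>\<^bsub>P q\<^esub>)" "\<zero>\<^bsub>Sd q\<^esub> = \<zero>\<^bsub>P q\<^esub>" "\<one>\<^bsub>Sd q\<^esub> = \<one>\<^bsub>P q\<^esub>"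
  by (simp_all add: dagger_series_def)

lemma S_P: "f \<in> carrier (S q) \<Longrightarrow> f \<in> carrier (P q)"
  by (simp add: carrier_convergent decaying_ps)

lemma Sd_S: "f \<in> carrier (Sd q) \<Longrightarrow> f \<in> carrier (S q)"
  using dagger_subset_convergent by blast

lemma S_eq: "P q\<lparr>carrier := carrier (S q)\<rparr> = S q"
  by (simp add: convergent_series_def)

lemma Sd_eq: "P q\<lparr>carrier := carrier (Sd q)\<rparr> = Sd q"
  by (simp add: dagger_series_def)

lemma S_a_inv:
  assumes "f \<in> carrier (S q)"
  shows "\<ominus>\<^bsub>S q\<^esub> f = \<ominus>\<^bsub>P q\<^esub> f"
proof -
  have "cring (P q\<lparr>carrier := carrier (S q)\<rparr>)" unfolding S_eq by (rule cS)
  moreover have "carrier (S q) \<subseteq> carrier (P q)" using S_P by (rule subsetI)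
  ultimately have "\<ominus>\<^bsub>P q\<lparr>carrier := carrier (S q)\<rparr>\<^esub> f = \<ominus>\<^bsub>P q\<^esub> f" using assms by (rule sub_a_inv[OF cP])
  then show ?thesis unfolding S_eq .
qed

lemma Sd_a_inv:
  assumes "f \<in> carrier (Sd q)"
  shows "\<ominus>\<^bsub>Sd q\<^esub> f = \<ominus>\<^bsub>P q\<^esub> f"
proof -
  have "cring (P q\<lparr>carrier := carrier (Sd q)\<rparr>)" unfolding Sd_eq by (rule cSd)
  moreover have "carrier (Sd q) \<subseteq> carrier (P q)" using S_P[OF Sd_S] by (rule subsetI)
  ultimately have "\<ominus>\<^bsub>P q\<lparr>carrier := carrier (Sd q)\<rparr>\<^esub> f = \<ominus>\<^bsub>P q\<^esub> f" using assms by (rule sub_a_inv[OF cP])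
  then show ?thesis unfolding Sd_eq .
qed

lemma pull_dagger_closed:
  assumes "finite Y" "finite W" "U \<subseteq> W" "\<phi> ` U \<subseteq> Y" "f \<in> carrier (dagger_series R absv Y)"
  shows "pull R \<phi> U f \<in> carrier (dagger_series R absv W)"
proof -
  from assms(5) obtain \<rho> where \<rho>: "\<rho> \<in> {1<..}" "f \<in> decaying \<rho> Y" unfolding carrier_dagger by (rule UN_E)
  have "0 \<le> \<rho>" using \<rho>(1) by simp
  then have "pull R \<phi> U f \<in> decaying \<rho> W" using \<rho>(2) by (rule pull_decaying[OF assms(1-4)])
  with \<rho>(1) show ?thesis unfolding carrier_dagger by (rule UN_I)
qed

lemma dagger_ps: "f \<in> carrier (dagger_series R absv W) \<Longrightarrow> f \<in> carrier (power_series R W)"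
  unfolding carrier_dagger by (erule UN_E) (rule decaying_ps)

lemma dagger_pull:
  assumes "finite Y" "finite W" "U \<subseteq> W" "\<phi> ` U \<subseteq> Y"
  shows "pull R \<phi> U \<in> ring_hom (dagger_series R absv Y) (dagger_series R absv W)"
  using dagger_ps pull_dagger_closed[OF assms]
  by (subst (1 2) dagger_series_carrier_update) (intro ring_hom_sub[OF pull_hom[OF assms]] subsetI image_subsetI)

lemma lift_dagger: "\<phi> ` {..q} \<subseteq> {..r} \<Longrightarrow> lift \<phi> q \<in> ring_hom (Sd r) (Sd q)"
  by (rule dagger_pull) auto

lemma lift_convergent:
  assumes "\<phi> ` {..q} \<subseteq> {..r}"
  shows "lift \<phi> q \<in> ring_hom (S r) (S q)"
proof -
  have *: "map_sum id \<phi> ` vars q \<subseteq> vars r" using assms by auto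
  show ?thesis
    unfolding convergent_eq using pull_hom[OF fvars fvars subset_refl *]
    by (rule ring_hom_sub) (use pull_decaying[OF fvars fvars subset_refl *, of 1] in \<open>auto intro: decaying_ps\<close>)
qed

lemma inclL_dagger: "inclL \<in> ring_hom (dagger_series R absv V) (Sd q)"
  by (rule dagger_pull) auto

lemma inclR_dagger: "inclR q \<in> ring_hom (dagger_series R absv {..q}) (Sd q)"
  by (rule dagger_pull) auto

lemma mexp_empty [simp]: "\<alpha> \<in> mexp {} \<longleftrightarrow> \<alpha> = 0"
  by (auto simp: mexp_def fun_eq_iff)

lemma Inl_image: "Inl ` B = Sum_Type.Plus B {}"
  by auto

lemma slice_inclL:
  assumes f: "f \<in> carrier (power_series R V)"
  shows "slice (inclL f) \<alpha> = (if \<alpha> = 0 then f else (\<lambda>_. \<zero>))"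
proof
  fix \<beta>
  have U: "case_sum \<beta> \<alpha> \<in> mexp (Inl ` V) \<longleftrightarrow> \<beta> \<in> mexp V \<and> \<alpha> = 0"
    unfolding Inl_image by simp
  have p: "push projl (Inl ` V) (case_sum \<beta> \<alpha>) = \<beta>" if "\<beta> \<in> mexp V"
  proof
    fix v
    have "{w. w \<in> Inl ` V \<and> projl w = v} = (if v \<in> V then {Inl v :: 'v + nat} else {})" by auto
    then show "push projl (Inl ` V) (case_sum \<beta> \<alpha>) v = \<beta> v" using that by (simp add: push_def mexp_def)
  qed
  have c: "mcoef (projl :: 'v + nat \<Rightarrow> 'v) (Inl ` V) \<mu> = 1" for \<mu>
    by (rule mcoef_inj) (auto simp: inj_on_def)
  show "slice (inclL f) \<alpha> \<beta> = (if \<alpha> = 0 then f else (\<lambda>_. \<zero>)) \<beta>"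
    using p U c f[THEN ps_coeff] ps_outside[OF f] by (auto simp: slice_def pull_def)
qed

text \<open>A simplicial map moves the simplex coordinates only, so the multinomial coefficient sees
  just \<alpha>, while \<beta> is carried along.\<close>

lemma slice_lift:
  assumes f: "\<And>\<mu>. f \<mu> \<in> carrier R" "\<And>\<mu>. \<mu> \<notin> mexp (vars r) \<Longrightarrow> f \<mu> = \<zero>"
  shows "slice (lift \<phi> q f) \<alpha> \<beta> =
    (if \<alpha> \<in> mexp {..q} then [mcoef \<phi> {..q} \<alpha>] \<cdot> slice f (push \<phi> {..q} \<alpha>) \<beta> else \<zero>)"
proof (cases "\<alpha> \<in> mexp {..q} \<and> \<beta> \<in> mexp V")
  case True
  let ?\<phi> = "map_sum id \<phi> :: 'v + nat \<Rightarrow> 'v + nat" and ?\<mu> = "case_sum \<beta> \<alpha>"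
  have p: "push ?\<phi> (vars q) ?\<mu> = case_sum \<beta> (push \<phi> {..q} \<alpha>)"
  proof
    fix x
    show "push ?\<phi> (vars q) ?\<mu> x = case_sum \<beta> (push \<phi> {..q} \<alpha>) x"
    proof (cases x)
      case (Inl v)
      have "{w. w \<in> vars q \<and> ?\<phi> w = Inl v} = (if v \<in> V then {Inl v} else {})"
        by auto
      then show ?thesis using True Inl by (simp add: push_def mexp_def)
    next
      case (Inr i)
      have "{w. w \<in> vars q \<and> ?\<phi> w = Inr i} = Inr ` {j \<in> {..q}. \<phi> j = i}"
        by (auto simp: Plus_def)
      then show ?thesis using Inr by (simp add: push_def sum.reindex)
    qed
  qed
  have im: "?\<phi> ` vars q = Sum_Type.Plus V (\<phi> ` {..q})" by (simp add: Plus_def image_Un image_image)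
  have "mcoef ?\<phi> (vars q) ?\<mu> = mcoef \<phi> {..q} \<alpha>"
  proof (rule mcoef_eqI[OF fvars])
    show "mcoef \<phi> {..q} \<alpha> * (\<Prod>w\<in>vars q. fact (?\<mu> w)) = (\<Prod>v\<in>?\<phi> ` vars q. fact (push ?\<phi> (vars q) ?\<mu> v))"
      unfolding im p using mcoef_spec[of "{..q}" \<phi> \<alpha>] by (simp add: prod.Plus mult.left_commute)
  qed
  then show ?thesis using True p by (simp add: slice_def pull_def)
next
  case False
  then show ?thesis using f(2) by (auto simp: slice_def pull_def)
qed

lemma slice_eqI:
  fixes f g :: "('v + 'w \<Rightarrow> nat) \<Rightarrow> 'z"
  assumes "\<And>\<alpha> \<beta>. slice f \<alpha> \<beta> = slice g \<alpha> \<beta>"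
  shows "f = g"
proof
  fix \<mu> :: "'v + 'w \<Rightarrow> nat"
  show "f \<mu> = g \<mu>" using assms[of "\<mu> \<circ> Inr" "\<mu> \<circ> Inl"] sum_split[of \<mu>] by (simp add: slice_def)
qed

lemma I_ps: "f \<in> I \<Longrightarrow> f \<in> carrier (power_series R V)"
  using I_T T_ps by blast

text \<open>Series in the variables of A alone are constant along the simplex, hence fixed by all
  simplicial maps.\<close>

lemma lift_inclL:
  assumes "f \<in> I" and \<phi>: "\<phi> ` {..q} \<subseteq> {..r}"
  shows "lift \<phi> q (inclL f) = (inclL f :: ('v + nat \<Rightarrow> nat) \<Rightarrow> 'a)"
proof (rule slice_eqI)
  fix \<alpha> \<beta>
  note fp = I_ps[OF assms(1)]
  have fc: "inclL f \<in> carrier (P r)" by (rule pull_closed[OF _ _ _ _ fp]) auto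
  have "push \<phi> {..q} \<alpha> = 0 \<longleftrightarrow> \<alpha> = 0" if "\<alpha> \<in> mexp {..q}"
    using push_eq_zero[of "{..q}" \<alpha> \<phi>] that by auto
  then have p: "\<alpha> \<in> mexp {..q} \<Longrightarrow> push \<phi> {..q} \<alpha> = 0 \<longleftrightarrow> \<alpha> = 0" .
  have l: "slice (lift \<phi> q (inclL f)) \<alpha> \<beta> = (if \<alpha> \<in> mexp {..q}
      then [mcoef \<phi> {..q} \<alpha>] \<cdot> slice (inclL f) (push \<phi> {..q} \<alpha>) \<beta> else \<zero>)"
    by (rule slice_lift[OF ps_coeff[OF fc] ps_outside[OF fc]])
  show "slice (lift \<phi> q (inclL f)) \<alpha> \<beta> = slice (inclL f) \<alpha> \<beta>"
  proof (cases "\<alpha> = 0")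
    case True
    then show ?thesis
      unfolding l slice_inclL[OF fp] using add.nat_pow_one ps_coeff[OF fp, of \<beta>] by simp
  next
    case False
    then show ?thesis
      unfolding l slice_inclL[OF fp] using p by simp
  qed
qed

text \<open>Naturality of \<open>theta\<close>: substitution multiplies slices by integers, and
  reduction modulo the ideal respects integer multiples.\<close>

lemma theta_pull:
  assumes f: "f \<in> carrier (S r)" and \<phi>: "\<phi> ` {..q} \<subseteq> {..r}"
  shows "theta (lift \<phi> q f) = pull A \<phi> {..q} (theta f)"
proof
  fix \<alpha>
  interpret T: cring T by (rule T_cring)
  interpret A: cring A by (rule A_cring)
  interpret q: ring_hom_cring T A "(+>\<^bsub>T\<^esub>) J" by (rule coset_hom)
  note fp = S_P[OF f]
  have pow: "[n] \<cdot>\<^bsub>T\<^esub> x = (\<lambda>\<beta>. [n] \<cdot> x \<beta>)" for n :: nat and x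
    by (induction n) (auto simp: T_ops ps_zero ps_add)
  have qpow: "J +>\<^bsub>T\<^esub> ([n] \<cdot>\<^bsub>T\<^esub> x) = [n] \<cdot>\<^bsub>A\<^esub> (J +>\<^bsub>T\<^esub> x)" if "x \<in> carrier T" for n :: nat and x
    using that by (induction n) auto
  show "theta (lift \<phi> q f) \<alpha> = pull A \<phi> {..q} (theta f) \<alpha>"
  proof (cases "\<alpha> \<in> mexp {..q}")
    case True
    then have "slice (lift \<phi> q f) \<alpha> = [mcoef \<phi> {..q} \<alpha>] \<cdot>\<^bsub>T\<^esub> slice f (push \<phi> {..q} \<alpha>)"
      by (auto simp: fun_eq_iff pow slice_lift[OF ps_coeff[OF fp] ps_outside[OF fp]])
    then show ?thesis using True qpow[OF slice_T[OF f]] by (simp add: theta_def pull_def)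
  next
    case False
    then have "slice (lift \<phi> q f) \<alpha> = \<zero>\<^bsub>T\<^esub>"
      by (auto simp: fun_eq_iff T_ops ps_zero slice_lift[OF ps_coeff[OF fp] ps_outside[OF fp]])
    then show ?thesis using False zero_A by (simp add: theta_def pull_def)
  qed
qed

lemma theta_linear_form:
  assumes "B \<subseteq> {..q :: nat}"
  shows "theta (linear_form R (Inr ` B)) = linear_form A B"
proof
  fix \<alpha> :: "nat \<Rightarrow> nat"
  interpret T: cring T by (rule T_cring)
  interpret A: cring A by (rule A_cring)
  interpret q: ring_hom_cring T A "(+>\<^bsub>T\<^esub>) J" by (rule coset_hom)
  have "slice (linear_form R (Inr ` B)) \<alpha> = (if \<exists>i\<in>B. \<alpha> = single i then \<one>\<^bsub>T\<^esub> else \<zero>\<^bsub>T\<^esub>)"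
    by (auto simp: fun_eq_iff[of "slice _ _"] slice_def linear_form_def case_sum_single T_ops ps_one ps_zero)
  then show "theta (linear_form R (Inr ` B)) \<alpha> = linear_form A B \<alpha>"
    using zero_A by (simp add: theta_def linear_form_def)
qed

end

text \<open>The elements of \<open>J\<close> model functions of norm less than 1, and \<open>Y q B\<close> the sum of the
  barycentric coordinates \<open>x\<^sub>i\<close>, \<open>i \<in> B\<close>, on the \<open>q\<close>-simplex.\<close>

locale simplicial_ball =
  fixes D :: "nat \<Rightarrow> 'd ring" and act :: "nat \<Rightarrow> nat \<Rightarrow> (nat \<Rightarrow> nat) \<Rightarrow> 'd \<Rightarrow> 'd"
    and Y :: "nat \<Rightarrow> nat set \<Rightarrow> 'd" and J :: "nat \<Rightarrow> 'd set"
  assumes D_cring: "cring (D q)"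
    and act_hom: "\<phi> ` {..q} \<subseteq> {..r} \<Longrightarrow> act q r \<phi> \<in> ring_hom (D r) (D q)"
    and act_act: "\<phi> ` {..q} \<subseteq> {..r} \<Longrightarrow> \<psi> ` {..r} \<subseteq> {..s} \<Longrightarrow> x \<in> carrier (D s)
      \<Longrightarrow> act q r \<phi> (act r s \<psi> x) = act q s (\<psi> \<circ> \<phi>) x"
    and act_id: "(\<And>j. j \<le> q \<Longrightarrow> \<phi> j = j) \<Longrightarrow> x \<in> carrier (D q) \<Longrightarrow> act q q \<phi> x = x"
    and act_cong: "(\<And>j. j \<le> q \<Longrightarrow> \<phi> j = \<psi> j) \<Longrightarrow> \<phi> ` {..q} \<subseteq> {..r} \<Longrightarrow> x \<in> carrier (D r)
      \<Longrightarrow> act q r \<phi> x = act q r \<psi> x"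
    and Y_closed: "B \<subseteq> {..q} \<Longrightarrow> Y q B \<in> carrier (D q)"
    and Y_all: "Y q {..q} = \<one>\<^bsub>D q\<^esub>" and Y_empty: "Y q {} = \<zero>\<^bsub>D q\<^esub>"
    and act_Y: "\<phi> ` {..q} \<subseteq> {..r} \<Longrightarrow> B \<subseteq> {..r} \<Longrightarrow> act q r \<phi> (Y r B) = Y q {j \<in> {..q}. \<phi> j \<in> B}"
    and J_subset: "J q \<subseteq> carrier (D q)" and J_zero: "\<zero>\<^bsub>D q\<^esub> \<in> J q"
    and J_add: "x \<in> J q \<Longrightarrow> y \<in> J q \<Longrightarrow> x \<oplus>\<^bsub>D q\<^esub> y \<in> J q"
    and J_uminus: "x \<in> J q \<Longrightarrow> \<ominus>\<^bsub>D q\<^esub> x \<in> J q"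
    and J_mult: "x \<in> J q \<Longrightarrow> y \<in> J q \<Longrightarrow> x \<otimes>\<^bsub>D q\<^esub> y \<in> J q"
    and J_Y: "B \<subseteq> {..q} \<Longrightarrow> x \<in> J q \<Longrightarrow> Y q B \<otimes>\<^bsub>D q\<^esub> x \<in> J q"
    and J_act: "\<phi> ` {..q} \<subseteq> {..r} \<Longrightarrow> x \<in> J r \<Longrightarrow> act q r \<phi> x \<in> J q"
    and J_quasi: "x \<in> J q \<Longrightarrow> \<exists>y\<in>J q. x \<oplus>\<^bsub>D q\<^esub> y \<oplus>\<^bsub>D q\<^esub> x \<otimes>\<^bsub>D q\<^esub> y = \<zero>\<^bsub>D q\<^esub>"

lemma quot_map_cong: "(\<And>x. x \<in> B \<Longrightarrow> h x = h' x) \<Longrightarrow> quot_map S J h B = quot_map S J h' B"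
  by (simp add: quot_map_def cong: image_cong)

section \<open>The relations, the quotients and the comparison map\<close>

context dagger_presentation
begin

lemma linear_form_Sd: "B \<subseteq> {..q} \<Longrightarrow> linear_form R (Inr ` B) \<in> carrier (Sd q)"
  unfolding carrier_dagger using linear_form_decaying[OF fvars, of "Inr ` B" q 2] by (intro UN_I[of 2]) auto

lemma linear_form_S: "B \<subseteq> {..q} \<Longrightarrow> linear_form R (Inr ` B) \<in> carrier (S q)"
  using linear_form_Sd Sd_S by blast

lemma theta_C: "f \<in> carrier (S q) \<Longrightarrow> theta f \<in> carrier (C q)"
  by (rule theta_convergent)

lemma C_cases:
  assumes "x \<in> carrier (C q)"
  obtains f where "f \<in> carrier (S q)" "x = theta f"
  using theta_surj[OF finite_atMost assms] by metis

lemma C_eq: "power_series A {..q}\<lparr>carrier := carrier (C q)\<rparr> = C q"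
  by (simp add: convergent_series_def)

lemma C_ps: "carrier (C q) \<subseteq> carrier (power_series A {..q})"
  by (auto simp: carrier_convergent_A)

lemma simplex_relation_dagger:
  "simplex_relation (dagger_series R absv {..q}) R q = simplex_equation R {..q} {..q}"
proof -
  have v: "variable R i \<in> carrier (dagger_series R absv {..q})" if "i \<le> q" for i
    unfolding carrier_dagger variable_eq using that
    by (intro UN_I[of 2] linear_form_decaying) auto
  have c: "cring (power_series R {..q}\<lparr>carrier := carrier (dagger_series R absv {..q})\<rparr>)"
    unfolding dagger_series_carrier_update[symmetric] by (rule dagger_cring) simp
  show ?thesis
    using simplex_relation_eq[OF refl c subsetI[OF dagger_ps] v]
    unfolding dagger_series_carrier_update[symmetric] .
qed

lemma simplex_relation_C: "simplex_relation (C q) A q = simplex_equation A {..q} {..q}"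
proof -
  interpret A: cring A by (rule A_cring)
  have "variable A i \<in> carrier (C q)" if "i \<le> q" for i
    using theta_linear_form[of "{i}" q] theta_C[OF linear_form_S[of "{i}" q]] that by (simp add: variable_eq)
  then show ?thesis
    using A.simplex_relation_eq[OF refl _ C_ps, of q] cC[of q] unfolding C_eq by blast
qed

lemma eqn_Sd: "eqn q \<in> carrier (Sd q)"
proof -
  interpret Sd: cring "Sd q" by (rule cSd)
  have "linear_form R (Inr ` {..q}) \<ominus>\<^bsub>Sd q\<^esub> \<one>\<^bsub>Sd q\<^esub> \<in> carrier (Sd q)"
    using linear_form_Sd[of "{..q}" q] by (intro Sd.minus_closed) auto
  then show ?thesis
    using Sd_a_inv[OF Sd.one_closed] by (simp add: a_minus_def simplex_equation_def Sd_ops)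
qed

lemma theta_eqn: "theta (eqn q) = simplex_equation A {..q} {..q}"
proof -
  interpret A: cring A by (rule A_cring)
  interpret S: cring "S q" by (rule cS)
  interpret PA: cring "power_series A {..q}" by (rule A.ps_cring) simp
  interpret h: ring_hom_cring "S q" "power_series A {..q}" theta
    by (rule cring_hom[OF cS PA.cring_axioms theta_hom_ps]) simp
  have l: "linear_form R (Inr ` {..q}) \<in> carrier (S q)" by (rule linear_form_S) simp
  have "eqn q = linear_form R (Inr ` {..q}) \<oplus>\<^bsub>S q\<^esub> \<ominus>\<^bsub>S q\<^esub> \<one>\<^bsub>S q\<^esub>"
    using S_a_inv[OF S.one_closed] by (simp add: a_minus_def simplex_equation_def S_ops)
  then show ?thesis
    using l h.hom_add[OF l, of "\<ominus>\<^bsub>S q\<^esub> \<one>\<^bsub>S q\<^esub>"] theta_linear_form[of "{..q}" q]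
    by (simp add: simplex_equation_def a_minus_def)
qed

lemma inclR_eqn: "inclR q (simplex_equation R {..q} {..q}) = eqn q"
proof -
  have *: "{w \<in> Inr ` {..q}. projr w \<in> {..q}} = (Inr ` {..q} :: ('v + nat) set)" by auto
  have "inclR q (simplex_equation R {..q} {..q})
      = simplex_equation R (vars q) {w \<in> Inr ` {..q}. projr w \<in> {..q}}"
    by (rule pull_simplex_equation) auto
  then show ?thesis unfolding * .
qed

lemma lift_eqn:
  assumes "\<phi> ` {..q} \<subseteq> {..r}"
  shows "lift \<phi> q (eqn r) = eqn q"
proof -
  have *: "{w \<in> vars q. map_sum id \<phi> w \<in> Inr ` {..r}} = (Inr ` {..q} :: ('v + nat) set)" using assms by auto
  have "lift \<phi> q (eqn r) = simplex_equation R (vars q) {w \<in> vars q. map_sum id \<phi> w \<in> Inr ` {..r}}"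
    using assms by (intro pull_simplex_equation) auto
  then show ?thesis unfolding * .
qed

lemma pull_A_eqn:
  fixes \<phi> :: "nat \<Rightarrow> nat"
  assumes "\<phi> ` {..q} \<subseteq> {..r}"
  shows "pull A \<phi> {..q} (simplex_equation A {..r} {..r}) = simplex_equation A {..q} {..q}"
proof -
  interpret A: cring A by (rule A_cring)
  have *: "{w \<in> {..q}. \<phi> w \<in> {..r}} = {..q}" using assms by auto
  have "pull A \<phi> {..q} (simplex_equation A {..r} {..r}) = simplex_equation A {..q} {w \<in> {..q}. \<phi> w \<in> {..r}}"
    using assms by (intro A.pull_simplex_equation) auto
  then show ?thesis unfolding * .
qed

lemma standard_simplex_ideal_eq:
  "standard_simplex_ideal R absv q = Idl\<^bsub>dagger_series R absv {..q}\<^esub> {simplex_equation R {..q} {..q}}"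
  by (simp add: standard_simplex_ideal_def simplex_relation_dagger)

lemma relation_dagger_closed: "simplex_equation R {..q :: nat} {..q} \<in> carrier (dagger_series R absv {..q})"
proof -
  have "decaying 2 {..q} \<subseteq> carrier (dagger_series R absv {..q})" unfolding carrier_dagger by (auto intro!: bexI[of _ 2])
  moreover have "simplex_equation R {..q} {..q} \<in> decaying 2 {..q}"
    unfolding simplex_equation_def a_minus_def
    by (intro decaying_add decaying_uminus one_decaying linear_form_decaying) auto
  ultimately show ?thesis by blast
qed

lemma standard_simplex_ideal_ideal: "ideal (standard_simplex_ideal R absv q) (dagger_series R absv {..q})"
proof -
  interpret W: cring "dagger_series R absv {..q}" by (rule dagger_cring) simp
  show ?thesis unfolding standard_simplex_ideal_eq using relation_dagger_closed by (intro W.genideal_ideal) auto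
qed

lemma L_eq: "L q = Idl\<^bsub>Sd q\<^esub> (inclL ` I \<union> inclR q ` standard_simplex_ideal R absv q)"
proof -
  interpret K: ideal "standard_simplex_ideal R absv q" "dagger_series R absv {..q}" by (rule standard_simplex_ideal_ideal)
  have 1: "linear_subst R V (vars q) (\<lambda>v. variable R (Inl v)) f = inclL f" if "f \<in> I" for f
  proof (rule linear_subst_eq_pull)
    fix v assume "v \<in> V"
    then have "{w \<in> Inl ` V. projl w = v} = {Inl v :: 'v + nat}" by auto
    then show "variable R (Inl v :: 'v + nat) = linear_form R {w \<in> Inl ` V. projl w = v}" by (simp add: variable_eq)
  qed (auto intro: I_ps[OF that])
  have 2: "linear_subst R {..q} (vars q) (\<lambda>v. variable R (Inr v)) f = inclR q f"
    if "f \<in> standard_simplex_ideal R absv q" for f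
  proof (rule linear_subst_eq_pull)
    fix v assume "v \<in> {..q}"
    then have "{w \<in> Inr ` {..q}. projr w = v} = {Inr v :: 'v + nat}" by auto
    then show "variable R (Inr v :: 'v + nat) = linear_form R {w \<in> Inr ` {..q}. projr w = v}" by (simp add: variable_eq)
  qed (use dagger_ps[OF K.a_Hcarr[OF that]] in auto)
  show ?thesis
    unfolding coproduct_ideal_def using 1 2 by (simp cong: image_cong)
qed

lemma L_generators: "inclL ` I \<union> inclR q ` standard_simplex_ideal R absv q \<subseteq> carrier (Sd q)"
proof -
  interpret I: ideal I "dagger_series R absv V" by (rule I)
  interpret K: ideal "standard_simplex_ideal R absv q" "dagger_series R absv {..q}" by (rule standard_simplex_ideal_ideal)
  show ?thesis
    using ring_hom_memE(1)[OF inclL_dagger] ring_hom_memE(1)[OF inclR_dagger] I.a_Hcarr K.a_Hcarr by blast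
qed

lemma L_ideal: "ideal (L q) (Sd q)"
proof -
  interpret Sd: cring "Sd q" by (rule cSd)
  show ?thesis unfolding L_eq by (rule Sd.genideal_ideal[OF L_generators])
qed

lemma inclL_L: "f \<in> I \<Longrightarrow> inclL f \<in> L q"
proof -
  interpret Sd: cring "Sd q" by (rule cSd)
  show "f \<in> I \<Longrightarrow> inclL f \<in> L q" using Sd.genideal_self[OF L_generators] unfolding L_eq by blast
qed

lemma eqn_L: "eqn q \<in> L q"
proof -
  interpret Sd: cring "Sd q" by (rule cSd)
  interpret W: cring "dagger_series R absv {..q}" by (rule dagger_cring) simp
  have "simplex_equation R {..q} {..q} \<in> standard_simplex_ideal R absv q"
    unfolding standard_simplex_ideal_eq using W.genideal_self relation_dagger_closed by blast
  then have "inclR q (simplex_equation R {..q} {..q}) \<in> L q"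
    using Sd.genideal_self[OF L_generators] unfolding L_eq by blast
  then show ?thesis unfolding inclR_eqn .
qed

text \<open>Allows inclusions of \<open>L q\<close> to be tested on \<open>I\<close> and on one
  equation: the preimage of \<open>K\<close> under \<open>inclR q\<close> is an ideal, so with the
  equation it contains the whole ideal of the standard simplex.\<close>

lemma L_minimal:
  assumes K: "ideal K (Sd q)" and gens: "inclL ` I \<subseteq> K" "eqn q \<in> K"
  shows "L q \<subseteq> K"
proof -
  interpret Sd: cring "Sd q" by (rule cSd)
  interpret W: cring "dagger_series R absv {..q}" by (rule dagger_cring) simp
  have "ideal {g \<in> carrier (dagger_series R absv {..q}). inclR q g \<in> K} (dagger_series R absv {..q})"
    by (rule ideal_vimage_cring[OF W.cring_axioms cSd inclR_dagger K])
  then have "standard_simplex_ideal R absv q \<subseteq> {g \<in> carrier (dagger_series R absv {..q}). inclR q g \<in> K}"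
    unfolding standard_simplex_ideal_eq
    using relation_dagger_closed gens(2) inclR_eqn by (intro W.genideal_minimal) auto
  then show ?thesis unfolding L_eq using gens(1) by (intro Sd.genideal_minimal K) auto
qed

lemma M_eq: "M q = Idl\<^bsub>C q\<^esub> {theta (eqn q)}"
  by (simp add: banach_simplex_ideal_def simplex_relation_C theta_eqn)

lemma theta_eqn_C: "theta (eqn q) \<in> carrier (C q)"
  by (rule theta_C[OF Sd_S[OF eqn_Sd]])

lemma M_ideal: "ideal (M q) (C q)"
proof -
  interpret C: cring "C q" by (rule cC)
  show ?thesis unfolding M_eq using theta_eqn_C by (intro C.genideal_ideal) auto
qed

lemma theta_ring_hom: "theta \<in> ring_hom (S q) (C q)"
  by (rule theta_hom) simp

lemma theta_Sd: "theta \<in> ring_hom (Sd q) (C q)"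
proof -
  note h = ring_hom_memE[OF theta_ring_hom[of q]]
  show ?thesis
  proof (rule ring_hom_memI)
    fix x assume x: "x \<in> carrier (Sd q)"
    show "theta x \<in> carrier (C q)" using h(1)[OF Sd_S[OF x]] .
    fix y assume y: "y \<in> carrier (Sd q)"
    show "theta (x \<otimes>\<^bsub>Sd q\<^esub> y) = theta x \<otimes>\<^bsub>C q\<^esub> theta y" "theta (x \<oplus>\<^bsub>Sd q\<^esub> y) = theta x \<oplus>\<^bsub>C q\<^esub> theta y"
      using h(2,3)[OF Sd_S[OF x] Sd_S[OF y]] by (simp_all add: S_ops Sd_ops)
  qed (use h(4) in \<open>simp add: S_ops Sd_ops\<close>)
qed

lemma I_J: "I \<subseteq> J"
  unfolding completion_ideal_def
  using cring.axioms(1)[OF T_cring] I_T by (rule ring.genideal_self)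

lemma coset_J: "t \<in> carrier T \<Longrightarrow> J +>\<^bsub>T\<^esub> t = \<zero>\<^bsub>A\<^esub> \<longleftrightarrow> t \<in> J"
proof -
  interpret T: cring T by (rule T_cring)
  interpret J: ideal J T by (rule J_ideal)
  assume t: "t \<in> carrier T"
  show ?thesis
    using J.coset_eq_iff[OF t T.zero_closed] zero_A t by (simp add: a_minus_def)
qed

lemma C_zero: "\<zero>\<^bsub>C q\<^esub> = (\<lambda>_. \<zero>\<^bsub>A\<^esub>)"
proof -
  interpret A: cring A by (rule A_cring)
  show ?thesis by (simp add: convergent_series_def A.ps_zero)
qed

lemma theta_zero_iff: "f \<in> carrier (S q) \<Longrightarrow> theta f = \<zero>\<^bsub>C q\<^esub> \<longleftrightarrow> (\<forall>\<alpha>. slice f \<alpha> \<in> J)"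
  by (simp add: C_zero theta_def fun_eq_iff[of "\<lambda>\<alpha>. J +>\<^bsub>T\<^esub> slice f \<alpha>"] coset_J slice_T)

text \<open>Checked on generators: members of \<open>I\<close> have all slices in the completed
  ideal and become zero, and the equation goes to the generator of \<open>M q\<close>.\<close>

lemma theta_L: "theta ` L q \<subseteq> M q"
proof -
  interpret C: cring "C q" by (rule cC)
  interpret M: ideal "M q" "C q" by (rule M_ideal)
  interpret T: cring T by (rule T_cring)
  interpret J: ideal J T by (rule J_ideal)
  have "L q \<subseteq> {f \<in> carrier (Sd q). theta f \<in> M q}"
  proof (rule L_minimal)
    show "ideal {f \<in> carrier (Sd q). theta f \<in> M q} (Sd q)"
      by (rule ideal_vimage_cring[OF cSd cC theta_Sd M_ideal])
    show "inclL ` I \<subseteq> {f \<in> carrier (Sd q). theta f \<in> M q}"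
    proof
      fix x assume "x \<in> inclL ` I"
      then obtain f where f: "f \<in> I" "x = inclL f" by blast
      have x: "x \<in> carrier (Sd q)" using L_generators f by blast
      have "slice x \<alpha> \<in> J" for \<alpha>
        using I_J f J.zero_closed by (auto simp: slice_inclL[OF I_ps] T_ops ps_zero)
      then have "theta x = \<zero>\<^bsub>C q\<^esub>" using theta_zero_iff[OF Sd_S[OF x]] by simp
      then show "x \<in> {f \<in> carrier (Sd q). theta f \<in> M q}" using x M.zero_closed by simp
    qed
    show "eqn q \<in> {f \<in> carrier (Sd q). theta f \<in> M q}"
      using eqn_Sd C.genideal_self[of "{theta (eqn q)}"] theta_eqn_C unfolding M_eq by auto
  qed
  then show ?thesis by auto
qed

lemma lift_L:
  assumes \<phi>: "\<phi> ` {..q} \<subseteq> {..r}"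
  shows "lift \<phi> q ` L r \<subseteq> L q"
proof -
  have "L r \<subseteq> {f \<in> carrier (Sd r). lift \<phi> q f \<in> L q}"
  proof (rule L_minimal)
    show "ideal {f \<in> carrier (Sd r). lift \<phi> q f \<in> L q} (Sd r)"
      by (rule ideal_vimage_cring[OF cSd cSd lift_dagger[OF \<phi>] L_ideal])
    show "inclL ` I \<subseteq> {f \<in> carrier (Sd r). lift \<phi> q f \<in> L q}"
      using L_generators lift_inclL[OF _ \<phi>] inclL_L by auto
    show "eqn r \<in> {f \<in> carrier (Sd r). lift \<phi> q f \<in> L q}"
      using eqn_Sd lift_eqn[OF \<phi>] eqn_L by simp
  qed
  then show ?thesis by auto
qed

lemma pull_A_hom:
  assumes \<phi>: "\<phi> ` {..q} \<subseteq> {..r}"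
  shows "pull A \<phi> {..q} \<in> ring_hom (C r) (C q)"
proof -
  interpret A: cring A by (rule A_cring)
  have "pull A \<phi> {..q} ` carrier (C r) \<subseteq> carrier (C q)"
  proof
    fix x assume "x \<in> pull A \<phi> {..q} ` carrier (C r)"
    then obtain y where y: "y \<in> carrier (C r)" "x = pull A \<phi> {..q} y" by blast
    obtain f where f: "f \<in> carrier (S r)" "y = theta f" using C_cases[OF y(1)] .
    have "x = theta (lift \<phi> q f)" using theta_pull[OF f(1) \<phi>] y f by simp
    then show "x \<in> carrier (C q)" using theta_C ring_hom_memE(1)[OF lift_convergent[OF \<phi>] f(1)] by simp
  qed
  then have "pull A \<phi> {..q} \<in> ring_hom (power_series A {..r}\<lparr>carrier := carrier (C r)\<rparr>)
      (power_series A {..q}\<lparr>carrier := carrier (C q)\<rparr>)"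
    using \<phi> C_ps by (intro ring_hom_sub A.pull_hom) auto
  then show ?thesis unfolding C_eq .
qed

lemma pull_M:
  assumes \<phi>: "\<phi> ` {..q} \<subseteq> {..r}"
  shows "pull A \<phi> {..q} ` M r \<subseteq> M q"
proof -
  interpret C: cring "C q" by (rule cC)
  interpret Cr: cring "C r" by (rule cC)
  have "theta (eqn q) \<in> M q" unfolding M_eq using C.genideal_self theta_eqn_C by blast
  then have "pull A \<phi> {..q} (theta (eqn r)) \<in> M q" using pull_A_eqn[OF \<phi>] by (simp add: theta_eqn)
  then have "M r \<subseteq> {x \<in> carrier (C r). pull A \<phi> {..q} x \<in> M q}"
    unfolding M_eq[of r] using theta_eqn_C
    by (intro Cr.genideal_minimal ideal_vimage_cring[OF cC cC pull_A_hom[OF \<phi>] M_ideal]) auto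
  then show ?thesis by auto
qed

text \<open>No convergence is imposed, so that the same set can be intersected with the
  overconvergent and with the convergent series.\<close>

definition ball :: "nat \<Rightarrow> (('v + nat \<Rightarrow> nat) \<Rightarrow> 'a) set"
  where "ball q = {f \<in> carrier (P q). \<forall>\<mu>. absv (f \<mu>) < 1}"

abbreviation "D q \<equiv> dagger_simplex R absv V I q"
abbreviation "B q \<equiv> banach_simplex A nrm q"

definition D_coset :: "nat \<Rightarrow> (('v + nat \<Rightarrow> nat) \<Rightarrow> 'a) \<Rightarrow> (('v + nat \<Rightarrow> nat) \<Rightarrow> 'a) set"
  where "D_coset q f = L q +>\<^bsub>Sd q\<^esub> f"

text \<open>Composed with \<open>theta\<close>, so that elements of both simplicial rings are
  represented by series over the base in the same variables.\<close>

definition B_coset :: "nat \<Rightarrow> (('v + nat \<Rightarrow> nat) \<Rightarrow> 'a) \<Rightarrow> ((nat \<Rightarrow> nat) \<Rightarrow> (('v \<Rightarrow> nat) \<Rightarrow> 'a) set) set"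
  where "B_coset q f = M q +>\<^bsub>C q\<^esub> theta f"

lemma D_eq: "D q = Sd q Quot L q"
  by (simp add: dagger_simplex_def dagger_coproduct_def)

lemma B_eq: "B q = C q Quot M q"
  by (simp add: banach_simplex_def)

lemma D_cring: "cring (D q)"
  unfolding D_eq using L_ideal cSd by (rule ideal.quotient_is_cring)

lemma B_cring: "cring (B q)"
  unfolding B_eq using M_ideal cC by (rule ideal.quotient_is_cring)

lemma D_coset_hom: "D_coset q \<in> ring_hom (Sd q) (D q)"
  using ideal.rcos_ring_hom[OF L_ideal] unfolding D_eq D_coset_def .

lemma B_coset_hom: "B_coset q \<in> ring_hom (S q) (B q)"
  using ring_hom_trans[OF theta_ring_hom ideal.rcos_ring_hom[OF M_ideal]]
  unfolding B_eq B_coset_def comp_def .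

lemma D_cases:
  assumes "x \<in> carrier (D q)"
  obtains f where "f \<in> carrier (Sd q)" "x = D_coset q f"
  using assms unfolding D_eq D_coset_def quot_carrier by blast

lemma B_cases:
  assumes "x \<in> carrier (B q)"
  obtains f where "f \<in> carrier (S q)" "x = B_coset q f"
proof -
  from assms obtain y where y: "y \<in> carrier (C q)" "x = M q +>\<^bsub>C q\<^esub> y"
    unfolding B_eq quot_carrier by blast
  from C_cases[OF y(1)] obtain f where "f \<in> carrier (S q)" "y = theta f" .
  then show ?thesis using that y by (simp add: B_coset_def)
qed

lemma linear_subst_lift:
  assumes \<phi>: "\<phi> ` {..q} \<subseteq> {..r}" and f: "f \<in> carrier (P r)"
  shows "linear_subst R (vars r) (vars q) (case_sum (\<lambda>v. variable R (Inl v))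
    (\<lambda>i. \<Oplus>\<^bsub>P q\<^esub>j\<in>{j \<in> {..q}. \<phi> j = i}. variable R (Inr j))) f = lift \<phi> q f"
proof (rule linear_subst_eq_pull)
  interpret P: cring "P q" by (rule cP)
  fix x assume x: "x \<in> vars r"
  show "case_sum (\<lambda>v. variable R (Inl v)) (\<lambda>i. \<Oplus>\<^bsub>P q\<^esub>j\<in>{j \<in> {..q}. \<phi> j = i}. variable R (Inr j)) x
    = linear_form R {w \<in> vars q. map_sum id \<phi> w = x}"
  proof (cases x)
    case (Inl v)
    then have "{w \<in> vars q. map_sum id \<phi> w = x} = {Inl v}" using x by auto
    then show ?thesis using Inl by (simp add: variable_eq)
  next
    case (Inr i)
    then have *: "{w \<in> vars q. map_sum id \<phi> w = x} = Inr ` {j \<in> {..q}. \<phi> j = i}" by auto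
    have "(\<Oplus>\<^bsub>P q\<^esub>w\<in>Inr ` {j \<in> {..q}. \<phi> j = i}. variable R w) = (\<Oplus>\<^bsub>P q\<^esub>j\<in>{j \<in> {..q}. \<phi> j = i}. variable R (Inr j))"
      by (rule P.finsum_reindex) (auto intro: variable_closed)
    then show ?thesis
      unfolding * using Inr finsum_variable_ps[OF fvars, of "Inr ` {j \<in> {..q}. \<phi> j = i}" q] by auto
  qed
qed (use \<phi> f in auto)

lemma D_act_coset:
  assumes \<phi>: "\<phi> ` {..q} \<subseteq> {..r}" and f: "f \<in> carrier (Sd r)"
  shows "dagger_simplex_act R absv V I q r \<phi> (D_coset r f) = D_coset q (lift \<phi> q f)"
proof -
  interpret Sd: cring "Sd r" by (rule cSd)
  interpret L: ideal "L r" "Sd r" by (rule L_ideal)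
  have "dagger_simplex_act R absv V I q r \<phi> (D_coset r f) = quot_map (Sd q) (L q) (lift \<phi> q) (D_coset r f)"
    unfolding dagger_simplex_act_def D_coset_def
    by (intro quot_map_cong linear_subst_lift[OF \<phi>] S_P[OF Sd_S] L.mem_coset(1)[OF f])
  also have "\<dots> = D_coset q (lift \<phi> q f)"
    unfolding D_coset_def by (rule quot_map_coset[OF cSd cSd L_ideal L_ideal lift_dagger[OF \<phi>] lift_L[OF \<phi>] f])
  finally show ?thesis .
qed

lemma B_act_coset:
  assumes \<phi>: "\<phi> ` {..q} \<subseteq> {..r}" and f: "f \<in> carrier (S r)"
  shows "banach_simplex_act A nrm q r \<phi> (B_coset r f) = B_coset q (lift \<phi> q f)"
proof -
  interpret A: cring A by (rule A_cring)
  interpret C: cring "C r" by (rule cC)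
  interpret M: ideal "M r" "C r" by (rule M_ideal)
  have *: "linear_subst A {..r} {..q} (\<lambda>i. \<Oplus>\<^bsub>power_series A {..q}\<^esub>j\<in>{j \<in> {..q}. \<phi> j = i}. variable A j) x = pull A \<phi> {..q} x"
    if x: "x \<in> carrier (C r)" for x
  proof (rule A.linear_subst_eq_pull)
    show "x \<in> carrier (power_series A {..r})" using C_ps x by blast
    show "(\<Oplus>\<^bsub>power_series A {..q}\<^esub>j\<in>{j \<in> {..q}. \<phi> j = i}. variable A j) = linear_form A {w \<in> {..q}. \<phi> w = i}" for i
      by (rule A.finsum_variable_ps) auto
  qed (use \<phi> in auto)
  have "banach_simplex_act A nrm q r \<phi> (B_coset r f) = quot_map (C q) (M q) (pull A \<phi> {..q}) (B_coset r f)"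
    unfolding banach_simplex_act_def B_coset_def
    by (intro quot_map_cong * M.mem_coset(1)[OF theta_C[OF f]])
  also have "\<dots> = M q +>\<^bsub>C q\<^esub> pull A \<phi> {..q} (theta f)"
    unfolding B_coset_def
    by (rule quot_map_coset[OF cC cC M_ideal M_ideal pull_A_hom[OF \<phi>] pull_M[OF \<phi>] theta_C[OF f]])
  also have "\<dots> = B_coset q (lift \<phi> q f)"
    unfolding B_coset_def theta_pull[OF f \<phi>] ..
  finally show ?thesis .
qed

text \<open>The simplicial ring map induced by the passage from A to its completion.\<close>

definition Theta :: "nat \<Rightarrow> (('v + nat \<Rightarrow> nat) \<Rightarrow> 'a) set \<Rightarrow> ((nat \<Rightarrow> nat) \<Rightarrow> (('v \<Rightarrow> nat) \<Rightarrow> 'a) set) set"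
  where "Theta q = quot_map (C q) (M q) theta"

lemma Theta_coset: "f \<in> carrier (Sd q) \<Longrightarrow> Theta q (D_coset q f) = B_coset q f"
  unfolding Theta_def D_coset_def B_coset_def
  by (rule quot_map_coset[OF cSd cC L_ideal M_ideal theta_Sd theta_L])

lemma Theta_hom: "Theta q \<in> ring_hom (D q) (B q)"
  unfolding Theta_def D_eq B_eq by (rule quot_map_hom[OF cSd cC L_ideal M_ideal theta_Sd theta_L])

lemma lift_lift:
  assumes \<phi>: "\<phi> ` {..q} \<subseteq> {..r}" and f: "f \<in> carrier (P s)"
  shows "lift \<phi> q (lift \<psi> r f) = lift (\<psi> \<circ> \<phi>) q f"
proof -
  have "lift \<phi> q (lift \<psi> r f) = pull R (map_sum id \<psi> \<circ> map_sum id \<phi>) (vars q) f"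
    using \<phi> ps_coeff[OF f] by (intro pull_pull) auto
  then show ?thesis by (simp add: map_sum.comp)
qed

lemma lift_id:
  assumes \<phi>: "\<And>j. j \<le> q \<Longrightarrow> \<phi> j = j" and f: "f \<in> carrier (P q)"
  shows "lift \<phi> q f = f"
proof
  fix \<mu>
  have "lift \<phi> q f = pull R id (vars q) f"
    using \<phi> by (intro pull_cong) auto
  moreover have "mcoef id (vars q) \<mu> = 1" by (rule mcoef_inj) auto
  moreover have "push id (vars q) \<mu> = \<mu>" if "\<mu> \<in> mexp (vars q)"
  proof
    fix v
    have "{w. w \<in> vars q \<and> id w = v} = (if v \<in> vars q then {v} else {})" by auto
    then show "push id (vars q) \<mu> v = \<mu> v" using that by (simp add: push_def mexp_def)
  qed
  ultimately show "lift \<phi> q f \<mu> = f \<mu>"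
    using ps_coeff[OF f, of \<mu>] ps_outside[OF f, of \<mu>] by (simp add: pull_def)
qed

lemma lift_linear_form:
  assumes \<phi>: "\<phi> ` {..q} \<subseteq> {..r}" and Z: "Z \<subseteq> {..r}"
  shows "lift \<phi> q (linear_form R (Inr ` Z)) = linear_form R (Inr ` {j \<in> {..q}. \<phi> j \<in> Z})"
proof -
  have *: "{w \<in> vars q. map_sum id \<phi> w \<in> Inr ` Z} = (Inr ` {j \<in> {..q}. \<phi> j \<in> Z} :: ('v + nat) set)" by auto
  have "lift \<phi> q (linear_form R (Inr ` Z)) = linear_form R {w \<in> vars q. map_sum id \<phi> w \<in> Inr ` Z}"
    using \<phi> Z by (intro pull_linear_form[of "vars r" "vars q"]) auto
  then show ?thesis unfolding * .
qed

lemma ball_P: "f \<in> ball q \<Longrightarrow> f \<in> carrier (P q)" by (simp add: ball_def)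

lemma ball_zero: "\<zero>\<^bsub>P q\<^esub> \<in> ball q"
  by (simp add: ball_def ps_zero ps_carrier)

lemma ball_add: "f \<in> ball q \<Longrightarrow> g \<in> ball q \<Longrightarrow> f \<oplus>\<^bsub>P q\<^esub> g \<in> ball q"
proof -
  interpret P: cring "P q" by (rule cP)
  assume f: "f \<in> ball q" and g: "g \<in> ball q"
  then have "f \<oplus>\<^bsub>P q\<^esub> g \<in> carrier (P q)" by (intro P.a_closed ball_P)
  then show ?thesis
    using f g ps_coeff[OF ball_P[OF f]] ps_coeff[OF ball_P[OF g]]
    by (simp add: ball_def ps_add absv_add_less)
qed

lemma ball_uminus: "f \<in> ball q \<Longrightarrow> \<ominus>\<^bsub>P q\<^esub> f \<in> ball q"
proof -
  interpret P: cring "P q" by (rule cP)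
  assume f: "f \<in> ball q"
  then have "\<ominus>\<^bsub>P q\<^esub> f \<in> carrier (P q)" by (intro P.a_inv_closed ball_P)
  then show ?thesis
    using f ps_coeff[OF ball_P[OF f]]
    by (simp add: ball_def ps_a_inv[OF fvars ball_P[OF f]] absv_uminus)
qed

text \<open>The multiplier must have norm at most 1, which holds for sums of barycentric
  coordinates; over K larger multipliers leave the ball.\<close>

lemma ball_mult:
  assumes f: "f \<in> ball q" and g: "g \<in> carrier (P q)" "\<And>\<mu>. absv (g \<mu>) \<le> 1"
  shows "g \<otimes>\<^bsub>P q\<^esub> f \<in> ball q"
proof -
  interpret P: cring "P q" by (rule cP)
  have "absv ((f \<otimes>\<^bsub>P q\<^esub> g) \<mu>) < 1 * 1" for \<mu>
    using f g by (intro mult_below_less[OF fvars]) (auto simp: ball_def)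
  then show ?thesis using P.m_closed[OF g(1) ball_P[OF f]] P.m_comm[OF g(1) ball_P[OF f]] by (simp add: ball_def)
qed

lemma ball_lift:
  assumes \<phi>: "\<phi> ` {..q} \<subseteq> {..r}" and f: "f \<in> ball r"
  shows "lift \<phi> q f \<in> ball q"
proof -
  have "lift \<phi> q f \<in> carrier (P q)"
    using \<phi> ball_P[OF f] by (intro pull_closed[of "vars r"]) auto
  moreover have "absv (lift \<phi> q f \<mu>) < 1" for \<mu>
    using f ps_coeff[OF ball_P[OF f]] by (intro absv_pull_less) (auto simp: ball_def)
  ultimately show ?thesis by (simp add: ball_def)
qed

lemma linear_form_le: "absv (linear_form R Z \<mu>) \<le> 1"
  using absv_one by (simp add: linear_form_def)

text \<open>Treats both simplicial rings at once: \<open>N q\<close> is the ring of series,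
  \<open>co q\<close> the quotient map, and each axiom is checked on representatives.\<close>

lemma simplicial_ballI:
  fixes Q :: "nat \<Rightarrow> 'q ring" and act :: "nat \<Rightarrow> nat \<Rightarrow> (nat \<Rightarrow> nat) \<Rightarrow> 'q \<Rightarrow> 'q"
  assumes cN: "\<And>q. cring (N q)" and NP: "\<And>q f. f \<in> carrier (N q) \<Longrightarrow> f \<in> carrier (P q)"
    and ops: "\<And>q. (\<otimes>\<^bsub>N q\<^esub>) = (\<otimes>\<^bsub>P q\<^esub>)" "\<And>q. (\<oplus>\<^bsub>N q\<^esub>) = (\<oplus>\<^bsub>P q\<^esub>)" "\<And>q. \<zero>\<^bsub>N q\<^esub> = \<zero>\<^bsub>P q\<^esub>" "\<And>q. \<one>\<^bsub>N q\<^esub> = \<one>\<^bsub>P q\<^esub>"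
    and neg: "\<And>q f. f \<in> carrier (N q) \<Longrightarrow> \<ominus>\<^bsub>N q\<^esub> f = \<ominus>\<^bsub>P q\<^esub> f"
    and cQ: "\<And>q. cring (Q q)" and hom: "\<And>q. co q \<in> ring_hom (N q) (Q q)"
    and surj: "\<And>q x. x \<in> carrier (Q q) \<Longrightarrow> \<exists>f\<in>carrier (N q). x = co q f"
    and act: "\<And>q r \<phi> f. \<phi> ` {..q} \<subseteq> {..r} \<Longrightarrow> f \<in> carrier (N r) \<Longrightarrow> act q r \<phi> (co r f) = co q (lift \<phi> q f)"
    and lift: "\<And>q r \<phi>. \<phi> ` {..q} \<subseteq> {..r} \<Longrightarrow> lift \<phi> q \<in> ring_hom (N r) (N q)"
    and lf: "\<And>q Z. Z \<subseteq> {..q} \<Longrightarrow> linear_form R (Inr ` Z) \<in> carrier (N q)"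
    and eqn: "\<And>q. co q (eqn q) = \<zero>\<^bsub>Q q\<^esub>"
    and quasi: "\<And>q f. f \<in> carrier (N q) \<Longrightarrow> (\<And>\<mu>. absv (f \<mu>) < 1) \<Longrightarrow> \<exists>g\<in>carrier (N q).
      (\<forall>\<mu>. absv (g \<mu>) < 1) \<and> f \<oplus>\<^bsub>P q\<^esub> g \<oplus>\<^bsub>P q\<^esub> f \<otimes>\<^bsub>P q\<^esub> g = \<zero>\<^bsub>P q\<^esub>"
  shows "simplicial_ball Q act (\<lambda>q Z. co q (linear_form R (Inr ` Z))) (\<lambda>q. co q ` (ball q \<inter> carrier (N q)))"
proof -
  have h: "ring_hom_cring (N q) (Q q) (co q)" for q using cN cQ hom by (rule cring_hom)
  note hc = ring_hom_memE(1)[OF hom] and hm = ring_hom_memE(2)[OF hom] and ha = ring_hom_memE(3)[OF hom]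
  note closed = ring.ring_simprules(1)[OF cring.axioms(1)[OF cN]] ring.ring_simprules(5)[OF cring.axioms(1)[OF cN]]
  note lc = ring_hom_memE(1)[OF lift]
  show ?thesis
  proof (rule simplicial_ball.intro)
    show "cring (Q q)" for q by (rule cQ)
    fix q
    interpret Q: cring "Q q" by (rule cQ)
    interpret N: cring "N q" by (rule cN)
    interpret h: ring_hom_cring "N q" "Q q" "co q" by (rule h)
    show "co q (linear_form R (Inr ` Z)) \<in> carrier (Q q)" if "Z \<subseteq> {..q}" for Z
      using hc lf[OF that] .
    show "co q (linear_form R (Inr ` {})) = \<zero>\<^bsub>Q q\<^esub>"
    proof -
      have "linear_form R (Inr ` {}) = \<zero>\<^bsub>N q\<^esub>" by (simp add: ops ps_zero linear_form_def)
      then show ?thesis by simp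
    qed
    show "co q (linear_form R (Inr ` {..q})) = \<one>\<^bsub>Q q\<^esub>"
    proof -
      have l: "linear_form R (Inr ` {..q}) \<in> carrier (N q)" by (rule lf) simp
      have "eqn q = linear_form R (Inr ` {..q}) \<oplus>\<^bsub>N q\<^esub> \<ominus>\<^bsub>N q\<^esub> \<one>\<^bsub>N q\<^esub>"
        using neg[OF N.one_closed] by (simp add: a_minus_def simplex_equation_def ops)
      then have "co q (linear_form R (Inr ` {..q})) \<ominus>\<^bsub>Q q\<^esub> \<one>\<^bsub>Q q\<^esub> = \<zero>\<^bsub>Q q\<^esub>"
        using l eqn[of q] by (simp add: a_minus_def)
      then show ?thesis using hc[OF l] by simp
    qed
    show "co q ` (ball q \<inter> carrier (N q)) \<subseteq> carrier (Q q)" using hc by blast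
    show "\<zero>\<^bsub>Q q\<^esub> \<in> co q ` (ball q \<inter> carrier (N q))"
      using ball_zero[of q] N.zero_closed h.hom_zero by (intro image_eqI[of _ _ "\<zero>\<^bsub>N q\<^esub>"]) (auto simp: ops)
    fix x assume x: "x \<in> co q ` (ball q \<inter> carrier (N q))"
    then obtain f where f: "f \<in> ball q" "f \<in> carrier (N q)" "x = co q f" by blast
    show "\<ominus>\<^bsub>Q q\<^esub> x \<in> co q ` (ball q \<inter> carrier (N q))"
    proof (rule image_eqI)
      show "\<ominus>\<^bsub>Q q\<^esub> x = co q (\<ominus>\<^bsub>N q\<^esub> f)" using f by simp
      show "\<ominus>\<^bsub>N q\<^esub> f \<in> ball q \<inter> carrier (N q)"
        using ball_uminus[OF f(1)] N.a_inv_closed[OF f(2)] unfolding neg[OF f(2)] by (rule IntI)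
    qed
    show "co q (linear_form R (Inr ` Z)) \<otimes>\<^bsub>Q q\<^esub> x \<in> co q ` (ball q \<inter> carrier (N q))" if Z: "Z \<subseteq> {..q}" for Z
    proof (rule image_eqI)
      show "co q (linear_form R (Inr ` Z)) \<otimes>\<^bsub>Q q\<^esub> x = co q (linear_form R (Inr ` Z) \<otimes>\<^bsub>N q\<^esub> f)"
        using hm[OF lf[OF Z] f(2)] f(3) by simp
      show "linear_form R (Inr ` Z) \<otimes>\<^bsub>N q\<^esub> f \<in> ball q \<inter> carrier (N q)"
        using ball_mult[OF f(1) NP[OF lf[OF Z]] linear_form_le] N.m_closed[OF lf[OF Z] f(2)]
        unfolding ops by (rule IntI)
    qed
    show "\<exists>y\<in>co q ` (ball q \<inter> carrier (N q)). x \<oplus>\<^bsub>Q q\<^esub> y \<oplus>\<^bsub>Q q\<^esub> x \<otimes>\<^bsub>Q q\<^esub> y = \<zero>\<^bsub>Q q\<^esub>"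
    proof -
      have "absv (f \<mu>) < 1" for \<mu> using f by (simp add: ball_def)
      from quasi[OF f(2) this] obtain g where g: "g \<in> carrier (N q)" "\<And>\<mu>. absv (g \<mu>) < 1"
        "f \<oplus>\<^bsub>P q\<^esub> g \<oplus>\<^bsub>P q\<^esub> f \<otimes>\<^bsub>P q\<^esub> g = \<zero>\<^bsub>P q\<^esub>" by blast
      have "co q (f \<oplus>\<^bsub>N q\<^esub> g \<oplus>\<^bsub>N q\<^esub> f \<otimes>\<^bsub>N q\<^esub> g) = \<zero>\<^bsub>Q q\<^esub>"
        using g(3) h.hom_zero by (simp add: ops)
      then have "x \<oplus>\<^bsub>Q q\<^esub> co q g \<oplus>\<^bsub>Q q\<^esub> x \<otimes>\<^bsub>Q q\<^esub> co q g = \<zero>\<^bsub>Q q\<^esub>"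
        using f g(1) by simp
      moreover have "g \<in> ball q" using g NP by (simp add: ball_def)
      ultimately show ?thesis using g(1) by blast
    qed
    fix y assume y: "y \<in> co q ` (ball q \<inter> carrier (N q))"
    then obtain g where g: "g \<in> ball q" "g \<in> carrier (N q)" "y = co q g" by blast
    show "x \<oplus>\<^bsub>Q q\<^esub> y \<in> co q ` (ball q \<inter> carrier (N q))"
    proof (rule image_eqI)
      show "x \<oplus>\<^bsub>Q q\<^esub> y = co q (f \<oplus>\<^bsub>N q\<^esub> g)" using f g by simp
      show "f \<oplus>\<^bsub>N q\<^esub> g \<in> ball q \<inter> carrier (N q)"
        using ball_add[OF f(1) g(1)] N.a_closed[OF f(2) g(2)] unfolding ops by (rule IntI)
    qed
    show "x \<otimes>\<^bsub>Q q\<^esub> y \<in> co q ` (ball q \<inter> carrier (N q))"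
    proof (rule image_eqI)
      show "x \<otimes>\<^bsub>Q q\<^esub> y = co q (f \<otimes>\<^bsub>N q\<^esub> g)" using f g by simp
      have "absv (f \<mu>) \<le> 1" for \<mu> using f(1) by (simp add: ball_def less_imp_le)
      from ball_mult[OF g(1) ball_P[OF f(1)] this] show "f \<otimes>\<^bsub>N q\<^esub> g \<in> ball q \<inter> carrier (N q)"
        using N.m_closed[OF f(2) g(2)] unfolding ops by (rule IntI)
    qed
  next
    fix q r :: nat and \<phi> :: "nat \<Rightarrow> nat" assume \<phi>: "\<phi> ` {..q} \<subseteq> {..r}"
    interpret Qr: cring "Q r" by (rule cQ)
    show "act q r \<phi> \<in> ring_hom (Q r) (Q q)"
    proof (rule ring_hom_memI)
      fix x assume "x \<in> carrier (Q r)"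
      then obtain f where f: "f \<in> carrier (N r)" "x = co r f" using surj by blast
      show "act q r \<phi> x \<in> carrier (Q q)" using f act[OF \<phi> f(1)] hc lc[OF \<phi> f(1)] by simp
      fix y assume "y \<in> carrier (Q r)"
      then obtain g where g: "g \<in> carrier (N r)" "y = co r g" using surj by blast
      show "act q r \<phi> (x \<otimes>\<^bsub>Q r\<^esub> y) = act q r \<phi> x \<otimes>\<^bsub>Q q\<^esub> act q r \<phi> y"
        using f g act[OF \<phi>] hm[OF f(1) g(1)] hm[OF lc[OF \<phi> f(1)] lc[OF \<phi> g(1)]] closed(2)[OF f(1) g(1)]
          ring_hom_memE(2)[OF lift[OF \<phi>] f(1) g(1)] by metis
      show "act q r \<phi> (x \<oplus>\<^bsub>Q r\<^esub> y) = act q r \<phi> x \<oplus>\<^bsub>Q q\<^esub> act q r \<phi> y"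
        using f g act[OF \<phi>] ha[OF f(1) g(1)] ha[OF lc[OF \<phi> f(1)] lc[OF \<phi> g(1)]] closed(1)[OF f(1) g(1)]
          ring_hom_memE(3)[OF lift[OF \<phi>] f(1) g(1)] by metis
    next
      show "act q r \<phi> \<one>\<^bsub>Q r\<^esub> = \<one>\<^bsub>Q q\<^esub>"
        using act[OF \<phi>, of "\<one>\<^bsub>N r\<^esub>"] ring_hom_memE(4)[OF hom] ring_hom_memE(4)[OF lift[OF \<phi>]]
          ring.ring_simprules(6)[OF cring.axioms(1)[OF cN]] by metis
    qed
    show "act q r \<phi> (co r (linear_form R (Inr ` Z))) = co q (linear_form R (Inr ` {j \<in> {..q}. \<phi> j \<in> Z}))"
      if Z: "Z \<subseteq> {..r}" for Z
      using act[OF \<phi> lf[OF Z]] lift_linear_form[OF \<phi> Z] by simp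
    show "act q r \<phi> x \<in> co q ` (ball q \<inter> carrier (N q))" if x: "x \<in> co r ` (ball r \<inter> carrier (N r))" for x
    proof -
      from x obtain f where f: "f \<in> ball r" "f \<in> carrier (N r)" "x = co r f" by blast
      then show ?thesis using act[OF \<phi> f(2)] ball_lift[OF \<phi> f(1)] lc[OF \<phi> f(2)] by auto
    qed
    {
      fix s \<psi> x assume \<psi>: "\<psi> ` {..r} \<subseteq> {..s :: nat}" and x: "x \<in> carrier (Q s)"
      then obtain f where f: "f \<in> carrier (N s)" "x = co s f" using surj by blast
      have "(\<psi> \<circ> \<phi>) ` {..q} \<subseteq> {..s}" using \<phi> \<psi> by auto
      then show "act q r \<phi> (act r s \<psi> x) = act q s (\<psi> \<circ> \<phi>) x"
        using f act[OF \<psi> f(1)] act[OF \<phi> lc[OF \<psi> f(1)]] act[of "\<psi> \<circ> \<phi>" q s f] lift_lift[OF \<phi> NP[OF f(1)]] by simp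
    next
      fix \<psi> x assume e: "\<And>j. j \<le> q \<Longrightarrow> \<phi> j = \<psi> j" and x: "x \<in> carrier (Q r)"
      then obtain f where f: "f \<in> carrier (N r)" "x = co r f" using surj by blast
      have \<psi>: "\<psi> ` {..q} \<subseteq> {..r}" using \<phi> e by fastforce
      have "lift \<phi> q f = lift \<psi> q f" by (rule pull_cong) (use e in auto)
      then show "act q r \<phi> x = act q r \<psi> x" using f act[OF \<phi> f(1)] act[OF \<psi> f(1)] by simp
    }
  next
    fix q :: nat and \<phi> :: "nat \<Rightarrow> nat" and x assume e: "\<And>j. j \<le> q \<Longrightarrow> \<phi> j = j" and x: "x \<in> carrier (Q q)"
    then obtain f where f: "f \<in> carrier (N q)" "x = co q f" using surj by blast
    have "\<phi> ` {..q} \<subseteq> {..q}" using e by auto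
    then show "act q q \<phi> x = x" using f act[OF _ f(1)] lift_id[OF e NP[OF f(1)]] by simp
  qed
qed

definition JD where "JD q = D_coset q ` (ball q \<inter> carrier (Sd q))"
definition JB where "JB q = B_coset q ` (ball q \<inter> carrier (S q))"

lemma D_coset_zero_iff: "f \<in> carrier (Sd q) \<Longrightarrow> D_coset q f = \<zero>\<^bsub>D q\<^esub> \<longleftrightarrow> f \<in> L q"
proof -
  interpret Sd: cring "Sd q" by (rule cSd)
  interpret L: ideal "L q" "Sd q" by (rule L_ideal)
  assume "f \<in> carrier (Sd q)"
  then show ?thesis
    using L.coset_eq_iff[of f "\<zero>\<^bsub>Sd q\<^esub>"] Sd.zero_closed by (simp add: D_coset_def D_eq L.quot_zero a_minus_def)
qed

lemma B_coset_zero_iff: "f \<in> carrier (S q) \<Longrightarrow> B_coset q f = \<zero>\<^bsub>B q\<^esub> \<longleftrightarrow> theta f \<in> M q"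
proof -
  interpret C: cring "C q" by (rule cC)
  interpret M: ideal "M q" "C q" by (rule M_ideal)
  assume "f \<in> carrier (S q)"
  then have "theta f \<in> carrier (C q)" by (rule theta_C)
  then show ?thesis
    using M.coset_eq_iff[of "theta f" "\<zero>\<^bsub>C q\<^esub>"] C.zero_closed by (simp add: B_coset_def B_eq M.quot_zero a_minus_def)
qed

lemma D_surj: "x \<in> carrier (D q) \<Longrightarrow> \<exists>f\<in>carrier (Sd q). x = D_coset q f"
  by (erule D_cases) blast

lemma B_surj: "x \<in> carrier (B q) \<Longrightarrow> \<exists>f\<in>carrier (S q). x = B_coset q f"
  by (erule B_cases) blast

lemma D_coset_eqn: "D_coset q (eqn q) = \<zero>\<^bsub>D q\<^esub>"
  using D_coset_zero_iff[OF eqn_Sd] eqn_L by (rule iffD2)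

lemma B_coset_eqn: "B_coset q (eqn q) = \<zero>\<^bsub>B q\<^esub>"
  using B_coset_zero_iff[OF Sd_S[OF eqn_Sd]] subsetD[OF theta_L imageI[OF eqn_L]] by (rule iffD2)

lemma D_simplicial_ball: "simplicial_ball D (dagger_simplex_act R absv V I) (\<lambda>q Z. D_coset q (linear_form R (Inr ` Z))) JD"
  unfolding JD_def[abs_def]
  by (rule simplicial_ballI[where N = Sd, OF cSd S_P[OF Sd_S] Sd_ops Sd_a_inv D_cring D_coset_hom D_surj D_act_coset
      lift_dagger linear_form_Sd D_coset_eqn quasi_inverse_dagger[OF fvars]])

lemma B_simplicial_ball: "simplicial_ball B (banach_simplex_act A nrm) (\<lambda>q Z. B_coset q (linear_form R (Inr ` Z))) JB"
  unfolding JB_def[abs_def]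
  by (rule simplicial_ballI[where N = S, OF cS S_P S_ops S_a_inv B_cring B_coset_hom B_surj B_act_coset
      lift_convergent linear_form_S B_coset_eqn quasi_inverse_convergent[OF fvars]])

lemma Theta_JD: "x \<in> JD q \<Longrightarrow> Theta q x \<in> JB q"
  using Theta_coset Sd_S by (fastforce simp: JD_def JB_def)

text \<open>The set \<open>F\<close> collects elements by which the error will be multiplied. Since
  \<open>JB q\<close> need not absorb such factors, their size has to enter the precision of the
  approximation.\<close>

lemma Theta_dense:
  assumes b: "b \<in> carrier (B q)" and F: "finite F" "F \<subseteq> carrier (B q)"
  obtains d where "d \<in> carrier (D q)" "b \<ominus>\<^bsub>B q\<^esub> Theta q d \<in> JB q"
    "\<And>c. c \<in> F \<Longrightarrow> c \<otimes>\<^bsub>B q\<^esub> (b \<ominus>\<^bsub>B q\<^esub> Theta q d) \<in> JB q"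
proof -
  interpret B: cring "B q" by (rule B_cring)
  interpret S: cring "S q" by (rule cS)
  interpret P: cring "P q" by (rule cP)
  interpret h: ring_hom_cring "S q" "B q" "B_coset q" by (rule cring_hom[OF cS B_cring B_coset_hom])
  obtain f where f: "f \<in> carrier (S q)" "b = B_coset q f" using B_cases[OF b] .
  have "\<forall>c\<in>F. \<exists>g. g \<in> carrier (S q) \<and> c = B_coset q g" using F(2) B_surj by blast
  from bchoice[OF this] obtain g where g: "\<And>c. c \<in> F \<Longrightarrow> g c \<in> carrier (S q)" "\<And>c. c \<in> F \<Longrightarrow> c = B_coset q (g c)"
    by blast
  have "\<exists>K\<ge>1. \<forall>\<mu>. absv (g c \<mu>) \<le> K" if "c \<in> F" for c
  proof -
    have "g c \<in> decaying 1 (vars q)" using g(1)[OF that] by (simp add: carrier_convergent)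
    then obtain K where "1 \<le> K" "\<And>\<mu>. weight 1 (vars q) (g c) \<mu> \<le> K" by (rule decaying_bounded) blast
    then show ?thesis by (intro exI[of _ K]) simp
  qed
  then have "\<forall>c\<in>F. \<exists>K. 1 \<le> K \<and> (\<forall>\<mu>. absv (g c \<mu>) \<le> K)" by blast
  from bchoice[OF this] obtain K where K: "\<And>c. c \<in> F \<Longrightarrow> 1 \<le> K c" "\<And>c \<mu>. c \<in> F \<Longrightarrow> absv (g c \<mu>) \<le> K c"
    by blast
  \<comment> \<open>A bound for the chosen representatives of all of \<open>F\<close>, at least 1,
    so that the precision \<open>1 / M'\<close> serves for the error and for its multiples by
    \<open>F\<close>.\<close>
  define M' where "M' = Max (insert 1 (K ` F))"
  have M1: "1 \<le> M'" and MK: "\<And>c. c \<in> F \<Longrightarrow> K c \<le> M'" using F(1) by (auto simp: M'_def)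
  have M0: "0 < M'" using M1 by simp
  have fd: "f \<in> decaying 1 (vars q)" using f by (simp add: carrier_convergent)
  have "0 < 1 / M'" using M0 by simp
  then obtain t where t: "t \<in> carrier (Sd q)" "\<And>\<mu>. absv (f \<mu> \<ominus> t \<mu>) < 1 / M'"
    by (rule truncate[OF fd _ fvars]) blast
  have tS: "t \<in> carrier (S q)" by (rule Sd_S[OF t(1)])
  let ?u = "f \<ominus>\<^bsub>S q\<^esub> t"
  have uS: "?u \<in> carrier (S q)" using f(1) tS by (rule S.minus_closed)
  have uc: "?u \<mu> = f \<mu> \<ominus> t \<mu>" for \<mu>
    unfolding a_minus_def S_a_inv[OF tS] S_ops ps_add ps_a_inv[OF fvars S_P[OF tS]] ..
  have us: "absv (?u \<mu>) < 1 / M'" for \<mu> using t(2) uc by simp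
  have bt: "b \<ominus>\<^bsub>B q\<^esub> Theta q (D_coset q t) = B_coset q ?u"
    using f tS by (simp add: Theta_coset[OF t(1)] a_minus_def)
  have "D_coset q t \<in> carrier (D q)" using ring_hom_memE(1)[OF D_coset_hom t(1)] .
  moreover have "b \<ominus>\<^bsub>B q\<^esub> Theta q (D_coset q t) \<in> JB q"
  proof -
    have "absv (?u \<mu>) < 1" for \<mu> using us[of \<mu>] M1 by (auto intro: less_le_trans)
    then have "?u \<in> ball q" using S_P[OF uS] by (simp add: ball_def)
    then show ?thesis unfolding bt JB_def using uS by blast
  qed
  moreover have "c \<otimes>\<^bsub>B q\<^esub> (b \<ominus>\<^bsub>B q\<^esub> Theta q (D_coset q t)) \<in> JB q" if c: "c \<in> F" for c
  proof -
    have gS: "g c \<in> carrier (S q)" by (rule g(1)[OF c])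
    have "absv ((?u \<otimes>\<^bsub>P q\<^esub> g c) \<mu>) < 1 / M' * M'" for \<mu>
      using us K(2)[OF c] MK[OF c] M0 by (intro mult_below_less[OF fvars S_P[OF uS] S_P[OF gS]]) (auto intro: order_trans)
    then have "?u \<otimes>\<^bsub>S q\<^esub> g c \<in> ball q"
      using M0 S_P[OF S.m_closed[OF uS gS]] by (simp add: ball_def S_ops)
    moreover have "c \<otimes>\<^bsub>B q\<^esub> (b \<ominus>\<^bsub>B q\<^esub> Theta q (D_coset q t)) = B_coset q (?u \<otimes>\<^bsub>S q\<^esub> g c)"
      unfolding bt using uS gS g(2)[OF c] B.m_comm by (metis h.hom_closed h.hom_mult)
    ultimately show ?thesis unfolding JB_def using S.m_closed[OF uS gS] by blast
  qed
  ultimately show ?thesis using that by blast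
qed

text \<open>The series is a finite sum of members of \<open>I\<close> times monomials in the simplex
  coordinates. Finiteness of \<open>F\<close> matters, because an ideal is closed under finite sums
  only.\<close>

lemma slices_in_L:
  assumes F: "finite F" "F \<subseteq> mexp {..q :: nat}" and i: "\<And>\<alpha>. \<alpha> \<in> F \<Longrightarrow> i \<alpha> \<in> I"
  shows "(\<lambda>\<mu>. if \<mu> \<circ> Inr \<in> F then i (\<mu> \<circ> Inr) (\<mu> \<circ> Inl) else \<zero>) \<in> L q"
  using F i
proof (induction F rule: finite_induct)
  case empty
  interpret Sd: cring "Sd q" by (rule cSd)
  interpret L: ideal "L q" "Sd q" by (rule L_ideal)
  show ?case using L.zero_closed by (simp add: Sd_ops ps_zero)
next
  case (insert \<gamma> F)
  interpret Sd: cring "Sd q" by (rule cSd)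
  interpret L: ideal "L q" "Sd q" by (rule L_ideal)
  have iI: "i \<gamma> \<in> I" using insert.prems by simp
  note ip = I_ps[OF iI]
  note [simp] = ps_coeff[OF ip]
  have \<gamma>: "\<gamma> \<in> mexp {..q}" using insert.prems by simp
  \<comment> \<open>The monomial with exponent \<gamma> in the simplex coordinates; multiplying by
    it moves a series in the variables of A to the slice \<gamma>.\<close>
  define m :: "('v + nat \<Rightarrow> nat) \<Rightarrow> 'a" where "m = (\<lambda>\<mu>. if \<mu> = case_sum 0 \<gamma> then \<one> else \<zero>)"
  have mp: "m \<in> carrier (P q)" using \<gamma> by (auto simp: m_def ps_carrier)
  have md: "m \<in> decaying 2 (vars q)" by (rule finite_support_decaying[OF mp, of "{case_sum 0 \<gamma>}"]) (auto simp: m_def)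
  have mSd: "m \<in> carrier (Sd q)" unfolding carrier_dagger using md by (intro UN_I[of 2]) auto
  have inc: "inclL (i \<gamma>) \<in> carrier (Sd q)" using L_generators iI by blast
  have prod: "(inclL (i \<gamma>) \<otimes>\<^bsub>P q\<^esub> m) \<mu> = (if \<mu> \<circ> Inr = \<gamma> then i \<gamma> (\<mu> \<circ> Inl) else \<zero>)" for \<mu>
  proof (cases "\<mu> \<in> mexp (vars q)")
    case True
    note [simp] = ps_coeff[OF mp] ps_coeff[OF S_P[OF Sd_S[OF inc]]]
    have s: "inclL (i \<gamma>) \<nu> = (if \<nu> \<circ> Inr = 0 then i \<gamma> (\<nu> \<circ> Inl) else \<zero>)" for \<nu> :: "'v + nat \<Rightarrow> nat"
      using fun_cong[OF slice_inclL[OF ip, of "\<nu> \<circ> Inr"], of "\<nu> \<circ> Inl"] sum_split[of \<nu>] by (auto simp: slice_def)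
    have p: "(inclL (i \<gamma>) \<otimes>\<^bsub>P q\<^esub> m) \<mu> = (\<Oplus>\<nu>\<in>{..\<mu>}. inclL (i \<gamma>) \<nu> \<otimes> m (\<mu> - \<nu>))"
      using True by (simp add: ps_mult)
    show ?thesis
    proof (cases "\<mu> \<circ> Inr = \<gamma>")
      case eq: True
      let ?\<nu> = "case_sum (\<mu> \<circ> Inl) 0 :: 'v + nat \<Rightarrow> nat"
      have \<mu>: "\<mu> = case_sum (\<mu> \<circ> Inl) \<gamma>" using sum_split[of \<mu>] eq by simp
      have "?\<nu> \<le> case_sum (\<mu> \<circ> Inl) \<gamma>" unfolding case_sum_le by (simp add: le_fun_def)
      then have le: "?\<nu> \<le> \<mu>" using \<mu> by metis
      have "case_sum (\<mu> \<circ> Inl) \<gamma> - ?\<nu> = case_sum 0 \<gamma>" unfolding case_sum_diff by simp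
      then have d: "\<mu> - ?\<nu> = case_sum 0 \<gamma>" using \<mu> by metis
      have "\<nu> = ?\<nu>" if "\<nu> \<le> \<mu>" "\<mu> - \<nu> = case_sum 0 \<gamma>" for \<nu>
        using that d le by (metis fun_nat_diff_diff)
      then have "(\<Oplus>\<nu>\<in>{..\<mu>}. inclL (i \<gamma>) \<nu> \<otimes> m (\<mu> - \<nu>)) = (\<lambda>\<nu>. inclL (i \<gamma>) \<nu> \<otimes> m (\<mu> - \<nu>)) ?\<nu>"
        using le finite_below[OF fvars True] by (intro finsum_single) (auto simp: m_def)
      also have "\<dots> = i \<gamma> (\<mu> \<circ> Inl)" by (simp add: d m_def s case_sum_o_inj)
      finally show ?thesis using p eq by simp
    next
      case False
      have "inclL (i \<gamma>) \<nu> \<otimes> m (\<mu> - \<nu>) = \<zero>" if "\<nu> \<le> \<mu>" for \<nu>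
      proof (cases "\<nu> \<circ> Inr = 0")
        case True
        have "\<mu> - \<nu> \<noteq> case_sum 0 \<gamma>"
        proof
          assume e: "\<mu> - \<nu> = case_sum 0 \<gamma>"
          have "(\<mu> \<circ> Inr) x = \<gamma> x" for x
            using fun_cong[OF e, of "Inr x"] fun_cong[OF True, of x] by simp
          then show False using False by blast
        qed
        then show ?thesis by (simp add: m_def)
      qed (simp add: s)
      then show ?thesis using False p by (auto intro!: finsum_zeroI)
    qed
  next
    case False
    then show ?thesis using ps_outside[OF ip] \<gamma> by (auto simp: ps_mult mexp_Plus)
  qed
  let ?g = "\<lambda>\<mu>. if \<mu> \<circ> Inr \<in> F then i (\<mu> \<circ> Inr) (\<mu> \<circ> Inl) else \<zero>"
  have "m \<otimes>\<^bsub>Sd q\<^esub> inclL (i \<gamma>) \<in> L q" using L.I_l_closed[OF inclL_L[OF iI] mSd] .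
  then have "inclL (i \<gamma>) \<otimes>\<^bsub>Sd q\<^esub> m \<in> L q" using Sd.m_comm[OF mSd inc] by simp
  moreover have "?g \<in> L q" by (rule insert.IH) (use insert.prems in auto)
  ultimately have "inclL (i \<gamma>) \<otimes>\<^bsub>Sd q\<^esub> m \<oplus>\<^bsub>Sd q\<^esub> ?g \<in> L q" by (rule L.a_closed)
  also have "inclL (i \<gamma>) \<otimes>\<^bsub>Sd q\<^esub> m \<oplus>\<^bsub>Sd q\<^esub> ?g
      = (\<lambda>\<mu>. if \<mu> \<circ> Inr \<in> insert \<gamma> F then i (\<mu> \<circ> Inr) (\<mu> \<circ> Inl) else \<zero>)"
  proof
    fix \<mu>
    have [simp]: "i \<alpha> \<nu> \<in> carrier R" if "\<alpha> \<in> F" for \<alpha> \<nu> using ps_coeff[OF I_ps] insert.prems that by blast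
    show "(inclL (i \<gamma>) \<otimes>\<^bsub>Sd q\<^esub> m \<oplus>\<^bsub>Sd q\<^esub> ?g) \<mu> = (if \<mu> \<circ> Inr \<in> insert \<gamma> F then i (\<mu> \<circ> Inr) (\<mu> \<circ> Inl) else \<zero>)"
      using insert.hyps by (auto simp: Sd_ops ps_add prod)
  qed
  finally show ?case .
qed

text \<open>If the overconvergent \<open>f\<close> and a convergent \<open>g\<close> in the ball
  have the same image, then \<open>f = g + e + k * eqn q\<close> with \<open>k\<close> convergent
  and all slices of \<open>e\<close> in the completed ideal. Replacing \<open>k\<close> by an
  overconvergent \<open>t\<close> and the large slices of \<open>e\<close> by members of
  \<open>I\<close> changes this by elements of the ball.\<close>

lemma Theta_small:
  assumes d: "d \<in> carrier (D q)" and small: "Theta q d \<in> JB q"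
  shows "d \<in> JD q"
proof -
  interpret Sd: cring "Sd q" by (rule cSd)
  interpret S: cring "S q" by (rule cS)
  interpret C: cring "C q" by (rule cC)
  interpret L: ideal "L q" "Sd q" by (rule L_ideal)
  interpret M: ideal "M q" "C q" by (rule M_ideal)
  interpret h: ring_hom_cring "S q" "C q" theta by (rule cring_hom[OF cS cC theta_ring_hom])
  obtain f where f: "f \<in> carrier (Sd q)" "d = D_coset q f" using D_cases[OF d] .
  have fS: "f \<in> carrier (S q)" by (rule Sd_S[OF f(1)])
  from small f obtain g where g: "g \<in> ball q" "g \<in> carrier (S q)" "B_coset q f = B_coset q g"
    by (auto simp: JB_def Theta_coset)
  have "theta f \<ominus>\<^bsub>C q\<^esub> theta g \<in> M q"
    using g(3) M.coset_eq_iff[OF theta_C[OF fS] theta_C[OF g(2)]] unfolding B_coset_def by simp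
  \<comment> \<open>The ideal \<open>M q\<close> is principal, so a single cofactor accounts for the
    difference.\<close>
  then obtain k' where k': "k' \<in> carrier (C q)" "theta f \<ominus>\<^bsub>C q\<^esub> theta g = k' \<otimes>\<^bsub>C q\<^esub> theta (eqn q)"
    unfolding M_eq using C.cring_principal_ideal[OF theta_eqn_C] by metis
  obtain k where k: "k \<in> carrier (S q)" "k' = theta k" using C_cases[OF k'(1)] .
  have eS: "eqn q \<in> carrier (S q)" by (rule Sd_S[OF eqn_Sd])
  define e where "e = f \<ominus>\<^bsub>S q\<^esub> g \<ominus>\<^bsub>S q\<^esub> k \<otimes>\<^bsub>S q\<^esub> eqn q"
  have e: "e \<in> carrier (S q)" unfolding e_def using fS g(2) k(1) eS by simp
  have "theta e = theta f \<ominus>\<^bsub>C q\<^esub> theta g \<ominus>\<^bsub>C q\<^esub> k' \<otimes>\<^bsub>C q\<^esub> theta (eqn q)"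
    unfolding e_def a_minus_def using fS g(2) k eS by simp
  then have "theta e = \<zero>\<^bsub>C q\<^esub>"
    using k' k(1) eS C.r_neg[of "k' \<otimes>\<^bsub>C q\<^esub> theta (eqn q)"] by (simp add: a_minus_def)
  then have eJ: "slice e \<alpha> \<in> J" for \<alpha> using theta_zero_iff[OF e] by simp
  have ed: "e \<in> decaying 1 (vars q)" using e by (simp add: carrier_convergent)
  \<comment> \<open>The simplex exponents at which some coefficient of \<open>e\<close> has norm at
    least 1. At all others zero is already a sufficient approximation, so finitely many members of
    \<open>I\<close> are enough.\<close>
  define F where "F = (\<lambda>\<mu>. \<mu> \<circ> Inr) ` {\<mu>. 1 \<le> weight 1 (vars q) e \<mu>}"
  have fF: "finite F" unfolding F_def by (intro finite_imageI decaying_finite[OF ed]) simp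
  have Fm: "F \<subseteq> mexp {..q}"
  proof
    fix \<alpha> assume "\<alpha> \<in> F"
    then obtain \<mu> where \<mu>: "\<alpha> = \<mu> \<circ> Inr" "1 \<le> absv (e \<mu>)" by (auto simp: F_def)
    have "\<mu> \<in> mexp (vars q)"
    proof (rule ccontr)
      assume "\<mu> \<notin> mexp (vars q)"
      then show False using \<mu>(2) ps_outside[OF S_P[OF e]] by simp
    qed
    then show "\<alpha> \<in> mexp {..q}" using \<mu> by (simp add: mexp_Plus)
  qed
  have "\<exists>i\<in>I. \<forall>\<nu>. absv (slice e \<alpha> \<nu> \<ominus> i \<nu>) < 1" for \<alpha>
    using completion_ideal_approx[OF fV I eJ[of \<alpha>] zero_less_one] by metis
  then obtain i where i: "\<And>\<alpha>. i \<alpha> \<in> I" "\<And>\<alpha> \<nu>. absv (slice e \<alpha> \<nu> \<ominus> i \<alpha> \<nu>) < 1" by metis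
  define l where "l = (\<lambda>\<mu> :: 'v + nat \<Rightarrow> nat. if \<mu> \<circ> Inr \<in> F then i (\<mu> \<circ> Inr) (\<mu> \<circ> Inl) else \<zero>)"
  have lL: "l \<in> L q" unfolding l_def by (rule slices_in_L[OF fF Fm i(1)])
  have lSd: "l \<in> carrier (Sd q)" by (rule L.a_Hcarr[OF lL])
  have lS: "l \<in> carrier (S q)" by (rule Sd_S[OF lSd])
  have el: "absv (e \<mu> \<ominus> l \<mu>) < 1" for \<mu>
  proof (cases "\<mu> \<circ> Inr \<in> F")
    case True
    then show ?thesis using i(2)[of "\<mu> \<circ> Inr" "\<mu> \<circ> Inl"] sum_split[of \<mu>] by (simp add: l_def slice_def)
  next
    case False
    then have "absv (e \<mu>) < 1" by (auto simp: F_def not_le[symmetric])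
    then show ?thesis using False ps_coeff[OF S_P[OF e], of \<mu>] by (simp add: l_def a_minus_def)
  qed
  have kd: "k \<in> decaying 1 (vars q)" using k by (simp add: carrier_convergent)
  obtain t where t: "t \<in> carrier (Sd q)" "\<And>\<mu>. absv (k \<mu> \<ominus> t \<mu>) < 1"
    by (rule truncate[OF kd zero_less_one fvars]) blast
  have tS: "t \<in> carrier (S q)" by (rule Sd_S[OF t(1)])
  have minus: "(u \<ominus>\<^bsub>S q\<^esub> v) \<mu> = u \<mu> \<ominus> v \<mu>" if "v \<in> carrier (S q)" for u v \<mu>
    unfolding a_minus_def S_a_inv[OF that] S_ops ps_add ps_a_inv[OF fvars S_P[OF that]] ..
  have b1: "e \<ominus>\<^bsub>S q\<^esub> l \<in> ball q"
    using S_P[OF S.minus_closed[OF e lS]] el minus[OF lS] by (simp add: ball_def)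
  have b2: "eqn q \<otimes>\<^bsub>P q\<^esub> (k \<ominus>\<^bsub>S q\<^esub> t) \<in> ball q"
  proof (rule ball_mult)
    show "k \<ominus>\<^bsub>S q\<^esub> t \<in> ball q"
      using S_P[OF S.minus_closed[OF k(1) tS]] t(2) minus[OF tS] by (simp add: ball_def)
    show "eqn q \<in> carrier (P q)" by (rule S_P[OF eS])
    fix \<mu>
    have "eqn q \<mu> = linear_form R (Inr ` {..q}) \<mu> \<ominus> (if \<mu> = 0 then \<one> else \<zero>)"
      by (rule simplex_equation_coeff[OF fvars]) auto
    also have "absv \<dots> \<le> max (absv (linear_form R (Inr ` {..q}) \<mu>)) (absv (if \<mu> = 0 then \<one> else \<zero>))"
      unfolding a_minus_def using absv_add[of "linear_form R (Inr ` {..q}) \<mu>" "\<ominus> (if \<mu> = 0 then \<one> else \<zero>)"]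
      by (auto simp: linear_form_coeff absv_uminus split: if_splits)
    also have "\<dots> \<le> 1" using linear_form_le[of "Inr ` {..q}" \<mu>] absv_one by simp
    finally show "absv (eqn q \<mu>) \<le> 1" .
  qed
  let ?l = "l \<oplus>\<^bsub>Sd q\<^esub> t \<otimes>\<^bsub>Sd q\<^esub> eqn q"
  have lL': "?l \<in> L q" using lL L.I_l_closed[OF eqn_L t(1)] by (rule L.a_closed)
  have l'Sd: "?l \<in> carrier (Sd q)" by (rule L.a_Hcarr[OF lL'])
  \<comment> \<open>The right side shows that the element lies in the ball. On the left it is a
    difference of overconvergent series, which the right side alone would not give.\<close>
  have "f \<ominus>\<^bsub>S q\<^esub> (l \<oplus>\<^bsub>S q\<^esub> t \<otimes>\<^bsub>S q\<^esub> eqn q)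
      = g \<oplus>\<^bsub>S q\<^esub> (eqn q \<otimes>\<^bsub>S q\<^esub> (k \<ominus>\<^bsub>S q\<^esub> t)) \<oplus>\<^bsub>S q\<^esub> (e \<ominus>\<^bsub>S q\<^esub> l)"
    unfolding e_def using fS g(2) k(1) eS tS lS by algebra
  moreover have "g \<oplus>\<^bsub>P q\<^esub> (eqn q \<otimes>\<^bsub>P q\<^esub> (k \<ominus>\<^bsub>S q\<^esub> t)) \<oplus>\<^bsub>P q\<^esub> (e \<ominus>\<^bsub>S q\<^esub> l) \<in> ball q"
    by (intro ball_add g(1) b1 b2)
  ultimately have "f \<ominus>\<^bsub>S q\<^esub> (l \<oplus>\<^bsub>S q\<^esub> t \<otimes>\<^bsub>S q\<^esub> eqn q) \<in> ball q" by (simp only: S_ops)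
  moreover have "f \<ominus>\<^bsub>S q\<^esub> (l \<oplus>\<^bsub>S q\<^esub> t \<otimes>\<^bsub>S q\<^esub> eqn q) = f \<ominus>\<^bsub>Sd q\<^esub> ?l"
    using S_a_inv[OF Sd_S[OF l'Sd]] Sd_a_inv[OF l'Sd] by (simp add: a_minus_def S_ops Sd_ops)
  ultimately have b: "f \<ominus>\<^bsub>Sd q\<^esub> ?l \<in> ball q" by simp
  have fl: "f \<ominus>\<^bsub>Sd q\<^esub> ?l \<in> carrier (Sd q)" using f(1) l'Sd by (rule Sd.minus_closed)
  have "f \<ominus>\<^bsub>Sd q\<^esub> (f \<ominus>\<^bsub>Sd q\<^esub> ?l) = ?l" using f(1) l'Sd by algebra
  then have "D_coset q f = D_coset q (f \<ominus>\<^bsub>Sd q\<^esub> ?l)"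
    unfolding D_coset_def using L.coset_eq_iff[OF f(1) fl] lL' by simp
  then show ?thesis unfolding f(2) JD_def using b fl by blast
qed

end

section \<open>Stable matrices\<close>

context cring
begin

abbreviation "SM \<equiv> stable_matrices R"

definition identity_outside :: "nat \<Rightarrow> (nat \<Rightarrow> nat \<Rightarrow> 'a) \<Rightarrow> bool"
  where "identity_outside N g \<longleftrightarrow> (\<forall>i j. i \<ge> N \<or> j \<ge> N \<longrightarrow> g i j = (if i = j then \<one> else \<zero>))"

lemma SM_carrier: "g \<in> carrier SM \<longleftrightarrow> (\<forall>i j. g i j \<in> carrier R) \<and> (\<exists>N. identity_outside N g)"
  by (simp add: stable_matrices_def identity_outside_def)

lemma SM_entry: "g \<in> carrier SM \<Longrightarrow> g i j \<in> carrier R"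
  by (simp add: SM_carrier)

lemma SM_one: "\<one>\<^bsub>SM\<^esub> = (\<lambda>i j. if i = j then \<one> else \<zero>)"
  by (simp add: stable_matrices_def)

lemma identity_outside_mono: "identity_outside N g \<Longrightarrow> N \<le> M \<Longrightarrow> identity_outside M g"
  by (auto simp: identity_outside_def)

text \<open>The definition sums over the nonzero entries of a row, a set that varies with the
  matrix. A common initial range makes sums comparable and exchangeable.\<close>

lemma SM_mult:
  assumes g: "g \<in> carrier SM" and h: "h \<in> carrier SM" and N: "identity_outside N g" and i: "N \<le> M" "i < M"
  shows "(g \<otimes>\<^bsub>SM\<^esub> h) i k = (\<Oplus>j\<in>{..<M}. g i j \<otimes> h j k)"
proof -
  note [simp] = SM_entry[OF g] SM_entry[OF h]
  have "{j. g i j \<noteq> \<zero>} \<subseteq> {..<M}"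
  proof
    fix j assume "j \<in> {j. g i j \<noteq> \<zero>}"
    then have "g i j \<noteq> \<zero>" by simp
    then show "j \<in> {..<M}" using N i by (cases "j < M") (auto simp: identity_outside_def)
  qed
  then have "(\<Oplus>j\<in>{j. g i j \<noteq> \<zero>}. g i j \<otimes> h j k) = (\<Oplus>j\<in>{..<M}. g i j \<otimes> h j k)"
    by (intro finsum_superset) auto
  then show ?thesis by (simp add: stable_matrices_def)
qed

lemma SM_mult_outside:
  assumes g: "g \<in> carrier SM" and h: "h \<in> carrier SM" and N: "identity_outside N g" "identity_outside N h"
  shows "identity_outside N (g \<otimes>\<^bsub>SM\<^esub> h)"
  unfolding identity_outside_def
proof (intro allI impI)
  fix i k assume ik: "i \<ge> N \<or> k \<ge> N"
  note [simp] = SM_entry[OF g] SM_entry[OF h]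
  \<comment> \<open>Larger than both \<open>i\<close> and \<open>k\<close>, so that the only
    surviving index lies in the range in either case.\<close>
  let ?M = "Suc (N + i + k)"
  have e: "(g \<otimes>\<^bsub>SM\<^esub> h) i k = (\<Oplus>j\<in>{..<?M}. g i j \<otimes> h j k)"
    by (rule SM_mult[OF g h N(1)]) auto
  show "(g \<otimes>\<^bsub>SM\<^esub> h) i k = (if i = k then \<one> else \<zero>)"
  proof (cases "i \<ge> N")
    case True
    have "(\<Oplus>j\<in>{..<?M}. g i j \<otimes> h j k) = (\<lambda>j. g i j \<otimes> h j k) i"
      using True N by (intro finsum_single) (auto simp: identity_outside_def)
    then show ?thesis using e True N by (simp add: identity_outside_def)
  next
    case False
    then have k: "k \<ge> N" using ik by simp
    have "(\<Oplus>j\<in>{..<?M}. g i j \<otimes> h j k) = (\<lambda>j. g i j \<otimes> h j k) k"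
      using k N by (intro finsum_single) (auto simp: identity_outside_def)
    then show ?thesis using e k N by (simp add: identity_outside_def)
  qed
qed

lemma SM_mult_entry:
  assumes g: "g \<in> carrier SM" and h: "h \<in> carrier SM"
  shows "(g \<otimes>\<^bsub>SM\<^esub> h) i k \<in> carrier R"
  using SM_entry[OF g] SM_entry[OF h] by (auto simp: stable_matrices_def intro!: finsum_closed)

lemma SM_mult_closed:
  assumes g: "g \<in> carrier SM" and h: "h \<in> carrier SM"
  shows "g \<otimes>\<^bsub>SM\<^esub> h \<in> carrier SM"
proof -
  obtain N N' where "identity_outside N g" "identity_outside N' h" using g h by (auto simp: SM_carrier)
  then have "identity_outside (max N N') g" "identity_outside (max N N') h"
    by (auto intro: identity_outside_mono)
  then have "identity_outside (max N N') (g \<otimes>\<^bsub>SM\<^esub> h)" by (rule SM_mult_outside[OF g h])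
  then show ?thesis using SM_mult_entry[OF g h] by (auto simp: SM_carrier)
qed

lemma SM_one_closed: "\<one>\<^bsub>SM\<^esub> \<in> carrier SM"
  by (auto simp: SM_carrier SM_one identity_outside_def)

lemma SM_monoid: "monoid SM"
proof (rule monoidI)
  show "\<one>\<^bsub>SM\<^esub> \<in> carrier SM" by (rule SM_one_closed)
  fix g assume g: "g \<in> carrier SM"
  obtain N where N: "identity_outside N g" using g by (auto simp: SM_carrier)
  note [simp] = SM_entry[OF g]
  have o: "identity_outside N \<one>\<^bsub>SM\<^esub>" by (auto simp: SM_one identity_outside_def)
  show "\<one>\<^bsub>SM\<^esub> \<otimes>\<^bsub>SM\<^esub> g = g"
  proof (intro ext)
    fix i k
    have "(\<one>\<^bsub>SM\<^esub> \<otimes>\<^bsub>SM\<^esub> g) i k = (\<Oplus>j\<in>{..<Suc (N + i)}. \<one>\<^bsub>SM\<^esub> i j \<otimes> g j k)"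
      by (rule SM_mult[OF SM_one_closed g o]) auto
    also have "\<dots> = (\<lambda>j. \<one>\<^bsub>SM\<^esub> i j \<otimes> g j k) i"
      by (intro finsum_single) (auto simp: SM_one)
    finally show "(\<one>\<^bsub>SM\<^esub> \<otimes>\<^bsub>SM\<^esub> g) i k = g i k" by (simp add: SM_one)
  qed
  show "g \<otimes>\<^bsub>SM\<^esub> \<one>\<^bsub>SM\<^esub> = g"
  proof (intro ext)
    fix i k
    have "(g \<otimes>\<^bsub>SM\<^esub> \<one>\<^bsub>SM\<^esub>) i k = (\<Oplus>j\<in>{..<Suc (N + i + k)}. g i j \<otimes> \<one>\<^bsub>SM\<^esub> j k)"
      by (rule SM_mult[OF g SM_one_closed N]) auto
    also have "\<dots> = (\<lambda>j. g i j \<otimes> \<one>\<^bsub>SM\<^esub> j k) k"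
      by (intro finsum_single) (auto simp: SM_one)
    finally show "(g \<otimes>\<^bsub>SM\<^esub> \<one>\<^bsub>SM\<^esub>) i k = g i k" by (simp add: SM_one)
  qed
  fix h assume h: "h \<in> carrier SM"
  note [simp] = SM_entry[OF h]
  show "g \<otimes>\<^bsub>SM\<^esub> h \<in> carrier SM" by (rule SM_mult_closed[OF g h])
  fix f assume f: "f \<in> carrier SM"
  note [simp] = SM_entry[OF f]
  note gh = SM_mult_closed[OF g h] and hf = SM_mult_closed[OF h f]
  obtain N' where N': "identity_outside N' h" using h by (auto simp: SM_carrier)
  show "g \<otimes>\<^bsub>SM\<^esub> h \<otimes>\<^bsub>SM\<^esub> f = g \<otimes>\<^bsub>SM\<^esub> (h \<otimes>\<^bsub>SM\<^esub> f)"
  proof (intro ext)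
    fix i k
    define M where "M = Suc (N + N' + i)"
    have gN: "identity_outside (N + N') g" "identity_outside (N + N') h"
      using N N' by (auto intro: identity_outside_mono)
    have ghN: "identity_outside (N + N') (g \<otimes>\<^bsub>SM\<^esub> h)" by (rule SM_mult_outside[OF g h gN])
    have "(g \<otimes>\<^bsub>SM\<^esub> h \<otimes>\<^bsub>SM\<^esub> f) i k = (\<Oplus>j\<in>{..<M}. (g \<otimes>\<^bsub>SM\<^esub> h) i j \<otimes> f j k)"
      by (rule SM_mult[OF gh f ghN]) (auto simp: M_def)
    also have "\<dots> = (\<Oplus>j\<in>{..<M}. (\<Oplus>l\<in>{..<M}. g i l \<otimes> h l j) \<otimes> f j k)"
      using SM_mult[OF g h gN(1), of M i] by (intro finsum_cong') (auto simp: M_def)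
    also have "\<dots> = (\<Oplus>j\<in>{..<M}. \<Oplus>l\<in>{..<M}. g i l \<otimes> h l j \<otimes> f j k)"
      by (intro finsum_cong' finsum_ldistr) auto
    also have "\<dots> = (\<Oplus>l\<in>{..<M}. \<Oplus>j\<in>{..<M}. g i l \<otimes> h l j \<otimes> f j k)"
      by (rule finsum_swap) auto
    also have "\<dots> = (\<Oplus>l\<in>{..<M}. g i l \<otimes> (\<Oplus>j\<in>{..<M}. h l j \<otimes> f j k))"
      by (intro finsum_cong') (auto simp: finsum_rdistr m_assoc)
    also have "\<dots> = (\<Oplus>l\<in>{..<M}. g i l \<otimes> (h \<otimes>\<^bsub>SM\<^esub> f) l k)"
      using SM_mult[OF h f gN(2), of M] by (intro finsum_cong') (auto simp: M_def)
    also have "\<dots> = (g \<otimes>\<^bsub>SM\<^esub> (h \<otimes>\<^bsub>SM\<^esub> f)) i k"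
      by (rule SM_mult[OF g hf gN(1), symmetric]) (auto simp: M_def)
    finally show "(g \<otimes>\<^bsub>SM\<^esub> h \<otimes>\<^bsub>SM\<^esub> f) i k = (g \<otimes>\<^bsub>SM\<^esub> (h \<otimes>\<^bsub>SM\<^esub> f)) i k" .
  qed
qed

text \<open>Supplies the finite set of multipliers against which approximation errors are
  controlled.\<close>

lemma SM_finite_entries:
  assumes "g \<in> carrier SM"
  shows "finite {g i j | i j. True}"
proof -
  obtain N where N: "identity_outside N g" using assms by (auto simp: SM_carrier)
  have "{g i j | i j. True} \<subseteq> (\<lambda>(i, j). g i j) ` ({..<N} \<times> {..<N}) \<union> {\<one>, \<zero>}"
  proof
    fix x assume "x \<in> {g i j | i j. True}"
    then obtain i j where x: "x = g i j" by blast
    show "x \<in> (\<lambda>(i, j). g i j) ` ({..<N} \<times> {..<N}) \<union> {\<one>, \<zero>}"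
      using x N by (cases "i < N \<and> j < N") (auto simp: identity_outside_def)
  qed
  then show ?thesis by (rule finite_subset) simp
qed

end

lemma map_matrix_hom:
  assumes S: "cring S" and T: "cring T" and h: "h \<in> ring_hom S T"
  shows "map_matrix h \<in> hom (stable_matrices S) (stable_matrices T)"
    "map_matrix h \<one>\<^bsub>stable_matrices S\<^esub> = \<one>\<^bsub>stable_matrices T\<^esub>"
proof -
  interpret S: cring S by fact
  interpret T: cring T by fact
  interpret h: ring_hom_cring S T h using assms by (rule cring_hom)
  have out: "T.identity_outside N (map_matrix h g)" if "S.identity_outside N g" for N g
    using that by (simp add: S.identity_outside_def T.identity_outside_def map_matrix_def)
  have cl: "map_matrix h g \<in> carrier (stable_matrices T)" if "g \<in> carrier (stable_matrices S)" for g
    using that out by (auto simp: S.SM_carrier T.SM_carrier map_matrix_def)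
  show "map_matrix h \<in> hom (stable_matrices S) (stable_matrices T)"
  proof (rule homI)
    fix g assume g: "g \<in> carrier (stable_matrices S)"
    show "map_matrix h g \<in> carrier (stable_matrices T)" by (rule cl[OF g])
    fix g' assume g': "g' \<in> carrier (stable_matrices S)"
    note [simp] = S.SM_entry[OF g] S.SM_entry[OF g']
    obtain N where N: "S.identity_outside N g" using g by (auto simp: S.SM_carrier)
    show "map_matrix h (g \<otimes>\<^bsub>stable_matrices S\<^esub> g') = map_matrix h g \<otimes>\<^bsub>stable_matrices T\<^esub> map_matrix h g'"
    proof (intro ext)
      fix i k
      let ?M = "Suc (N + i)"
      have "map_matrix h (g \<otimes>\<^bsub>stable_matrices S\<^esub> g') i k = h (\<Oplus>\<^bsub>S\<^esub>j\<in>{..<?M}. g i j \<otimes>\<^bsub>S\<^esub> g' j k)"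
        using S.SM_mult[OF g g' N, of ?M i k] by (simp add: map_matrix_def)
      also have "\<dots> = (\<Oplus>\<^bsub>T\<^esub>j\<in>{..<?M}. map_matrix h g i j \<otimes>\<^bsub>T\<^esub> map_matrix h g' j k)"
        by (subst h.hom_finsum) (auto simp: map_matrix_def o_def)
      also have "\<dots> = (map_matrix h g \<otimes>\<^bsub>stable_matrices T\<^esub> map_matrix h g') i k"
        by (rule T.SM_mult[OF cl[OF g] cl[OF g'] out[OF N], symmetric]) auto
      finally show "map_matrix h (g \<otimes>\<^bsub>stable_matrices S\<^esub> g') i k =
        (map_matrix h g \<otimes>\<^bsub>stable_matrices T\<^esub> map_matrix h g') i k" .
    qed
  qed
  show "map_matrix h \<one>\<^bsub>stable_matrices S\<^esub> = \<one>\<^bsub>stable_matrices T\<^esub>"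
    by (auto simp: map_matrix_def S.SM_one T.SM_one fun_eq_iff)
qed

lemma GL_group: "cring S \<Longrightarrow> group (GL S)"
  unfolding GL_def by (rule monoid.units_group[OF cring.SM_monoid])

lemma GL_mult: "g \<otimes>\<^bsub>GL S\<^esub> h = g \<otimes>\<^bsub>stable_matrices S\<^esub> h" and GL_one: "\<one>\<^bsub>GL S\<^esub> = \<one>\<^bsub>stable_matrices S\<^esub>"
  by (simp_all add: GL_def units_of_def)

lemma GL_carrier: "g \<in> carrier (GL S) \<longleftrightarrow> g \<in> carrier (stable_matrices S) \<and>
    (\<exists>h\<in>carrier (stable_matrices S). h \<otimes>\<^bsub>stable_matrices S\<^esub> g = \<one>\<^bsub>stable_matrices S\<^esub> \<and>
      g \<otimes>\<^bsub>stable_matrices S\<^esub> h = \<one>\<^bsub>stable_matrices S\<^esub>)"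
  by (simp add: GL_def units_of_def Units_def)

lemma GL_hom:
  assumes S: "cring S" and T: "cring T" and h: "h \<in> ring_hom S T"
  shows "map_matrix h \<in> hom (GL S) (GL T)"
proof -
  note m = map_matrix_hom[OF assms]
  note c = hom_in_carrier[OF m(1)] and x = hom_mult[OF m(1)]
  show ?thesis
  proof (rule homI)
    fix g assume "g \<in> carrier (GL S)"
    then obtain g' where g: "g \<in> carrier (stable_matrices S)" "g' \<in> carrier (stable_matrices S)"
      "g' \<otimes>\<^bsub>stable_matrices S\<^esub> g = \<one>\<^bsub>stable_matrices S\<^esub>" "g \<otimes>\<^bsub>stable_matrices S\<^esub> g' = \<one>\<^bsub>stable_matrices S\<^esub>"
      by (auto simp: GL_carrier)
    show "map_matrix h g \<in> carrier (GL T)"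
      unfolding GL_carrier using c[OF g(1)] c[OF g(2)] x[OF g(2,1)] x[OF g(1,2)] g(3,4) m(2)
      by (intro conjI bexI[of _ "map_matrix h g'"]) simp_all
  next
    fix g g' assume "g \<in> carrier (GL S)" "g' \<in> carrier (GL S)"
    then show "map_matrix h (g \<otimes>\<^bsub>GL S\<^esub> g') = map_matrix h g \<otimes>\<^bsub>GL T\<^esub> map_matrix h g'"
      unfolding GL_mult by (intro x) (auto simp: GL_carrier)
  qed
qed

text \<open>\<open>J\<close> is a subring without unit rather than an ideal. The last axiom says
  \<open>(1 + x)(1 + y) = 1\<close>, so that \<open>1 + J\<close> is a group under
  multiplication.\<close>

locale quasi_regular = cring R for R (structure) +
  fixes J
  assumes J_subset: "J \<subseteq> carrier R" and J_zero: "\<zero> \<in> J"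
    and J_add: "x \<in> J \<Longrightarrow> y \<in> J \<Longrightarrow> x \<oplus> y \<in> J"
    and J_uminus: "x \<in> J \<Longrightarrow> \<ominus> x \<in> J"
    and J_mult: "x \<in> J \<Longrightarrow> y \<in> J \<Longrightarrow> x \<otimes> y \<in> J"
    and J_quasi: "x \<in> J \<Longrightarrow> \<exists>y\<in>J. x \<oplus> y \<oplus> x \<otimes> y = \<zero>"
begin

lemma J_carr: "x \<in> J \<Longrightarrow> x \<in> carrier R"
  using J_subset by blast

lemma J_finsum: "finite B \<Longrightarrow> (\<And>b. b \<in> B \<Longrightarrow> f b \<in> J) \<Longrightarrow> (\<Oplus>b\<in>B. f b) \<in> J"
proof (induction B rule: finite_induct)
  case (insert x B)
  then have "(\<Oplus>b\<in>insert x B. f b) = f x \<oplus> (\<Oplus>b\<in>B. f b)" by (intro finsum_insert) (auto intro: J_carr)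
  then show ?case using insert J_add by simp
qed (simp add: J_zero)

definition congruent_one :: "(nat \<Rightarrow> nat \<Rightarrow> 'a) set"
  where "congruent_one = {g \<in> carrier SM. \<forall>i j. g i j \<ominus> (if i = j then \<one> else \<zero>) \<in> J}"

lemma congruent_one_SM: "g \<in> congruent_one \<Longrightarrow> g \<in> carrier SM"
  by (simp add: congruent_one_def)

lemma congruent_one_entry:
  assumes "g \<in> congruent_one"
  shows "\<exists>x\<in>J. g i j = (if i = j then \<one> else \<zero>) \<oplus> x"
proof (rule bexI)
  show "g i j \<ominus> (if i = j then \<one> else \<zero>) \<in> J" using assms by (simp add: congruent_one_def)
  have "g i j \<in> carrier R" using assms by (auto simp: congruent_one_def SM_entry)
  then show "g i j = (if i = j then \<one> else \<zero>) \<oplus> (g i j \<ominus> (if i = j then \<one> else \<zero>))"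
    by (auto simp: a_minus_def a_ac r_neg)
qed

lemma congruent_oneI:
  assumes "g \<in> carrier SM" "\<And>i j. \<exists>x\<in>J. g i j = (if i = j then \<one> else \<zero>) \<oplus> x"
  shows "g \<in> congruent_one"
proof -
  have "g i j \<ominus> (if i = j then \<one> else \<zero>) \<in> J" for i j
  proof -
    obtain x where x: "x \<in> J" "g i j = (if i = j then \<one> else \<zero>) \<oplus> x" using assms(2) by blast
    have "g i j \<ominus> (if i = j then \<one> else \<zero>) = x"
      using J_carr[OF x(1)] unfolding x(2) by (auto simp: a_minus_def a_ac r_neg)
    then show ?thesis using x(1) by simp
  qed
  then show ?thesis using assms(1) by (simp add: congruent_one_def)
qed

lemma congruent_one_one: "\<one>\<^bsub>SM\<^esub> \<in> congruent_one"
  using SM_one_closed J_zero by (intro congruent_oneI bexI[of _ \<zero>]) (auto simp: SM_one)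

lemma congruent_one_mult:
  assumes g: "g \<in> congruent_one" and h: "h \<in> congruent_one"
  shows "g \<otimes>\<^bsub>SM\<^esub> h \<in> congruent_one"
proof (rule congruent_oneI)
  note gS = congruent_one_SM[OF g] and hS = congruent_one_SM[OF h]
  note [simp] = SM_entry[OF gS] SM_entry[OF hS]
  show "g \<otimes>\<^bsub>SM\<^esub> h \<in> carrier SM" using gS hS by (rule SM_mult_closed)
  fix i k
  obtain N where N: "identity_outside N g" using gS by (auto simp: SM_carrier)
  define M where "M = Suc (N + i + k)"
  define x where "x j = g i j \<ominus> (if i = j then \<one> else \<zero>)" for j
  have x: "x j \<in> J" "g i j = (if i = j then \<one> else \<zero>) \<oplus> x j" for j
    using g SM_entry[OF gS, of i j] by (auto simp: x_def congruent_one_def a_minus_def a_ac r_neg)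
  note xc [simp] = J_carr[OF x(1)]
  obtain y where y: "y \<in> J" "h i k = (if i = k then \<one> else \<zero>) \<oplus> y" using congruent_one_entry[OF h] by blast
  \<comment> \<open>\<open>J\<close> need not absorb arbitrary ring elements, so the entry of
    \<open>h\<close> is split into the entry of the identity and a member of
    \<open>J\<close>.\<close>
  have J: "x j \<otimes> h j k \<in> J" for j
  proof -
    obtain z where z: "z \<in> J" "h j k = (if j = k then \<one> else \<zero>) \<oplus> z" using congruent_one_entry[OF h] by blast
    have "x j \<otimes> h j k = (if j = k then x j else \<zero>) \<oplus> x j \<otimes> z"
      using J_carr[OF z(1)] unfolding z(2) by (simp add: r_distr)
    then show ?thesis using x(1) z(1) J_mult J_add J_zero by simp
  qed
  have "(g \<otimes>\<^bsub>SM\<^esub> h) i k = (\<Oplus>j\<in>{..<M}. g i j \<otimes> h j k)"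
    by (rule SM_mult[OF gS hS N]) (auto simp: M_def)
  also have "\<dots> = (\<Oplus>j\<in>{..<M}. (if i = j then \<one> else \<zero>) \<otimes> h j k \<oplus> x j \<otimes> h j k)"
  proof (intro finsum_cong' refl)
    fix j
    have "g i j \<otimes> h j k = ((if i = j then \<one> else \<zero>) \<oplus> x j) \<otimes> h j k" using x(2)[of j] by simp
    then show "g i j \<otimes> h j k = (if i = j then \<one> else \<zero>) \<otimes> h j k \<oplus> x j \<otimes> h j k"
      by (simp add: l_distr)
  qed auto
  also have "\<dots> = (\<Oplus>j\<in>{..<M}. (if i = j then \<one> else \<zero>) \<otimes> h j k) \<oplus> (\<Oplus>j\<in>{..<M}. x j \<otimes> h j k)"
    by (rule finsum_addf) auto
  also have "(\<Oplus>j\<in>{..<M}. (if i = j then \<one> else \<zero>) \<otimes> h j k) = (\<lambda>j. (if i = j then \<one> else \<zero>) \<otimes> h j k) i"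
    by (rule finsum_single) (auto simp: M_def)
  finally have "(g \<otimes>\<^bsub>SM\<^esub> h) i k = (if i = k then \<one> else \<zero>) \<oplus> (y \<oplus> (\<Oplus>j\<in>{..<M}. x j \<otimes> h j k))"
    using J_carr[OF y(1)] y(2) J_carr[OF J_finsum[of "{..<M}" "\<lambda>j. x j \<otimes> h j k"]] J by (simp add: a_assoc)
  moreover have "y \<oplus> (\<Oplus>j\<in>{..<M}. x j \<otimes> h j k) \<in> J" using y(1) J by (intro J_add J_finsum) auto
  ultimately show "\<exists>x\<in>J. (g \<otimes>\<^bsub>SM\<^esub> h) i k = (if i = k then \<one> else \<zero>) \<oplus> x" by blast
qed

text \<open>One step of Gaussian elimination. The pivot \<open>1 + x\<close> with \<open>x\<close>
  in \<open>J\<close> is a unit, so no pivot has to be searched, and the elementary matrix used is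
  itself congruent to 1.\<close>

lemma clear_column:
  assumes g: "g \<in> congruent_one" and N: "identity_outside N g" and c: "c < N"
    and cols: "\<And>i j. j < c \<Longrightarrow> g i j = (if i = j then \<one> else \<zero>)"
  obtains e where "e \<in> congruent_one" "identity_outside N (e \<otimes>\<^bsub>SM\<^esub> g)"
    "\<And>i j. j < Suc c \<Longrightarrow> (e \<otimes>\<^bsub>SM\<^esub> g) i j = (if i = j then \<one> else \<zero>)"
proof -
  note gS = congruent_one_SM[OF g]
  note [simp] = SM_entry[OF gS]
  obtain x where x: "x \<in> J" "g c c = \<one> \<oplus> x" using congruent_one_entry[OF g, of c c] by auto
  obtain y where y: "y \<in> J" "x \<oplus> y \<oplus> x \<otimes> y = \<zero>" using J_quasi[OF x(1)] by blast
  note [simp] = J_carr[OF x(1)] J_carr[OF y(1)]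
  define a where "a = \<one> \<oplus> y"
  have a [simp]: "a \<in> carrier R" by (simp add: a_def)
  have "a \<otimes> g c c = \<one> \<oplus> (x \<oplus> y \<oplus> x \<otimes> y)"
    unfolding a_def x(2) by (simp add: l_distr r_distr a_ac m_comm)
  then have ag: "a \<otimes> g c c = \<one>" using y(2) by simp
  \<comment> \<open>The identity except in column \<open>c\<close>, where it scales the pivot row by
    the inverse \<open>a\<close> of the pivot and subtracts the multiples that clear the other
    entries of the column.\<close>
  define e where "e i j = (if j = c then (if i = c then a else \<ominus> (g i c \<otimes> a)) else if i = j then \<one> else \<zero>)" for i j
  have ec [simp]: "e i j \<in> carrier R" for i j by (simp add: e_def)
  have gic: "g i c \<in> J" if "i \<noteq> c" for i
    using congruent_one_entry[OF g, of i c] that J_carr by auto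
  have eN: "identity_outside N e"
    unfolding identity_outside_def
  proof (intro allI impI)
    fix i j assume ij: "i \<ge> N \<or> j \<ge> N"
    have "g i c = \<zero>" if "i \<ge> N" using N that c by (auto simp: identity_outside_def)
    then show "e i j = (if i = j then \<one> else \<zero>)" using ij c by (auto simp: e_def)
  qed
  have eS: "e \<in> carrier SM" using eN by (auto simp: SM_carrier)
  have eK: "e \<in> congruent_one"
  proof (rule congruent_oneI[OF eS])
    fix i j
    show "\<exists>x\<in>J. e i j = (if i = j then \<one> else \<zero>) \<oplus> x"
    proof (cases "j = c")
      case True
      show ?thesis
      proof (cases "i = c")
        case False
        have "g i c \<otimes> a = g i c \<oplus> g i c \<otimes> y" by (simp add: a_def r_distr)
        then have "\<ominus> (g i c \<otimes> a) \<in> J" using gic[OF False] y(1) J_mult J_add J_uminus by simp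
        then show ?thesis using True False by (intro bexI[of _ "\<ominus> (g i c \<otimes> a)"]) (auto simp: e_def)
      qed (use True y(1) in \<open>auto simp: e_def a_def\<close>)
    qed (auto simp: e_def intro!: bexI[of _ \<zero>] J_zero)
  qed
  have eg: "(e \<otimes>\<^bsub>SM\<^esub> g) i j = (if i = c then a \<otimes> g c j else g i j \<ominus> g i c \<otimes> a \<otimes> g c j)" for i j
  proof -
    let ?M = "Suc (N + i)"
    have "(e \<otimes>\<^bsub>SM\<^esub> g) i j = (\<Oplus>l\<in>{..<?M}. e i l \<otimes> g l j)" by (rule SM_mult[OF eS gS eN]) auto
    also have "\<dots> = (\<Oplus>l\<in>{i, c}. e i l \<otimes> g l j)"
      using c by (intro finsum_superset[symmetric]) (auto simp: e_def)
    also have "\<dots> = (if i = c then a \<otimes> g c j else g i j \<ominus> g i c \<otimes> a \<otimes> g c j)"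
      by (cases "i = c") (auto simp: e_def a_minus_def l_minus)
    finally show ?thesis .
  qed
  have "(e \<otimes>\<^bsub>SM\<^esub> g) i j = (if i = j then \<one> else \<zero>)" if j: "j < Suc c" for i j
  proof (cases "j = c")
    case True
    have "g i c \<otimes> a \<otimes> g c c = g i c" using ag by (simp add: m_assoc)
    then show ?thesis using True ag by (auto simp: eg a_minus_def r_neg)
  next
    case False
    then have "j < c" using j by simp
    then show ?thesis using cols[of j] by (auto simp: eg a_minus_def)
  qed
  then show ?thesis using that[OF eK SM_mult_outside[OF eS gS eN N]] by blast
qed

text \<open>Columns are cleared from the left. The induction is on the number \<open>k\<close> of
  columns still to be treated, inside a block of fixed size \<open>N\<close>; for
  \<open>k = N\<close> nothing is required of the columns.\<close>

lemma congruent_one_left_inverse: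
  assumes "g \<in> congruent_one"
  obtains h where "h \<in> congruent_one" "h \<otimes>\<^bsub>SM\<^esub> g = \<one>\<^bsub>SM\<^esub>"
proof -
  interpret SM: monoid SM by (rule SM_monoid)
  obtain N where N: "identity_outside N g" using congruent_one_SM[OF assms] by (auto simp: SM_carrier)
  have "\<exists>h\<in>congruent_one. h \<otimes>\<^bsub>SM\<^esub> g = \<one>\<^bsub>SM\<^esub>"
    if "g \<in> congruent_one" "identity_outside N g" "\<And>i j. j < N - k \<Longrightarrow> g i j = (if i = j then \<one> else \<zero>)" for g k
    using that
  proof (induction k arbitrary: g)
    case 0
    have "g i j = (if i = j then \<one> else \<zero>)" for i j
      using 0 by (cases "j < N") (auto simp: identity_outside_def)
    then have "g = \<one>\<^bsub>SM\<^esub>" by (simp add: SM_one fun_eq_iff)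
    then show ?case using congruent_one_one by (intro bexI[of _ "\<one>\<^bsub>SM\<^esub>"]) auto
  next
    case (Suc k)
    show ?case
    proof (cases "k < N")
      case True
      then have c: "N - Suc k < N" "Suc (N - Suc k) = N - k" by auto
      obtain e where e: "e \<in> congruent_one" "identity_outside N (e \<otimes>\<^bsub>SM\<^esub> g)"
        "\<And>i j. j < Suc (N - Suc k) \<Longrightarrow> (e \<otimes>\<^bsub>SM\<^esub> g) i j = (if i = j then \<one> else \<zero>)"
        using clear_column[OF Suc.prems(1,2) c(1) Suc.prems(3)] by blast
      have "e \<otimes>\<^bsub>SM\<^esub> g \<in> congruent_one" using e(1) Suc.prems(1) by (rule congruent_one_mult)
      from Suc.IH[OF this e(2)] e(3) c(2)
      obtain h where h: "h \<in> congruent_one" "h \<otimes>\<^bsub>SM\<^esub> (e \<otimes>\<^bsub>SM\<^esub> g) = \<one>\<^bsub>SM\<^esub>" by auto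
      have "(h \<otimes>\<^bsub>SM\<^esub> e) \<otimes>\<^bsub>SM\<^esub> g = \<one>\<^bsub>SM\<^esub>"
        using h e(1) Suc.prems(1) SM.m_assoc congruent_one_SM by simp
      then show ?thesis using congruent_one_mult[OF h(1) e(1)] by blast
    next
      case False
      \<comment> \<open>Here \<open>k\<close> is at least \<open>N\<close>, and both truncated
        differences are zero.\<close>
      then have "N - Suc k = N - k" by simp
      then show ?thesis using Suc.IH[OF Suc.prems(1,2)] Suc.prems(3) by simp
    qed
  qed
  from this[OF assms N, of N] show ?thesis using that by auto
qed

text \<open>The left inverse has a left inverse of its own, which must then be \<open>g\<close>;
  hence the inverse is two-sided.\<close>

lemma congruent_one_inverse:
  assumes g: "g \<in> congruent_one"
  obtains h where "h \<in> congruent_one" "h \<otimes>\<^bsub>SM\<^esub> g = \<one>\<^bsub>SM\<^esub>" "g \<otimes>\<^bsub>SM\<^esub> h = \<one>\<^bsub>SM\<^esub>"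
proof -
  interpret SM: monoid SM by (rule SM_monoid)
  obtain h where h: "h \<in> congruent_one" "h \<otimes>\<^bsub>SM\<^esub> g = \<one>\<^bsub>SM\<^esub>" using congruent_one_left_inverse[OF g] .
  obtain k where k: "k \<in> congruent_one" "k \<otimes>\<^bsub>SM\<^esub> h = \<one>\<^bsub>SM\<^esub>" using congruent_one_left_inverse[OF h(1)] .
  note S = congruent_one_SM[OF g] congruent_one_SM[OF h(1)] congruent_one_SM[OF k(1)]
  have "k = k \<otimes>\<^bsub>SM\<^esub> (h \<otimes>\<^bsub>SM\<^esub> g)" using S h by simp
  also have "\<dots> = g" using S k(2) by (simp add: SM.m_assoc[symmetric])
  finally show ?thesis using that h k by simp
qed

lemma congruent_one_GL: "congruent_one \<subseteq> carrier (GL R)"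
proof
  fix g assume g: "g \<in> congruent_one"
  then obtain h where "h \<in> congruent_one" "h \<otimes>\<^bsub>SM\<^esub> g = \<one>\<^bsub>SM\<^esub>" "g \<otimes>\<^bsub>SM\<^esub> h = \<one>\<^bsub>SM\<^esub>"
    by (rule congruent_one_inverse)
  then show "g \<in> carrier (GL R)" using g congruent_one_SM by (auto simp: GL_carrier)
qed

lemma congruent_one_subgroup: "subgroup congruent_one (GL R)"
proof -
  interpret G: group "GL R" by (rule GL_group[OF cring_axioms])
  show ?thesis
  proof (rule G.subgroupI)
    show "congruent_one \<subseteq> carrier (GL R)" by (rule congruent_one_GL)
    show "congruent_one \<noteq> {}" using congruent_one_one by blast
    fix g assume g: "g \<in> congruent_one"
    then obtain h where h: "h \<in> congruent_one" "h \<otimes>\<^bsub>SM\<^esub> g = \<one>\<^bsub>SM\<^esub>" "g \<otimes>\<^bsub>SM\<^esub> h = \<one>\<^bsub>SM\<^esub>"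
      by (rule congruent_one_inverse)
    then have "inv\<^bsub>GL R\<^esub> g = h"
      using congruent_one_GL g by (intro G.inv_equality) (auto simp: GL_mult GL_one)
    then show "inv\<^bsub>GL R\<^esub> g \<in> congruent_one" using h by simp
    fix h assume "h \<in> congruent_one"
    then show "g \<otimes>\<^bsub>GL R\<^esub> h \<in> congruent_one" unfolding GL_mult by (rule congruent_one_mult[OF g])
  qed
qed

end

section \<open>Simplicial groups\<close>

definition codegeneracy :: "nat \<Rightarrow> nat \<Rightarrow> nat"
  where "codegeneracy j k = (if k \<le> j then k else k - 1)"

lemma coface_range: "i \<le> Suc n \<Longrightarrow> coface i ` {..n} \<subseteq> {..Suc n}"
  by (auto simp: coface_def)

lemma codegeneracy_range: "j \<le> n \<Longrightarrow> codegeneracy j ` {..Suc n} \<subseteq> {..n}"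
  by (auto simp: codegeneracy_def)

text \<open>All maps of vertices act on the simplicial objects at hand, not only the increasing ones.\<close>

locale simplicial_group =
  fixes G :: "nat \<Rightarrow> 'g monoid" and act :: "nat \<Rightarrow> nat \<Rightarrow> (nat \<Rightarrow> nat) \<Rightarrow> 'g \<Rightarrow> 'g"
  assumes group: "group (G q)"
    and act_hom: "\<phi> ` {..q} \<subseteq> {..r} \<Longrightarrow> act q r \<phi> \<in> hom (G r) (G q)"
    and act_act: "\<phi> ` {..q} \<subseteq> {..r} \<Longrightarrow> \<psi> ` {..r} \<subseteq> {..s} \<Longrightarrow> x \<in> carrier (G s)
      \<Longrightarrow> act q r \<phi> (act r s \<psi> x) = act q s (\<psi> \<circ> \<phi>) x"
    and act_id: "(\<And>j. j \<le> q \<Longrightarrow> \<phi> j = j) \<Longrightarrow> x \<in> carrier (G q) \<Longrightarrow> act q q \<phi> x = x"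
    and act_cong: "(\<And>j. j \<le> q \<Longrightarrow> \<phi> j = \<psi> j) \<Longrightarrow> \<phi> ` {..q} \<subseteq> {..r} \<Longrightarrow> x \<in> carrier (G r)
      \<Longrightarrow> act q r \<phi> x = act q r \<psi> x"
begin

abbreviation "face n i \<equiv> act n (Suc n) (coface i)"
abbreviation "degen n j \<equiv> act (Suc n) n (codegeneracy j)"

lemma act_hom': "\<phi> ` {..q} \<subseteq> {..r} \<Longrightarrow> group_hom (G r) (G q) (act q r \<phi>)"
  by (simp add: group_hom_def group_hom_axioms_def group act_hom)

lemma face_hom: "i \<le> Suc n \<Longrightarrow> group_hom (G (Suc n)) (G n) (face n i)"
  by (rule act_hom'[OF coface_range])

lemma degen_hom: "j \<le> n \<Longrightarrow> group_hom (G n) (G (Suc n)) (degen n j)"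
  by (rule act_hom'[OF codegeneracy_range])

text \<open>Two composites with the same underlying map of vertices agree. The simplicial identities
  thereby reduce to arithmetic on vertices.\<close>

lemma act_square:
  assumes "\<phi> ` {..q} \<subseteq> {..r}" "\<psi> ` {..r} \<subseteq> {..s}" "\<phi>' ` {..q} \<subseteq> {..r'}" "\<psi>' ` {..r'} \<subseteq> {..s}"
    and "\<And>j. j \<le> q \<Longrightarrow> \<psi> (\<phi> j) = \<psi>' (\<phi>' j)" and x: "x \<in> carrier (G s)"
  shows "act q r \<phi> (act r s \<psi> x) = act q r' \<phi>' (act r' s \<psi>' x)"
proof -
  have "(\<psi> \<circ> \<phi>) ` {..q} \<subseteq> {..s}" using assms(1,2) by auto
  then have "act q s (\<psi> \<circ> \<phi>) x = act q s (\<psi>' \<circ> \<phi>') x"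
    using assms(5) x by (intro act_cong) auto
  then show ?thesis using assms by (simp add: act_act)
qed

lemma face_face:
  assumes "i < j" "j \<le> Suc (Suc n)" "x \<in> carrier (G (Suc (Suc n)))"
  shows "face n i (face (Suc n) j x) = face n (j - 1) (face (Suc n) i x)"
  using assms by (intro act_square coface_range) (auto simp: coface_def)

lemma face_degen:
  assumes "i = j \<or> i = Suc j" "j \<le> n" "x \<in> carrier (G n)"
  shows "face n i (degen n j x) = x"
proof -
  have "(codegeneracy j \<circ> coface i) ` {..n} \<subseteq> {..n}" using assms by (auto simp: codegeneracy_def coface_def)
  moreover have "face n i (degen n j x) = act n n (codegeneracy j \<circ> coface i) x"
    using assms by (intro act_act coface_range codegeneracy_range) auto
  ultimately show ?thesis using assms by (subst act_id[symmetric, of n "codegeneracy j \<circ> coface i"]) (auto simp: codegeneracy_def coface_def)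
qed

lemma face_degen_less:
  assumes "i < j" "j \<le> Suc n" "x \<in> carrier (G (Suc n))"
  shows "face (Suc n) i (degen (Suc n) j x) = degen n (j - 1) (face n i x)"
  using assms by (intro act_square coface_range codegeneracy_range) (auto simp: coface_def codegeneracy_def)

lemma face_degen_greater:
  assumes "Suc j < i" "i \<le> Suc (Suc n)" "x \<in> carrier (G (Suc n))"
  shows "face (Suc n) i (degen (Suc n) j x) = degen n j (face n (i - 1) x)"
  using assms by (intro act_square coface_range codegeneracy_range) (auto simp: coface_def codegeneracy_def)

lemma spheres_carrier: "x \<in> spheres G act n \<Longrightarrow> x \<in> carrier (G n)"
  by (simp add: spheres_def)

lemma spheresD: "x \<in> spheres G act (Suc n) \<Longrightarrow> i \<le> Suc n \<Longrightarrow> face n i x = \<one>\<^bsub>G n\<^esub>"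
  by (simp add: spheres_def)

lemma spheres_subgroup: "subgroup (spheres G act n) (G n)"
proof -
  interpret G: group "G n" by (rule group)
  show ?thesis
  proof (cases n)
    case 0
    then show ?thesis using G.subgroup_self by (simp add: spheres_def)
  next
    case (Suc m)
    interpret Gm: group "G m" by (rule group)
    have h: "group_hom (G n) (G m) (face m i)" if "i \<le> n" for i using face_hom that Suc by simp
    show ?thesis
    proof (rule G.subgroupI)
      show "spheres G act n \<subseteq> carrier (G n)" by (auto simp: spheres_def)
      show "spheres G act n \<noteq> {}"
        using group_hom.hom_one[OF h] G.one_closed Suc by (auto simp: spheres_def intro!: exI[of _ "\<one>\<^bsub>G n\<^esub>"])
      fix x assume x: "x \<in> spheres G act n"
      then show "inv\<^bsub>G n\<^esub> x \<in> spheres G act n"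
        using group_hom.hom_inv[OF h] G.inv_closed[of x] Suc by (auto simp: spheres_def)
      fix y assume "y \<in> spheres G act n"
      then show "x \<otimes>\<^bsub>G n\<^esub> y \<in> spheres G act n"
        using x hom_mult[OF group_hom.homh[OF h]] G.m_closed[of x y] Suc by (auto simp: spheres_def)
    qed
  qed
qed

abbreviation "rel n \<equiv> sphere_homotopy G act n"

lemma relI:
  assumes "x \<in> spheres G act n" "y \<in> spheres G act n" "z \<in> carrier (G (Suc n))"
    "\<And>i. i < n \<Longrightarrow> face n i z = \<one>\<^bsub>G n\<^esub>" "face n n z = x" "face n (Suc n) z = y"
  shows "(x, y) \<in> rel n"
  using assms by (auto simp: sphere_homotopy_def)

lemma relE:
  assumes "(x, y) \<in> rel n"
  obtains z where "x \<in> spheres G act n" "y \<in> spheres G act n" "z \<in> carrier (G (Suc n))"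
    "\<And>i. i < n \<Longrightarrow> face n i z = \<one>\<^bsub>G n\<^esub>" "face n n z = x" "face n (Suc n) z = y"
  using assms by (auto simp: sphere_homotopy_def)

text \<open>The last degeneracy is a homotopy: its two top faces are \<open>x\<close>, and the
  others are degeneracies of trivial faces.\<close>

lemma rel_refl:
  assumes x: "x \<in> spheres G act n"
  shows "(x, x) \<in> rel n"
proof (rule relI[OF x x])
  note xc = spheres_carrier[OF x]
  show "degen n n x \<in> carrier (G (Suc n))" using group_hom.hom_closed[OF degen_hom xc] by simp
  show "face n n (degen n n x) = x" "face n (Suc n) (degen n n x) = x" using xc by (auto intro: face_degen)
  fix i assume i: "i < n"
  then obtain m where n: "n = Suc m" by (cases n) auto
  have "face n i (degen n n x) = degen m m (face m i x)"
    using face_degen_less[of i n m x] i xc by (simp add: n)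
  also have "\<dots> = \<one>\<^bsub>G n\<^esub>" using spheresD[of x m i] x i n group_hom.hom_one[OF degen_hom[of m m]] by simp
  finally show "face n i (degen n n x) = \<one>\<^bsub>G n\<^esub>" .
qed

lemma rel_mult:
  assumes "(x, y) \<in> rel n" "(x', y') \<in> rel n"
  shows "(x \<otimes>\<^bsub>G n\<^esub> x', y \<otimes>\<^bsub>G n\<^esub> y') \<in> rel n"
proof -
  interpret S: subgroup "spheres G act n" "G n" by (rule spheres_subgroup)
  interpret G: group "G n" by (rule group)
  interpret G': group "G (Suc n)" by (rule group)
  obtain z where z: "x \<in> spheres G act n" "y \<in> spheres G act n" "z \<in> carrier (G (Suc n))"
    "\<And>i. i < n \<Longrightarrow> face n i z = \<one>\<^bsub>G n\<^esub>" "face n n z = x" "face n (Suc n) z = y" by (rule relE[OF assms(1)]) blast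
  obtain z' where z': "x' \<in> spheres G act n" "y' \<in> spheres G act n" "z' \<in> carrier (G (Suc n))"
    "\<And>i. i < n \<Longrightarrow> face n i z' = \<one>\<^bsub>G n\<^esub>" "face n n z' = x'" "face n (Suc n) z' = y'" by (rule relE[OF assms(2)]) blast
  have f: "face n i (z \<otimes>\<^bsub>G (Suc n)\<^esub> z') = face n i z \<otimes>\<^bsub>G n\<^esub> face n i z'" if "i \<le> Suc n" for i
    using hom_mult[OF group_hom.homh[OF face_hom[OF that]]] z(3) z'(3) by simp
  show ?thesis
    using z z' f by (intro relI[where z = "z \<otimes>\<^bsub>G (Suc n)\<^esub> z'"]) auto
qed

lemma rel_inv:
  assumes "(x, y) \<in> rel n"
  shows "(inv\<^bsub>G n\<^esub> x, inv\<^bsub>G n\<^esub> y) \<in> rel n"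
proof -
  interpret S: subgroup "spheres G act n" "G n" by (rule spheres_subgroup)
  interpret G: group "G n" by (rule group)
  interpret G': group "G (Suc n)" by (rule group)
  obtain z where z: "x \<in> spheres G act n" "y \<in> spheres G act n" "z \<in> carrier (G (Suc n))"
    "\<And>i. i < n \<Longrightarrow> face n i z = \<one>\<^bsub>G n\<^esub>" "face n n z = x" "face n (Suc n) z = y" by (rule relE[OF assms(1)]) blast
  have f: "face n i (inv\<^bsub>G (Suc n)\<^esub> z) = inv\<^bsub>G n\<^esub> face n i z" if "i \<le> Suc n" for i
    using group_hom.hom_inv[OF face_hom[OF that] z(3)] .
  show ?thesis
    using z f by (intro relI[where z = "inv\<^bsub>G (Suc n)\<^esub> z"]) auto
qed

text \<open>Products and inverses of homotopies make the relation a subgroup of the square of the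
  group of spheres that contains the diagonal. For such a subgroup symmetry follows by looking at
  \<open>x x^-1 y\<close> and \<open>x y^-1 y\<close>, and transitivity in the same way.\<close>

lemma rel_equiv: "equiv (spheres G act n) (rel n)"
proof -
  interpret S: subgroup "spheres G act n" "G n" by (rule spheres_subgroup)
  interpret G: group "G n" by (rule group)
  have sp: "x \<in> spheres G act n \<and> y \<in> spheres G act n" if "(x, y) \<in> rel n" for x y
    using that by (auto simp: sphere_homotopy_def)
  have sym: "(y, x) \<in> rel n" if "(x, y) \<in> rel n" for x y
  proof -
    have "(x \<otimes>\<^bsub>G n\<^esub> inv\<^bsub>G n\<^esub> x \<otimes>\<^bsub>G n\<^esub> y, x \<otimes>\<^bsub>G n\<^esub> inv\<^bsub>G n\<^esub> y \<otimes>\<^bsub>G n\<^esub> y) \<in> rel n"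
      using sp[OF that] that by (intro rel_mult rel_inv rel_refl) auto
    then show ?thesis using sp[OF that] by (simp add: G.m_assoc)
  qed
  have trans: "(x, w) \<in> rel n" if "(x, y) \<in> rel n" "(y, w) \<in> rel n" for x y w
  proof -
    have "(x \<otimes>\<^bsub>G n\<^esub> inv\<^bsub>G n\<^esub> y \<otimes>\<^bsub>G n\<^esub> y, y \<otimes>\<^bsub>G n\<^esub> inv\<^bsub>G n\<^esub> y \<otimes>\<^bsub>G n\<^esub> w) \<in> rel n"
      using sp[OF that(1)] that by (intro rel_mult rel_inv rel_refl) auto
    then show ?thesis using sp[OF that(1)] sp[OF that(2)] by (simp add: G.m_assoc)
  qed
  show ?thesis
  proof (rule equivI)
    show "rel n \<subseteq> spheres G act n \<times> spheres G act n" using sp by (intro subrelI) simp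
    show "refl_on (spheres G act n) (rel n)" by (rule refl_onI) (rule rel_refl)
    show "Relation.sym (rel n)" by (rule symI) (rule sym)
    show "Relation.trans (rel n)" by (rule transI) (rule trans)
  qed
qed

end

text \<open>Contractibility in the form in which it is applied: every map from the boundary of a
  simplex extends to the simplex. The family \<open>a\<close> lists the faces; for
  \<open>n = 0\<close> there is no compatibility condition, and any two vertices have to be
  joined.\<close>

definition boundary_fillable :: "(nat \<Rightarrow> nat \<Rightarrow> (nat \<Rightarrow> nat) \<Rightarrow> 'g \<Rightarrow> 'g) \<Rightarrow> (nat \<Rightarrow> 'g set) \<Rightarrow> bool"
  where "boundary_fillable act N \<longleftrightarrow> (\<forall>n a. (\<forall>i\<le>Suc n. a i \<in> N n) \<and>
    (\<forall>m i j. n = Suc m \<longrightarrow> i < j \<longrightarrow> j \<le> Suc n \<longrightarrow> act m n (coface i) (a j) = act m n (coface (j - 1)) (a i))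
    \<longrightarrow> (\<exists>v\<in>N (Suc n). \<forall>i\<le>Suc n. act n (Suc n) (coface i) v = a i))"

text \<open>The conditions \<open>dense\<close> and \<open>\<theta>_KH\<close> say that \<theta>
  induces a bijection from the left cosets of \<open>KG\<close> to those of \<open>KH\<close> in
  every degree: \<open>h\<close> and the image of \<open>g\<close> lie in one coset exactly when
  \<open>inv h\<close> times that image is in \<open>KH\<close>. The two filling conditions make the
  subgroups contractible.\<close>

locale simplicial_group_approximation =
  G: simplicial_group G gact + H: simplicial_group H hact
  for G :: "nat \<Rightarrow> 'g monoid" and gact and H :: "nat \<Rightarrow> 'h monoid" and hact +
  fixes \<theta> :: "nat \<Rightarrow> 'g \<Rightarrow> 'h" and KG :: "nat \<Rightarrow> 'g set" and KH :: "nat \<Rightarrow> 'h set"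
  assumes \<theta>_hom: "\<theta> q \<in> hom (G q) (H q)"
    and \<theta>_act: "\<phi> ` {..q} \<subseteq> {..r} \<Longrightarrow> x \<in> carrier (G r) \<Longrightarrow> \<theta> q (gact q r \<phi> x) = hact q r \<phi> (\<theta> r x)"
    and KG: "subgroup (KG q) (G q)" and KH: "subgroup (KH q) (H q)"
    and KH_act: "\<phi> ` {..q} \<subseteq> {..r} \<Longrightarrow> h \<in> KH r \<Longrightarrow> hact q r \<phi> h \<in> KH q"
    and \<theta>_KH: "x \<in> carrier (G q) \<Longrightarrow> \<theta> q x \<in> KH q \<longleftrightarrow> x \<in> KG q"
    and dense: "h \<in> carrier (H q) \<Longrightarrow> \<exists>g\<in>carrier (G q). inv\<^bsub>H q\<^esub> h \<otimes>\<^bsub>H q\<^esub> \<theta> q g \<in> KH q"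
    and fill_G: "boundary_fillable gact KG" and fill_H: "boundary_fillable hact KH"
begin

lemma \<theta>_group_hom: "group_hom (G q) (H q) (\<theta> q)"
  by (simp add: group_hom_def group_hom_axioms_def G.group H.group \<theta>_hom)

lemma \<theta>_sphere:
  assumes x: "x \<in> spheres G gact n"
  shows "\<theta> n x \<in> spheres H hact n"
proof (cases n)
  case 0
  then show ?thesis using x hom_in_carrier[OF \<theta>_hom] by (simp add: spheres_def)
next
  case (Suc m)
  have "hact m n (coface i) (\<theta> n x) = \<one>\<^bsub>H m\<^esub>" if "i \<le> n" for i
    using \<theta>_act[OF coface_range, of i m x] G.spheresD[of x m i] x that Suc
      group_hom.hom_one[OF \<theta>_group_hom, of m] G.spheres_carrier[OF x] by simp
  then show ?thesis using hom_in_carrier[OF \<theta>_hom G.spheres_carrier[OF x]] Suc by (simp add: spheres_def)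
qed

lemma \<theta>_rel:
  assumes "(x, y) \<in> G.rel n"
  shows "(\<theta> n x, \<theta> n y) \<in> H.rel n"
proof -
  obtain z where z: "x \<in> spheres G gact n" "y \<in> spheres G gact n" "z \<in> carrier (G (Suc n))"
    "\<And>i. i < n \<Longrightarrow> G.face n i z = \<one>\<^bsub>G n\<^esub>" "G.face n n z = x" "G.face n (Suc n) z = y" by (rule G.relE[OF assms]) blast
  have f: "H.face n i (\<theta> (Suc n) z) = \<theta> n (G.face n i z)" if "i \<le> Suc n" for i
    using \<theta>_act[OF coface_range[OF that] z(3)] by simp
  show ?thesis
    using z f \<theta>_sphere hom_in_carrier[OF \<theta>_hom z(3)] group_hom.hom_one[OF \<theta>_group_hom, of n]
    by (intro H.relI[where z = "\<theta> (Suc n) z"]) auto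
qed

text \<open>An approximation \<open>g0\<close> of the sphere \<open>h\<close> has faces in
  \<open>KG\<close>, because those of \<open>h\<close> are trivial. Dividing by a filler of these
  faces gives a sphere, and its image differs from \<open>h\<close> by a sphere in
  \<open>KH\<close>, which bounds.\<close>

lemma \<theta>_surj:
  assumes h: "h \<in> spheres H hact n"
  obtains g where "g \<in> spheres G gact n" "(h, \<theta> n g) \<in> H.rel n"
proof -
  interpret Gn: group "G n" by (rule G.group)
  interpret Hn: group "H n" by (rule H.group)
  interpret \<theta>: group_hom "G n" "H n" "\<theta> n" by (rule \<theta>_group_hom)
  interpret KHn: subgroup "KH n" "H n" by (rule KH)
  interpret KGn: subgroup "KG n" "G n" by (rule KG)
  have hc: "h \<in> carrier (H n)" by (rule H.spheres_carrier[OF h])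
  obtain g0 where g0: "g0 \<in> carrier (G n)" "inv\<^bsub>H n\<^esub> h \<otimes>\<^bsub>H n\<^esub> \<theta> n g0 \<in> KH n" using dense[OF hc] by blast
  have "\<exists>v\<in>KG n. g0 \<otimes>\<^bsub>G n\<^esub> inv\<^bsub>G n\<^esub> v \<in> spheres G gact n"
  proof (cases n)
    case 0
    have "g0 \<otimes>\<^bsub>G n\<^esub> inv\<^bsub>G n\<^esub> \<one>\<^bsub>G n\<^esub> = g0" using g0(1) by simp
    moreover have "g0 \<in> spheres G gact n" using g0(1) 0 by (simp add: spheres_def)
    ultimately show ?thesis using KGn.one_closed by (intro bexI[of _ "\<one>\<^bsub>G n\<^esub>"]) simp_all
  next
    case (Suc m)
    have face: "G.face m i g0 \<in> KG m" if i: "i \<le> n" for i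
    proof -
      have r: "coface i ` {..m} \<subseteq> {..n}" using i Suc coface_range by simp
      interpret fH: group_hom "H n" "H m" "hact m n (coface i)" by (rule H.act_hom'[OF r])
      have c: "\<theta> n g0 \<in> carrier (H n)" using g0 by simp
      have "hact m n (coface i) (inv\<^bsub>H n\<^esub> h \<otimes>\<^bsub>H n\<^esub> \<theta> n g0) = hact m n (coface i) (\<theta> n g0)"
      proof -
        have "hact m n (coface i) h = \<one>\<^bsub>H m\<^esub>" using H.spheresD[of h m i] h i Suc by simp
        then show ?thesis using hc c by simp
      qed
      then have "\<theta> m (gact m n (coface i) g0) \<in> KH m"
        using KH_act[OF r g0(2)] \<theta>_act[OF r g0(1)] by simp
      then show ?thesis
        using \<theta>_KH hom_in_carrier[OF G.act_hom[OF r] g0(1)] Suc by simp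
    qed
    have compat: "gact l m (coface i) (G.face m j g0) = gact l m (coface (j - 1)) (G.face m i g0)"
      if "m = Suc l" "i < j" "j \<le> Suc m" for l i j
      using G.face_face[of i j l g0] that g0(1) Suc by simp
    \<comment> \<open>The faces of \<open>g0\<close> satisfy the compatibility condition
      automatically, so there is \<open>v\<close> in the subgroup with the same faces.\<close>
    obtain v where v: "v \<in> KG (Suc m)" "\<And>i. i \<le> Suc m \<Longrightarrow> G.face m i v = G.face m i g0"
      using fill_G[unfolded boundary_fillable_def, rule_format, of m "\<lambda>i. G.face m i g0"] face compat Suc by blast
    have vc: "v \<in> carrier (G n)" using v(1) Suc KGn.subset by blast
    have "G.face m i (g0 \<otimes>\<^bsub>G n\<^esub> inv\<^bsub>G n\<^esub> v) = \<one>\<^bsub>G m\<^esub>" if i: "i \<le> n" for i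
    proof -
      interpret f: group_hom "G (Suc m)" "G m" "G.face m i" using G.face_hom[of i m] i Suc by simp
      show ?thesis using g0(1) vc v(2)[of i] i Suc by simp
    qed
    moreover have "g0 \<otimes>\<^bsub>G n\<^esub> inv\<^bsub>G n\<^esub> v \<in> carrier (G n)" using g0(1) vc by simp
    ultimately have "g0 \<otimes>\<^bsub>G n\<^esub> inv\<^bsub>G n\<^esub> v \<in> spheres G gact n"
      using Suc by (simp add: spheres_def)
    then show ?thesis using v(1) Suc by blast
  qed
  then obtain v where v: "v \<in> KG n" "g0 \<otimes>\<^bsub>G n\<^esub> inv\<^bsub>G n\<^esub> v \<in> spheres G gact n" by blast
  let ?g = "g0 \<otimes>\<^bsub>G n\<^esub> inv\<^bsub>G n\<^esub> v"
  have vc: "v \<in> carrier (G n)" using v(1) by simp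
  have "\<theta> n v \<in> KH n" using \<theta>_KH[OF vc] v(1) by simp
  then have "(inv\<^bsub>H n\<^esub> h \<otimes>\<^bsub>H n\<^esub> \<theta> n g0) \<otimes>\<^bsub>H n\<^esub> inv\<^bsub>H n\<^esub> \<theta> n v \<in> KH n" using g0(2) by simp
  also have "(inv\<^bsub>H n\<^esub> h \<otimes>\<^bsub>H n\<^esub> \<theta> n g0) \<otimes>\<^bsub>H n\<^esub> inv\<^bsub>H n\<^esub> \<theta> n v = inv\<^bsub>H n\<^esub> h \<otimes>\<^bsub>H n\<^esub> \<theta> n ?g"
    using hc g0(1) vc by (simp add: Hn.m_assoc)
  finally have wK: "inv\<^bsub>H n\<^esub> h \<otimes>\<^bsub>H n\<^esub> \<theta> n ?g \<in> KH n" .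
  interpret S: subgroup "spheres H hact n" "H n" by (rule H.spheres_subgroup)
  let ?w = "inv\<^bsub>H n\<^esub> h \<otimes>\<^bsub>H n\<^esub> \<theta> n ?g"
  have w: "?w \<in> spheres H hact n" using h \<theta>_sphere[OF v(2)] by simp
  have "(\<one>\<^bsub>H n\<^esub>, ?w) \<in> H.rel n"
  proof -
    \<comment> \<open>With \<open>?w\<close> on the last face and the unit elsewhere, a filler is
      exactly a homotopy from the unit to \<open>?w\<close>.\<close>
    define a where "a i = (if i = Suc n then ?w else \<one>\<^bsub>H n\<^esub>)" for i
    have "hact l n (coface i) (a j) = hact l n (coface (j - 1)) (a i)"
      if l: "n = Suc l" "i < j" "j \<le> Suc n" for l i j
    proof -
      have "hact l n (coface i) (a j) = \<one>\<^bsub>H l\<^esub>"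
        using H.spheresD[of ?w l i] w l group_hom.hom_one[OF H.face_hom[of i l]] by (auto simp: a_def)
      moreover have "hact l n (coface (j - 1)) (a i) = \<one>\<^bsub>H l\<^esub>"
        using l group_hom.hom_one[OF H.face_hom[of "j - 1" l]] by (auto simp: a_def)
      ultimately show ?thesis by simp
    qed
    moreover have "\<forall>i\<le>Suc n. a i \<in> KH n" using wK by (simp add: a_def)
    ultimately obtain z where z: "z \<in> KH (Suc n)" "\<And>i. i \<le> Suc n \<Longrightarrow> H.face n i z = a i"
      using fill_H[unfolded boundary_fillable_def, rule_format, of n a] by blast
    have zc: "z \<in> carrier (H (Suc n))" using z(1) subgroup.subset[OF KH] by blast
    show ?thesis
      using w zc z(2) by (intro H.relI[where z = z]) (auto simp: a_def)
  qed
  then have "(h \<otimes>\<^bsub>H n\<^esub> \<one>\<^bsub>H n\<^esub>, h \<otimes>\<^bsub>H n\<^esub> ?w) \<in> H.rel n"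
    by (intro H.rel_mult H.rel_refl h)
  moreover have "h \<otimes>\<^bsub>H n\<^esub> ?w = \<theta> n ?g"
    using hc g0(1) vc by (simp add: Hn.m_assoc[symmetric])
  ultimately show ?thesis using that[OF v(2)] hc by simp
qed

text \<open>A null-homotopy \<open>z\<close> in the target is approximated by some \<open>y\<close>,
  whose faces are correct up to elements of \<open>KG\<close>. These errors form a compatible
  boundary, and dividing \<open>y\<close> by a filler of it gives a null-homotopy in the
  source.\<close>

lemma \<theta>_inj_one:
  assumes g: "g \<in> spheres G gact n" and r: "(\<one>\<^bsub>H n\<^esub>, \<theta> n g) \<in> H.rel n"
  shows "(\<one>\<^bsub>G n\<^esub>, g) \<in> G.rel n"
proof -
  interpret Gn: group "G n" by (rule G.group)
  interpret Hn: group "H n" by (rule H.group)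
  interpret Gs: group "G (Suc n)" by (rule G.group)
  interpret Hs: group "H (Suc n)" by (rule H.group)
  interpret \<theta>: group_hom "G n" "H n" "\<theta> n" by (rule \<theta>_group_hom)
  interpret \<theta>s: group_hom "G (Suc n)" "H (Suc n)" "\<theta> (Suc n)" by (rule \<theta>_group_hom)
  have gc: "g \<in> carrier (G n)" by (rule G.spheres_carrier[OF g])
  obtain z where z: "z \<in> carrier (H (Suc n))" "\<And>i. i < n \<Longrightarrow> H.face n i z = \<one>\<^bsub>H n\<^esub>"
    "H.face n n z = \<one>\<^bsub>H n\<^esub>" "H.face n (Suc n) z = \<theta> n g" by (rule H.relE[OF r]) blast
  then have z1: "H.face n i z = \<one>\<^bsub>H n\<^esub>" if "i \<le> n" for i using that by (cases "i = n") auto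
  obtain y where y: "y \<in> carrier (G (Suc n))" "inv\<^bsub>H (Suc n)\<^esub> z \<otimes>\<^bsub>H (Suc n)\<^esub> \<theta> (Suc n) y \<in> KH (Suc n)"
    using dense[OF z(1)] by blast
  have fy: "G.face n i y \<in> carrier (G n)" if "i \<le> Suc n" for i
    using group_hom.hom_closed[OF G.face_hom[OF that] y(1)] .
  have f: "inv\<^bsub>H n\<^esub> H.face n i z \<otimes>\<^bsub>H n\<^esub> \<theta> n (G.face n i y) \<in> KH n" if i: "i \<le> Suc n" for i
  proof -
    interpret fH: group_hom "H (Suc n)" "H n" "H.face n i" by (rule H.face_hom[OF i])
    have "H.face n i (inv\<^bsub>H (Suc n)\<^esub> z \<otimes>\<^bsub>H (Suc n)\<^esub> \<theta> (Suc n) y) \<in> KH n"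
      by (rule KH_act[OF coface_range[OF i] y(2)])
    then show ?thesis using z(1) y(1) \<theta>_act[OF coface_range[OF i] y(1)] by simp
  qed
  \<comment> \<open>The error on each face: the face wanted is the unit, except for \<open>g\<close>
    on the last one. As the filler is divided out on the right, the inverse of the wanted face
    stands on the left.\<close>
  define a where "a i = (if i = Suc n then inv\<^bsub>G n\<^esub> g \<otimes>\<^bsub>G n\<^esub> G.face n i y else G.face n i y)" for i
  have aK: "a i \<in> KG n" if i: "i \<le> Suc n" for i
  proof (cases "i = Suc n")
    case True
    have "\<theta> n (inv\<^bsub>G n\<^esub> g \<otimes>\<^bsub>G n\<^esub> G.face n i y) \<in> KH n"
      using f[OF i] z(4) True gc fy[OF i] by simp
    moreover have "inv\<^bsub>G n\<^esub> g \<otimes>\<^bsub>G n\<^esub> G.face n i y \<in> carrier (G n)" using gc fy[OF i] by simp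
    ultimately have "inv\<^bsub>G n\<^esub> g \<otimes>\<^bsub>G n\<^esub> G.face n i y \<in> KG n" using \<theta>_KH by blast
    then show ?thesis using True by (simp add: a_def)
  next
    case False
    then show ?thesis using f[OF i] z1[of i] i fy[OF i] \<theta>_KH by (simp add: a_def)
  qed
  have compat: "gact l n (coface i) (a j) = gact l n (coface (j - 1)) (a i)"
    if l: "n = Suc l" "i < j" "j \<le> Suc n" for l i j
  proof -
    interpret fG: group_hom "G n" "G l" "gact l n (coface i)" using G.face_hom[of i l] l by simp
    have "gact l n (coface i) (a j) = gact l n (coface i) (G.face n j y)"
    proof (cases "j = Suc n")
      case True
      have "gact l n (coface i) g = \<one>\<^bsub>G l\<^esub>" using G.spheresD[of g l i] g l by simp
      then show ?thesis using True gc fy[of j] by (simp add: a_def)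
    qed (simp add: a_def)
    also have "\<dots> = gact l n (coface (j - 1)) (G.face n i y)"
      using G.face_face[of i j l y] y(1) l by simp
    finally show ?thesis using l by (simp add: a_def)
  qed
  obtain v where v: "v \<in> KG (Suc n)" "\<And>i. i \<le> Suc n \<Longrightarrow> G.face n i v = a i"
    using fill_G[unfolded boundary_fillable_def, rule_format, of n a] aK compat by blast
  have vc: "v \<in> carrier (G (Suc n))" using v(1) subgroup.subset[OF KG] by blast
  have fv: "G.face n i (y \<otimes>\<^bsub>G (Suc n)\<^esub> inv\<^bsub>G (Suc n)\<^esub> v) = G.face n i y \<otimes>\<^bsub>G n\<^esub> inv\<^bsub>G n\<^esub> a i" if i: "i \<le> Suc n" for i
  proof -
    interpret fG: group_hom "G (Suc n)" "G n" "G.face n i" by (rule G.face_hom[OF i])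
    show ?thesis using y(1) vc v(2)[OF i] by simp
  qed
  show ?thesis
  proof (rule G.relI)
    show "\<one>\<^bsub>G n\<^esub> \<in> spheres G gact n" by (rule subgroup.one_closed[OF G.spheres_subgroup])
    show "y \<otimes>\<^bsub>G (Suc n)\<^esub> inv\<^bsub>G (Suc n)\<^esub> v \<in> carrier (G (Suc n))" using y(1) vc by simp
    show "G.face n i (y \<otimes>\<^bsub>G (Suc n)\<^esub> inv\<^bsub>G (Suc n)\<^esub> v) = \<one>\<^bsub>G n\<^esub>" if "i < n" for i
      using fv[of i] that fy[of i] by (simp add: a_def)
    show "G.face n n (y \<otimes>\<^bsub>G (Suc n)\<^esub> inv\<^bsub>G (Suc n)\<^esub> v) = \<one>\<^bsub>G n\<^esub>"
      using fv[of n] fy[of n] by (simp add: a_def)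
    show "G.face n (Suc n) (y \<otimes>\<^bsub>G (Suc n)\<^esub> inv\<^bsub>G (Suc n)\<^esub> v) = g"
      using fv[of "Suc n"] fy[of "Suc n"] gc by (simp add: a_def Gn.inv_mult_group Gn.m_assoc[symmetric])
  qed (rule g)
qed

lemma \<theta>_inj:
  assumes x: "x \<in> spheres G gact n" and y: "y \<in> spheres G gact n" and r: "(\<theta> n x, \<theta> n y) \<in> H.rel n"
  shows "(x, y) \<in> G.rel n"
proof -
  interpret Gn: group "G n" by (rule G.group)
  interpret Hn: group "H n" by (rule H.group)
  interpret \<theta>: group_hom "G n" "H n" "\<theta> n" by (rule \<theta>_group_hom)
  interpret S: subgroup "spheres G gact n" "G n" by (rule G.spheres_subgroup)
  interpret SH: subgroup "spheres H hact n" "H n" by (rule H.spheres_subgroup)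
  have "(inv\<^bsub>H n\<^esub> \<theta> n x \<otimes>\<^bsub>H n\<^esub> \<theta> n x, inv\<^bsub>H n\<^esub> \<theta> n x \<otimes>\<^bsub>H n\<^esub> \<theta> n y) \<in> H.rel n"
    using \<theta>_sphere[OF x] r by (intro H.rel_mult H.rel_refl) auto
  then have "(\<one>\<^bsub>H n\<^esub>, \<theta> n (inv\<^bsub>G n\<^esub> x \<otimes>\<^bsub>G n\<^esub> y)) \<in> H.rel n"
    using x y by simp
  then have "(\<one>\<^bsub>G n\<^esub>, inv\<^bsub>G n\<^esub> x \<otimes>\<^bsub>G n\<^esub> y) \<in> G.rel n"
    using x y by (intro \<theta>_inj_one) auto
  then have "(x \<otimes>\<^bsub>G n\<^esub> \<one>\<^bsub>G n\<^esub>, x \<otimes>\<^bsub>G n\<^esub> (inv\<^bsub>G n\<^esub> x \<otimes>\<^bsub>G n\<^esub> y)) \<in> G.rel n"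
    by (intro G.rel_mult G.rel_refl x)
  then show ?thesis using x y by (simp add: Gn.m_assoc[symmetric])
qed

theorem homotopy_group_iso: "homotopy_group G gact n \<cong> homotopy_group H hact n"
proof -
  \<comment> \<open>The image of a class under \<theta> need not be a whole class of the target, so
    it is saturated.\<close>
  let ?\<Phi> = "\<lambda>C. H.rel n `` (\<theta> n ` C)"
  interpret Gn: group "G n" by (rule G.group)
  interpret Hn: group "H n" by (rule H.group)
  interpret \<theta>: group_hom "G n" "H n" "\<theta> n" by (rule \<theta>_group_hom)
  interpret S: subgroup "spheres G gact n" "G n" by (rule G.spheres_subgroup)
  interpret SH: subgroup "spheres H hact n" "H n" by (rule H.spheres_subgroup)
  note eG = G.rel_equiv[of n] and eH = H.rel_equiv[of n]
  have clsG: "G.rel n `` {x} = G.rel n `` {y} \<longleftrightarrow> (x, y) \<in> G.rel n" if "x \<in> spheres G gact n" "y \<in> spheres G gact n" for x y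
    using eq_equiv_class_iff[OF eG that] .
  have clsH: "H.rel n `` {x} = H.rel n `` {y} \<longleftrightarrow> (x, y) \<in> H.rel n" if "x \<in> spheres H hact n" "y \<in> spheres H hact n" for x y
    using eq_equiv_class_iff[OF eH that] .
  have \<Phi>: "?\<Phi> (G.rel n `` {x}) = H.rel n `` {\<theta> n x}" if x: "x \<in> spheres G gact n" for x
  proof -
    have "H.rel n `` {\<theta> n y} = H.rel n `` {\<theta> n x}" if "(x, y) \<in> G.rel n" for y
      using equiv_class_eq[OF eH \<theta>_rel[OF that]] by simp
    moreover have "x \<in> G.rel n `` {x}" using G.rel_refl[OF x] by simp
    ultimately show ?thesis by blast
  qed
  have prodG: "G.rel n `` {u \<otimes>\<^bsub>G n\<^esub> v | u v. u \<in> G.rel n `` {x} \<and> v \<in> G.rel n `` {y}} = G.rel n `` {x \<otimes>\<^bsub>G n\<^esub> y}"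
    if x: "x \<in> spheres G gact n" and y: "y \<in> spheres G gact n" for x y
  proof -
    have "G.rel n `` {u \<otimes>\<^bsub>G n\<^esub> v} = G.rel n `` {x \<otimes>\<^bsub>G n\<^esub> y}" if "(x, u) \<in> G.rel n" "(y, v) \<in> G.rel n" for u v
      using equiv_class_eq[OF eG G.rel_mult[OF that]] by simp
    moreover have "(x, x) \<in> G.rel n" "(y, y) \<in> G.rel n" using G.rel_refl x y by auto
    ultimately show ?thesis by blast
  qed
  have prodH: "H.rel n `` {u \<otimes>\<^bsub>H n\<^esub> v | u v. u \<in> H.rel n `` {x} \<and> v \<in> H.rel n `` {y}} = H.rel n `` {x \<otimes>\<^bsub>H n\<^esub> y}"
    if x: "x \<in> spheres H hact n" and y: "y \<in> spheres H hact n" for x y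
  proof -
    have "H.rel n `` {u \<otimes>\<^bsub>H n\<^esub> v} = H.rel n `` {x \<otimes>\<^bsub>H n\<^esub> y}" if "(x, u) \<in> H.rel n" "(y, v) \<in> H.rel n" for u v
      using equiv_class_eq[OF eH H.rel_mult[OF that]] by simp
    moreover have "(x, x) \<in> H.rel n" "(y, y) \<in> H.rel n" using H.rel_refl x y by auto
    ultimately show ?thesis by blast
  qed
  have "?\<Phi> \<in> hom (homotopy_group G gact n) (homotopy_group H hact n)"
  proof (rule homI)
    fix C assume "C \<in> carrier (homotopy_group G gact n)"
    then obtain x where x: "x \<in> spheres G gact n" "C = G.rel n `` {x}"
      by (auto simp: homotopy_group_def elim: quotientE)
    show "?\<Phi> C \<in> carrier (homotopy_group H hact n)"
      using \<Phi>[OF x(1)] quotientI[OF \<theta>_sphere[OF x(1)]] x(2) by (simp add: homotopy_group_def)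
    fix E assume "E \<in> carrier (homotopy_group G gact n)"
    then obtain y where y: "y \<in> spheres G gact n" "E = G.rel n `` {y}"
      by (auto simp: homotopy_group_def elim: quotientE)
    have "C \<otimes>\<^bsub>homotopy_group G gact n\<^esub> E = G.rel n `` {x \<otimes>\<^bsub>G n\<^esub> y}"
      using prodG[OF x(1) y(1)] x(2) y(2) by (simp add: homotopy_group_def)
    moreover have "?\<Phi> C \<otimes>\<^bsub>homotopy_group H hact n\<^esub> ?\<Phi> E = H.rel n `` {\<theta> n x \<otimes>\<^bsub>H n\<^esub> \<theta> n y}"
      using prodH[OF \<theta>_sphere[OF x(1)] \<theta>_sphere[OF y(1)]] \<Phi>[OF x(1)] \<Phi>[OF y(1)] x(2) y(2)
      by (simp add: homotopy_group_def)
    ultimately show "?\<Phi> (C \<otimes>\<^bsub>homotopy_group G gact n\<^esub> E) = ?\<Phi> C \<otimes>\<^bsub>homotopy_group H hact n\<^esub> ?\<Phi> E"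
      using \<Phi>[of "x \<otimes>\<^bsub>G n\<^esub> y"] x(1) y(1) by simp
  qed
  moreover have "bij_betw ?\<Phi> (carrier (homotopy_group G gact n)) (carrier (homotopy_group H hact n))"
  proof (rule bij_betw_imageI)
    show "inj_on ?\<Phi> (carrier (homotopy_group G gact n))"
    proof (rule inj_onI)
      fix C E assume "C \<in> carrier (homotopy_group G gact n)" "E \<in> carrier (homotopy_group G gact n)" and e: "?\<Phi> C = ?\<Phi> E"
      then obtain x y where x: "x \<in> spheres G gact n" "C = G.rel n `` {x}" and y: "y \<in> spheres G gact n" "E = G.rel n `` {y}"
        by (auto simp: homotopy_group_def elim!: quotientE)
      have "H.rel n `` {\<theta> n x} = H.rel n `` {\<theta> n y}" using e \<Phi>[OF x(1)] \<Phi>[OF y(1)] x(2) y(2) by simp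
      then have "(\<theta> n x, \<theta> n y) \<in> H.rel n" using clsH \<theta>_sphere[OF x(1)] \<theta>_sphere[OF y(1)] by simp
      then show "C = E" using \<theta>_inj[OF x(1) y(1)] clsG[OF x(1) y(1)] x(2) y(2) by simp
    qed
    show "?\<Phi> ` carrier (homotopy_group G gact n) = carrier (homotopy_group H hact n)"
    proof (intro equalityI subsetI)
      fix E assume "E \<in> ?\<Phi> ` carrier (homotopy_group G gact n)"
      then show "E \<in> carrier (homotopy_group H hact n)"
        using calculation hom_in_carrier by fastforce
    next
      fix E assume "E \<in> carrier (homotopy_group H hact n)"
      then obtain h where h: "h \<in> spheres H hact n" "E = H.rel n `` {h}"
        by (auto simp: homotopy_group_def elim: quotientE)
      obtain g where g: "g \<in> spheres G gact n" "(h, \<theta> n g) \<in> H.rel n" using \<theta>_surj[OF h(1)] .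
      have "E = ?\<Phi> (G.rel n `` {g})" using \<Phi>[OF g(1)] clsH[OF h(1) \<theta>_sphere[OF g(1)]] g(2) h(2) by simp
      moreover have "G.rel n `` {g} \<in> carrier (homotopy_group G gact n)"
        using quotientI[OF g(1)] by (simp add: homotopy_group_def)
      ultimately show "E \<in> ?\<Phi> ` carrier (homotopy_group G gact n)" by blast
    qed
  qed
  ultimately show ?thesis unfolding is_iso_def iso_def by blast
qed

end

section \<open>Filling boundaries in the unit ball\<close>

context simplicial_ball
begin

abbreviation "face n i \<equiv> act n (Suc n) (coface i)"
abbreviation "degen n j \<equiv> act (Suc n) n (codegeneracy j)"

lemma J_carrier: "x \<in> J q \<Longrightarrow> x \<in> carrier (D q)"
  using J_subset by blast

lemma act_ring_hom: "\<phi> ` {..q} \<subseteq> {..r} \<Longrightarrow> ring_hom_cring (D r) (D q) (act q r \<phi>)"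
  by (rule cring_hom[OF D_cring D_cring act_hom])

lemma face_ring_hom: "i \<le> Suc n \<Longrightarrow> ring_hom_cring (D (Suc n)) (D n) (face n i)"
  by (rule act_ring_hom[OF coface_range])

lemma degen_ring_hom: "j \<le> n \<Longrightarrow> ring_hom_cring (D n) (D (Suc n)) (degen n j)"
  by (rule act_ring_hom[OF codegeneracy_range])

lemma act_square:
  assumes "\<phi> ` {..q} \<subseteq> {..r}" "\<psi> ` {..r} \<subseteq> {..s}" "\<phi>' ` {..q} \<subseteq> {..r'}" "\<psi>' ` {..r'} \<subseteq> {..s}"
    and "\<And>j. j \<le> q \<Longrightarrow> \<psi> (\<phi> j) = \<psi>' (\<phi>' j)" and x: "x \<in> carrier (D s)"
  shows "act q r \<phi> (act r s \<psi> x) = act q r' \<phi>' (act r' s \<psi>' x)"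
proof -
  have "(\<psi> \<circ> \<phi>) ` {..q} \<subseteq> {..s}" using assms(1,2) by auto
  then have "act q s (\<psi> \<circ> \<phi>) x = act q s (\<psi>' \<circ> \<phi>') x"
    using assms(5) x by (intro act_cong) auto
  then show ?thesis using assms by (simp add: act_act)
qed

lemma face_face:
  assumes "i < j" "j \<le> Suc (Suc n)" "x \<in> carrier (D (Suc (Suc n)))"
  shows "face n i (face (Suc n) j x) = face n (j - 1) (face (Suc n) i x)"
  using assms by (intro act_square coface_range) (auto simp: coface_def)

lemma face_degen:
  assumes "i = j \<or> i = Suc j" "j \<le> n" "x \<in> carrier (D n)"
  shows "face n i (degen n j x) = x"
proof -
  have "(codegeneracy j \<circ> coface i) ` {..n} \<subseteq> {..n}" using assms by (auto simp: codegeneracy_def coface_def)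
  moreover have "face n i (degen n j x) = act n n (codegeneracy j \<circ> coface i) x"
    using assms by (intro act_act coface_range codegeneracy_range) auto
  ultimately show ?thesis
    using assms by (subst act_id[symmetric, of n "codegeneracy j \<circ> coface i"]) (auto simp: codegeneracy_def coface_def)
qed

lemma face_degen_less:
  assumes "i < j" "j \<le> Suc n" "x \<in> carrier (D (Suc n))"
  shows "face (Suc n) i (degen (Suc n) j x) = degen n (j - 1) (face n i x)"
  using assms by (intro act_square coface_range codegeneracy_range) (auto simp: coface_def codegeneracy_def)

lemma face_degen_greater:
  assumes "Suc j < i" "i \<le> Suc (Suc n)" "x \<in> carrier (D (Suc n))"
  shows "face (Suc n) i (degen (Suc n) j x) = degen n j (face n (i - 1) x)"
  using assms by (intro act_square coface_range codegeneracy_range) (auto simp: coface_def codegeneracy_def)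

lemma degen_vanish:
  assumes y: "y \<in> carrier (D n)" "\<And>l i. n = Suc l \<Longrightarrow> i \<le> n \<Longrightarrow> act l n (coface i) y = \<zero>\<^bsub>D l\<^esub>"
    and j: "j \<le> n" and i: "i \<le> Suc n" "i \<noteq> j" "i \<noteq> Suc j"
  shows "face n i (degen n j y) = \<zero>\<^bsub>D n\<^esub>"
proof -
  have "n \<noteq> 0" using i j by auto
  then obtain l where n: "n = Suc l" by (cases n) auto
  show ?thesis
  proof (cases "i < j")
    case True
    have "face n i (degen n j y) = degen l (j - 1) (face l i y)"
      using face_degen_less[of i j l y] True j y(1) by (simp add: n)
    also have "face l i y = \<zero>\<^bsub>D l\<^esub>" using y(2)[of l i] True j n by simp
    also have "degen l (j - 1) \<zero>\<^bsub>D l\<^esub> = \<zero>\<^bsub>D n\<^esub>"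
      using ring_hom_cring.hom_zero[OF degen_ring_hom[of "j - 1" l]] j True n by simp
    finally show ?thesis .
  next
    case False
    then have "Suc j < i" using i by simp
    then have "face n i (degen n j y) = degen l j (face l (i - 1) y)"
      using face_degen_greater[of j i l y] i(1) y(1) by (simp add: n)
    also have "face l (i - 1) y = \<zero>\<^bsub>D l\<^esub>" using y(2)[of l "i - 1"] i n by simp
    also have "degen l j \<zero>\<^bsub>D l\<^esub> = \<zero>\<^bsub>D n\<^esub>"
      using ring_hom_cring.hom_zero[OF degen_ring_hom[of j l]] \<open>Suc j < i\<close> i n by simp
    finally show ?thesis .
  qed
qed

text \<open>Only the faces \<open>j\<close> and \<open>j + 1\<close> of this term survive. Face
  \<open>j + 1\<close> here is also face \<open>j + 1\<close> of the term for \<open>j + 1\<close>,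
  so consecutive terms cancel there once they carry opposite signs.\<close>

lemma face_term:
  assumes y: "y \<in> carrier (D n)" "\<And>l i. n = Suc l \<Longrightarrow> i \<le> n \<Longrightarrow> act l n (coface i) y = \<zero>\<^bsub>D l\<^esub>"
    and j: "j \<le> n" and i: "i \<le> Suc n"
  shows "face n i (Y (Suc n) {j<..Suc n} \<otimes>\<^bsub>D (Suc n)\<^esub> degen n j y)
    = (if i = j then Y n {j..n} \<otimes>\<^bsub>D n\<^esub> y else if i = Suc j then Y n {Suc j..n} \<otimes>\<^bsub>D n\<^esub> y else \<zero>\<^bsub>D n\<^esub>)"
proof -
  interpret f: ring_hom_cring "D (Suc n)" "D n" "face n i" by (rule face_ring_hom[OF i])
  interpret s: ring_hom_cring "D n" "D (Suc n)" "degen n j" by (rule degen_ring_hom[OF j])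
  have Yc: "Y (Suc n) {j<..Suc n} \<in> carrier (D (Suc n))" by (rule Y_closed) auto
  have "face n i (Y (Suc n) {j<..Suc n}) = Y n {k \<in> {..n}. coface i k \<in> {j<..Suc n}}"
    by (rule act_Y[OF coface_range[OF i]]) auto
  moreover have "{k \<in> {..n}. coface i k \<in> {j<..Suc n}} = {j..n}" if "i = j"
    using that by (auto simp: coface_def)
  moreover have "{k \<in> {..n}. coface i k \<in> {j<..Suc n}} = {Suc j..n}" if "i = Suc j"
    using that by (auto simp: coface_def)
  moreover have "face n i (Y (Suc n) {j<..Suc n}) \<in> carrier (D n)" using Yc by simp
  ultimately show ?thesis
    using Yc y(1) face_degen[of i j n y] degen_vanish[OF y j i] j by auto
qed

text \<open>The sum \<open>\<Sum>\<^sub>j (-1)\<^sup>j (x\<^sub>j\<^sub>+\<^sub>1 + \<dots> + x\<^sub>n\<^sub>+\<^sub>1) s\<^sub>j(y)\<close> is the shuffle product of the path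
  \<open>x\<^sub>1\<close> from 0 to 1 with \<open>y\<close>; its terms are added one at a time.\<close>

lemma fill_zero_face:
  assumes y: "y \<in> J n" and y0: "\<And>l i. n = Suc l \<Longrightarrow> i \<le> n \<Longrightarrow> act l n (coface i) y = \<zero>\<^bsub>D l\<^esub>"
  shows "\<exists>F\<in>J (Suc n). face n 0 F = y \<and> (\<forall>i. 1 \<le> i \<and> i \<le> Suc n \<longrightarrow> face n i F = \<zero>\<^bsub>D n\<^esub>)"
proof -
  interpret D: cring "D n" by (rule D_cring)
  interpret D': cring "D (Suc n)" by (rule D_cring)
  note yc = J_carrier[OF y]
  let ?t = "\<lambda>j. Y (Suc n) {j<..Suc n} \<otimes>\<^bsub>D (Suc n)\<^esub> degen n j y"
  have tJ: "?t j \<in> J (Suc n)" if "j \<le> n" for j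
    using J_act[OF codegeneracy_range[OF that] y] by (intro J_Y) auto
  have Yy: "Y n {m..n} \<otimes>\<^bsub>D n\<^esub> y \<in> carrier (D n)" for m
    using yc by (intro D.m_closed Y_closed) auto
  \<comment> \<open>After the terms 0 to \<open>m\<close> the faces are right except for the one of
    index \<open>m + 1\<close>. The disjunction records its sign, which decides whether the next
    term is subtracted or added.\<close>
  have "\<exists>F\<in>J (Suc n). face n 0 F = y \<and> (\<forall>i. 1 \<le> i \<and> i \<le> Suc n \<and> i \<noteq> Suc m \<longrightarrow> face n i F = \<zero>\<^bsub>D n\<^esub>) \<and>
      (face n (Suc m) F = Y n {Suc m..n} \<otimes>\<^bsub>D n\<^esub> y \<or> face n (Suc m) F = \<ominus>\<^bsub>D n\<^esub> (Y n {Suc m..n} \<otimes>\<^bsub>D n\<^esub> y))"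
    if "m \<le> n" for m
    using that
  proof (induction m)
    case 0
    have "Y n {0..n} \<otimes>\<^bsub>D n\<^esub> y = y" using Y_all[of n] yc by (simp add: atLeast0AtMost)
    then show ?case
      using face_term[OF yc y0, of 0] tJ[of 0] by (intro bexI[of _ "?t 0"]) auto
  next
    case (Suc m)
    then obtain F where F: "F \<in> J (Suc n)" "face n 0 F = y"
      "\<And>i. 1 \<le> i \<Longrightarrow> i \<le> Suc n \<Longrightarrow> i \<noteq> Suc m \<Longrightarrow> face n i F = \<zero>\<^bsub>D n\<^esub>"
      and Fm: "face n (Suc m) F = Y n {Suc m..n} \<otimes>\<^bsub>D n\<^esub> y \<or> face n (Suc m) F = \<ominus>\<^bsub>D n\<^esub> (Y n {Suc m..n} \<otimes>\<^bsub>D n\<^esub> y)"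
      by auto
    note Fc = J_carrier[OF F(1)]
    let ?s = "?t (Suc m)"
    have sJ: "?s \<in> J (Suc n)" using tJ Suc.prems .
    note sc = J_carrier[OF sJ]
    have fs: "face n i ?s = (if i = Suc m then Y n {Suc m..n} \<otimes>\<^bsub>D n\<^esub> y
        else if i = Suc (Suc m) then Y n {Suc (Suc m)..n} \<otimes>\<^bsub>D n\<^esub> y else \<zero>\<^bsub>D n\<^esub>)" if "i \<le> Suc n" for i
      by (rule face_term[OF yc y0 Suc.prems that])
    have hadd: "face n i (F \<oplus>\<^bsub>D (Suc n)\<^esub> ?s) = face n i F \<oplus>\<^bsub>D n\<^esub> face n i ?s"
      and hsub: "face n i (F \<oplus>\<^bsub>D (Suc n)\<^esub> \<ominus>\<^bsub>D (Suc n)\<^esub> ?s) = face n i F \<oplus>\<^bsub>D n\<^esub> \<ominus>\<^bsub>D n\<^esub> face n i ?s"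
      if "i \<le> Suc n" for i
    proof -
      interpret f: ring_hom_cring "D (Suc n)" "D n" "face n i" by (rule face_ring_hom[OF that])
      show "face n i (F \<oplus>\<^bsub>D (Suc n)\<^esub> ?s) = face n i F \<oplus>\<^bsub>D n\<^esub> face n i ?s" by (rule f.hom_add[OF Fc sc])
      show "face n i (F \<oplus>\<^bsub>D (Suc n)\<^esub> \<ominus>\<^bsub>D (Suc n)\<^esub> ?s) = face n i F \<oplus>\<^bsub>D n\<^esub> \<ominus>\<^bsub>D n\<^esub> face n i ?s"
        using f.hom_add[OF Fc D'.a_inv_closed[OF sc]] f.hom_a_inv[OF sc] by simp
    qed
    have Sm: "Suc m \<le> Suc n" "Suc (Suc m) \<le> Suc n" using Suc.prems by auto
    from Fm show ?case
    proof
      assume e: "face n (Suc m) F = Y n {Suc m..n} \<otimes>\<^bsub>D n\<^esub> y"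
      let ?F = "F \<oplus>\<^bsub>D (Suc n)\<^esub> \<ominus>\<^bsub>D (Suc n)\<^esub> ?s"
      have "?F \<in> J (Suc n)" using F(1) sJ by (intro J_add J_uminus)
      moreover have "face n 0 ?F = y" using hsub[of 0] fs[of 0] F(2) yc by simp
      moreover have "face n i ?F = \<zero>\<^bsub>D n\<^esub>" if "1 \<le> i" "i \<le> Suc n" "i \<noteq> Suc (Suc m)" for i
        using hsub[of i] fs[of i] F(3)[of i] that e Yy[of "Suc m"] by (cases "i = Suc m") (auto simp: D.r_neg)
      moreover have "face n (Suc (Suc m)) ?F = \<ominus>\<^bsub>D n\<^esub> (Y n {Suc (Suc m)..n} \<otimes>\<^bsub>D n\<^esub> y)"
        using hsub[OF Sm(2)] fs[OF Sm(2)] F(3)[OF _ Sm(2)] Yy[of "Suc (Suc m)"] by simp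
      ultimately show ?thesis by blast
    next
      assume e: "face n (Suc m) F = \<ominus>\<^bsub>D n\<^esub> (Y n {Suc m..n} \<otimes>\<^bsub>D n\<^esub> y)"
      let ?F = "F \<oplus>\<^bsub>D (Suc n)\<^esub> ?s"
      have "?F \<in> J (Suc n)" using F(1) sJ by (intro J_add)
      moreover have "face n 0 ?F = y" using hadd[of 0] fs[of 0] F(2) yc by simp
      moreover have "face n i ?F = \<zero>\<^bsub>D n\<^esub>" if "1 \<le> i" "i \<le> Suc n" "i \<noteq> Suc (Suc m)" for i
        using hadd[of i] fs[of i] F(3)[of i] that e Yy[of "Suc m"] by (cases "i = Suc m") (auto simp: D.l_neg)
      moreover have "face n (Suc (Suc m)) ?F = Y n {Suc (Suc m)..n} \<otimes>\<^bsub>D n\<^esub> y"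
        using hadd[OF Sm(2)] fs[OF Sm(2)] F(3)[OF _ Sm(2)] Yy[of "Suc (Suc m)"] by simp
      ultimately show ?thesis by blast
    qed
  qed
  from this[of n] obtain F where F: "F \<in> J (Suc n)" "face n 0 F = y"
    "\<And>i. 1 \<le> i \<Longrightarrow> i \<le> Suc n \<Longrightarrow> i \<noteq> Suc n \<Longrightarrow> face n i F = \<zero>\<^bsub>D n\<^esub>"
    "face n (Suc n) F = Y n {Suc n..n} \<otimes>\<^bsub>D n\<^esub> y \<or> face n (Suc n) F = \<ominus>\<^bsub>D n\<^esub> (Y n {Suc n..n} \<otimes>\<^bsub>D n\<^esub> y)"
    by auto
  \<comment> \<open>For \<open>m = n\<close> the remaining sum of coordinates is empty, so the last
    face vanishes as well.\<close>
  have "face n (Suc n) F = \<zero>\<^bsub>D n\<^esub>" using F(4) Y_empty[of n] yc by auto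
  then show ?thesis using F(1-3) by (intro bexI[of _ F]) (metis le_SucE)+
qed

text \<open>All faces but face 0 are matched first, as in the proof that a simplicial group is Kan.
  The discrepancy on face 0 then has trivial faces, and \<open>fill_zero_face\<close> removes it
  without disturbing the others.\<close>

lemma J_fillable: "boundary_fillable act J"
  unfolding boundary_fillable_def
proof (intro allI impI, elim conjE)
  fix n and a :: "nat \<Rightarrow> 'd"
  assume "\<forall>i\<le>Suc n. a i \<in> J n"
    and "\<forall>m i j. n = Suc m \<longrightarrow> i < j \<longrightarrow> j \<le> Suc n \<longrightarrow> act m n (coface i) (a j) = act m n (coface (j - 1)) (a i)"
  then have a: "\<And>i. i \<le> Suc n \<Longrightarrow> a i \<in> J n"
    and compat: "\<And>m i j. n = Suc m \<Longrightarrow> i < j \<Longrightarrow> j \<le> Suc n \<Longrightarrow> act m n (coface i) (a j) = act m n (coface (j - 1)) (a i)"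
    by blast+
  interpret D: cring "D n" by (rule D_cring)
  interpret D': cring "D (Suc n)" by (rule D_cring)
  note ac = J_carrier[OF a]
  have minus: "x \<ominus>\<^bsub>D q\<^esub> y \<in> J q" if "x \<in> J q" "y \<in> J q" for x y q
    unfolding a_minus_def using that by (intro J_add J_uminus)
  have fJ: "face n i x \<in> J n" if "i \<le> Suc n" "x \<in> J (Suc n)" for i x
    by (rule J_act[OF coface_range[OF that(1)] that(2)])
  \<comment> \<open>Once face \<open>i + 1\<close> of \<open>w\<close> is correct, the error on a
    face \<open>r \<le> i\<close> has trivial \<open>i\<close>-th face, because \<open>a\<close> and
    the faces of \<open>w\<close> obey the same simplicial identity.\<close>
  have vanish: "act l n (coface i) (a r \<ominus>\<^bsub>D n\<^esub> face n r w) = \<zero>\<^bsub>D l\<^esub>"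
    if l: "n = Suc l" and ri: "r \<le> i" "i \<le> n" and w: "w \<in> J (Suc n)" "face n (Suc i) w = a (Suc i)" for l i r w
  proof -
    interpret Dl: cring "D l" by (rule D_cring)
    interpret f: ring_hom_cring "D n" "D l" "act l n (coface i)" using face_ring_hom[of i l] ri l by simp
    have wc: "w \<in> carrier (D (Suc n))" by (rule J_carrier[OF w(1)])
    have fw: "face n r w \<in> carrier (D n)" using fJ[of r w] ri w(1) J_carrier by simp
    have "act l n (coface r) (a (Suc i)) = act l n (coface i) (a r)"
      using compat[OF l, of r "Suc i"] ri by simp
    moreover have "act l n (coface r) (face n (Suc i) w) = act l n (coface i) (face n r w)"
      using face_face[of r "Suc i" l w] ri wc l by simp
    ultimately have "act l n (coface i) (a r) = act l n (coface i) (face n r w)" using w(2) by simp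
    moreover have "act l n (coface i) (face n r w) \<in> carrier (D l)" using fw by simp
    ultimately show ?thesis using fw ac[of r] ri by (simp add: a_minus_def Dl.r_neg)
  qed
  \<comment> \<open>Faces are corrected from the top downwards: after \<open>k\<close> rounds the
    top \<open>k\<close> faces agree, and for \<open>k = n + 1\<close> only face 0 is left.\<close>
  have horn: "\<exists>w\<in>J (Suc n). \<forall>i. Suc n - k < i \<and> i \<le> Suc n \<longrightarrow> face n i w = a i" if "k \<le> Suc n" for k
    using that
  proof (induction k)
    case 0
    then show ?case using J_zero by (intro bexI[of _ "\<zero>\<^bsub>D (Suc n)\<^esub>"]) auto
  next
    case (Suc k)
    then obtain w where w: "w \<in> J (Suc n)" "\<And>i. Suc n - k < i \<Longrightarrow> i \<le> Suc n \<Longrightarrow> face n i w = a i" by auto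
    define r where "r = Suc n - k"
    have r: "1 \<le> r" "r \<le> Suc n" using Suc.prems by (auto simp: r_def)
    define y where "y = a r \<ominus>\<^bsub>D n\<^esub> face n r w"
    have y: "y \<in> J n" unfolding y_def by (intro minus a r(2) fJ w(1))
    note yc = J_carrier[OF y] and wc = J_carrier[OF w(1)]
    have j: "r - 1 \<le> n" using r by simp
    \<comment> \<open>Its face \<open>r\<close> is the error \<open>y\<close>, and its faces above
      \<open>r\<close> are degeneracies of faces of \<open>y\<close> that vanish, so the earlier
      corrections persist.\<close>
    let ?s = "degen n (r - 1) y"
    have sJ: "?s \<in> J (Suc n)" by (rule J_act[OF codegeneracy_range[OF j] y])
    note sc = J_carrier[OF sJ]
    let ?w = "w \<oplus>\<^bsub>D (Suc n)\<^esub> ?s"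
    have "face n i ?w = a i" if i: "Suc n - Suc k < i" "i \<le> Suc n" for i
    proof -
      interpret f: ring_hom_cring "D (Suc n)" "D n" "face n i" by (rule face_ring_hom[OF i(2)])
      have h: "face n i ?w = face n i w \<oplus>\<^bsub>D n\<^esub> face n i ?s" by (rule f.hom_add[OF wc sc])
      have fw: "face n i w \<in> carrier (D n)" using wc by simp
      show ?thesis
      proof (cases "i = r")
        case True
        have "face n i ?s = y" using face_degen[of i "r - 1" n y] True r j yc by simp
        then show ?thesis using h True fw ac[OF r(2)] by (simp add: y_def a_minus_def D.a_lcomm D.r_neg)
      next
        case False
        then have ir: "r < i" using i by (auto simp: r_def)
        then have "n \<noteq> 0" using r i by auto
        then obtain l where l: "n = Suc l" by (cases n) auto
        have "face n i ?s = degen l (r - 1) (face l (i - 1) y)"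
          using face_degen_greater[of "r - 1" i l y] ir r i(2) yc l by simp
        also have "face l (i - 1) y = \<zero>\<^bsub>D l\<^esub>"
          using vanish[OF l, of r "i - 1" w] ir i(2) w l by (simp add: y_def r_def)
        also have "degen l (r - 1) \<zero>\<^bsub>D l\<^esub> = \<zero>\<^bsub>D n\<^esub>"
          using ring_hom_cring.hom_zero[OF degen_ring_hom[of "r - 1" l]] ir i(2) l by simp
        finally show ?thesis using h w(2)[of i] ir i(2) fw by (simp add: r_def)
      qed
    qed
    then show ?case using J_add[OF w(1) sJ] by blast
  qed
  from horn[of "Suc n"] obtain w where w: "w \<in> J (Suc n)" "\<And>i. 1 \<le> i \<Longrightarrow> i \<le> Suc n \<Longrightarrow> face n i w = a i"
    by auto
  define y where "y = a 0 \<ominus>\<^bsub>D n\<^esub> face n 0 w"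
  have y: "y \<in> J n" unfolding y_def by (intro minus a fJ w(1)) auto
  have "act l n (coface i) y = \<zero>\<^bsub>D l\<^esub>" if "n = Suc l" "i \<le> n" for l i
    unfolding y_def using that w by (intro vanish) auto
  then obtain F where F: "F \<in> J (Suc n)" "face n 0 F = y" "\<And>i. 1 \<le> i \<Longrightarrow> i \<le> Suc n \<Longrightarrow> face n i F = \<zero>\<^bsub>D n\<^esub>"
    using fill_zero_face[OF y] by blast
  have "face n i (w \<oplus>\<^bsub>D (Suc n)\<^esub> F) = a i" if i: "i \<le> Suc n" for i
  proof -
    interpret f: ring_hom_cring "D (Suc n)" "D n" "face n i" by (rule face_ring_hom[OF i])
    note wc = J_carrier[OF w(1)] and Fc = J_carrier[OF F(1)]
    have h: "face n i (w \<oplus>\<^bsub>D (Suc n)\<^esub> F) = face n i w \<oplus>\<^bsub>D n\<^esub> face n i F" by (rule f.hom_add[OF wc Fc])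
    have fw: "face n i w \<in> carrier (D n)" using wc by simp
    show ?thesis
    proof (cases "i = 0")
      case True
      then show ?thesis using h F(2) fw ac[of 0] by (simp add: y_def a_minus_def D.a_lcomm D.r_neg)
    next
      case False
      then show ?thesis using h F(3)[of i] w(2)[of i] i fw by simp
    qed
  qed
  then show "\<exists>v\<in>J (Suc n). \<forall>i\<le>Suc n. face n i v = a i" using J_add[OF w(1) F(1)] by blast
qed

lemma D_quasi_regular: "quasi_regular (D q) (J q)"
  by (intro quasi_regular.intro D_cring quasi_regular_axioms.intro J_subset J_zero J_add J_uminus J_mult J_quasi)

abbreviation "Gl q \<equiv> GL (D q)"
abbreviation "Gact \<equiv> \<lambda>q r \<phi>. map_matrix (act q r \<phi>)"
abbreviation "K q \<equiv> quasi_regular.congruent_one (D q) (J q)"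

lemma GL_entry: "g \<in> carrier (GL (D q)) \<Longrightarrow> g i j \<in> carrier (D q)"
  using cring.SM_entry[OF D_cring] by (simp add: GL_carrier)

lemma GL_simplicial_group: "simplicial_group Gl Gact"
proof (rule simplicial_group.intro)
  show "group (Gl q)" for q by (rule GL_group[OF D_cring])
  fix q r :: nat and \<phi> :: "nat \<Rightarrow> nat" assume \<phi>: "\<phi> ` {..q} \<subseteq> {..r}"
  show "map_matrix (act q r \<phi>) \<in> hom (Gl r) (Gl q)" by (rule GL_hom[OF D_cring D_cring act_hom[OF \<phi>]])
  {
    fix s \<psi> g assume "\<psi> ` {..r} \<subseteq> {..s :: nat}" "g \<in> carrier (Gl s)"
    then show "map_matrix (act q r \<phi>) (map_matrix (act r s \<psi>) g) = map_matrix (act q s (\<psi> \<circ> \<phi>)) g"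
      using \<phi> GL_entry by (simp add: map_matrix_def fun_eq_iff act_act)
  next
    fix \<psi> g assume "\<And>j. j \<le> q \<Longrightarrow> \<phi> j = \<psi> j" "g \<in> carrier (Gl r)"
    then show "map_matrix (act q r \<phi>) g = map_matrix (act q r \<psi>) g"
      using act_cong[OF _ \<phi> GL_entry] by (simp add: map_matrix_def fun_eq_iff)
  }
next
  fix q :: nat and \<phi> :: "nat \<Rightarrow> nat" and g assume "\<And>j. j \<le> q \<Longrightarrow> \<phi> j = j" "g \<in> carrier (Gl q)"
  then show "map_matrix (act q q \<phi>) g = g"
    using act_id GL_entry by (simp add: map_matrix_def fun_eq_iff)
qed

lemma K_act:
  assumes \<phi>: "\<phi> ` {..q} \<subseteq> {..r}" and g: "g \<in> K r"
  shows "map_matrix (act q r \<phi>) g \<in> K q"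
proof -
  interpret q: quasi_regular "D q" "J q" by (rule D_quasi_regular)
  interpret r: quasi_regular "D r" "J r" by (rule D_quasi_regular)
  interpret h: ring_hom_cring "D r" "D q" "act q r \<phi>" by (rule act_ring_hom[OF \<phi>])
  show ?thesis
  proof (rule q.congruent_oneI)
    show "map_matrix (act q r \<phi>) g \<in> carrier q.SM"
      using hom_in_carrier[OF map_matrix_hom(1)[OF D_cring D_cring act_hom[OF \<phi>]]] r.congruent_one_SM[OF g] .
    fix i j
    obtain x where x: "x \<in> J r" "g i j = (if i = j then \<one>\<^bsub>D r\<^esub> else \<zero>\<^bsub>D r\<^esub>) \<oplus>\<^bsub>D r\<^esub> x"
      using r.congruent_one_entry[OF g] by blast
    show "\<exists>x\<in>J q. map_matrix (act q r \<phi>) g i j = (if i = j then \<one>\<^bsub>D q\<^esub> else \<zero>\<^bsub>D q\<^esub>) \<oplus>\<^bsub>D q\<^esub> x"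
      using J_act[OF \<phi> x(1)] J_carrier[OF x(1)] by (intro bexI[of _ "act q r \<phi> x"]) (auto simp: map_matrix_def x(2))
  qed
qed

text \<open>The boundary problem is linear in the entries: subtracting the identity matrix, which
  all simplicial maps fix, gives boundaries in \<open>J\<close> that are filled one entry at a time.
  The result is congruent to 1 and therefore invertible.\<close>

lemma K_fillable: "boundary_fillable Gact K"
  unfolding boundary_fillable_def
proof (intro allI impI, elim conjE)
  fix n and a :: "nat \<Rightarrow> nat \<Rightarrow> nat \<Rightarrow> 'd"
  assume "\<forall>i\<le>Suc n. a i \<in> K n"
    and "\<forall>m i j. n = Suc m \<longrightarrow> i < j \<longrightarrow> j \<le> Suc n \<longrightarrow> Gact m n (coface i) (a j) = Gact m n (coface (j - 1)) (a i)"
  then have a: "\<And>i. i \<le> Suc n \<Longrightarrow> a i \<in> K n"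
    and compat: "\<And>m i j. n = Suc m \<Longrightarrow> i < j \<Longrightarrow> j \<le> Suc n \<Longrightarrow> Gact m n (coface i) (a j) = Gact m n (coface (j - 1)) (a i)"
    by blast+
  interpret q: quasi_regular "D n" "J n" by (rule D_quasi_regular)
  interpret s: quasi_regular "D (Suc n)" "J (Suc n)" by (rule D_quasi_regular)
  define \<delta> where "\<delta> m s t = (if s = (t :: nat) then \<one>\<^bsub>D m\<^esub> else \<zero>\<^bsub>D m\<^esub>)" for m s t
  have \<delta>c: "\<delta> m s t \<in> carrier (D m)" for m s t
  proof -
    interpret m: cring "D m" by (rule D_cring)
    show ?thesis by (simp add: \<delta>_def)
  qed
  have \<delta>_act: "act m k \<phi> (\<delta> k s t) = \<delta> m s t" if \<phi>: "\<phi> ` {..m} \<subseteq> {..k}" for m k \<phi> s t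
  proof -
    interpret h: ring_hom_cring "D k" "D m" "act m k \<phi>" by (rule act_ring_hom[OF \<phi>])
    show ?thesis by (simp add: \<delta>_def)
  qed
  define b where "b s t i = a i s t \<ominus>\<^bsub>D n\<^esub> \<delta> n s t" for s t i
  have b: "b s t i \<in> J n" if "i \<le> Suc n" for s t i
    using a[OF that] by (simp add: b_def \<delta>_def q.congruent_one_def)
  have ac: "a i s t \<in> carrier (D n)" if "i \<le> Suc n" for s t i
    using q.SM_entry[OF q.congruent_one_SM[OF a[OF that]]] .
  have bcompat: "act m n (coface i) (b s t j) = act m n (coface (j - 1)) (b s t i)"
    if m: "n = Suc m" and ij: "i < j" "j \<le> Suc n" for m i j s t
  proof -
    interpret h: ring_hom_cring "D n" "D m" "act m n (coface i)" using face_ring_hom[of i m] m ij by simp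
    interpret h': ring_hom_cring "D n" "D m" "act m n (coface (j - 1))" using face_ring_hom[of "j - 1" m] m ij by simp
    have "act m n (coface i) (\<delta> n s t) = \<delta> m s t" "act m n (coface (j - 1)) (\<delta> n s t) = \<delta> m s t"
      using \<delta>_act[of "coface i" m n] \<delta>_act[of "coface (j - 1)" m n] coface_range m ij by auto
    moreover have "act m n (coface i) (a j s t) = act m n (coface (j - 1)) (a i s t)"
      using fun_cong[OF fun_cong[OF compat[OF m ij], of s], of t] by (simp add: map_matrix_def)
    ultimately show ?thesis
      using ac[of j s t] ac[of i s t] ij \<delta>c by (simp add: b_def a_minus_def del: One_nat_def)
  qed
  \<comment> \<open>Zero boundaries receive the zero filler. Arbitrary fillers could be nonzero in
    infinitely many entries and so lead out of the stable matrices.\<close>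
  have "\<exists>v\<in>J (Suc n). (\<forall>i\<le>Suc n. face n i v = b s t i) \<and> ((\<forall>i\<le>Suc n. b s t i = \<zero>\<^bsub>D n\<^esub>) \<longrightarrow> v = \<zero>\<^bsub>D (Suc n)\<^esub>)" for s t
  proof (cases "\<forall>i\<le>Suc n. b s t i = \<zero>\<^bsub>D n\<^esub>")
    case True
    then show ?thesis
      using J_zero ring_hom_cring.hom_zero[OF face_ring_hom] by (intro bexI[of _ "\<zero>\<^bsub>D (Suc n)\<^esub>"]) auto
  next
    case False
    then show ?thesis
      using J_fillable[unfolded boundary_fillable_def, rule_format, of n "b s t"] b bcompat by blast
  qed
  then obtain v where v: "\<And>s t. v s t \<in> J (Suc n)" "\<And>s t i. i \<le> Suc n \<Longrightarrow> face n i (v s t) = b s t i"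
    "\<And>s t. (\<forall>i\<le>Suc n. b s t i = \<zero>\<^bsub>D n\<^esub>) \<Longrightarrow> v s t = \<zero>\<^bsub>D (Suc n)\<^esub>" by metis
  define w where "w s t = \<delta> (Suc n) s t \<oplus>\<^bsub>D (Suc n)\<^esub> v s t" for s t
  \<comment> \<open>Finitely many faces share one block outside which all are the identity.\<close>
  have "\<exists>N. \<forall>i\<le>Suc n. q.identity_outside N (a i)"
  proof -
    have "\<forall>i\<in>{..Suc n}. \<exists>N. q.identity_outside N (a i)"
      using q.congruent_one_SM[OF a] by (auto simp: q.SM_carrier)
    from bchoice[OF this] obtain N where N: "\<And>i. i \<le> Suc n \<Longrightarrow> q.identity_outside (N i) (a i)" by auto
    have "q.identity_outside (Max (N ` {..Suc n})) (a i)" if "i \<le> Suc n" for i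
      using N[OF that] that by (intro q.identity_outside_mono[OF N[OF that]] Max_ge) auto
    then show ?thesis by blast
  qed
  then obtain N where N: "\<And>i. i \<le> Suc n \<Longrightarrow> q.identity_outside N (a i)" by blast
  have wN: "s.identity_outside N w"
    unfolding s.identity_outside_def
  proof (intro allI impI)
    fix s t assume st: "N \<le> s \<or> N \<le> t"
    have "b s t i = \<zero>\<^bsub>D n\<^esub>" if "i \<le> Suc n" for i
      using N[OF that] st by (auto simp: b_def \<delta>_def q.identity_outside_def a_minus_def q.r_neg)
    then have "v s t = \<zero>\<^bsub>D (Suc n)\<^esub>" using v(3) by blast
    then show "w s t = (if s = t then \<one>\<^bsub>D (Suc n)\<^esub> else \<zero>\<^bsub>D (Suc n)\<^esub>)" by (simp add: w_def \<delta>_def)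
  qed
  have "w \<in> K (Suc n)"
  proof (rule s.congruent_oneI)
    show "w \<in> carrier s.SM"
      using wN J_carrier[OF v(1)] \<delta>c by (auto simp: s.SM_carrier w_def)
    show "\<exists>x\<in>J (Suc n). w i j = (if i = j then \<one>\<^bsub>D (Suc n)\<^esub> else \<zero>\<^bsub>D (Suc n)\<^esub>) \<oplus>\<^bsub>D (Suc n)\<^esub> x" for i j
      using v(1) by (auto simp: w_def \<delta>_def)
  qed
  moreover have "Gact n (Suc n) (coface i) w = a i" if i: "i \<le> Suc n" for i
  proof (intro ext)
    fix s t
    interpret h: ring_hom_cring "D (Suc n)" "D n" "face n i" by (rule face_ring_hom[OF i])
    have "face n i (w s t) = \<delta> n s t \<oplus>\<^bsub>D n\<^esub> b s t i"
      using J_carrier[OF v(1)] \<delta>c \<delta>_act[OF coface_range[OF i]] v(2)[OF i] by (simp add: w_def)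
    also have "\<dots> = a i s t"
    proof -
      interpret Dn: cring "D n" by (rule D_cring)
      show ?thesis
        using ac[OF i, of s t] \<delta>c[of n s t] unfolding b_def by algebra
    qed
    finally show "Gact n (Suc n) (coface i) w s t = a i s t" by (simp add: map_matrix_def)
  qed
  ultimately show "\<exists>v\<in>K (Suc n). \<forall>i\<le>Suc n. Gact n (Suc n) (coface i) v = a i" by blast
qed

lemma K_subgroup: "subgroup (K q) (Gl q)"
  by (rule quasi_regular.congruent_one_subgroup[OF D_quasi_regular])

end

section \<open>Comparison of the general linear groups\<close>

context quasi_regular
begin

text \<open>With \<open>a\<close> inverse to \<open>h\<close>, the product \<open>a u\<close> is 1
  minus \<open>a (h - u)\<close>. The hypothesis concerns products of entries because smallness of
  \<open>h - u\<close> alone is not preserved by multiplication with \<open>a\<close>.\<close>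

lemma congruent_one_near_inverse:
  assumes a: "a \<in> carrier SM" and h: "h \<in> carrier SM" and u: "u \<in> carrier SM"
    and near: "\<And>i j k l. a i j \<otimes> (h k l \<ominus> u k l) \<in> J"
  shows "a \<otimes>\<^bsub>SM\<^esub> h = \<one>\<^bsub>SM\<^esub> \<Longrightarrow> a \<otimes>\<^bsub>SM\<^esub> u \<in> congruent_one"
    "h \<otimes>\<^bsub>SM\<^esub> a = \<one>\<^bsub>SM\<^esub> \<Longrightarrow> u \<otimes>\<^bsub>SM\<^esub> a \<in> congruent_one"
proof -
  note [simp] = SM_entry[OF a] SM_entry[OF h] SM_entry[OF u]
  obtain N1 N2 N3 where N: "identity_outside N1 a" "identity_outside N2 h" "identity_outside N3 u"
    using a h u by (auto simp: SM_carrier)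
  show "a \<otimes>\<^bsub>SM\<^esub> u \<in> congruent_one" if one: "a \<otimes>\<^bsub>SM\<^esub> h = \<one>\<^bsub>SM\<^esub>"
  proof (rule congruent_oneI[OF SM_mult_closed[OF a u]])
    fix i k
    let ?M = "Suc (N1 + i)"
    have e: "(a \<otimes>\<^bsub>SM\<^esub> h) i k = (\<Oplus>j\<in>{..<?M}. a i j \<otimes> h j k)" "(a \<otimes>\<^bsub>SM\<^esub> u) i k = (\<Oplus>j\<in>{..<?M}. a i j \<otimes> u j k)"
      by (auto intro: SM_mult[OF a h N(1)] SM_mult[OF a u N(1)])
    let ?r = "\<Oplus>j\<in>{..<?M}. a i j \<otimes> (h j k \<ominus> u j k)"
    have rJ: "?r \<in> J" using near by (intro J_finsum) auto
    have "(\<Oplus>j\<in>{..<?M}. a i j \<otimes> u j k) \<oplus> ?r = (\<Oplus>j\<in>{..<?M}. a i j \<otimes> u j k \<oplus> a i j \<otimes> (h j k \<ominus> u j k))"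
      by (rule finsum_addf[symmetric]) auto
    also have "\<dots> = (\<Oplus>j\<in>{..<?M}. a i j \<otimes> h j k)"
      by (intro finsum_cong') (auto simp: a_minus_def r_distr[symmetric] a_lcomm r_neg)
    also have "\<dots> = (if i = k then \<one> else \<zero>)" using e(1) one by (simp add: SM_one)
    finally have "(a \<otimes>\<^bsub>SM\<^esub> u) i k \<oplus> ?r = (if i = k then \<one> else \<zero>)" using e(2) by simp
    moreover have "(a \<otimes>\<^bsub>SM\<^esub> u) i k = ((a \<otimes>\<^bsub>SM\<^esub> u) i k \<oplus> ?r) \<oplus> \<ominus> ?r"
      using SM_entry[OF SM_mult_closed[OF a u], of i k] J_carr[OF rJ] by (simp only: a_assoc a_inv_closed r_neg r_zero)
    ultimately have "(a \<otimes>\<^bsub>SM\<^esub> u) i k = (if i = k then \<one> else \<zero>) \<oplus> \<ominus> ?r" by simp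
    then show "\<exists>x\<in>J. (a \<otimes>\<^bsub>SM\<^esub> u) i k = (if i = k then \<one> else \<zero>) \<oplus> x" using J_uminus[OF rJ] by blast
  qed
  show "u \<otimes>\<^bsub>SM\<^esub> a \<in> congruent_one" if one: "h \<otimes>\<^bsub>SM\<^esub> a = \<one>\<^bsub>SM\<^esub>"
  proof (rule congruent_oneI[OF SM_mult_closed[OF u a]])
    fix i k
    let ?M = "Suc (N2 + N3 + i)"
    have e: "(h \<otimes>\<^bsub>SM\<^esub> a) i k = (\<Oplus>j\<in>{..<?M}. h i j \<otimes> a j k)" "(u \<otimes>\<^bsub>SM\<^esub> a) i k = (\<Oplus>j\<in>{..<?M}. u i j \<otimes> a j k)"
      by (auto intro: SM_mult[OF h a N(2)] SM_mult[OF u a N(3)])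
    let ?r = "\<Oplus>j\<in>{..<?M}. a j k \<otimes> (h i j \<ominus> u i j)"
    have rJ: "?r \<in> J" using near by (intro J_finsum) auto
    have "(\<Oplus>j\<in>{..<?M}. u i j \<otimes> a j k) \<oplus> ?r = (\<Oplus>j\<in>{..<?M}. u i j \<otimes> a j k \<oplus> a j k \<otimes> (h i j \<ominus> u i j))"
      by (rule finsum_addf[symmetric]) auto
    also have "\<dots> = (\<Oplus>j\<in>{..<?M}. h i j \<otimes> a j k)"
    proof (intro finsum_cong' refl)
      fix j
      have "u i j \<otimes> a j k \<oplus> a j k \<otimes> (h i j \<ominus> u i j) = a j k \<otimes> (u i j \<oplus> (h i j \<ominus> u i j))"
        by (simp add: r_distr m_comm[of "u i j"])
      also have "u i j \<oplus> (h i j \<ominus> u i j) = h i j" by (simp add: a_minus_def a_lcomm r_neg)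
      finally show "u i j \<otimes> a j k \<oplus> a j k \<otimes> (h i j \<ominus> u i j) = h i j \<otimes> a j k" by (simp add: m_comm)
    qed auto
    also have "\<dots> = (if i = k then \<one> else \<zero>)" using e(1) one by (simp add: SM_one)
    finally have "(u \<otimes>\<^bsub>SM\<^esub> a) i k \<oplus> ?r = (if i = k then \<one> else \<zero>)" using e(2) by simp
    moreover have "(u \<otimes>\<^bsub>SM\<^esub> a) i k = ((u \<otimes>\<^bsub>SM\<^esub> a) i k \<oplus> ?r) \<oplus> \<ominus> ?r"
      using SM_entry[OF SM_mult_closed[OF u a], of i k] J_carr[OF rJ] by (simp only: a_assoc a_inv_closed r_neg r_zero)
    ultimately have "(u \<otimes>\<^bsub>SM\<^esub> a) i k = (if i = k then \<one> else \<zero>) \<oplus> \<ominus> ?r" by simp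
    then show "\<exists>x\<in>J. (u \<otimes>\<^bsub>SM\<^esub> a) i k = (if i = k then \<one> else \<zero>) \<oplus> x" using J_uminus[OF rJ] by blast
  qed
qed

end

section \<open>Approximating invertible matrices over the completion\<close>

context dagger_presentation
begin

abbreviation "KD q \<equiv> quasi_regular.congruent_one (D q) (JD q)"
abbreviation "KB q \<equiv> quasi_regular.congruent_one (B q) (JB q)"
abbreviation "MD q \<equiv> stable_matrices (D q)"
abbreviation "MB q \<equiv> stable_matrices (B q)"

lemma approximate_matrix:
  assumes h: "h \<in> carrier (MB q)" and F: "finite F" "F \<subseteq> carrier (B q)"
  obtains g where "g \<in> carrier (MD q)"
    "\<And>i j c. c \<in> F \<Longrightarrow> c \<otimes>\<^bsub>B q\<^esub> (h i j \<ominus>\<^bsub>B q\<^esub> Theta q (g i j)) \<in> JB q"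
proof -
  interpret D: cring "D q" by (rule D_cring)
  interpret B: cring "B q" by (rule B_cring)
  interpret Bq: quasi_regular "B q" "JB q" by (rule simplicial_ball.D_quasi_regular[OF B_simplicial_ball])
  interpret h: ring_hom_cring "D q" "B q" "Theta q" by (rule cring_hom[OF D_cring B_cring Theta_hom])
  have "\<exists>d\<in>carrier (D q). \<forall>c\<in>F. c \<otimes>\<^bsub>B q\<^esub> (h i j \<ominus>\<^bsub>B q\<^esub> Theta q d) \<in> JB q" for i j
    by (rule Theta_dense[OF B.SM_entry[OF h, of i j] F]) blast
  then obtain d where d: "\<And>i j. d i j \<in> carrier (D q)"
    "\<And>i j c. c \<in> F \<Longrightarrow> c \<otimes>\<^bsub>B q\<^esub> (h i j \<ominus>\<^bsub>B q\<^esub> Theta q (d i j)) \<in> JB q" by metis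
  obtain N where N: "B.identity_outside N h" using h by (auto simp: B.SM_carrier)
  \<comment> \<open>Outside the block of \<open>h\<close> the approximation is exact. The matrix
    stays stable, and the error there is zero.\<close>
  define g where "g i j = (if i \<ge> N \<or> j \<ge> N then if i = j then \<one>\<^bsub>D q\<^esub> else \<zero>\<^bsub>D q\<^esub> else d i j)" for i j
  have "D.identity_outside N g" by (simp add: D.identity_outside_def g_def)
  then have "g \<in> carrier (MD q)" using d(1) by (auto simp: D.SM_carrier g_def)
  moreover have "c \<otimes>\<^bsub>B q\<^esub> (h i j \<ominus>\<^bsub>B q\<^esub> Theta q (g i j)) \<in> JB q" if c: "c \<in> F" for i j c
  proof (cases "i \<ge> N \<or> j \<ge> N")
    case True
    then have "h i j = Theta q (g i j)" using N by (auto simp: B.identity_outside_def g_def)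
    then have "c \<otimes>\<^bsub>B q\<^esub> (h i j \<ominus>\<^bsub>B q\<^esub> Theta q (g i j)) = \<zero>\<^bsub>B q\<^esub>"
      using B.SM_entry[OF h, of i j] c F(2) by (auto simp: a_minus_def B.r_neg)
    then show ?thesis using Bq.J_zero by simp
  next
    case False
    then show ?thesis using d(2)[OF c] by (simp add: g_def)
  qed
  ultimately show ?thesis using that by blast
qed

lemma Theta_K_iff:
  assumes x: "x \<in> carrier (MD q)"
  shows "map_matrix (Theta q) x \<in> KB q \<longleftrightarrow> x \<in> KD q"
proof -
  interpret D: quasi_regular "D q" "JD q" by (rule simplicial_ball.D_quasi_regular[OF D_simplicial_ball])
  interpret B: quasi_regular "B q" "JB q" by (rule simplicial_ball.D_quasi_regular[OF B_simplicial_ball])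
  interpret h: ring_hom_cring "D q" "B q" "Theta q" by (rule cring_hom[OF D_cring B_cring Theta_hom])
  have xc: "x i j \<in> carrier (D q)" for i j by (rule D.SM_entry[OF x])
  have \<delta>: "(if i = j then \<one>\<^bsub>D q\<^esub> else \<zero>\<^bsub>D q\<^esub>) \<in> carrier (D q)" for i j :: nat by simp
  have e: "map_matrix (Theta q) x i j \<ominus>\<^bsub>B q\<^esub> (if i = j then \<one>\<^bsub>B q\<^esub> else \<zero>\<^bsub>B q\<^esub>)
      = Theta q (x i j \<ominus>\<^bsub>D q\<^esub> (if i = j then \<one>\<^bsub>D q\<^esub> else \<zero>\<^bsub>D q\<^esub>))" for i j
    using xc[of i j] by (cases "i = j") (simp_all add: map_matrix_def a_minus_def)
  have iff: "Theta q y \<in> JB q \<longleftrightarrow> y \<in> JD q" if "y \<in> carrier (D q)" for y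
    using Theta_JD Theta_small[OF that] by blast
  have "map_matrix (Theta q) x \<in> carrier (MB q)"
    by (rule hom_in_carrier[OF map_matrix_hom(1)[OF D_cring B_cring Theta_hom] x])
  then show ?thesis
    using x iff[OF D.minus_closed[OF xc \<delta>]] by (simp add: D.congruent_one_def B.congruent_one_def e)
qed

text \<open>Approximations \<open>g\<close> of \<open>h\<close> and \<open>l\<close> of its inverse
  \<open>k\<close> are not inverse to each other, but the images of \<open>l g\<close> and
  \<open>g l\<close> are products of matrices congruent to 1. So \<open>l g\<close> and
  \<open>g l\<close> lie in \<open>KD\<close> and are invertible, which gives \<open>g\<close> a
  left and a right inverse.\<close>

lemma GL_dense:
  assumes h: "h \<in> carrier (GL (B q))"
  shows "\<exists>g\<in>carrier (GL (D q)). inv\<^bsub>GL (B q)\<^esub> h \<otimes>\<^bsub>GL (B q)\<^esub> map_matrix (Theta q) g \<in> KB q"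
proof -
  interpret D: quasi_regular "D q" "JD q" by (rule simplicial_ball.D_quasi_regular[OF D_simplicial_ball])
  interpret B: quasi_regular "B q" "JB q" by (rule simplicial_ball.D_quasi_regular[OF B_simplicial_ball])
  interpret GB: group "GL (B q)" by (rule GL_group[OF B_cring])
  interpret MD: monoid "MD q" by (rule D.SM_monoid)
  interpret MB: monoid "MB q" by (rule B.SM_monoid)
  let ?\<theta> = "map_matrix (Theta q)"
  note hom = map_matrix_hom(1)[OF D_cring B_cring Theta_hom]
  from h obtain k where hk: "h \<in> carrier (MB q)" "k \<in> carrier (MB q)"
    "k \<otimes>\<^bsub>MB q\<^esub> h = \<one>\<^bsub>MB q\<^esub>" "h \<otimes>\<^bsub>MB q\<^esub> k = \<one>\<^bsub>MB q\<^esub>" by (auto simp: GL_carrier)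
  \<comment> \<open>The entries of \<open>k\<close> multiply the error in approximating
    \<open>h\<close>, and those of \<open>h\<close> the error in approximating
    \<open>k\<close>.\<close>
  define F where "F = {h i j | i j. True} \<union> {k i j | i j. True}"
  have F: "finite F" "F \<subseteq> carrier (B q)"
    using B.SM_finite_entries[OF hk(1)] B.SM_finite_entries[OF hk(2)] B.SM_entry[OF hk(1)] B.SM_entry[OF hk(2)]
    by (auto simp: F_def)
  obtain g where g: "g \<in> carrier (MD q)"
    "\<And>i j c. c \<in> F \<Longrightarrow> c \<otimes>\<^bsub>B q\<^esub> (h i j \<ominus>\<^bsub>B q\<^esub> Theta q (g i j)) \<in> JB q"
    by (rule approximate_matrix[OF hk(1) F]) blast
  obtain l where l: "l \<in> carrier (MD q)"
    "\<And>i j c. c \<in> F \<Longrightarrow> c \<otimes>\<^bsub>B q\<^esub> (k i j \<ominus>\<^bsub>B q\<^esub> Theta q (l i j)) \<in> JB q"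
    by (rule approximate_matrix[OF hk(2) F]) blast
  have gB: "?\<theta> g \<in> carrier (MB q)" and lB: "?\<theta> l \<in> carrier (MB q)"
    using hom_in_carrier[OF hom] g(1) l(1) by auto
  have ng: "k i j \<otimes>\<^bsub>B q\<^esub> (h r s \<ominus>\<^bsub>B q\<^esub> ?\<theta> g r s) \<in> JB q" for i j r s
    using g(2)[of "k i j" r s] by (auto simp: map_matrix_def F_def)
  have nl: "h i j \<otimes>\<^bsub>B q\<^esub> (k r s \<ominus>\<^bsub>B q\<^esub> ?\<theta> l r s) \<in> JB q" for i j r s
    using l(2)[of "h i j" r s] by (auto simp: map_matrix_def F_def)
  have kg: "k \<otimes>\<^bsub>MB q\<^esub> ?\<theta> g \<in> KB q" and gk: "?\<theta> g \<otimes>\<^bsub>MB q\<^esub> k \<in> KB q"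
    using B.congruent_one_near_inverse[OF hk(2,1) gB ng] hk(3,4) by auto
  have hl: "h \<otimes>\<^bsub>MB q\<^esub> ?\<theta> l \<in> KB q" and lh: "?\<theta> l \<otimes>\<^bsub>MB q\<^esub> h \<in> KB q"
    using B.congruent_one_near_inverse[OF hk(1,2) lB nl] hk(3,4) by auto
  have "?\<theta> (l \<otimes>\<^bsub>MD q\<^esub> g) = (?\<theta> l \<otimes>\<^bsub>MB q\<^esub> h) \<otimes>\<^bsub>MB q\<^esub> (k \<otimes>\<^bsub>MB q\<^esub> ?\<theta> g)"
  proof -
    have "(?\<theta> l \<otimes>\<^bsub>MB q\<^esub> h) \<otimes>\<^bsub>MB q\<^esub> (k \<otimes>\<^bsub>MB q\<^esub> ?\<theta> g) = ?\<theta> l \<otimes>\<^bsub>MB q\<^esub> ((h \<otimes>\<^bsub>MB q\<^esub> k) \<otimes>\<^bsub>MB q\<^esub> ?\<theta> g)"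
      using hk(1,2) gB lB by (simp add: MB.m_assoc)
    then show ?thesis using hk(4) gB hom_mult[OF hom l(1) g(1)] by simp
  qed
  then have "?\<theta> (l \<otimes>\<^bsub>MD q\<^esub> g) \<in> KB q" using B.congruent_one_mult[OF lh kg] by simp
  then have "l \<otimes>\<^bsub>MD q\<^esub> g \<in> KD q" using Theta_K_iff l(1) g(1) by simp
  then obtain u where u: "u \<in> carrier (MD q)" "u \<otimes>\<^bsub>MD q\<^esub> (l \<otimes>\<^bsub>MD q\<^esub> g) = \<one>\<^bsub>MD q\<^esub>"
    by (rule D.congruent_one_inverse) (auto intro: D.congruent_one_SM)
  have "?\<theta> (g \<otimes>\<^bsub>MD q\<^esub> l) = (?\<theta> g \<otimes>\<^bsub>MB q\<^esub> k) \<otimes>\<^bsub>MB q\<^esub> (h \<otimes>\<^bsub>MB q\<^esub> ?\<theta> l)"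
  proof -
    have "(?\<theta> g \<otimes>\<^bsub>MB q\<^esub> k) \<otimes>\<^bsub>MB q\<^esub> (h \<otimes>\<^bsub>MB q\<^esub> ?\<theta> l) = ?\<theta> g \<otimes>\<^bsub>MB q\<^esub> ((k \<otimes>\<^bsub>MB q\<^esub> h) \<otimes>\<^bsub>MB q\<^esub> ?\<theta> l)"
      using hk(1,2) gB lB by (simp add: MB.m_assoc)
    then show ?thesis using hk(3) lB hom_mult[OF hom g(1) l(1)] by simp
  qed
  then have "?\<theta> (g \<otimes>\<^bsub>MD q\<^esub> l) \<in> KB q" using B.congruent_one_mult[OF gk hl] by simp
  then have "g \<otimes>\<^bsub>MD q\<^esub> l \<in> KD q" using Theta_K_iff l(1) g(1) by simp
  then obtain v where v: "v \<in> carrier (MD q)" "(g \<otimes>\<^bsub>MD q\<^esub> l) \<otimes>\<^bsub>MD q\<^esub> v = \<one>\<^bsub>MD q\<^esub>"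
    by (rule D.congruent_one_inverse) (auto intro: D.congruent_one_SM)
  have left: "(u \<otimes>\<^bsub>MD q\<^esub> l) \<otimes>\<^bsub>MD q\<^esub> g = \<one>\<^bsub>MD q\<^esub>" using u l(1) g(1) by (simp add: MD.m_assoc)
  have right: "g \<otimes>\<^bsub>MD q\<^esub> (l \<otimes>\<^bsub>MD q\<^esub> v) = \<one>\<^bsub>MD q\<^esub>" using v l(1) g(1) by (simp add: MD.m_assoc)
  have "u \<otimes>\<^bsub>MD q\<^esub> l = l \<otimes>\<^bsub>MD q\<^esub> v"
    using MD.inv_unique[OF left right] u(1) v(1) l(1) g(1) by simp
  then have gG: "g \<in> carrier (GL (D q))"
    using left right u(1) v(1) l(1) g(1) by (auto simp: GL_carrier intro!: bexI[of _ "l \<otimes>\<^bsub>MD q\<^esub> v"])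
  have "k \<in> carrier (GL (B q))" using hk by (auto simp: GL_carrier)
  then have "inv\<^bsub>GL (B q)\<^esub> h = k"
    using h hk(3) by (intro GB.inv_equality) (auto simp: GL_mult GL_one)
  then show ?thesis using gG kg by (intro bexI[of _ g]) (simp_all add: GL_mult)
qed

lemma approximation:
  "simplicial_group_approximation (\<lambda>q. GL (D q)) (\<lambda>q r \<phi>. map_matrix (dagger_simplex_act R absv V I q r \<phi>))
    (\<lambda>q. GL (B q)) (\<lambda>q r \<phi>. map_matrix (banach_simplex_act A nrm q r \<phi>))
    (\<lambda>q. map_matrix (Theta q)) KD KB"
proof (rule simplicial_group_approximation.intro)
  show "simplicial_group (\<lambda>q. GL (D q)) (\<lambda>q r \<phi>. map_matrix (dagger_simplex_act R absv V I q r \<phi>))"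
    by (rule simplicial_ball.GL_simplicial_group[OF D_simplicial_ball])
  show "simplicial_group (\<lambda>q. GL (B q)) (\<lambda>q r \<phi>. map_matrix (banach_simplex_act A nrm q r \<phi>))"
    by (rule simplicial_ball.GL_simplicial_group[OF B_simplicial_ball])
  show "simplicial_group_approximation_axioms (\<lambda>q. GL (D q)) (\<lambda>q r \<phi>. map_matrix (dagger_simplex_act R absv V I q r \<phi>))
    (\<lambda>q. GL (B q)) (\<lambda>q r \<phi>. map_matrix (banach_simplex_act A nrm q r \<phi>))
    (\<lambda>q. map_matrix (Theta q)) KD KB"
  proof (rule simplicial_group_approximation_axioms.intro)
    show "map_matrix (Theta q) \<in> hom (GL (D q)) (GL (B q))" for q
      by (rule GL_hom[OF D_cring B_cring Theta_hom])
    show "subgroup (KD q) (GL (D q))" for q by (rule simplicial_ball.K_subgroup[OF D_simplicial_ball])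
    show "subgroup (KB q) (GL (B q))" for q by (rule simplicial_ball.K_subgroup[OF B_simplicial_ball])
    show "map_matrix (banach_simplex_act A nrm q r \<phi>) h \<in> KB q" if "\<phi> ` {..q} \<subseteq> {..r}" "h \<in> KB r" for \<phi> q r h
      by (rule simplicial_ball.K_act[OF B_simplicial_ball that])
    show "map_matrix (Theta q) x \<in> KB q \<longleftrightarrow> x \<in> KD q" if "x \<in> carrier (GL (D q))" for x q
      using that by (intro Theta_K_iff) (simp add: GL_carrier)
    show "\<exists>g\<in>carrier (GL (D q)). inv\<^bsub>GL (B q)\<^esub> h \<otimes>\<^bsub>GL (B q)\<^esub> map_matrix (Theta q) g \<in> KB q"
      if "h \<in> carrier (GL (B q))" for h q by (rule GL_dense[OF that])
    show "boundary_fillable (\<lambda>q r \<phi>. map_matrix (dagger_simplex_act R absv V I q r \<phi>)) KD"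
      by (rule simplicial_ball.K_fillable[OF D_simplicial_ball])
    show "boundary_fillable (\<lambda>q r \<phi>. map_matrix (banach_simplex_act A nrm q r \<phi>)) KB"
      by (rule simplicial_ball.K_fillable[OF B_simplicial_ball])
    fix q r :: nat and \<phi> :: "nat \<Rightarrow> nat" and x assume \<phi>: "\<phi> ` {..q} \<subseteq> {..r}" and x: "x \<in> carrier (GL (D r))"
    show "map_matrix (Theta q) (map_matrix (dagger_simplex_act R absv V I q r \<phi>) x)
      = map_matrix (banach_simplex_act A nrm q r \<phi>) (map_matrix (Theta r) x)"
    proof (intro ext)
      fix i j
      have "x i j \<in> carrier (D r)" by (rule simplicial_ball.GL_entry[OF D_simplicial_ball x])
      then obtain f where f: "f \<in> carrier (Sd r)" "x i j = D_coset r f" by (rule D_cases)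
      have "lift \<phi> q f \<in> carrier (Sd q)" by (rule ring_hom_memE(1)[OF lift_dagger[OF \<phi>] f(1)])
      then show "map_matrix (Theta q) (map_matrix (dagger_simplex_act R absv V I q r \<phi>) x) i j
        = map_matrix (banach_simplex_act A nrm q r \<phi>) (map_matrix (Theta r) x) i j"
        using f D_act_coset[OF \<phi> f(1)] B_act_coset[OF \<phi> Sd_S[OF f(1)]]
        by (simp add: map_matrix_def Theta_coset)
    qed
  qed
qed

theorem K_top_dagger_iso: "K_top_dagger R absv V I n \<cong> K_top_banach A nrm n"
  unfolding K_top_dagger_def K_top_banach_def
  by (rule simplicial_group_approximation.homotopy_group_iso[OF approximation])

end

section \<open>The two base rings R and K\<close>

context mixed_char_complete_dvr
begin

lemma absv_one_eq: "absv \<one> = 1"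
proof -
  have "absv \<one> * absv \<one> = absv \<one>" using absv_mult[of \<one> \<one>] by simp
  moreover have "absv \<one> \<noteq> 0" using absv_eq_zero[of \<one>] by simp
  ultimately show ?thesis by simp
qed

lemma absv_minus_eq: "x \<in> carrier K \<Longrightarrow> absv (\<ominus> x) = absv x"
proof -
  assume x: "x \<in> carrier K"
  have "absv (\<ominus> \<one>) * absv (\<ominus> \<one>) = 1" using absv_mult[of "\<ominus> \<one>" "\<ominus> \<one>"] absv_one_eq by (simp add: l_minus)
  then have "absv (\<ominus> \<one>) = 1" using absv_nonneg[of "\<ominus> \<one>"] by (simp add: square_eq_1_iff)
  then show ?thesis using absv_mult[of "\<ominus> \<one>" x] x by (simp add: l_minus)
qed

text \<open>As 1 is the difference of \<open>1 + x\<close> and \<open>x\<close>, the ultrametric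
  inequality forces \<open>1 + x\<close> to have norm at least 1, hence its inverse norm at most
  1.\<close>

lemma one_add_small_inverse:
  assumes x: "x \<in> carrier K" "absv x < 1"
  shows "\<exists>y\<in>carrier K. (\<one> \<oplus> x) \<otimes> y = \<one> \<and> absv y \<le> 1"
proof -
  have "\<one> = (\<one> \<oplus> x) \<oplus> \<ominus> x" using x by (simp add: a_assoc r_neg)
  then have "1 \<le> max (absv (\<one> \<oplus> x)) (absv (\<ominus> x))"
    using absv_add[of "\<one> \<oplus> x" "\<ominus> x"] x absv_one_eq by simp
  then have 1: "1 \<le> absv (\<one> \<oplus> x)" using x absv_minus_eq by simp
  then have "\<one> \<oplus> x \<noteq> \<zero>" using absv_eq_zero[of \<zero>] by auto
  then have "\<one> \<oplus> x \<in> Units K" using x by (simp add: field_Units)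
  then have y: "inv (\<one> \<oplus> x) \<in> carrier K" "(\<one> \<oplus> x) \<otimes> inv (\<one> \<oplus> x) = \<one>" by auto
  have "absv (\<one> \<oplus> x) * absv (inv (\<one> \<oplus> x)) = 1" using absv_mult[of "\<one> \<oplus> x" "inv (\<one> \<oplus> x)"] y x absv_one_eq by simp
  then have "absv (inv (\<one> \<oplus> x)) \<le> 1"
    using 1 absv_nonneg[OF y(1)] mult_right_mono[OF 1, of "absv (inv (\<one> \<oplus> x))"] by simp
  then show ?thesis using y by blast
qed

lemma ultrametric_K: "ultrametric_cring K absv"
  using cring_axioms absv_nonneg absv_eq_zero[of \<zero>] absv_one_eq absv_mult absv_add absv_minus_eq one_add_small_inverse
  by (intro ultrametric_cring.intro ultrametric_cring_axioms.intro) auto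

lemma ultrametric_R: "ultrametric_cring (K\<lparr>carrier := R\<rparr>) absv"
proof -
  have c: "cring (K\<lparr>carrier := R\<rparr>)" by (rule subring_cring[OF cring_axioms subring])
  have RK: "R \<subseteq> carrier K" by (rule subringE(1)[OF subring])
  have neg: "\<ominus>\<^bsub>K\<lparr>carrier := R\<rparr>\<^esub> x = \<ominus> x" if "x \<in> R" for x
    by (rule sub_a_inv[OF cring_axioms c RK that])
  show ?thesis
  proof (intro ultrametric_cring.intro c ultrametric_cring_axioms.intro)
    fix x assume x: "x \<in> carrier (K\<lparr>carrier := R\<rparr>)"
    then have xK: "x \<in> carrier K" using RK by auto
    show "0 \<le> absv x" using absv_nonneg[OF xK] .
    show "absv (\<ominus>\<^bsub>K\<lparr>carrier := R\<rparr>\<^esub> x) = absv x" using neg x absv_minus_eq[OF xK] by simp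
    \<comment> \<open>The inverse is taken in K; the bound on its norm puts it into R.\<close>
    show "\<exists>y\<in>carrier (K\<lparr>carrier := R\<rparr>). (\<one>\<^bsub>K\<lparr>carrier := R\<rparr>\<^esub> \<oplus>\<^bsub>K\<lparr>carrier := R\<rparr>\<^esub> x) \<otimes>\<^bsub>K\<lparr>carrier := R\<rparr>\<^esub> y
        = \<one>\<^bsub>K\<lparr>carrier := R\<rparr>\<^esub> \<and> absv y \<le> 1" if "absv x < 1"
      using one_add_small_inverse[OF xK that] by (auto simp: valuation_ring)
    fix y assume "y \<in> carrier (K\<lparr>carrier := R\<rparr>)"
    then have yK: "y \<in> carrier K" using RK by auto
    show "absv (x \<otimes>\<^bsub>K\<lparr>carrier := R\<rparr>\<^esub> y) = absv x * absv y" using absv_mult[OF xK yK] by simp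
    show "absv (x \<oplus>\<^bsub>K\<lparr>carrier := R\<rparr>\<^esub> y) \<le> max (absv x) (absv y)" using absv_add[OF xK yK] by simp
  qed (use absv_eq_zero[of \<zero>] absv_one_eq in auto)
qed

end

theorem proposition7p5:
  fixes K :: "'a ring" and R :: "'a set" and \<pi> :: 'a and p :: nat and absv :: "'a \<Rightarrow> real"
    and \<Lambda> :: "'a ring" and m n :: nat and I :: "((nat \<Rightarrow> nat) \<Rightarrow> 'a) set"
  assumes "mixed_char_complete_dvr K R \<pi> p absv"
    and "\<Lambda> = K\<lparr>carrier := R\<rparr> \<or> \<Lambda> = K"
    and "ideal I (dagger_series \<Lambda> absv {1..m})"
    and "n \<ge> 1"
  shows "K_top_dagger \<Lambda> absv {1..m} I n \<cong>
    K_top_banach (completion \<Lambda> absv {1..m} I) (residue_norm absv {1..m}) n"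
proof -
  interpret mixed_char_complete_dvr K R \<pi> p absv by fact
  have "ultrametric_cring \<Lambda> absv" using assms(2) ultrametric_K ultrametric_R by auto
  then have "dagger_presentation \<Lambda> absv {1..m} I"
    using assms(3) by (intro dagger_presentation.intro dagger_presentation_axioms.intro) auto
  then show ?thesis by (rule dagger_presentation.K_top_dagger_iso)
qed

end
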